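(* Let $B_1\subset\mathbb{R}^2\cong\mathbb{C}$ be the unit disk, $N\ge2$, and $a_1,\dots,a_N$ distinct points on $\partial B_1$ with $d_1,\dots,d_N\in\{\pm1\}$, $\sum_jd_j=2$. Then $$W_{B_1}(\{(a_j,d_j)\})=-2\pi\sum_{1\le j<k\le N}d_jd_k\log|a_j-a_k|.$$ If $\Omega\subset\mathbb{R}^2$ is a bounded, simply connected $C^{1,1}$ domain, $\Phi:\overline{B_1}\to\overline\Omega$ a $C^1$ conformal diffeomorphism with inverse $\Psi$, then for any $N\ge2$ distinct points $a_1,\dots,a_N\in\partial\Omega$ with $d_j\in\{\pm1\}$, $\sum_jd_j=2$, $$W_\Omega(\{(a_j,d_j)\})=-2\pi\sum_{1\le j<k\le N}d_jd_k\log|\Psi(a_k)-\Psi(a_j)|+\sum_{k=1}^N\pi(d_k-1)\log|\Psi'(a_k)|+\int_{\partial\Omega}\varkappa(w)\Big(\sum_{j=1}^Nd_j\log|\Psi(w)-\Psi(a_j)|-\log|\Psi'(w)|\Big)d\mathcal{H}^1(w),$$ where $\varkappa$ is the curvature of $\partial\Omega$.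
   Context: Let $\Omega$ be a bounded, simply connected $C^{1,1}$ domain with outer unit normal $\nu$, tangent $\tau=(-\nu_2,\nu_1)$ and curvature $\varkappa$ (with $\int_{\partial\Omega}\varkappa=2\pi$). For $N\ge2$ distinct $a_j\in\partial\Omega$ with $d_j\in\{\pm1\}$, $\sum d_j=2$, let $\phi:\partial\Omega\to\mathbb{R}$ be $BV$ with $e^{\mathrm{i}\phi}\cdot\nu=0$ on $\partial\Omega\setminus\{a_j\}$ and $\partial_\tau\phi=\varkappa-\pi\sum_jd_j\delta_{a_j}$ (unique up to a constant in $\pi\mathbb{Z}$), and $\phi_*$ its harmonic extension to $\Omega$. The renormalized energy is $$W_\Omega(\{(a_j,d_j)\})=\lim_{\rho\to0}\Big(\int_{\Omega\setminus\bigcup_jB_\rho(a_j)}|\nabla\phi_*|^2dx-N\pi\log\frac1\rho\Big).$$ *)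

theory Defs
  imports "HOL-Complex_Analysis.Complex_Analysis"
begin

definition partial_x :: "(complex \<Rightarrow> real) \<Rightarrow> complex \<Rightarrow> real" where
  "partial_x f z = deriv (\<lambda>t::real. f (z + complex_of_real t)) 0"

definition partial_y :: "(complex \<Rightarrow> real) \<Rightarrow> complex \<Rightarrow> real" where
  "partial_y f z = deriv (\<lambda>t::real. f (z + \<i> * complex_of_real t)) 0"

definition harmonic_on :: "(complex \<Rightarrow> real) \<Rightarrow> complex set \<Rightarrow> bool" where
  "harmonic_on f S \<longleftrightarrow> open S \<and>
     (\<forall>z\<in>S. f differentiable (at z) \<and> partial_x f differentiable (at z)
              \<and> partial_y f differentiable (at z)) \<and>
     continuous_on S (partial_x (partial_x f)) \<and> continuous_on S (partial_y (partial_y f)) \<and>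
     continuous_on S (partial_x (partial_y f)) \<and> continuous_on S (partial_y (partial_x f)) \<and>
     (\<forall>z\<in>S. partial_x (partial_x f) z + partial_y (partial_y f) z = 0)"

text \<open>Unit tangent, outer unit normal and curvature along a boundary parametrisation gamma.
  tau = gamma', nu = -i tau (so tau = (-nu_2, nu_1)), gamma'' = i kappa gamma'.\<close>
definition tangent_at :: "(real \<Rightarrow> complex) \<Rightarrow> real \<Rightarrow> complex" where
  "tangent_at \<gamma> s = vector_derivative \<gamma> (at s)"

definition normal_at :: "(real \<Rightarrow> complex) \<Rightarrow> real \<Rightarrow> complex" where
  "normal_at \<gamma> s = - \<i> * tangent_at \<gamma> s"

definition curvature_at :: "(real \<Rightarrow> complex) \<Rightarrow> real \<Rightarrow> real" where
  "curvature_at \<gamma> s = Im (cnj (tangent_at \<gamma> s) * vector_derivative (tangent_at \<gamma>) (at s))"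

definition C11_boundary_param :: "complex set \<Rightarrow> (real \<Rightarrow> complex) \<Rightarrow> real \<Rightarrow> bool" where
  "C11_boundary_param \<Omega> \<gamma> L \<longleftrightarrow> L > 0 \<and>
     (\<forall>s. \<gamma> (s + L) = \<gamma> s) \<and> inj_on \<gamma> {0..<L} \<and> \<gamma> ` {0..L} = frontier \<Omega> \<and>
     (\<forall>s. \<gamma> differentiable (at s)) \<and> (\<forall>s. norm (tangent_at \<gamma> s) = 1) \<and>
     (\<exists>K. \<forall>s t. norm (tangent_at \<gamma> s - tangent_at \<gamma> t) \<le> K * \<bar>s - t\<bar>) \<and>
     (\<forall>z\<in>\<Omega>. winding_number (\<lambda>t. \<gamma> (L * t)) z = 1)"

definition C11_domain :: "complex set \<Rightarrow> bool" where
  "C11_domain \<Omega> \<longleftrightarrow> open \<Omega> \<and> bounded \<Omega> \<and> connected \<Omega> \<and> simply_connected \<Omega> \<and>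
     (\<exists>\<gamma> L. C11_boundary_param \<Omega> \<gamma> L)"

definition admissible_config :: "complex set \<Rightarrow> nat \<Rightarrow> (nat \<Rightarrow> complex) \<Rightarrow> (nat \<Rightarrow> int) \<Rightarrow> bool" where
  "admissible_config \<Omega> N a d \<longleftrightarrow> 2 \<le> N \<and> inj_on a {..<N} \<and> a ` {..<N} \<subseteq> frontier \<Omega> \<and>
     (\<forall>j<N. d j = 1 \<or> d j = -1) \<and> (\<Sum>j<N. d j) = 2"

text \<open>The BV phase phi on the boundary: e^{i phi} . nu = 0 off the a_j, and
  d_tau phi = kappa - pi sum_j d_j delta_{a_j}, written along the arc-length parameter:
  the increment of phi between two non-singular boundary points equals the integral of
  the curvature minus pi times the sum of the degrees of the points passed.\<close>
definition boundary_phase ::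
  "complex set \<Rightarrow> (real \<Rightarrow> complex) \<Rightarrow> real \<Rightarrow> nat \<Rightarrow> (nat \<Rightarrow> complex) \<Rightarrow> (nat \<Rightarrow> int)
    \<Rightarrow> (complex \<Rightarrow> real) \<Rightarrow> bool" where
  "boundary_phase \<Omega> \<gamma> L N a d \<phi> \<longleftrightarrow>
     (\<forall>s. \<gamma> s \<notin> a ` {..<N} \<longrightarrow> inner (cis (\<phi> (\<gamma> s))) (normal_at \<gamma> s) = 0) \<and>
     (\<forall>s t. 0 \<le> s \<and> s \<le> t \<and> t < L \<and> \<gamma> s \<notin> a ` {..<N} \<and> \<gamma> t \<notin> a ` {..<N} \<longrightarrow>
        \<phi> (\<gamma> t) - \<phi> (\<gamma> s) =
          integral {s..t} (curvature_at \<gamma>)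
          - pi * (\<Sum>j\<in>{j. j < N \<and> (\<exists>u\<in>{s<..<t}. \<gamma> u = a j)}. real_of_int (d j)))"

definition harmonic_extension ::
  "complex set \<Rightarrow> nat \<Rightarrow> (nat \<Rightarrow> complex) \<Rightarrow> (complex \<Rightarrow> real) \<Rightarrow> (complex \<Rightarrow> real) \<Rightarrow> bool" where
  "harmonic_extension \<Omega> N a \<phi> \<phi>s \<longleftrightarrow> harmonic_on \<phi>s \<Omega> \<and> bounded (\<phi>s ` \<Omega>) \<and>
     (\<forall>b \<in> frontier \<Omega> - a ` {..<N}. (\<phi>s \<longlongrightarrow> \<phi> b) (at b within \<Omega>))"

definition dirichlet_energy_punctured ::
  "complex set \<Rightarrow> nat \<Rightarrow> (nat \<Rightarrow> complex) \<Rightarrow> (complex \<Rightarrow> real) \<Rightarrow> real \<Rightarrow> real" where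
  "dirichlet_energy_punctured \<Omega> N a f \<rho> =
     integral (\<Omega> - (\<Union>j<N. ball (a j) \<rho>)) (\<lambda>z. (partial_x f z)\<^sup>2 + (partial_y f z)\<^sup>2)"

definition renormalized_energy_is ::
  "complex set \<Rightarrow> (real \<Rightarrow> complex) \<Rightarrow> real \<Rightarrow> nat \<Rightarrow> (nat \<Rightarrow> complex) \<Rightarrow> (nat \<Rightarrow> int)
    \<Rightarrow> real \<Rightarrow> bool" where
  "renormalized_energy_is \<Omega> \<gamma> L N a d W \<longleftrightarrow>
     (\<exists>\<phi> \<phi>s. boundary_phase \<Omega> \<gamma> L N a d \<phi> \<and> harmonic_extension \<Omega> N a \<phi> \<phi>s) \<and>
     (\<forall>\<phi> \<phi>s. boundary_phase \<Omega> \<gamma> L N a d \<phi> \<and> harmonic_extension \<Omega> N a \<phi> \<phi>s \<longrightarrow>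
        ((\<lambda>\<rho>. dirichlet_energy_punctured \<Omega> N a \<phi>s \<rho> - real N * pi * ln (1 / \<rho>)) \<longlongrightarrow> W)
          (at_right 0))"

end

theory Submission
  imports Defs
begin

text \<open>
  Pull everything back to the unit disc. Put b j = \<Psi> (a j) and let H be a logarithm of \<Phi>'. With
  G z = (\<Sum>j<N. d j * Ln (1 - z / b j)) + H z, the harmonic extension of the phase is
  Im (G (\<Psi> z)) up to a constant, so by conformal invariance the energy is the integral of
  |G'|^2 over the disc without the preimages of the balls around the a j.

  Expanding the square leaves three kinds of terms. The diagonal poles 1 / |z - b j|^2 produce
  \<pi> * ln (1 / \<rho>) - \<pi> * ln |\<Psi>' (a j)|, because the preimage of the ball of radius \<rho> lies between
  balls of radius (1 \<plusminus> \<delta>) * \<rho> * |\<Psi>' (a j)|. All other terms are integrable and are evaluated by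
  the identity that the integral over the disc of F'(z) / cnj (w - z) is \<pi> * (F w - F 0) for |w| = 1.
  For the terms containing H' it is combined, through Fubini, with the representation
  H'(z) = 1/\<pi> times the integral of \<kappa>(s) / (\<Psi> (\<gamma> s) - z), which is where the curvature enters. It comes from
  differentiating the tangent angle arg \<gamma>' = arg \<Psi>(\<gamma>) + \<pi>/2 + Im H (\<Psi> \<gamma>), a Lipschitz function and
  hence almost everywhere differentiable.
\<close>

section \<open>Lipschitz functions of one real variable\<close>

text \<open>The boundary is only C^{1,1}: the tangent is Lipschitz, the curvature exists almost
  everywhere and is merely bounded, and H' may blow up at the circle. So no term is moved to the
  boundary by Green's formula; each is an absolutely convergent disc integral, and the proof lives
  on integrability margins. The margin is a fourth root: 1/d = d^(-1/4) d^(-3/4), with d the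
  distance from z to a boundary point; the first factor is at most (1-|z|)^(-1/4), the second is
  integrable along the circle. Hence |H'| = O((1-|z|)^(-1/4)), and a product of two such losses
  costs (1-|z|)^(-1/2), still integrable in the radius.

  The energy predicate speaks of every phase and every bounded extension, so uniqueness has to be
  shown although nothing is prescribed at the a j; a logarithmic barrier, infinite at these points,
  replaces boundary values there.

  That the degrees sum to 2 enters twice: each factor Ln (1 - z / b j) carries half the boundary
  angle, so together they carry it once; and in the final sum it makes the constant Re (H 0)
  cancel.\<close>

lemma emeasure_disjoint_cballs_mono:
  fixes c r :: "'i \<Rightarrow> real" and M M' :: "real measure"
  assumes C: "countable C"
    and disj: "pairwise (\<lambda>i j. disjnt (cball (c i) (r i)) (cball (c j) (r j))) C"
    and sets: "sets M = sets borel" "sets M' = sets borel"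
    and le: "\<And>i. i \<in> C \<Longrightarrow> emeasure M (cball (c i) (r i)) \<le> k * emeasure M' (cball (c i) (r i))"
  shows "emeasure M (\<Union>i\<in>C. cball (c i) (r i)) \<le> k * emeasure M' (\<Union>i\<in>C. cball (c i) (r i))"
proof -
  have d: "disjoint_family_on (\<lambda>i. cball (c i) (r i)) C"
    using disj by (auto simp: disjoint_family_on_def pairwise_def disjnt_def)
  have "emeasure M (\<Union>i\<in>C. cball (c i) (r i)) = (\<integral>\<^sup>+i. emeasure M (cball (c i) (r i)) \<partial>count_space C)"
    by (rule emeasure_UN_countable) (use C d sets in auto)
  also have "\<dots> \<le> (\<integral>\<^sup>+i. k * emeasure M' (cball (c i) (r i)) \<partial>count_space C)"
    by (rule nn_integral_mono) (use le in auto)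
  also have "\<dots> = k * (\<integral>\<^sup>+i. emeasure M' (cball (c i) (r i)) \<partial>count_space C)"
    by (rule nn_integral_cmult) auto
  also have "(\<integral>\<^sup>+i. emeasure M' (cball (c i) (r i)) \<partial>count_space C) = emeasure M' (\<Union>i\<in>C. cball (c i) (r i))"
    by (rule emeasure_UN_countable [symmetric]) (use C d sets in auto)
  finally show ?thesis .
qed

text \<open>Separates the lower and the upper derivative by p and q without mentioning either: both
  inequalities occur at every scale. Countably many rational pairs p < q then exhaust the points
  where a Lipschitz function has no derivative.\<close>

definition quotient_osc :: "(real \<Rightarrow> real) \<Rightarrow> real \<Rightarrow> real \<Rightarrow> real set" where
  "quotient_osc f p q = {x. \<forall>d>0. (\<exists>y. 0 < \<bar>y - x\<bar> \<and> \<bar>y - x\<bar> < d \<and> (f y - f x) / (y - x) < p)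
                               \<and> (\<exists>y. 0 < \<bar>y - x\<bar> \<and> \<bar>y - x\<bar> < d \<and> q < (f y - f x) / (y - x))}"

lemma open_quotient_cond:
  fixes f :: "real \<Rightarrow> real"
  assumes "continuous_on UNIV f" "open T"
  shows "open {x. \<exists>y. 0 < \<bar>y - x\<bar> \<and> \<bar>y - x\<bar> < d \<and> (f y - f x) / (y - x) \<in> T}"
proof -
  have "open {x. 0 < \<bar>y - x\<bar> \<and> \<bar>y - x\<bar> < d \<and> (f y - f x) / (y - x) \<in> T}" for y
  proof -
    have 1: "open {x. 0 < \<bar>y - x\<bar> \<and> \<bar>y - x\<bar> < d}"
      by (intro open_Collect_conj open_Collect_less continuous_intros)
    have 2: "continuous_on {x. 0 < \<bar>y - x\<bar> \<and> \<bar>y - x\<bar> < d} (\<lambda>x. (f y - f x) / (y - x))"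
      by (intro continuous_intros continuous_on_subset [OF assms(1)]) auto
    have "open ({x. 0 < \<bar>y - x\<bar> \<and> \<bar>y - x\<bar> < d} \<inter> (\<lambda>x. (f y - f x) / (y - x)) -` T)"
      by (rule continuous_open_preimage [OF 2 1 assms(2)])
    then show ?thesis
      by (rule back_subst [of "open"]) auto
  qed
  then have "open (\<Union>y. {x. 0 < \<bar>y - x\<bar> \<and> \<bar>y - x\<bar> < d \<and> (f y - f x) / (y - x) \<in> T})"
    by blast
  then show ?thesis
    by (rule back_subst [of "open"]) auto
qed

text \<open>Only the scales 1 / (n + 1) matter, so the set is a countable intersection of open
  sets.\<close>

lemma borel_quotient_osc:
  fixes f :: "real \<Rightarrow> real"
  assumes "continuous_on UNIV f"
  shows "quotient_osc f p q \<in> sets borel"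
proof -
  let ?A = "\<lambda>T (n::nat). {x. \<exists>y. 0 < \<bar>y - x\<bar> \<and> \<bar>y - x\<bar> < 1 / real (Suc n) \<and> (f y - f x) / (y - x) \<in> T}"
  have "quotient_osc f p q = (\<Inter>n. ?A {..<p} n \<inter> ?A {q<..} n)"
  proof (intro equalityI subsetI)
    fix x assume "x \<in> quotient_osc f p q"
    then have *: "\<And>n. (\<exists>y. 0 < \<bar>y - x\<bar> \<and> \<bar>y - x\<bar> < 1 / real (Suc n) \<and> (f y - f x) / (y - x) < p)
             \<and> (\<exists>y. 0 < \<bar>y - x\<bar> \<and> \<bar>y - x\<bar> < 1 / real (Suc n) \<and> q < (f y - f x) / (y - x))"
      unfolding quotient_osc_def by simp
    then show "x \<in> (\<Inter>n. ?A {..<p} n \<inter> ?A {q<..} n)"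
      by simp
  next
    fix x assume x: "x \<in> (\<Inter>n. ?A {..<p} n \<inter> ?A {q<..} n)"
    show "x \<in> quotient_osc f p q"
      unfolding quotient_osc_def
    proof (clarsimp, intro conjI)
      fix d :: real assume "d > 0"
      then obtain n where n: "1 / real (Suc n) < d"
        using nat_approx_posE by blast
      show "\<exists>y. y \<noteq> x \<and> \<bar>y - x\<bar> < d \<and> (f y - f x) / (y - x) < p"
        using x n by (fastforce dest!: INT_D [where a=n])
      show "\<exists>y. y \<noteq> x \<and> \<bar>y - x\<bar> < d \<and> q < (f y - f x) / (y - x)"
        using x n by (fastforce dest!: INT_D [where a=n])
    qed
  qed
  moreover have A: "?A T n \<in> sets borel" if "open T" for T n
    using open_quotient_cond [OF assms that] by (rule borel_open)
  moreover have "(\<Inter>n. ?A {..<p} n \<inter> ?A {q<..} n) \<in> sets borel"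
    using A [OF open_lessThan] A [OF open_greaterThan] by (intro sets.countable_INT' sets.Int) blast+
  ultimately show ?thesis
    by metis
qed

text \<open>Vitali's covering argument, applied twice to the Stieltjes measure \<open>\<mu>\<close>
  of f. Intervals with slope below p cover almost all of S inside an open set of measure at most m +
  e, so their union has \<open>\<mu>\<close> at most p (m + e). Intervals with slope above q, chosen
  inside the first ones, again cover almost all of S, so \<open>\<mu>\<close> of them is at least q
  m.\<close>

lemma negligible_quotient_osc:
  fixes f :: "real \<Rightarrow> real"
  assumes mono: "mono f" and cont: "continuous_on UNIV f" and pq: "p < q"
  shows "negligible (quotient_osc f p q)"
proof (cases "p > 0")
  case False
  have "(f y - f x) / (y - x) \<ge> 0" for x y
    using monoD [OF mono, of x y] monoD [OF mono, of y x]
    by (cases "x \<le> y") (auto simp: zero_le_divide_iff)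
  then have "quotient_osc f p q = {}"
    using False unfolding quotient_osc_def by (auto simp: not_less intro!: exI[of _ 1]) (meson order_trans not_less)+
  then show ?thesis by simp
next
  case True
  define \<mu> where "\<mu> = interval_measure f"
  have sets\<mu> [simp]: "sets \<mu> = sets borel"
    by (simp add: \<mu>_def)
  have \<mu>: "emeasure \<mu> (cball c r) = ennreal (f (c + r) - f (c - r))" if "r > 0" for c r
    unfolding \<mu>_def cball_eq_atLeastAtMost using that
    by (subst emeasure_interval_measure_Icc) (auto intro: monoD [OF mono] continuous_on_subset [OF cont])
  have lb: "emeasure lborel (cball c r) = ennreal (2 * r)" if "r > 0" for c r :: real
    unfolding cball_eq_atLeastAtMost using that by simp
  \<comment> \<open>Vitali's theorem wants balls. The segment from x to y is the ball about its
    midpoint; x is not its centre, but the ball shrinks to x as y does.\<close>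
  have seg: "\<exists>c r. r > 0 \<and> x \<in> cball c r \<and> y \<in> cball c r \<and> cball c r \<subseteq> cball x \<bar>y - x\<bar> \<and> 2 * r = \<bar>y - x\<bar> \<and>
       f (c + r) - f (c - r) = (f y - f x) / (y - x) * (2 * r)" if "y \<noteq> x" for x y
  proof (intro exI conjI)
    show "\<bar>y - x\<bar> / 2 > 0" using that by simp
    have *: "(x + y) / 2 - \<bar>y - x\<bar> / 2 = min x y" "(x + y) / 2 + \<bar>y - x\<bar> / 2 = max x y"
      by (auto simp: min_def max_def abs_if field_simps)
    show "x \<in> cball ((x + y) / 2) (\<bar>y - x\<bar> / 2)" "y \<in> cball ((x + y) / 2) (\<bar>y - x\<bar> / 2)"
      "cball ((x + y) / 2) (\<bar>y - x\<bar> / 2) \<subseteq> cball x \<bar>y - x\<bar>"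
      unfolding cball_eq_atLeastAtMost * by (auto simp: min_def max_def abs_if split: if_splits)
    show "f ((x + y) / 2 + \<bar>y - x\<bar> / 2) - f ((x + y) / 2 - \<bar>y - x\<bar> / 2)
          = (f y - f x) / (y - x) * (2 * (\<bar>y - x\<bar> / 2))"
      unfolding * using that by (auto simp: min_def max_def abs_if field_simps)
  qed simp
  have "negligible (quotient_osc f p q \<inter> ball 0 R)" for R
  proof -
    define S where "S = quotient_osc f p q \<inter> ball 0 R"
    have Sb: "S \<in> sets borel"
      unfolding S_def using borel_quotient_osc [OF cont] by auto
    have Sl: "S \<in> lmeasurable"
      by (rule bounded_set_imp_lmeasurable) (use Sb in \<open>auto simp: S_def\<close>)
    define m where "m = measure lebesgue S"
    have em: "emeasure lborel S = ennreal m"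
      using Sl Sb emeasure_eq_measure2 [of S lebesgue] unfolding m_def
      by (simp add: fmeasurable_def emeasure_eq_ennreal_measure)
    have key: "q * m \<le> p * (m + e)" if "e > 0" for e
    proof -
      obtain O' where O': "open O'" "S \<subseteq> O'" "O' - S \<in> lmeasurable" "emeasure lebesgue (O' - S) < ennreal e"
        using sets_lebesgue_outer_open [of S e] Sl \<open>e > 0\<close> by (metis fmeasurableD)
      have O'e: "emeasure lborel O' \<le> ennreal (m + e)"
      proof -
        have "emeasure lborel O' = emeasure lborel (S \<union> (O' - S))"
          using O'(2) by (simp add: Un_absorb1)
        also have "\<dots> = emeasure lborel S + emeasure lborel (O' - S)"
          using Sb O'(1) by (intro plus_emeasure [symmetric]) auto
        also have "\<dots> \<le> ennreal m + ennreal e"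
          using O'(4) em Sb O'(1) by (intro add_mono) auto
        finally show ?thesis
          using \<open>e > 0\<close> by (simp add: m_def)
      qed
      define K1 where "K1 = {(c,r). r > 0 \<and> cball c r \<subseteq> O' \<and> emeasure \<mu> (cball c r) \<le> ennreal p * emeasure lborel (cball c r)}"
      have 1: "\<exists>i. i \<in> K1 \<and> x \<in> cball (fst i) (snd i) \<and> snd i < d" if "x \<in> S" "d > 0" for x d
      proof -
        obtain d' where d': "d' > 0" "cball x d' \<subseteq> O'"
          using O' \<open>x \<in> S\<close> open_contains_cball by blast
        obtain y where y: "y \<noteq> x" "\<bar>y - x\<bar> < min d d'" "(f y - f x) / (y - x) < p"
          using \<open>x \<in> S\<close> d' \<open>d > 0\<close> unfolding S_def quotient_osc_def by (force dest: spec [where x = "min d d'"])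
        obtain c r where cr: "r > 0" "x \<in> cball c r" "cball c r \<subseteq> cball x \<bar>y - x\<bar>" "2 * r = \<bar>y - x\<bar>"
          "f (c + r) - f (c - r) = (f y - f x) / (y - x) * (2 * r)"
          using seg [OF y(1)] by blast
        have "f (c + r) - f (c - r) \<le> p * (2 * r)"
          unfolding cr(5) using y(3) cr(1) by (intro mult_right_mono) auto
        then have "emeasure \<mu> (cball c r) \<le> ennreal p * emeasure lborel (cball c r)"
          using \<mu> lb cr(1) True by (simp add: ennreal_mult' [symmetric])
        moreover have "cball c r \<subseteq> O'"
          using cr(3) d'(2) y(2) by (meson less_imp_le min_less_iff_conj order_trans subset_cball)
        ultimately show ?thesis
          using cr y(2) by (intro exI [of _ "(c, r)"]) (auto simp: K1_def)
      qed
      obtain C1 where C1: "countable C1" "C1 \<subseteq> K1"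
        "pairwise (\<lambda>i j. disjnt (cball (fst i) (snd i)) (cball (fst j) (snd j))) C1"
        "negligible (S - (\<Union>i\<in>C1. cball (fst i) (snd i)))"
        by (rule Vitali_covering_theorem_cballs [of K1 snd S fst, OF _ 1]) (force simp: K1_def, blast+)
      \<comment> \<open>The second cover has to lie inside the first, hence inside an open set;
        dropping the boundary spheres loses only a null set.\<close>
      define U where "U = (\<Union>i\<in>C1. ball (fst i) (snd i))"
      define V where "V = (\<Union>i\<in>C1. cball (fst i) (snd i))"
      have "negligible (\<Union>i\<in>C1. sphere (fst i) (snd i))"
        by (auto intro: negligible_sphere C1)
      then have "negligible ((S - V) \<union> (\<Union>i\<in>C1. sphere (fst i) (snd i)))"
        using C1 unfolding V_def by (intro negligible_Un)
      then have negU: "negligible (S - U)"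
        by (rule negligible_subset) (force simp: U_def V_def)
      have Uo: "open U" unfolding U_def by auto
      define K2 where "K2 = {(c,r). r > 0 \<and> cball c r \<subseteq> U \<and> ennreal q * emeasure lborel (cball c r) \<le> emeasure \<mu> (cball c r)}"
      have 2: "\<exists>i. i \<in> K2 \<and> x \<in> cball (fst i) (snd i) \<and> snd i < d" if "x \<in> S \<inter> U" "d > 0" for x d
      proof -
        obtain d' where d': "d' > 0" "cball x d' \<subseteq> U"
          using Uo \<open>x \<in> S \<inter> U\<close> open_contains_cball by blast
        obtain y where y: "y \<noteq> x" "\<bar>y - x\<bar> < min d d'" "q < (f y - f x) / (y - x)"
          using \<open>x \<in> S \<inter> U\<close> d' \<open>d > 0\<close> unfolding S_def quotient_osc_def by (force dest: spec [where x = "min d d'"])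
        obtain c r where cr: "r > 0" "x \<in> cball c r" "cball c r \<subseteq> cball x \<bar>y - x\<bar>" "2 * r = \<bar>y - x\<bar>"
          "f (c + r) - f (c - r) = (f y - f x) / (y - x) * (2 * r)"
          using seg [OF y(1)] by blast
        have "q * (2 * r) \<le> f (c + r) - f (c - r)"
          unfolding cr(5) using y(3) cr(1) by (intro mult_right_mono) auto
        then have "ennreal q * emeasure lborel (cball c r) \<le> emeasure \<mu> (cball c r)"
          using \<mu> lb cr(1) True pq by (simp add: ennreal_mult' [symmetric] ennreal_leI)
        moreover have "cball c r \<subseteq> U"
          using cr(3) d'(2) y(2) by (meson less_imp_le min_less_iff_conj order_trans subset_cball)
        ultimately show ?thesis
          using cr y(2) by (intro exI [of _ "(c, r)"]) (auto simp: K2_def)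
      qed
      obtain C2 where C2: "countable C2" "C2 \<subseteq> K2"
        "pairwise (\<lambda>i j. disjnt (cball (fst i) (snd i)) (cball (fst j) (snd j))) C2"
        "negligible (S \<inter> U - (\<Union>i\<in>C2. cball (fst i) (snd i)))"
        by (rule Vitali_covering_theorem_cballs [of K2 snd "S \<inter> U" fst, OF _ 2]) (force simp: K2_def, blast+)
      define W where "W = (\<Union>i\<in>C2. cball (fst i) (snd i))"
      have Wb: "W \<in> sets borel" and Vb: "V \<in> sets borel"
        unfolding W_def V_def using C1 C2 by (auto intro!: sets.countable_UN')
      have "negligible ((S - U) \<union> (S \<inter> U - W))"
        using negU C2(4) unfolding W_def by (rule negligible_Un)
      then have "negligible (S - W)"
        by (rule negligible_subset) auto
      then have nW: "S - W \<in> null_sets lborel"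
        using Sb Wb by (simp add: negligible_iff_null_sets null_sets_completion_iff)
      have "emeasure lborel S \<le> emeasure lborel (W \<union> (S - W))"
        using Sb Wb by (intro emeasure_mono) auto
      also have "\<dots> = emeasure lborel W"
        using nW Wb by (intro emeasure_Un_null_set) auto
      finally have "ennreal q * emeasure lborel S \<le> ennreal q * emeasure lborel W"
        by (rule mult_left_mono) simp
      also have "\<dots> \<le> emeasure \<mu> W"
      proof -
        have "emeasure lborel W \<le> ennreal (1 / q) * emeasure \<mu> W"
          unfolding W_def
        proof (rule emeasure_disjoint_cballs_mono [OF C2(1,3)])
          fix i assume "i \<in> C2"
          then have "ennreal q * emeasure lborel (cball (fst i) (snd i)) \<le> emeasure \<mu> (cball (fst i) (snd i))"
            using C2(2) by (force simp: K2_def)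
          then have "ennreal (1 / q) * (ennreal q * emeasure lborel (cball (fst i) (snd i))) \<le> ennreal (1 / q) * emeasure \<mu> (cball (fst i) (snd i))"
            by (rule mult_left_mono) simp
          then show "emeasure lborel (cball (fst i) (snd i)) \<le> ennreal (1 / q) * emeasure \<mu> (cball (fst i) (snd i))"
            using True pq by (simp add: mult.assoc [symmetric] ennreal_mult' [symmetric])
        qed auto
        then have "ennreal q * emeasure lborel W \<le> ennreal q * (ennreal (1 / q) * emeasure \<mu> W)"
          by (rule mult_left_mono) simp
        then show ?thesis
          using True pq by (simp add: mult.assoc [symmetric] ennreal_mult' [symmetric])
      qed
      also have "\<dots> \<le> emeasure \<mu> V"
      proof (rule emeasure_mono)
        have "W \<subseteq> U" using C2(2) by (force simp: W_def K2_def)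
        also have "U \<subseteq> V" by (force simp: U_def V_def)
        finally show "W \<subseteq> V" .
      qed (use Vb in auto)
      also have "\<dots> \<le> ennreal p * emeasure lborel V"
        unfolding V_def by (rule emeasure_disjoint_cballs_mono [OF C1(1,3)]) (use C1(2) in \<open>force simp: K1_def\<close>)+
      also have "\<dots> \<le> ennreal p * emeasure lborel O'"
        by (intro mult_left_mono emeasure_mono) (use C1(2) O' in \<open>force simp: V_def K1_def\<close>)+
      also have "\<dots> \<le> ennreal p * ennreal (m + e)"
        using O'e by (intro mult_left_mono) auto
      finally have "ennreal (q * m) \<le> ennreal (p * (m + e))"
        using True pq \<open>e > 0\<close> unfolding em by (simp add: ennreal_mult m_def)
      then show ?thesis
        using True \<open>e > 0\<close> by (subst (asm) ennreal_le_iff) (auto simp: m_def)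
    qed
    have "m = 0"
    proof (rule ccontr)
      assume "m \<noteq> 0"
      then have m: "m > 0" using measure_nonneg by (metis m_def less_eq_real_def)
      \<comment> \<open>This choice of e makes p (m + e) equal to (p + q) m / 2, which is less than
        q m.\<close>
      have "q * m \<le> p * (m + (q - p) * m / (2 * p))"
        by (rule key) (use m pq True in simp)
      also have "\<dots> = (p + q) / 2 * m"
        using True by (simp add: field_simps)
      finally show False
        using m pq by simp
    qed
    then show ?thesis
      using Sl unfolding m_def S_def by (simp add: negligible_iff_measure)
  qed
  then have "negligible (\<Union>n::nat. quotient_osc f p q \<inter> ball 0 (real n))"
    by (intro negligible_countable_Union) auto
  moreover have "quotient_osc f p q \<subseteq> (\<Union>n::nat. quotient_osc f p q \<inter> ball 0 (real n))"
    by (auto simp: reals_Archimedean2)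
  ultimately show ?thesis
    using negligible_subset by blast
qed

text \<open>Off the exceptional set no two rationals fit strictly between Liminf and Limsup of the
  difference quotient, so these agree; the Lipschitz bound makes the common value finite. Working in
  \<open>ereal\<close> guarantees that both exist.\<close>

lemma mono_lipschitz_differentiable_AE:
  fixes f :: "real \<Rightarrow> real"
  assumes mono: "mono f" and lip: "\<And>x y. \<bar>f x - f y\<bar> \<le> K * \<bar>x - y\<bar>"
  obtains N where "negligible N" "\<And>x. x \<notin> N \<Longrightarrow> f differentiable (at x)"
proof
  have "K-lipschitz_on UNIV f"
  proof (rule lipschitz_onI)
    show "0 \<le> K" using order_trans [OF abs_ge_zero lip [of 0 1]] by simp
  qed (use lip in \<open>simp add: dist_real_def\<close>)
  then have cont: "continuous_on UNIV f"
    by (rule lipschitz_on_continuous_on)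
  define N where "N = (\<Union>p\<in>\<rat>. \<Union>q\<in>\<rat> \<inter> {p<..}. quotient_osc f p q)"
  show "negligible N"
    unfolding N_def
    by (intro negligible_countable_Union countable_image countable_rat)
       (auto intro!: negligible_Union_nat negligible_countable_Union countable_image
          negligible_quotient_osc mono cont intro: countable_subset [OF _ countable_rat])
  fix x assume "x \<notin> N"
  let ?D = "\<lambda>y. (f y - f x) / (y - x)"
  have bd: "\<bar>?D y\<bar> \<le> K" if "y \<noteq> x" for y
    using lip [of y x] that by (simp add: abs_divide divide_le_eq)
  let ?F = "at x :: real filter"
  define l where "l = Liminf ?F (\<lambda>y. ereal (?D y))"
  define u where "u = Limsup ?F (\<lambda>y. ereal (?D y))"
  have lu: "l \<le> u"
    unfolding l_def u_def by (rule Liminf_le_Limsup) simp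
  have "l = u"
  proof (rule ccontr)
    assume "l \<noteq> u"
    then have "l < u" using lu by simp
    then obtain p' where p': "l < ereal (real_of_rat p')" "ereal (real_of_rat p') < u"
      by (metis ereal_dense3)
    then obtain q' where q': "ereal (real_of_rat p') < ereal (real_of_rat q')" "ereal (real_of_rat q') < u"
      by (metis ereal_dense3)
    let ?p = "real_of_rat p'" and ?q = "real_of_rat q'"
    have a: "\<exists>\<^sub>F y in ?F. ereal (?D y) < ?p"
    proof (rule ccontr)
      assume "\<not> ?thesis"
      then have "\<forall>\<^sub>F y in ?F. ereal ?p \<le> ereal (?D y)"
        by (simp add: not_frequently not_less)
      then have "ereal ?p \<le> l" unfolding l_def by (rule Liminf_bounded)
      then show False using p' by simp
    qed
    have b: "\<exists>\<^sub>F y in ?F. ?q < ereal (?D y)"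
    proof (rule ccontr)
      assume "\<not> ?thesis"
      then have "\<forall>\<^sub>F y in ?F. ereal (?D y) \<le> ereal ?q"
        by (simp add: not_frequently not_less)
      then have "u \<le> ereal ?q" unfolding u_def by (rule Limsup_bounded)
      then show False using q' by simp
    qed
    have "x \<in> quotient_osc f ?p ?q"
      using a b unfolding quotient_osc_def frequently_at by (auto simp: dist_real_def)
    then have "x \<in> N"
      using q' unfolding N_def by force
    then show False using \<open>x \<notin> N\<close> by simp
  qed
  have "\<bar>l\<bar> \<noteq> \<infinity>"
  proof -
    have 1: "\<forall>\<^sub>F y in ?F. ereal (- K) \<le> ereal (?D y)" and 2: "\<forall>\<^sub>F y in ?F. ereal (?D y) \<le> ereal K"
      using bd unfolding eventually_at_filter ereal_less_eq abs_le_iff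
      by (auto simp: minus_le_iff intro!: always_eventually)
    have "ereal (-K) \<le> l" unfolding l_def
      by (rule Liminf_bounded [OF 1])
    moreover have "u \<le> ereal K" unfolding u_def
      by (rule Limsup_bounded [OF 2])
    ultimately show ?thesis using \<open>l = u\<close> by auto
  qed
  then obtain L where L: "l = ereal L" by auto
  have "((\<lambda>y. ereal (?D y)) \<longlongrightarrow> ereal L) ?F"
    by (subst tendsto_iff_Liminf_eq_Limsup) (use L \<open>l = u\<close> l_def u_def in auto)
  then have "(?D \<longlongrightarrow> L) ?F" by simp
  then have "(f has_real_derivative L) (at x)"
    by (simp add: has_field_derivative_iff)
  then show "f differentiable (at x)"
    by (metis differentiableI has_field_derivative_def)
qed

text \<open>Adding \<open>K * x\<close> makes the function increasing and changes neither Lipschitz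
  continuity nor differentiability.\<close>

lemma lipschitz_differentiable_AE:
  fixes f :: "real \<Rightarrow> real"
  assumes lip: "\<And>x y. \<bar>f x - f y\<bar> \<le> K * \<bar>x - y\<bar>"
  obtains N where "negligible N" "\<And>x. x \<notin> N \<Longrightarrow> f differentiable (at x)"
proof -
  have "mono (\<lambda>x. f x + K * x)"
  proof (rule monoI)
    fix x y :: real assume "x \<le> y"
    then show "f x + K * x \<le> f y + K * y"
      using lip [of x y] by (simp add: algebra_simps abs_le_iff)
  qed
  moreover have "\<bar>(f x + K * x) - (f y + K * y)\<bar> \<le> (2 * K) * \<bar>x - y\<bar>" for x y
  proof -
    have K: "0 \<le> K" using order_trans [OF abs_ge_zero lip [of 0 1]] by simp
    have "\<bar>(f x + K * x) - (f y + K * y)\<bar> \<le> \<bar>f x - f y\<bar> + \<bar>K * (x - y)\<bar>"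
      by (simp add: algebra_simps abs_if)
    also have "\<dots> \<le> (2 * K) * \<bar>x - y\<bar>"
      using lip [of x y] K by (simp add: abs_mult)
    finally show ?thesis .
  qed
  ultimately obtain N where N: "negligible N" "\<And>x. x \<notin> N \<Longrightarrow> (\<lambda>x. f x + K * x) differentiable (at x)"
    by (rule mono_lipschitz_differentiable_AE) blast
  show thesis
  proof
    show "f differentiable (at x)" if "x \<notin> N" for x
    proof -
      have "(\<lambda>x. (f x + K * x) - K * x) differentiable (at x)"
        by (intro derivative_intros N that)
      then show ?thesis by simp
    qed
  qed (fact N)
qed

text \<open>The forward quotients are bounded by K and converge to \<open>f'\<close> off a null set,
  while their integrals reduce, by translation, to averages of f just after b and just after a.
  Continuity of f gives the limits of these averages, dominated convergence the rest.\<close>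

lemma lipschitz_fundamental_theorem:
  fixes f f' :: "real \<Rightarrow> real"
  assumes lip: "\<And>x y. \<bar>f x - f y\<bar> \<le> K * \<bar>x - y\<bar>" and N: "negligible N" and ab: "a \<le> b"
    and der: "\<And>x. x \<in> {a..b} - N \<Longrightarrow> (f has_real_derivative f' x) (at x)"
  shows "(f' has_integral (f b - f a)) {a..b}"
proof -
  have "K-lipschitz_on UNIV f"
  proof (rule lipschitz_onI)
    show "0 \<le> K" using order_trans [OF abs_ge_zero lip [of 0 1]] by simp
  qed (use lip in \<open>simp add: dist_real_def\<close>)
  then have cont: "continuous_on S f" for S
    using lipschitz_on_continuous_on continuous_on_subset by blast
  define g where "g n x = (f (x + 1 / real (Suc n)) - f x) * real (Suc n)" for n x
  have contg: "continuous_on S (g n)" for S n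
    unfolding g_def by (intro continuous_intros continuous_on_compose2 [OF cont [of UNIV]]) auto
  \<comment> \<open>The primitive is used up to b + 1 because the shifts 1 / Suc n are at most
    1.\<close>
  define P where "P x = integral {a..x} f" for x
  have P: "(P has_real_derivative f x) (at x within {a..b+1})" if "x \<in> {a..b+1}" for x
    unfolding P_def using integral_has_real_derivative [OF cont that] by blast
  have intg: "(g n has_integral (real (Suc n) * (P (b + 1 / real (Suc n)) - P b) - real (Suc n) * P (a + 1 / real (Suc n)))) {a..b}" for n
  proof -
    define h where "h = 1 / real (Suc n)"
    have h: "0 < h" "h \<le> 1" by (auto simp: h_def)
    have 1: "((\<lambda>x. f (x + h)) has_integral (P (b + h) - P (a + h))) {a..b}"
    proof -
      have "(f has_integral integral {a+h..b+h} f) {a+h..b+h}"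
        by (intro integrable_integral integrable_continuous_interval cont)
      then have "((\<lambda>x. f (x + h)) has_integral integral {a+h..b+h} f) {a..b}"
        using has_integral_shift_real_ivl [of f _ "a+h" "b+h" h]
        by (simp add: add.commute)
      moreover have "P (a+h) + integral {a+h..b+h} f = P (b+h)"
        unfolding P_def using h ab
        by (intro Henstock_Kurzweil_Integration.integral_combine integrable_continuous_interval cont) auto
      ultimately show ?thesis
        using eq_diff_eq by (metis add.commute)
    qed
    have 2: "(f has_integral P b) {a..b}"
      unfolding P_def by (intro integrable_integral integrable_continuous_interval cont)
    have "((\<lambda>x. (f (x + h) - f x) * real (Suc n)) has_integral ((P (b + h) - P (a + h) - P b) * real (Suc n))) {a..b}"
      by (intro has_integral_mult_left has_integral_diff 1 2)
    then show ?thesis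
      unfolding g_def h_def by (simp add: algebra_simps)
  qed
  have lim: "(\<lambda>n. real (Suc n) * (P (c + 1 / real (Suc n)) - P c)) \<longlonglongrightarrow> f c" if "c \<in> {a..b}" for c
  proof -
    have "((\<lambda>y. (P y - P c) / (y - c)) \<longlongrightarrow> f c) (at c within {a..b+1})"
      using P [of c] that by (simp add: has_field_derivative_iff)
    moreover have "filterlim (\<lambda>n. c + 1 / real (Suc n)) (at c within {a..b+1}) sequentially"
      unfolding filterlim_at
    proof
      show "\<forall>\<^sub>F n in sequentially. c + 1 / real (Suc n) \<in> {a..b+1} \<and> c + 1 / real (Suc n) \<noteq> c"
        using that by (intro always_eventually) (auto intro!: add_mono simp: add_increasing2)
      have "(\<lambda>n. c + 1 / real (Suc n)) \<longlonglongrightarrow> c + 0"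
        by (intro tendsto_intros lim_1_over_n [THEN LIMSEQ_Suc])
      then show "(\<lambda>n. c + 1 / real (Suc n)) \<longlonglongrightarrow> c" by simp
    qed
    ultimately have "(\<lambda>n. (P (c + 1 / real (Suc n)) - P c) / (c + 1 / real (Suc n) - c)) \<longlonglongrightarrow> f c"
      by (rule filterlim_compose)
    then show ?thesis by (simp add: field_simps)
  qed
  have Pa: "P a = 0" by (simp add: P_def)
  have limI: "(\<lambda>n. integral {a..b} (g n)) \<longlonglongrightarrow> f b - f a"
  proof -
    have "(\<lambda>n. integral {a..b} (g n)) = (\<lambda>n. real (Suc n) * (P (b + 1 / real (Suc n)) - P b) - real (Suc n) * (P (a + 1 / real (Suc n)) - P a))"
      using intg Pa by (auto simp: integral_unique)
    then show ?thesis
      using ab by (simp only:) (intro tendsto_diff lim, auto)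
  qed
  let ?S = "{a..b} - N"
  have ig: "g n integrable_on ?S" "integral ?S (g n) = integral {a..b} (g n)" for n
  proof -
    have "g n integrable_on {a..b}" by (intro integrable_continuous_interval contg)
    then show "g n integrable_on ?S"
      by (rule integrable_spike_set) (auto intro: negligible_subset [OF N])
    show "integral ?S (g n) = integral {a..b} (g n)"
      by (rule integral_spike_set) (auto intro: negligible_subset [OF N])
  qed
  have bound: "norm (g n x) \<le> K" for n x
  proof -
    have "\<bar>f (x + 1 / real (Suc n)) - f x\<bar> \<le> K * (1 / real (Suc n))"
      using lip [of "x + 1 / real (Suc n)" x] by simp
    then have "\<bar>f (x + 1 / real (Suc n)) - f x\<bar> * real (Suc n) \<le> K * (1 / real (Suc n)) * real (Suc n)"
      by (intro mult_right_mono) auto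
    then show ?thesis
      unfolding g_def real_norm_def abs_mult abs_of_nat by simp
  qed
  have conv: "(\<lambda>n. g n x) \<longlonglongrightarrow> f' x" if "x \<in> ?S" for x
  proof -
    have "((\<lambda>y. (f y - f x) / (y - x)) \<longlongrightarrow> f' x) (at x)"
      using der that by (simp add: has_field_derivative_iff)
    moreover have "filterlim (\<lambda>n. x + 1 / real (Suc n)) (at x) sequentially"
      unfolding filterlim_at
    proof
      have "(\<lambda>n. x + 1 / real (Suc n)) \<longlonglongrightarrow> x + 0"
        by (intro tendsto_intros lim_1_over_n [THEN LIMSEQ_Suc])
      then show "(\<lambda>n. x + 1 / real (Suc n)) \<longlonglongrightarrow> x" by simp
    qed auto
    ultimately have "(\<lambda>n. (f (x + 1 / real (Suc n)) - f x) / (x + 1 / real (Suc n) - x)) \<longlonglongrightarrow> f' x"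
      by (rule filterlim_compose)
    then show ?thesis by (simp add: g_def field_simps)
  qed
  have Kint: "(\<lambda>x. K) integrable_on ?S"
    by (rule integrable_spike_set [of _ "{a..b}"]) (auto intro: negligible_subset [OF N])
  have "f' integrable_on ?S" "(\<lambda>n. integral ?S (g n)) \<longlonglongrightarrow> integral ?S f'"
    using dominated_convergence [OF ig(1) Kint bound conv] by auto
  then have "f' integrable_on ?S" "integral ?S f' = f b - f a"
    using limI LIMSEQ_unique ig(2) by auto
  then have "(f' has_integral (f b - f a)) ?S"
    by (simp add: has_integral_iff)
  moreover have "(f' has_integral (f b - f a)) ?S \<longleftrightarrow> (f' has_integral (f b - f a)) {a..b}"
    by (rule has_integral_spike_set_eq) (auto intro: negligible_subset [OF N])
  ultimately show ?thesis by simp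
qed

section \<open>Change of variables and polar coordinates in the complex plane\<close>

text \<open>Carries the gauge integral across an identification of two Euclidean spaces. Preserving
  boxes and their content handles bounded boxes; preserving norms lets the limit over boxes that
  contain large balls go through.\<close>

lemma has_integral_box_isometry:
  fixes T :: "'a::euclidean_space \<Rightarrow> 'b::euclidean_space" and f :: "'b \<Rightarrow> 'c::banach"
  assumes TU: "\<And>x. T (U x) = x" and UT: "\<And>x. U (T x) = x" and cont: "\<And>x. isCont T x"
    and box: "\<And>a b. T ` cbox a b = cbox (T a) (T b)"
    and content: "\<And>a b. measure lborel (cbox (T a) (T b)) = measure lborel (cbox a b)"
    and norm: "\<And>x. norm (T x) = norm x"
    and f: "(f has_integral i) S"
  shows "((\<lambda>x. f (T x)) has_integral i) (U ` S)"
proof -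
  have inU: "x \<in> U ` S \<longleftrightarrow> T x \<in> S" for x
    using TU UT by (metis image_iff)
  have boxU: "U ` cbox a b = cbox (U a) (U b)" for a b
    using box [of "U a" "U b"] TU UT by (metis (no_types, lifting) image_cong image_image image_ident)
  let ?g = "\<lambda>x. if x \<in> S then f x else 0"
  let ?h = "\<lambda>x. if x \<in> U ` S then f (T x) else 0"
  have *: "(?h has_integral z) (cbox (U a) (U b))" if "(?g has_integral z) (cbox a b)" for z a b
  proof -
    have "((\<lambda>x. ?g (T x)) has_integral (1 / 1) *\<^sub>R z) (U ` cbox a b)"
      by (rule has_integral_twiddle [OF _ UT TU cont]) (use box boxU content that in auto)
    then show ?thesis
      by (simp add: boxU inU)
  qed
  show ?thesis
    unfolding has_integral' [of "\<lambda>x. f (T x)"]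
  proof (intro allI impI)
    fix e :: real assume "e > 0"
    then obtain B where B: "B > 0" "\<And>a b. ball 0 B \<subseteq> cbox a b \<Longrightarrow>
        \<exists>z. (?g has_integral z) (cbox a b) \<and> norm (z - i) < e"
      using f unfolding has_integral' [of f] by metis
    show "\<exists>B>0. \<forall>a b. ball 0 B \<subseteq> cbox a b \<longrightarrow>
        (\<exists>z. (?h has_integral z) (cbox a b) \<and> norm (z - i) < e)"
    proof (intro exI [of _ B] conjI allI impI)
      fix a b :: 'a assume ab: "ball 0 B \<subseteq> cbox a b"
      have "ball 0 B \<subseteq> cbox (T a) (T b)"
      proof
        fix y :: 'b assume "y \<in> ball 0 B"
        then have "norm (U y) < B"
          using norm [of "U y"] TU by simp
        then have "U y \<in> cbox a b" using ab by auto
        then show "y \<in> cbox (T a) (T b)"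
          using box TU by (metis image_eqI)
      qed
      then obtain z where z: "(?g has_integral z) (cbox (T a) (T b))" "norm (z - i) < e"
        using B by blast
      then show "\<exists>z. (?h has_integral z) (cbox a b) \<and> norm (z - i) < e"
        using * [OF z(1)] UT by auto
    qed (use B in auto)
  qed
qed

section \<open>The complex plane in the coordinates of \<open>real^2\<close>\<close>

definition complex_of_vec :: "real^2 \<Rightarrow> complex" where
  "complex_of_vec v = Complex (v $ 1) (v $ 2)"

definition vec_of_complex :: "complex \<Rightarrow> real^2" where
  "vec_of_complex z = vector [Re z, Im z]"

lemma vec_of_complex_nth [simp]: "vec_of_complex z $ 1 = Re z" "vec_of_complex z $ 2 = Im z"
  by (auto simp: vec_of_complex_def)

lemma complex_of_vec_inverse [simp]: "vec_of_complex (complex_of_vec v) = v"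
  by (simp add: vec_eq_iff forall_2 complex_of_vec_def)

lemma vec_of_complex_inverse [simp]: "complex_of_vec (vec_of_complex z) = z"
  by (simp add: complex_of_vec_def)

lemma linear_complex_of_vec: "linear complex_of_vec"
  by (rule linearI) (auto simp: complex_of_vec_def complex_eq_iff)

lemma linear_vec_of_complex: "linear vec_of_complex"
  by (rule linearI) (auto simp: vec_eq_iff forall_2)

lemma norm_complex_of_vec [simp]: "norm (complex_of_vec v) = norm v"
  by (simp add: complex_of_vec_def norm_vec_def L2_set_def sum_2 cmod_def)

lemma norm_vec_of_complex [simp]: "norm (vec_of_complex z) = norm z"
  by (metis norm_complex_of_vec vec_of_complex_inverse)

lemma box_complex_of_vec: "complex_of_vec ` cbox a b = cbox (complex_of_vec a) (complex_of_vec b)"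
proof -
  have "v \<in> cbox a b \<longleftrightarrow> complex_of_vec v \<in> cbox (complex_of_vec a) (complex_of_vec b)" for v
    by (auto simp: mem_box_cart forall_2 in_cbox_complex_iff complex_of_vec_def)
  then show ?thesis
    by (metis (no_types, lifting) image_iff set_eqI vec_of_complex_inverse)
qed

lemma box_vec_of_complex: "vec_of_complex ` cbox a b = cbox (vec_of_complex a) (vec_of_complex b)"
  using box_complex_of_vec [of "vec_of_complex a" "vec_of_complex b"]
  by (metis (no_types, lifting) complex_of_vec_inverse image_cong image_image image_ident vec_of_complex_inverse)

lemma content_complex_of_vec: "measure lborel (cbox (complex_of_vec a) (complex_of_vec b)) = measure lborel (cbox a b)"
proof -
  have 1: "measure lborel (cbox x y) = (if Re x \<le> Re y \<and> Im x \<le> Im y then (Re y - Re x) * (Im y - Im x) else 0)" for x y :: complex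
    by (auto simp: content_cbox_if_cart content_cbox' content_eq_0 Basis_complex_def box_eq_empty not_le content_cbox_if)
  have 2: "measure lborel (cbox a b) = (if a$1 \<le> b$1 \<and> a$2 \<le> b$2 then (b$1 - a$1) * (b$2 - a$2) else 0)"
  proof -
    have "cbox a b = {} \<longleftrightarrow> \<not> (a$1 \<le> b$1 \<and> a$2 \<le> b$2)"
      using interval_ne_empty_cart(1) [of a b] by (auto simp: forall_2)
    then show ?thesis
      by (auto simp: content_cbox_if_cart UNIV_2)
  qed
  show ?thesis
    unfolding 1 2 by (simp add: complex_of_vec_def)
qed

lemma has_integral_complex_of_vec:
  fixes f :: "complex \<Rightarrow> 'c::banach"
  shows "((\<lambda>v. f (complex_of_vec v)) has_integral i) (vec_of_complex ` S) \<longleftrightarrow> (f has_integral i) S"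
proof
  have c1: "isCont complex_of_vec x" for x
    by (intro linear_continuous_at) (simp add: linear_complex_of_vec linear_conv_bounded_linear [symmetric])
  have c2: "isCont vec_of_complex y" for y
    by (intro linear_continuous_at) (simp add: linear_vec_of_complex linear_conv_bounded_linear [symmetric])
  show "((\<lambda>v. f (complex_of_vec v)) has_integral i) (vec_of_complex ` S)" if "(f has_integral i) S"
    by (rule has_integral_box_isometry [OF _ _ c1 box_complex_of_vec content_complex_of_vec _ that]) auto
  show "(f has_integral i) S" if *: "((\<lambda>v. f (complex_of_vec v)) has_integral i) (vec_of_complex ` S)"
  proof -
    have "((\<lambda>z. f (complex_of_vec (vec_of_complex z))) has_integral i) (complex_of_vec ` (vec_of_complex ` S))"
      by (rule has_integral_box_isometry [OF _ _ c2 box_vec_of_complex _ _ *])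
        (auto simp: content_complex_of_vec [of "vec_of_complex _" "vec_of_complex _", symmetric])
    then show ?thesis by (simp add: image_image)
  qed
qed

lemma integrable_complex_of_vec:
  fixes f :: "complex \<Rightarrow> 'c::banach"
  shows "(\<lambda>v. f (complex_of_vec v)) integrable_on (vec_of_complex ` S) \<longleftrightarrow> f integrable_on S"
    "integral (vec_of_complex ` S) (\<lambda>v. f (complex_of_vec v)) = integral S f"
  by (simp_all add: integrable_on_def integral_def has_integral_complex_of_vec)

lemma absolutely_integrable_complex_of_vec:
  fixes f :: "complex \<Rightarrow> 'c::euclidean_space"
  shows "(\<lambda>v. f (complex_of_vec v)) absolutely_integrable_on (vec_of_complex ` S) \<longleftrightarrow> f absolutely_integrable_on S"
  unfolding absolutely_integrable_on_def using integrable_complex_of_vec(1) [where f=f] integrable_complex_of_vec(1) [where f="\<lambda>z. norm (f z)"]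
  by simp

text \<open>The real derivative of a holomorphic map is multiplication by \<open>g'\<close>, whose
  determinant is |g'|^2; the integral is moved to \<open>real^2\<close>, where the theorem is stated
  with determinants. A complex integrand serves the kernel integrals and, through
  \<open>of_real\<close>, the energies.\<close>

lemma has_absolute_integral_change_of_variables_complex:
  fixes f g g' :: "complex \<Rightarrow> complex"
  assumes S: "S \<in> sets lebesgue"
    and der: "\<And>z. z \<in> S \<Longrightarrow> (g has_field_derivative g' z) (at z within S)"
    and inj: "inj_on g S"
  shows "(\<lambda>z. (cmod (g' z))\<^sup>2 *\<^sub>R f (g z)) absolutely_integrable_on S \<and>
           integral S (\<lambda>z. (cmod (g' z))\<^sup>2 *\<^sub>R f (g z)) = b
     \<longleftrightarrow> f absolutely_integrable_on (g ` S) \<and> integral (g ` S) f = b"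
proof -
  let ?U = vec_of_complex and ?T = complex_of_vec
  let ?S = "?U ` S"
  let ?g = "\<lambda>v. ?U (g (?T v))"
  let ?g' = "\<lambda>v h. ?U (g' (?T v) * ?T h)"
  let ?f = "\<lambda>v. ?U (f (?T v))"
  have blT: "bounded_linear ?T" and blU: "bounded_linear ?U"
    using linear_complex_of_vec linear_vec_of_complex by (auto simp: linear_conv_bounded_linear)
  \<comment> \<open>Measurability of the image is read off from integrability of the constant 1,
    which means finite measure; hence the exhaustion by bounded pieces.\<close>
  have S': "?S \<in> sets lebesgue"
  proof -
    have "?T -` S \<inter> space lebesgue \<in> sets lebesgue"
    proof -
      have *: "S \<inter> cball 0 (real n) \<in> lmeasurable" for n
        using S by (intro bounded_set_imp_lmeasurable) auto
      have "?U ` (S \<inter> cball 0 (real n)) \<in> lmeasurable" for n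
        using * [of n] unfolding lmeasurable_iff_integrable_on
        using integrable_complex_of_vec(1) [of "\<lambda>_. 1 :: real"] by simp
      then have "(\<Union>n. ?U ` (S \<inter> cball 0 (real n))) \<in> sets lebesgue"
        by (intro sets.countable_UN) (auto dest: fmeasurableD)
      moreover have "(\<Union>n. ?U ` (S \<inter> cball 0 (real n))) = ?T -` S"
      proof (intro equalityI subsetI)
        fix v assume "v \<in> ?T -` S"
        moreover obtain n where "norm (?T v) \<le> real n"
          using real_arch_simple by blast
        ultimately have "?U (?T v) \<in> ?U ` (S \<inter> cball 0 (real n))"
          by (intro imageI) auto
        then show "v \<in> (\<Union>n. ?U ` (S \<inter> cball 0 (real n)))" by auto
      qed auto
      ultimately show ?thesis by simp
    qed
    moreover have "?S = ?T -` S"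
      by (auto simp: image_iff) (metis complex_of_vec_inverse)
    ultimately show ?thesis by simp
  qed
  have der': "(?g has_derivative ?g' v) (at v within ?S)" if "v \<in> ?S" for v
  proof -
    have im: "?T ` ?S = S" by (simp add: image_image)
    have "(g has_derivative (*) (g' (?T v))) (at (?T v) within ?T ` ?S)"
      using der [of "?T v"] that im by (auto simp: has_field_derivative_def)
    then have "((\<lambda>v. g (?T v)) has_derivative (\<lambda>h. g' (?T v) * ?T h)) (at v within ?S)"
      using has_derivative_in_compose [OF bounded_linear_imp_has_derivative [OF blT]] by blast
    then show ?thesis
      by (rule bounded_linear.has_derivative [OF blU])
  qed
  have inj': "inj_on ?g ?S"
    using inj unfolding inj_on_def by (auto) (metis vec_of_complex_inverse)
  have det: "det (matrix (?g' v)) = (cmod (g' (?T v)))\<^sup>2" for v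
  proof -
    have "?T (axis 1 1) = 1" "?T (axis 2 1) = \<i>"
      by (auto simp: complex_of_vec_def axis_def complex_eq_iff)
    then show ?thesis
      unfolding det_2 matrix_def cmod_power2 by (simp add: power2_eq_square)
  qed
  have im: "?g ` ?S = ?U ` (g ` S)" by (simp add: image_image)
  have eqU: "?U y = ?U z \<longleftrightarrow> y = z" for y z by (metis vec_of_complex_inverse)
  have absU: "(\<lambda>v. ?U (h v)) absolutely_integrable_on A \<longleftrightarrow> h absolutely_integrable_on A" for h :: "real^2 \<Rightarrow> complex" and A
    using absolutely_integrable_linear [OF _ blU, where f=h] absolutely_integrable_linear [OF _ blT, where f="\<lambda>v. ?U (h v)"]
    by (auto simp: o_def)
  have intU: "integral A (\<lambda>v. ?U (h v)) = ?U (integral A h)" if "h absolutely_integrable_on A" for h :: "real^2 \<Rightarrow> complex" and A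
    using integral_linear [OF _ blU, of h A] that by (auto simp: o_def absolutely_integrable_on_def)
  have sc: "c *\<^sub>R ?U y = ?U (c *\<^sub>R y)" for c y
    by (simp add: linear_cmul [OF linear_vec_of_complex])
  have conv: "(\<lambda>v. ?U (h (?T v))) absolutely_integrable_on (?U ` A) \<and> integral (?U ` A) (\<lambda>v. ?U (h (?T v))) = ?U b
      \<longleftrightarrow> h absolutely_integrable_on A \<and> integral A h = b" for h :: "complex \<Rightarrow> complex" and A
  proof (cases "h absolutely_integrable_on A")
    case True
    then have 1: "(\<lambda>v. h (?T v)) absolutely_integrable_on (?U ` A)"
      by (simp add: absolutely_integrable_complex_of_vec)
    have "integral (?U ` A) (\<lambda>v. ?U (h (?T v))) = ?U (integral A h)"
      by (simp add: intU [OF 1] integrable_complex_of_vec)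
    then show ?thesis
      by (simp add: absU 1 True eqU)
  qed (simp add: absU absolutely_integrable_complex_of_vec)
  have "(\<lambda>v. \<bar>det (matrix (?g' v))\<bar> *\<^sub>R ?f (?g v)) absolutely_integrable_on ?S \<and>
           integral ?S (\<lambda>v. \<bar>det (matrix (?g' v))\<bar> *\<^sub>R ?f (?g v)) = ?U b
     \<longleftrightarrow> ?f absolutely_integrable_on (?g ` ?S) \<and> integral (?g ` ?S) ?f = ?U b"
    by (rule has_absolute_integral_change_of_variables [OF S' der' inj'])
  moreover have "(\<lambda>v. \<bar>det (matrix (?g' v))\<bar> *\<^sub>R ?f (?g v)) = (\<lambda>v. ?U ((cmod (g' (?T v)))\<^sup>2 *\<^sub>R f (g (?T v))))"
    by (simp add: det sc)
  ultimately show ?thesis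
    using conv [where h="\<lambda>z. (cmod (g' z))\<^sup>2 *\<^sub>R f (g z)" and A=S] conv [where h=f and A="g ` S"] unfolding im by simp
qed

section \<open>Fubini and polar coordinates through the logarithmic strip\<close>

lemma lborel_complex_eq_prod: "lborel = distr (lborel \<Otimes>\<^sub>M lborel) borel (\<lambda>(x, y). Complex x y)"
proof (rule lborel_eqI)
  have [measurable]: "(\<lambda>(x, y). Complex x y) \<in> borel_measurable (lborel \<Otimes>\<^sub>M lborel)"
    unfolding lborel_prod measurable_lborel2 case_prod_beta Complex_eq
    by (intro borel_measurable_continuous_onI continuous_intros)
  fix l u :: complex assume le: "\<And>b. b \<in> Basis \<Longrightarrow> l \<bullet> b \<le> u \<bullet> b"
  have "(\<lambda>(x, y). Complex x y) -` box l u \<inter> space (lborel \<Otimes>\<^sub>M lborel) = {Re l<..<Re u} \<times> {Im l<..<Im u}"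
    by (auto simp: in_box_complex_iff space_pair_measure)
  then have "emeasure (distr (lborel \<Otimes>\<^sub>M lborel) borel (\<lambda>(x, y). Complex x y)) (box l u)
     = emeasure (lborel \<Otimes>\<^sub>M lborel) ({Re l<..<Re u} \<times> {Im l<..<Im u})"
    by (subst emeasure_distr) auto
  also have "\<dots> = emeasure lborel {Re l<..<Re u} * emeasure lborel {Im l<..<Im u}"
    by (rule lborel.emeasure_pair_measure_Times) auto
  also have "\<dots> = ennreal ((Re u - Re l) * (Im u - Im l))"
    using le [of 1] le [of \<i>] by (simp add: Basis_complex_def ennreal_mult)
  also have "(Re u - Re l) * (Im u - Im l) = (\<Prod>b\<in>Basis. (u - l) \<bullet> b)"
    by (simp add: Basis_complex_def)
  finally show "emeasure (distr (lborel \<Otimes>\<^sub>M lborel) borel (\<lambda>(x, y). Complex x y)) (box l u) = ennreal (\<Prod>b\<in>Basis. (u - l) \<bullet> b)" .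
qed simp

text \<open>The bridge between the two integrals in use: \<open>absolutely_integrable_on\<close>
  refers to Lebesgue measure, product measures and Fubini to \<open>lborel\<close>. Continuity on a
  Borel set makes the extension by zero Borel, and completion then changes nothing.\<close>

lemma absolutely_integrable_on_iff_lborel:
  fixes f :: "'a::euclidean_space \<Rightarrow> 'b::euclidean_space"
  assumes "continuous_on S f" "S \<in> sets borel"
  shows "f absolutely_integrable_on S \<longleftrightarrow> integrable lborel (\<lambda>x. indicator S x *\<^sub>R f x)"
    and "f absolutely_integrable_on S \<Longrightarrow> integral S f = (\<integral>x. indicator S x *\<^sub>R f x \<partial>lborel)"
proof -
  have m: "(\<lambda>x. indicator S x *\<^sub>R f x) \<in> borel_measurable lborel"
    using borel_measurable_continuous_on_indicator [OF assms(2,1)] by simp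
  show "f absolutely_integrable_on S \<longleftrightarrow> integrable lborel (\<lambda>x. indicator S x *\<^sub>R f x)"
    unfolding set_integrable_def by (rule integrable_completion [OF m])
  show "integral S f = (\<integral>x. indicator S x *\<^sub>R f x \<partial>lborel)" if "f absolutely_integrable_on S"
    using set_lebesgue_integral_eq_integral(2) [OF that] integral_completion [OF m]
    by (simp add: set_lebesgue_integral_def)
qed


lemma integral_norm_nonneg: "0 \<le> integral S (\<lambda>x. norm (f x))"
  by (cases "(\<lambda>x. norm (f x)) integrable_on S")
     (auto simp: not_integrable_integral intro: Henstock_Kurzweil_Integration.integral_nonneg)

text \<open>The half strip is the disc in logarithmic coordinates, slit along the positive real
  axis. Continuity of h on the whole left half plane lets the vertical integrals be taken over the
  closed interval.\<close>

lemma strip_Fubini: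
  fixes h :: "complex \<Rightarrow> complex"
  defines "St \<equiv> {z. Re z < 0 \<and> 0 < Im z \<and> Im z < 2 * pi}"
  assumes cont: "continuous_on {z. Re z < 0} h" and h: "h absolutely_integrable_on St"
  shows "(\<lambda>x. integral {0..2*pi} (\<lambda>y. h (Complex x y))) absolutely_integrable_on {..<0}"
    and "integral {..<0} (\<lambda>x. integral {0..2*pi} (\<lambda>y. h (Complex x y))) = integral St h"
proof -
  let ?h = "\<lambda>(x,y). indicator St (Complex x y) *\<^sub>R h (Complex x y)"
  have St: "open St"
    unfolding St_def by (intro open_Collect_conj open_Collect_less continuous_intros)
  have contS: "continuous_on St h"
    by (rule continuous_on_subset [OF cont]) (auto simp: St_def)
  have [measurable]: "(\<lambda>(x, y). Complex x y) \<in> borel_measurable (lborel \<Otimes>\<^sub>M lborel)"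
    unfolding lborel_prod measurable_lborel2 case_prod_beta Complex_eq
    by (intro borel_measurable_continuous_onI continuous_intros)
  have m: "(\<lambda>z. indicator St z *\<^sub>R h z) \<in> borel_measurable borel"
    using borel_measurable_continuous_on_indicator [OF _ contS] St by simp
  have ih: "integrable lborel (\<lambda>z. indicator St z *\<^sub>R h z)"
    using absolutely_integrable_on_iff_lborel(1) [OF contS] St h by simp
  have i2: "integrable (lborel \<Otimes>\<^sub>M lborel) ?h"
    using ih integrable_distr_eq [of "\<lambda>(x, y). Complex x y" "lborel \<Otimes>\<^sub>M lborel" borel "\<lambda>z. indicator St z *\<^sub>R h z"] m
    by (subst (asm) lborel_complex_eq_prod) (simp add: case_prod_beta')
  have e2: "integral\<^sup>L (lborel \<Otimes>\<^sub>M lborel) ?h = integral St h"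
    using integral_distr [of "\<lambda>(x, y). Complex x y" "lborel \<Otimes>\<^sub>M lborel" borel "\<lambda>z. indicator St z *\<^sub>R h z",
        folded lborel_complex_eq_prod] m
      absolutely_integrable_on_iff_lborel(2) [OF contS _ h] St
    by (simp add: case_prod_beta')
  have inner: "(\<integral>y. ?h (x, y) \<partial>lborel) = indicator {..<0} x *\<^sub>R integral {0..2*pi} (\<lambda>y. h (Complex x y))" for x
  proof (cases "x < 0")
    case True
    have c: "continuous_on {0..2*pi} (\<lambda>y. h (Complex x y))"
      unfolding Complex_eq
      by (intro continuous_on_compose2 [OF cont] continuous_intros) (use True in auto)
    then have c': "continuous_on {0<..<2*pi} (\<lambda>y. h (Complex x y))"
      by (rule continuous_on_subset) auto
    have "(\<lambda>y. h (Complex x y)) absolutely_integrable_on {0..2*pi}"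
      by (rule absolutely_integrable_continuous_real [OF c])
    then have "(\<lambda>y. h (Complex x y)) absolutely_integrable_on {0<..<2*pi}"
      by (rule set_integrable_subset) auto
    then have "integral {0<..<2*pi} (\<lambda>y. h (Complex x y)) = (\<integral>y. indicator {0<..<2*pi} y *\<^sub>R h (Complex x y) \<partial>lborel)"
      by (intro absolutely_integrable_on_iff_lborel(2) [OF c']) auto
    moreover have "(\<lambda>y. ?h (x, y)) = (\<lambda>y. indicator {0<..<2*pi} y *\<^sub>R h (Complex x y))"
      using True by (auto simp: St_def indicator_def)
    ultimately show ?thesis
      using True by (simp add: integral_open_interval_real)
  qed (auto simp: St_def)
  have i1: "integrable lborel (\<lambda>x. indicator {..<0} x *\<^sub>R integral {0..2*pi} (\<lambda>y. h (Complex x y)))"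
    using lborel_pair.integrable_fst' [OF i2] unfolding inner .
  then have "integrable lebesgue (\<lambda>x. indicator {..<0} x *\<^sub>R integral {0..2*pi} (\<lambda>y. h (Complex x y)))"
    by (subst integrable_completion) (auto dest: borel_measurable_integrable)
  then show ai: "(\<lambda>x. integral {0..2*pi} (\<lambda>y. h (Complex x y))) absolutely_integrable_on {..<0}"
    by (simp add: set_integrable_def)
  have "integral {..<0} (\<lambda>x. integral {0..2*pi} (\<lambda>y. h (Complex x y)))
     = (\<integral>x. indicator {..<0} x *\<^sub>R integral {0..2*pi} (\<lambda>y. h (Complex x y)) \<partial>lborel)"
    using set_lebesgue_integral_eq_integral(2) [OF ai] i1
    by (simp add: set_lebesgue_integral_def integral_completion borel_measurable_integrable)
  also have "\<dots> = integral\<^sup>L (lborel \<Otimes>\<^sub>M lborel) ?h"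
    using lborel_pair.integral_fst' [OF i2] unfolding inner .
  finally show "integral {..<0} (\<lambda>x. integral {0..2*pi} (\<lambda>y. h (Complex x y))) = integral St h"
    using e2 by simp
qed

text \<open>The Tonelli direction: a bound on the absolute vertical integrals yields integrability
  on the strip. It turns estimates on circles into absolute integrability on the disc.\<close>

lemma strip_absolutely_integrable_bound:
  fixes h :: "complex \<Rightarrow> complex"
  defines "St \<equiv> {z. Re z < 0 \<and> 0 < Im z \<and> Im z < 2 * pi}"
  assumes cont: "continuous_on {z. Re z < 0} h"
    and bound: "\<And>x. x < 0 \<Longrightarrow> integral {0..2*pi} (\<lambda>y. norm (h (Complex x y))) \<le> B x"
    and B: "set_integrable lborel {..<0} B"
  shows "h absolutely_integrable_on St"
proof -
  let ?h = "\<lambda>(x,y). indicator St (Complex x y) *\<^sub>R h (Complex x y)"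
  have St: "open St"
    unfolding St_def by (intro open_Collect_conj open_Collect_less continuous_intros)
  have contS: "continuous_on St h"
    by (rule continuous_on_subset [OF cont]) (auto simp: St_def)
  have [measurable]: "(\<lambda>(x, y). Complex x y) \<in> borel_measurable (lborel \<Otimes>\<^sub>M lborel)"
    unfolding lborel_prod measurable_lborel2 case_prod_beta Complex_eq
    by (intro borel_measurable_continuous_onI continuous_intros)
  have m [measurable]: "(\<lambda>z. indicator St z *\<^sub>R h z) \<in> borel_measurable borel"
    using borel_measurable_continuous_on_indicator [OF _ contS] St by simp
  have mh [measurable]: "?h \<in> borel_measurable (lborel \<Otimes>\<^sub>M lborel)"
    using measurable_compose [OF _ m, of "\<lambda>(x, y). Complex x y" "lborel \<Otimes>\<^sub>M lborel"] by (simp add: case_prod_beta')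
  have c: "continuous_on {0..2*pi} (\<lambda>y. h (Complex x y))" if "x < 0" for x
    unfolding Complex_eq
    by (intro continuous_on_compose2 [OF cont] continuous_intros) (use that in auto)
  have sub: "(\<lambda>y. g (h (Complex x y))) absolutely_integrable_on {0<..<2*pi}" if "x < 0" "continuous_on UNIV g" for x and g :: "complex \<Rightarrow> 'b::euclidean_space"
  proof -
    have "(\<lambda>y. g (h (Complex x y))) absolutely_integrable_on {0..2*pi}"
      by (intro absolutely_integrable_continuous_real continuous_on_compose2 [OF that(2) c [OF that(1)]]) auto
    then show ?thesis
      by (rule set_integrable_subset) auto
  qed
  have c': "continuous_on {0<..<2*pi} (\<lambda>y. g (h (Complex x y)))" if "x < 0" "continuous_on UNIV g" for x and g :: "complex \<Rightarrow> 'b::euclidean_space"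
    by (rule continuous_on_subset [OF continuous_on_compose2 [OF that(2) c [OF that(1)]]]) auto
  have eq: "indicator St (Complex x y) *\<^sub>R h (Complex x y) = indicator {..<0} x *\<^sub>R indicator {0<..<2*pi} y *\<^sub>R h (Complex x y)" for x y
    by (auto simp: St_def indicator_def)
  have inner_i: "integrable lborel (\<lambda>y. ?h (x, y))" for x
  proof (cases "x < 0")
    case True
    then show ?thesis
      using absolutely_integrable_on_iff_lborel(1) [OF c' [OF True, of "\<lambda>z. z"]] sub [OF True, of "\<lambda>z. z"]
      by (simp add: eq)
  qed (simp add: eq)
  have inner: "(\<integral>y. norm (?h (x, y)) \<partial>lborel) = indicator {..<0} x *\<^sub>R integral {0..2*pi} (\<lambda>y. norm (h (Complex x y)))" for x
  proof (cases "x < 0")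
    case True
    have "integral {0<..<2*pi} (\<lambda>y. norm (h (Complex x y))) = (\<integral>y. indicator {0<..<2*pi} y *\<^sub>R norm (h (Complex x y)) \<partial>lborel)"
      by (intro absolutely_integrable_on_iff_lborel(2) [OF c' [OF True]] sub [OF True]) (auto intro: continuous_intros)
    moreover have "(\<lambda>y. norm (?h (x, y))) = (\<lambda>y. indicator {0<..<2*pi} y *\<^sub>R norm (h (Complex x y)))"
      using True by (auto simp: St_def indicator_def)
    ultimately show ?thesis
      using True by (simp add: integral_open_interval_real)
  qed (simp add: eq)
  have "integrable (lborel \<Otimes>\<^sub>M lborel) ?h"
  proof (rule lborel_pair.Fubini_integrable [OF mh])
    show "AE x in lborel. integrable lborel (\<lambda>y. ?h (x, y))"
      using inner_i by simp
    show "integrable lborel (\<lambda>x. \<integral>y. norm (?h (x, y)) \<partial>lborel)"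
    proof (rule Bochner_Integration.integrable_bound)
      show "integrable lborel (\<lambda>x. indicator {..<0} x *\<^sub>R B x)"
        using B by (simp add: set_integrable_def)
      show "(\<lambda>x. \<integral>y. norm (?h (x, y)) \<partial>lborel) \<in> borel_measurable lborel"
        by (rule lborel.borel_measurable_lebesgue_integral)
          (use measurable_compose [OF mh borel_measurable_norm] in \<open>simp add: case_prod_beta'\<close>)
      show "AE x in lborel. norm (\<integral>y. norm (?h (x, y)) \<partial>lborel) \<le> norm (indicator {..<0} x *\<^sub>R B x)"
      proof (intro AE_I2)
        fix x :: real
        have "integral {0..2*pi} (\<lambda>y. norm (h (Complex x y))) \<ge> 0"
          by (rule integral_norm_nonneg)
        then show "norm (\<integral>y. norm (?h (x, y)) \<partial>lborel) \<le> norm (indicator {..<0} x *\<^sub>R B x)"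
          unfolding inner using bound [of x] by (auto simp: indicator_def)
      qed
    qed
  qed
  then have "integrable lborel (\<lambda>z. indicator St z *\<^sub>R h z)"
    using integrable_distr_eq [of "\<lambda>(x, y). Complex x y" "lborel \<Otimes>\<^sub>M lborel" borel "\<lambda>z. indicator St z *\<^sub>R h z"] m
    by (subst lborel_complex_eq_prod) (simp add: case_prod_beta')
  then show ?thesis
    using absolutely_integrable_on_iff_lborel(1) [OF contS] St by simp
qed

lemma polar_change_of_variables:
  fixes f :: "complex \<Rightarrow> complex"
  defines "St \<equiv> {z. Re z < 0 \<and> 0 < Im z \<and> Im z < 2 * pi}"
  shows "(\<lambda>z. exp (2 * Re z) *\<^sub>R f (exp z)) absolutely_integrable_on St \<and> integral St (\<lambda>z. exp (2 * Re z) *\<^sub>R f (exp z)) = b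
     \<longleftrightarrow> f absolutely_integrable_on ball 0 1 \<and> integral (ball 0 1) f = b"
proof -
  have St: "open St"
    unfolding St_def by (intro open_Collect_conj open_Collect_less continuous_intros)
  have inj: "inj_on exp St"
    by (rule inj_onI, rule exp_complex_eqI) (auto simp: St_def)
  have sub: "exp ` St \<subseteq> ball 0 1"
    by (auto simp: St_def)
  \<comment> \<open>A point off the real axis has an argument strictly between 0 and 2 pi, so the
    exponential misses only part of a line.\<close>
  have "ball 0 1 - exp ` St \<subseteq> {z. \<i> \<bullet> z = 0}"
  proof clarify
    fix z :: complex assume z: "z \<in> ball 0 1" "z \<notin> exp ` St"
    show "\<i> \<bullet> z = 0"
    proof (rule ccontr)
      assume "\<i> \<bullet> z \<noteq> 0"
      then have im: "Im z \<noteq> 0" by (simp add: inner_complex_def)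
      then have "z \<noteq> 0" by auto
      have "Arg2pi z \<noteq> 0"
        using im by (auto simp: Arg2pi_eq_0 complex_is_Real_iff)
      then have "Complex (ln (cmod z)) (Arg2pi z) \<in> St"
        using Arg2pi [of z] z(1) \<open>z \<noteq> 0\<close> by (auto simp: St_def order_less_le)
      moreover have "exp (Complex (ln (cmod z)) (Arg2pi z)) = z"
        using Arg2pi_eq [of z] \<open>z \<noteq> 0\<close> by (simp add: Complex_eq exp_add exp_of_real)
      ultimately show False using z(2) by (metis imageI)
    qed
  qed
  then have neg: "negligible (ball 0 1 - exp ` St)"
    using negligible_hyperplane [of \<i> 0] negligible_subset by auto
  have "(\<lambda>z. (cmod (exp z))\<^sup>2 *\<^sub>R f (exp z)) absolutely_integrable_on St \<and> integral St (\<lambda>z. (cmod (exp z))\<^sup>2 *\<^sub>R f (exp z)) = b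
     \<longleftrightarrow> f absolutely_integrable_on (exp ` St) \<and> integral (exp ` St) f = b"
    by (rule has_absolute_integral_change_of_variables_complex [OF _ _ inj])
       (use St in \<open>auto intro!: derivative_eq_intros\<close>)
  moreover have "(cmod (exp z))\<^sup>2 = exp (2 * Re z)" for z
    by (simp add: exp_double)
  moreover have n: "negligible {x \<in> exp ` St - ball 0 1. f x \<noteq> 0}" "negligible {x \<in> ball 0 1 - exp ` St. f x \<noteq> 0}"
    using sub by (force intro: negligible_subset [OF negligible_empty]) (rule negligible_subset [OF neg], blast)
  moreover have "f absolutely_integrable_on (exp ` St) \<longleftrightarrow> f absolutely_integrable_on ball 0 1"
    by (rule absolutely_integrable_spike_set_eq [OF n])
  moreover have "integral (exp ` St) f = integral (ball 0 1) f"
    by (rule integral_spike_set [OF n])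
  ultimately show ?thesis by simp
qed

lemma polar_integral:
  fixes f :: "complex \<Rightarrow> complex"
  assumes cont: "continuous_on (ball 0 1) f" and f: "f absolutely_integrable_on ball 0 1"
  shows "(\<lambda>x. exp (2 * x) *\<^sub>R integral {0..2*pi} (\<lambda>y. f (exp (Complex x y)))) absolutely_integrable_on {..<0}"
    and "integral {..<0} (\<lambda>x. exp (2 * x) *\<^sub>R integral {0..2*pi} (\<lambda>y. f (exp (Complex x y)))) = integral (ball 0 1) f"
proof -
  let ?h = "\<lambda>z. exp (2 * Re z) *\<^sub>R f (exp z)"
  have c: "continuous_on {z. Re z < 0} ?h"
    by (intro continuous_intros continuous_on_compose2 [OF cont]) auto
  show "(\<lambda>x. exp (2 * x) *\<^sub>R integral {0..2*pi} (\<lambda>y. f (exp (Complex x y)))) absolutely_integrable_on {..<0}"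
    "integral {..<0} (\<lambda>x. exp (2 * x) *\<^sub>R integral {0..2*pi} (\<lambda>y. f (exp (Complex x y)))) = integral (ball 0 1) f"
    using strip_Fubini [OF c] polar_change_of_variables [of f "integral (ball 0 1) f"] f by simp_all
qed

lemma polar_absolutely_integrable_bound:
  fixes f :: "complex \<Rightarrow> complex"
  assumes cont: "continuous_on (ball 0 1) f"
    and bound: "\<And>x. x < 0 \<Longrightarrow> exp (2 * x) * integral {0..2*pi} (\<lambda>y. norm (f (exp (Complex x y)))) \<le> B x"
    and B: "set_integrable lborel {..<0} B"
  shows "f absolutely_integrable_on ball 0 1"
proof -
  let ?h = "\<lambda>z. exp (2 * Re z) *\<^sub>R f (exp z)"
  have c: "continuous_on {z. Re z < 0} ?h"
    by (intro continuous_intros continuous_on_compose2 [OF cont]) auto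
  show ?thesis
    using strip_absolutely_integrable_bound [OF c _ B] bound polar_change_of_variables [of f]
    by auto
qed

section \<open>The conjugate Cauchy kernel on the unit disc\<close>

lemma circlepath_integral_iff:
  "(f has_contour_integral I) (circlepath 0 r) \<longleftrightarrow>
     ((\<lambda>t. f (r * cis t) * r * \<i> * cis t) has_integral I) {0..2*pi}"
  unfolding circlepath_def by (subst has_contour_integral_part_circlepath_iff) auto

lemma exp_Complex: "exp (Complex x y) = of_real (exp x) * cis y"
  by (simp add: Complex_eq exp_add exp_of_real cis_conv_exp)

text \<open>On |z| = r the conjugate of z is r^2 / z, so 1 / cnj (w - z) turns into a Cauchy kernel
  with pole r^2 w, inside the circle. The circle integral is therefore 2 pi w f(r^2 w), and with r =
  exp x the radial integrand becomes the derivative of pi F(exp (2 x) w). At the boundary this asks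
  for a radial limit of F and nothing more.\<close>

lemma disc_kernel_integral:
  fixes f F :: "complex \<Rightarrow> complex"
  assumes F: "\<And>z. z \<in> ball 0 1 \<Longrightarrow> (F has_field_derivative f z) (at z)" and w: "cmod w = 1"
    and int: "(\<lambda>z. f z / cnj (w - z)) absolutely_integrable_on ball 0 1"
    and lim: "((\<lambda>r. F (of_real r * w)) \<longlongrightarrow> l) (at_left 1)"
  shows "integral (ball 0 1) (\<lambda>z. f z / cnj (w - z)) = of_real pi * (l - F 0)"
proof -
  have holF: "F holomorphic_on ball 0 1"
    using F by (meson field_differentiable_at_within field_differentiable_def holomorphic_on_def)
  have holf: "f holomorphic_on ball 0 1"
  proof -
    have "deriv F holomorphic_on ball 0 1"
      by (intro holomorphic_deriv holF) auto
    then show ?thesis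
      by (rule holomorphic_transform) (use F in \<open>auto dest: DERIV_imp_deriv\<close>)
  qed
  have contf: "continuous_on (ball 0 1) f"
    using holf by (rule holomorphic_on_imp_continuous_on)
  have ne: "w \<noteq> z" if "z \<in> ball 0 1" for z
    using w that by auto
  have wn: "w \<noteq> 0" using w by auto
  have cw: "cnj w = 1 / w"
    using w wn by (simp add: field_simps complex_norm_square [symmetric] mult.commute)
  have cont: "continuous_on (ball 0 1) (\<lambda>z. f z / cnj (w - z))"
    by (intro continuous_intros contf) (use ne in auto)
  have inner: "integral {0..2*pi} (\<lambda>y. f (exp (Complex x y)) / cnj (w - exp (Complex x y)))
      = 2 * of_real pi * w * f (of_real (exp (2 * x)) * w)" if "x < 0" for x
  proof -
    define r where "r = exp x"
    have r: "0 < r" "r < 1" using that by (auto simp: r_def)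
    have "r * r < r * 1" using r by (intro mult_strict_left_mono) auto
    then have inb: "of_real (r\<^sup>2) * w \<in> ball 0 r"
      using r w by (simp add: norm_mult power2_eq_square)
    have "((\<lambda>u. f u / (u - of_real (r\<^sup>2) * w)) has_contour_integral (2 * of_real pi * \<i> * f (of_real (r\<^sup>2) * w))) (circlepath 0 r)"
      by (rule Cauchy_integral_circlepath_simple)
        (rule holomorphic_on_subset [OF holf], use r inb in auto)
    then have "((\<lambda>t. f (r * cis t) / (r * cis t - of_real (r\<^sup>2) * w) * r * \<i> * cis t) has_integral (2 * of_real pi * \<i> * f (of_real (r\<^sup>2) * w))) {0..2*pi}"
      by (simp add: circlepath_integral_iff)
    \<comment> \<open>The factor w / \<i> converts the contour integrand into the integrand with
      respect to the angle.\<close>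
    then have "((\<lambda>t. (w / \<i>) * (f (r * cis t) / (r * cis t - of_real (r\<^sup>2) * w) * r * \<i> * cis t)) has_integral (w / \<i>) * (2 * of_real pi * \<i> * f (of_real (r\<^sup>2) * w))) {0..2*pi}"
      by (rule has_integral_mult_right)
    moreover have "(w / \<i>) * (f (r * cis t) / (r * cis t - of_real (r\<^sup>2) * w) * r * \<i> * cis t) = f (exp (Complex x t)) / cnj (w - exp (Complex x t))" for t
    proof -
      have e: "exp (Complex x t) = r * cis t" by (simp add: exp_Complex r_def)
      have "cnj (w - r * cis t) = 1 / w - r * cis (- t)"
        by (simp add: cw cis_cnj)
      also have "\<dots> = (cis t - r * w) / (w * cis t)"
        using wn by (simp add: field_simps cis_mult)
      finally have c: "cnj (w - r * cis t) = (cis t - r * w) / (w * cis t)" .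
      define D where "D = cis t - r * w"
      have "D \<noteq> 0"
        unfolding D_def
      proof
        assume "cis t - r * w = 0"
        then have "cmod (cis t) = cmod (r * w)" by simp
        then show False using r w by (simp add: norm_mult)
      qed
      moreover have eq: "r * cis t - of_real (r\<^sup>2) * w = r * D"
        by (simp add: power2_eq_square algebra_simps D_def)
      ultimately show ?thesis
        unfolding e c eq D_def [symmetric] using r wn by (simp add: field_simps)
    qed
    ultimately have "((\<lambda>t. f (exp (Complex x t)) / cnj (w - exp (Complex x t))) has_integral (w / \<i>) * (2 * of_real pi * \<i> * f (of_real (r\<^sup>2) * w))) {0..2*pi}"
      by simp
    moreover have "r\<^sup>2 = exp (2 * x)" by (simp add: r_def exp_double)
    ultimately show ?thesis
      by (simp add: integral_unique field_simps)
  qed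
  let ?g = "\<lambda>x. exp (2 * x) *\<^sub>R (2 * of_real pi * w * f (of_real (exp (2 * x)) * w))"
  have pol: "(\<lambda>x. exp (2 * x) *\<^sub>R integral {0..2*pi} (\<lambda>y. f (exp (Complex x y)) / cnj (w - exp (Complex x y)))) absolutely_integrable_on {..<0}"
    "integral {..<0} (\<lambda>x. exp (2 * x) *\<^sub>R integral {0..2*pi} (\<lambda>y. f (exp (Complex x y)) / cnj (w - exp (Complex x y)))) = integral (ball 0 1) (\<lambda>z. f z / cnj (w - z))"
    using polar_integral [OF cont int] by auto
  have ai: "?g absolutely_integrable_on {..<0}"
    by (rule set_integrable_cong [THEN iffD1, OF refl refl _ pol(1)]) (simp only: inner lessThan_iff)
  have eqI: "integral {..<0} ?g = integral (ball 0 1) (\<lambda>z. f z / cnj (w - z))"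
    unfolding pol(2) [symmetric] by (rule integral_cong) (simp only: inner lessThan_iff)
  have in_ball: "of_real (exp (2 * x)) * w \<in> ball 0 1" if "x < 0" for x
    using that w by (simp add: norm_mult)
  have contg: "continuous_on {..<0} ?g"
    by (intro continuous_intros continuous_on_compose2 [OF contf]) (use in_ball in auto)
  have ii: "set_integrable lborel {..<0} ?g"
    using absolutely_integrable_on_iff_lborel(1) [OF contg] ai by (simp add: set_integrable_def)
  have "(LBINT x=-\<infinity>..0. ?g x) = of_real pi * l - of_real pi * F 0"
  proof (rule interval_integral_FTC_integrable)
    show "((\<lambda>x. of_real pi * F (of_real (exp (2 * x)) * w)) has_vector_derivative ?g x) (at x)"
      if "-\<infinity> < ereal x" "ereal x < 0" for x
    proof -
      have "x < 0" using that by (simp add: zero_ereal_def)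
      have 1: "((\<lambda>x. of_real (exp (2 * x)) * w) has_vector_derivative (of_real (2 * exp (2 * x)) * w)) (at x)"
        by (rule has_vector_derivative_mult_left, rule has_vector_derivative_of_real)
          (auto intro!: derivative_eq_intros)
      have "((\<lambda>x. F (of_real (exp (2 * x)) * w)) has_vector_derivative (of_real (2 * exp (2 * x)) * w * f (of_real (exp (2 * x)) * w))) (at x)"
        using field_vector_diff_chain_at [OF 1 F [OF in_ball [OF \<open>x < 0\<close>]]] by (simp add: o_def)
      then have "((\<lambda>x. of_real pi * F (of_real (exp (2 * x)) * w)) has_vector_derivative (of_real pi * (of_real (2 * exp (2 * x)) * w * f (of_real (exp (2 * x)) * w)))) (at x)"
        by (rule has_vector_derivative_mult_right)
      then show ?thesis
        by (simp add: scaleR_conv_of_real mult_ac)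
    qed
    show "isCont ?g x" if "-\<infinity> < ereal x" "ereal x < 0" for x
      using contg that by (simp add: continuous_on_eq_continuous_at zero_ereal_def)
    show "set_integrable lborel (einterval (-\<infinity>) 0) ?g"
    proof -
      have "einterval (-\<infinity>) 0 = {..<0}" by (auto simp: einterval_def zero_ereal_def)
      then show ?thesis using ii by simp
    qed
    have F0: "isCont F 0"
      using F [of 0] DERIV_isCont by auto
    have "((\<lambda>x::real. exp (2 * x)) \<longlongrightarrow> 0) at_bot"
      by (rule filterlim_compose [OF exp_at_bot]) (auto intro!: filterlim_tendsto_pos_mult_at_bot filterlim_ident tendsto_const)
    then have "((\<lambda>x. of_real (exp (2 * x)) * w) \<longlongrightarrow> of_real 0 * w) at_bot"
      by (intro tendsto_mult tendsto_of_real tendsto_const)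
    then have "((\<lambda>x. of_real (exp (2 * x)) * w) \<longlongrightarrow> 0) at_bot" by simp
    then have "((\<lambda>x. of_real pi * F (of_real (exp (2 * x)) * w)) \<longlongrightarrow> of_real pi * F 0) at_bot"
      by (intro tendsto_mult_left isCont_tendsto_compose [OF F0])
    then show "(((\<lambda>x. of_real pi * F (of_real (exp (2 * x)) * w)) \<circ> real_of_ereal) \<longlongrightarrow> of_real pi * F 0) (at_right (-\<infinity>))"
      by (simp add: ereal_tendsto_simps)
    have "filterlim (\<lambda>x::real. exp (2 * x)) (at_left 1) (at_left 0)"
      unfolding filterlim_at
    proof
      show "\<forall>\<^sub>F x::real in at_left 0. exp (2 * x) \<in> {..<1} \<and> exp (2 * x) \<noteq> 1"
        by (rule eventually_at_leftI [of "-1"]) auto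
      have "((\<lambda>x::real. exp (2 * x)) \<longlongrightarrow> exp (2 * 0)) (at_left 0)"
        by (intro tendsto_intros)
      then show "((\<lambda>x::real. exp (2 * x)) \<longlongrightarrow> 1) (at_left 0)" by simp
    qed
    then have "((\<lambda>x. F (of_real (exp (2 * x)) * w)) \<longlongrightarrow> l) (at_left 0)"
      by (rule filterlim_compose [OF lim])
    then have "((\<lambda>x. of_real pi * F (of_real (exp (2 * x)) * w)) \<longlongrightarrow> of_real pi * l) (at_left 0)"
      by (intro tendsto_intros)
    then show "(((\<lambda>x. of_real pi * F (of_real (exp (2 * x)) * w)) \<circ> real_of_ereal) \<longlongrightarrow> of_real pi * l) (at_left 0)"
      unfolding zero_ereal_def by (simp add: ereal_tendsto_simps)
  qed simp
  moreover have "(LBINT x=-\<infinity>..0. ?g x) = integral {..<0} ?g"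
  proof -
    have "einterval (-\<infinity>) 0 = {..<0}" by (auto simp: einterval_def zero_ereal_def)
    then show ?thesis
      using set_borel_integral_eq_integral(2) [OF ii] by (simp add: interval_lebesgue_integral_def)
  qed
  ultimately show ?thesis
    using eqI by (simp add: algebra_simps)
qed

text \<open>Even roots are extended as odd functions, root 4 (-x) = - root 4 x, so 4 root 4 (t - c)
  is a continuous increasing primitive across the singularity. The point c is the single exceptional
  point of the fundamental theorem and may lie inside or outside the interval.\<close>

lemma root4_inverse_cube_integral:
  fixes c :: real
  assumes ab: "a \<le> b"
  shows "((\<lambda>t. 1 / (root 4 \<bar>t - c\<bar>) ^ 3) has_integral (4 * root 4 (b - c) - 4 * root 4 (a - c))) {a..b}"
proof (rule fundamental_theorem_of_calculus_interior_strong [of "{c}"])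
  show "((\<lambda>t. 4 * root 4 (t - c)) has_vector_derivative 1 / (root 4 \<bar>t - c\<bar>) ^ 3) (at t)"
    if "t \<in> {a<..<b} - {c}" for t
  proof (cases "t > c")
    case True
    have "DERIV (root 4) (t - c) :> inverse (real 4 * root 4 (t - c) ^ (4 - Suc 0))"
      by (rule DERIV_real_root) (use True in auto)
    then have "((\<lambda>t. root 4 (t - c)) has_real_derivative inverse (real 4 * root 4 (t - c) ^ (4 - Suc 0))) (at t)"
      by (simp add: DERIV_shift [of _ _ t "- c", simplified])
    then have "((\<lambda>t. 4 * root 4 (t - c)) has_real_derivative 4 * inverse (real 4 * root 4 (t - c) ^ (4 - Suc 0))) (at t)"
      by (rule DERIV_cmult)
    then show ?thesis
      using True by (simp add: has_real_derivative_iff_has_vector_derivative [symmetric] field_simps)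
  next
    case False
    then have neg: "t - c < 0" using that by auto
    have "DERIV (root 4) (t - c) :> inverse (- real 4 * root 4 (t - c) ^ (4 - Suc 0))"
      by (rule DERIV_even_real_root) (use neg in auto)
    then have "((\<lambda>t. root 4 (t - c)) has_real_derivative inverse (- real 4 * root 4 (t - c) ^ (4 - Suc 0))) (at t)"
      by (simp add: DERIV_shift [of _ _ t "- c", simplified])
    then have "((\<lambda>t. 4 * root 4 (t - c)) has_real_derivative 4 * inverse (- real 4 * root 4 (t - c) ^ (4 - Suc 0))) (at t)"
      by (rule DERIV_cmult)
    moreover have "root 4 \<bar>t - c\<bar> = - root 4 (t - c)"
      using neg by (simp add: real_root_minus [symmetric])
    ultimately show ?thesis
      using neg by (simp add: has_real_derivative_iff_has_vector_derivative [symmetric] field_simps)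
  qed
qed (use ab in \<open>auto intro!: continuous_intros\<close>)

text \<open>The left side is 2 |sin (v / 2)|, and concavity keeps the sine above the segment from
  (0, 0) to (pi / 2, 1).\<close>

lemma cis_minus_one_lower_bound:
  assumes "\<bar>v\<bar> \<le> pi"
  shows "cmod (cis v - 1) \<ge> 2 / pi * \<bar>v\<bar>"
proof -
  have "cmod (cis v - 1) = 2 * \<bar>sin (v / 2)\<bar>"
    using dist_exp_i_1 [of v] by (simp add: dist_norm cis_conv_exp)
  moreover have "\<bar>sin (v / 2)\<bar> \<ge> \<bar>v\<bar> / pi"
  proof -
    have "sin u \<ge> 2 / pi * u" if "0 \<le> u" "u \<le> pi / 2" for u :: real
    proof -
      have "concave_on {0..pi} sin"
        by (rule f''_le0_imp_concave [where f' = cos and f'' = "\<lambda>x. - sin x"])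
           (auto intro!: derivative_eq_intros sin_ge_zero)
      then have "sin ((1 - 2 * u / pi) *\<^sub>R 0 + (2 * u / pi) *\<^sub>R (pi / 2)) \<ge> (1 - 2 * u / pi) * sin 0 + (2 * u / pi) * sin (pi / 2)"
        by (rule concave_onD) (use that in \<open>auto simp: field_simps\<close>)
      then show ?thesis by simp
    qed
    from this [of "\<bar>v\<bar> / 2"] have "sin (\<bar>v\<bar> / 2) \<ge> \<bar>v\<bar> / pi"
      using assms by simp
    then show ?thesis by (cases "v \<ge> 0") auto
  qed
  ultimately show ?thesis by simp
qed

text \<open>Split 1/d as d^(-1/4) d^(-3/4). The first factor is bounded through d \<ge> 1 - r. For
  the second, d is at least |v| / pi, where v is the angle difference brought into [-pi, pi]. It is
  one of three translates of t - \<tau>; summing over all three spares the integral a case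
  distinction.\<close>

lemma circle_distance_pointwise:
  fixes t \<tau> r :: real
  assumes t: "0 \<le> t" "t \<le> 2 * pi" and \<tau>: "0 \<le> \<tau>" "\<tau> \<le> 2 * pi" and r: "0 \<le> r" "r < 1"
    and nz: "t \<noteq> \<tau>" "t \<noteq> \<tau> + 2 * pi" "t \<noteq> \<tau> - 2 * pi"
  shows "1 / cmod (cis t - r * cis \<tau>) \<le> (1 / root 4 (1 - r)) *
     (16 * (1 / root 4 \<bar>t - \<tau>\<bar> ^ 3 + 1 / root 4 \<bar>t - (\<tau> + 2 * pi)\<bar> ^ 3 + 1 / root 4 \<bar>t - (\<tau> - 2 * pi)\<bar> ^ 3))"
proof -
  define d where "d = cmod (cis t - r * cis \<tau>)"
  define S where "S = 1 / root 4 \<bar>t - \<tau>\<bar> ^ 3 + 1 / root 4 \<bar>t - (\<tau> + 2 * pi)\<bar> ^ 3 + 1 / root 4 \<bar>t - (\<tau> - 2 * pi)\<bar> ^ 3"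
  have d1: "d \<ge> 1 - r"
    using norm_triangle_ineq2 [of "cis t" "r * cis \<tau>"] r by (simp add: d_def norm_mult)
  then have dpos: "d > 0" using r by simp
  \<comment> \<open>Moving r cis \<tau> out to the circle costs 1 - r, which is itself at most
    d.\<close>
  have d2: "2 * d \<ge> cmod (cis t - cis \<tau>)"
  proof -
    have "cmod (cis t - cis \<tau>) \<le> cmod (cis t - r * cis \<tau>) + cmod (r * cis \<tau> - cis \<tau>)"
      by (metis diff_add_cancel norm_triangle_ineq add_diff_eq)
    also have "cmod (r * cis \<tau> - cis \<tau>) = 1 - r"
    proof -
      have "r * cis \<tau> - cis \<tau> = of_real (r - 1) * cis \<tau>" by (simp add: algebra_simps)
      then show ?thesis using r by (simp add: norm_mult del: of_real_diff)
    qed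
    finally show ?thesis using d1 d_def by simp
  qed
  obtain v where v: "\<bar>v\<bar> \<le> pi" "cis t = cis \<tau> * cis v" "v \<in> {t - \<tau>, t - (\<tau> + 2 * pi), t - (\<tau> - 2 * pi)}"
  proof -
    have c: "cis \<tau> * cis (t - \<tau>) = cis t" "cis \<tau> * cis (t - (\<tau> + 2 * pi)) = cis t" "cis \<tau> * cis (t - (\<tau> - 2 * pi)) = cis t"
      by (simp_all add: cis_mult) (simp_all add: complex_eq_iff cos_diff sin_diff cos_add sin_add)
    consider "\<bar>t - \<tau>\<bar> \<le> pi" | "t - \<tau> > pi" | "t - \<tau> < - pi" by linarith
    then show thesis
    proof cases
      case 1 then show ?thesis using that [of "t - \<tau>"] c by auto
    next
      case 2 then show ?thesis using that [of "t - (\<tau> + 2 * pi)"] c t \<tau> by auto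
    next
      case 3 then show ?thesis using that [of "t - (\<tau> - 2 * pi)"] c t \<tau> by auto
    qed
  qed
  have "cis t - cis \<tau> = cis \<tau> * (cis v - 1)" using v(2) by (simp add: algebra_simps)
  then have "cmod (cis t - cis \<tau>) = cmod (cis v - 1)" by (simp add: norm_mult)
  then have "2 * d \<ge> 2 / pi * \<bar>v\<bar>" using cis_minus_one_lower_bound [OF v(1)] d2 by linarith
  then have d3: "\<bar>v\<bar> \<le> pi * d" by (simp add: field_simps)
  have dS: "1 / root 4 d ^ 3 \<le> 16 * S"
  proof -
    have False': "v \<noteq> 0" using v(3) nz by auto
    \<comment> \<open>The constant pi is enlarged to 16, whose fourth root is exactly 2.\<close>
    have "root 4 \<bar>v\<bar> \<le> root 4 (16 * d)"
      using d3 pi_less_4 dpos by (intro real_root_le_mono) (auto intro: order_trans mult_right_mono)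
    also have "\<dots> = 2 * root 4 d"
      using real_root_pow_pos2 [of 4 2] by (simp add: real_root_mult real_root_power_cancel [of 4 2, simplified])
    finally have le: "root 4 \<bar>v\<bar> \<le> 2 * root 4 d" .
    have vp: "root 4 \<bar>v\<bar> > 0" using False' by simp
    have "root 4 \<bar>v\<bar> ^ 3 \<le> (2 * root 4 d) ^ 3" using le vp by (intro power_mono) auto
    then have "1 / root 4 d ^ 3 \<le> 8 * (1 / root 4 \<bar>v\<bar> ^ 3)"
      using vp dpos by (simp add: field_simps power_mult_distrib)
    also have "1 / root 4 \<bar>v\<bar> ^ 3 \<le> 2 * S"
    proof -
      define q where "q x = 1 / root 4 \<bar>x\<bar> ^ 3" for x
      have "q x \<ge> 0" for x by (simp add: q_def)
      then show ?thesis
        using v(3) unfolding S_def q_def [symmetric] by (auto intro: add_increasing add_increasing2)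
    qed
    finally show ?thesis by simp
  qed
  have "1 / d = 1 / root 4 d * (1 / root 4 d ^ 3)"
    using dpos real_root_pow_pos2 [of 4 d] by (simp add: power4_eq_xxxx power3_eq_cube)
  also have "\<dots> \<le> (1 / root 4 (1 - r)) * (16 * S)"
    using d1 r dpos dS by (intro mult_mono divide_left_mono) auto
  finally show ?thesis unfolding d_def S_def .
qed


text \<open>The true growth is logarithmic in 1 - |z|; the power -1/4 is weaker but sufficient, and
  it comes from an explicit primitive.\<close>

lemma circle_distance_integral_bound:
  obtains C where "C > 0"
    "\<And>z. z \<in> ball 0 1 \<Longrightarrow> integral {0..2*pi} (\<lambda>t. 1 / cmod (cis t - z)) \<le> C / root 4 (1 - cmod z)"
proof
  let ?C = "16 * (24 * root 4 (4 * pi))"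
  show "?C > 0" by simp
  fix z :: complex assume z: "z \<in> ball 0 1"
  define r where "r = cmod z"
  define \<tau> where "\<tau> = Arg2pi z"
  have r: "0 \<le> r" "r < 1" using z by (auto simp: r_def)
  have \<tau>: "0 \<le> \<tau>" "\<tau> \<le> 2 * pi" using Arg2pi [of z] by (auto simp: \<tau>_def)
  have ze: "z = r * cis \<tau>"
    using Arg2pi_eq [of z] by (simp add: r_def \<tau>_def cis_conv_exp)
  let ?q = "\<lambda>c t. 1 / (root 4 \<bar>t - c\<bar>) ^ 3"
  let ?Q = "\<lambda>c. 4 * root 4 (2 * pi - c) - 4 * root 4 (0 - c)"
  let ?Z = "{\<tau>, \<tau> + 2 * pi, \<tau> - 2 * pi}"
  \<comment> \<open>At these three angles a term of the majorant becomes 1 / 0 = 0 and the pointwise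
    bound may fail, so the integrand is set to 0 there.\<close>
  let ?h = "\<lambda>t. if t \<in> ?Z then 0 else 1 / cmod (cis t - z)"
  have "continuous_on {0..2*pi} (\<lambda>t. 1 / cmod (cis t - z))"
    by (intro continuous_intros) (use z in auto)
  then have "((\<lambda>t. 1 / cmod (cis t - z)) has_integral integral {0..2*pi} (\<lambda>t. 1 / cmod (cis t - z))) {0..2*pi}"
    by (intro integrable_integral integrable_continuous_interval)
  then have 1: "(?h has_integral integral {0..2*pi} (\<lambda>t. 1 / cmod (cis t - z))) {0..2*pi}"
    by (rule has_integral_spike_finite [of ?Z, rotated 2]) auto
  have 2: "((\<lambda>t. (1 / root 4 (1 - r)) * (16 * (?q \<tau> t + ?q (\<tau> + 2 * pi) t + ?q (\<tau> - 2 * pi) t)))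
     has_integral ((1 / root 4 (1 - r)) * (16 * (?Q \<tau> + ?Q (\<tau> + 2 * pi) + ?Q (\<tau> - 2 * pi))))) {0..2*pi}"
    by (intro has_integral_mult_right has_integral_add root4_inverse_cube_integral) auto
  have "integral {0..2*pi} (\<lambda>t. 1 / cmod (cis t - z)) \<le> (1 / root 4 (1 - r)) * (16 * (?Q \<tau> + ?Q (\<tau> + 2 * pi) + ?Q (\<tau> - 2 * pi)))"
  proof (rule has_integral_le [OF 1 2])
    fix t assume t: "t \<in> {0..2*pi}"
    show "?h t \<le> (1 / root 4 (1 - r)) * (16 * (?q \<tau> t + ?q (\<tau> + 2 * pi) t + ?q (\<tau> - 2 * pi) t))"
    proof (cases "t \<in> ?Z")
      case True
      have "0 \<le> (1 / root 4 (1 - r)) * (16 * (?q \<tau> t + ?q (\<tau> + 2 * pi) t + ?q (\<tau> - 2 * pi) t))"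
        using r by (intro mult_nonneg_nonneg add_nonneg_nonneg) auto
      then show ?thesis using True by simp
    next
      case False
      then show ?thesis
        using circle_distance_pointwise [of t \<tau> r] t \<tau> r by (auto simp: ze)
    qed
  qed
  also have "\<dots> \<le> (1 / root 4 (1 - r)) * (16 * (24 * root 4 (4 * pi)))"
  proof -
    have "?Q c \<le> 8 * root 4 (4 * pi)" if "- (2 * pi) \<le> c" "c \<le> 4 * pi" for c
    proof -
      have "root 4 (2 * pi - c) \<le> root 4 (4 * pi)" "root 4 (- (0 - c)) \<le> root 4 (4 * pi)"
        using that by (intro real_root_le_mono; simp)+
      moreover have "root 4 (0 - c) = - root 4 c"
        by (simp add: real_root_minus)
      moreover have "root 4 (- (0 - c)) = root 4 c"
        by simp
      ultimately show ?thesis by linarith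
    qed
    from this [of \<tau>] this [of "\<tau> + 2 * pi"] this [of "\<tau> - 2 * pi"]
    have "?Q \<tau> + ?Q (\<tau> + 2 * pi) + ?Q (\<tau> - 2 * pi) \<le> 24 * root 4 (4 * pi)"
      using \<tau> pi_gt_zero by (simp del: diff_0)
    then show ?thesis
      using r by (intro mult_left_mono) auto
  qed
  finally show "integral {0..2*pi} (\<lambda>t. 1 / cmod (cis t - z)) \<le> ?C / root 4 (1 - cmod z)"
    by (simp add: r_def)
qed

text \<open>The primitive is - 2 sqrt (1 - exp x). The factor exp x is one of the two supplied by
  the polar Jacobian exp (2 x); the other one is estimated by 1.\<close>

lemma radial_bound_integrable:
  "set_integrable lborel {..<0} (\<lambda>x. K * (exp x / sqrt (1 - exp x)))"
proof -
  have "set_integrable lborel (einterval (-\<infinity>) 0) (\<lambda>x. exp x / sqrt (1 - exp x))"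
  proof (rule interval_integral_FTC_nonneg(1))
    show "((\<lambda>x. - 2 * sqrt (1 - exp x)) has_real_derivative exp x / sqrt (1 - exp x)) (at x)"
      if "-\<infinity> < ereal x" "ereal x < 0" for x
      using that by (auto intro!: derivative_eq_intros simp: zero_ereal_def divide_simps)
    show "isCont (\<lambda>x. exp x / sqrt (1 - exp x)) x" if "-\<infinity> < ereal x" "ereal x < 0" for x
      using that by (intro continuous_intros) (auto simp: zero_ereal_def)
    show "AE x in lborel. -\<infinity> < ereal x \<longrightarrow> ereal x < 0 \<longrightarrow> 0 \<le> exp x / sqrt (1 - exp x)"
      by (auto simp: zero_ereal_def)
    have "((\<lambda>x::real. - 2 * sqrt (1 - exp x)) \<longlongrightarrow> - 2 * sqrt (1 - 0)) at_bot"
      by (intro tendsto_intros exp_at_bot)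
    then show "(((\<lambda>x. - 2 * sqrt (1 - exp x)) \<circ> real_of_ereal) \<longlongrightarrow> - 2) (at_right (-\<infinity>))"
      by (simp add: ereal_tendsto_simps)
    have "((\<lambda>x::real. - 2 * sqrt (1 - exp x)) \<longlongrightarrow> - 2 * sqrt (1 - exp 0)) (at_left 0)"
      by (intro tendsto_intros)
    then show "(((\<lambda>x. - 2 * sqrt (1 - exp x)) \<circ> real_of_ereal) \<longlongrightarrow> 0) (at_left 0)"
      unfolding zero_ereal_def by (simp add: ereal_tendsto_simps)
  qed simp
  moreover have "einterval (-\<infinity>) 0 = {..<0}" by (auto simp: einterval_def zero_ereal_def)
  ultimately have "set_integrable lborel {..<0} (\<lambda>x. exp x / sqrt (1 - exp x))"
    by simp
  then show ?thesis
    by (rule set_integrable_mult_right)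
qed

lemma root4_square: "0 \<le> x \<Longrightarrow> root 4 x * root 4 x = sqrt x"
proof -
  assume "0 \<le> x"
  have "root 4 x = root 2 (root 2 x)"
    using real_root_mult_exp [of 2 2 x] by simp
  then show ?thesis
    using \<open>0 \<le> x\<close> by (simp add: sqrt_def [symmetric])
qed

text \<open>The integrability criterion behind every term other than the diagonal poles. The
  hypothesis allows one loss (1 - |z|)^(-1/4) times either a boundary pole or a second loss. A pole
  averaged over a circle again costs one such loss, so the circle integrals are O((1 - r)^(-1/2)),
  which is integrable in r.\<close>

lemma disc_bound_absolutely_integrable:
  fixes f :: "complex \<Rightarrow> complex"
  assumes cont: "continuous_on (ball 0 1) f" and b: "cmod b = 1"
    and bound: "\<And>z. z \<in> ball 0 1 \<Longrightarrow> cmod (f z) \<le> K * (1 / root 4 (1 - cmod z)) * (1 / cmod (b - z) + 1 / root 4 (1 - cmod z))"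
  shows "f absolutely_integrable_on ball 0 1"
proof -
  obtain C where C: "C > 0"
    "\<And>z. z \<in> ball 0 1 \<Longrightarrow> integral {0..2*pi} (\<lambda>t. 1 / cmod (cis t - z)) \<le> C / root 4 (1 - cmod z)"
    using circle_distance_integral_bound by blast
  have K: "K \<ge> 0"
    using order_trans [OF norm_ge_zero bound [of 0]] b by simp
  obtain \<beta> where \<beta>: "b = cis \<beta>"
  proof
    have "b \<noteq> 0" using b by auto
    then show "b = cis (Arg b)" using b by (simp add: cis_Arg sgn_eq)
  qed
  show ?thesis
  proof (rule polar_absolutely_integrable_bound [OF cont])
    show "set_integrable lborel {..<0} (\<lambda>x. (K * (C + 2 * pi)) * (exp x / sqrt (1 - exp x)))"
      by (rule radial_bound_integrable)
    fix x :: real assume x: "x < 0"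
    define r where "r = exp x"
    have r: "0 < r" "r < 1" using x by (auto simp: r_def)
    let ?R = "1 / root 4 (1 - r)"
    have Rp: "root 4 (1 - r) > 0" using r by simp
    have inb: "r * cis y \<in> ball 0 1" for y using r by (simp add: norm_mult)
    \<comment> \<open>Exchanges the moving and the fixed point, so that the circle estimate can be
      used for the fixed point r b.\<close>
    have cb: "cmod (b - r * cis y) = cmod (cis y - r * b)" for y
    proof -
      have "cmod (b - r * cis y) = cmod (cnj (b - r * cis y) * (cis y * b))"
        by (simp add: norm_mult b del: complex_cnj_diff)
      also have "cnj (b - r * cis y) * (cis y * b) = cis y - r * b"
        by (simp add: \<beta> cis_cnj algebra_simps cis_mult)
      finally show ?thesis .
    qed
    have c1: "continuous_on {0..2*pi} (\<lambda>y. norm (f (exp (Complex x y))))"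
      unfolding exp_Complex r_def [symmetric] using inb
      by (intro continuous_intros continuous_on_compose2 [OF cont]) auto
    have c2: "continuous_on {0..2*pi} (\<lambda>y. 1 / cmod (cis y - r * b))"
    proof (intro continuous_intros ballI)
      fix y show "cmod (cis y - r * b) \<noteq> 0"
      proof
        assume "cmod (cis y - r * b) = 0"
        then have "cmod (cis y) = cmod (r * b)" by simp
        then show False using r b by (simp add: norm_mult)
      qed
    qed
    have "integral {0..2*pi} (\<lambda>y. norm (f (exp (Complex x y))))
       \<le> integral {0..2*pi} (\<lambda>y. K * ?R * (1 / cmod (cis y - r * b) + ?R))"
    proof (rule integral_le)
      show "(\<lambda>y. norm (f (exp (Complex x y)))) integrable_on {0..2*pi}"
        using c1 by (rule integrable_continuous_interval)
      show "(\<lambda>y. K * ?R * (1 / cmod (cis y - r * b) + ?R)) integrable_on {0..2*pi}"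
        using c2 by (intro integrable_continuous_interval continuous_on_mult continuous_on_add continuous_on_const)
      fix y
      show "norm (f (exp (Complex x y))) \<le> K * ?R * (1 / cmod (cis y - r * b) + ?R)"
        using bound [OF inb [of y]] r by (simp add: exp_Complex r_def [symmetric] cb norm_mult)
    qed
    also have "\<dots> = K * ?R * (integral {0..2*pi} (\<lambda>y. 1 / cmod (cis y - r * b)) + 2 * pi * ?R)"
    proof -
      have "((\<lambda>y. K * ?R * (1 / cmod (cis y - r * b) + ?R)) has_integral
        (K * ?R * (integral {0..2*pi} (\<lambda>y. 1 / cmod (cis y - r * b)) + 2 * pi * ?R))) {0..2*pi}"
        by (intro has_integral_mult_right has_integral_add integrable_integral integrable_continuous_interval c2)
          (use has_integral_const_real [of ?R 0 "2 * pi"] in simp)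
      then show ?thesis by (rule integral_unique)
    qed
    also have "\<dots> \<le> K * ?R * (C * ?R + 2 * pi * ?R)"
      using C(2) [of "r * b"] K Rp r b by (intro mult_left_mono add_right_mono) (auto simp: norm_mult)
    also have "\<dots> = K * (C + 2 * pi) * (1 / (root 4 (1 - r) * root 4 (1 - r)))"
      using Rp by (simp add: field_simps)
    finally have "integral {0..2*pi} (\<lambda>y. norm (f (exp (Complex x y)))) \<le> K * (C + 2 * pi) * (1 / sqrt (1 - r))"
      using r by (simp add: root4_square)
    then have "exp (2 * x) * integral {0..2*pi} (\<lambda>y. norm (f (exp (Complex x y)))) \<le> exp x * (K * (C + 2 * pi) * (1 / sqrt (1 - r)))"
      using x by (intro mult_mono) (auto intro!: integral_norm_nonneg)
    then show "exp (2 * x) * integral {0..2*pi} (\<lambda>y. norm (f (exp (Complex x y)))) \<le> (K * (C + 2 * pi)) * (exp x / sqrt (1 - exp x))"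
      by (simp add: r_def mult_ac)
  qed
qed

section \<open>The inverse square integral over the punctured disc\<close>

text \<open>An integrable majorant of |ln (2 sin y)| with singularities at both ends. The powers
  -3/4 are those with a known primitive, and \<open>y - 0\<close> keeps the shape |y - c| of that
  primitive; the summand 2 absorbs ln 2.\<close>

definition sine_bound :: "real \<Rightarrow> real" where
  "sine_bound y = 2 + 32 * (1 / (root 4 \<bar>y - 0\<bar>) ^ 3 + 1 / (root 4 \<bar>y - pi\<bar>) ^ 3)"

lemma sine_bound_integrable: "sine_bound integrable_on {0<..<pi}"
proof -
  have "sine_bound integrable_on {0..pi}"
    unfolding sine_bound_def
    by (intro integrable_add integrable_on_mult_right integrable_const_ivl
        root4_inverse_cube_integral [THEN has_integral_integrable]) auto
  then show ?thesis by (simp add: integrable_on_open_interval_real integrable_const_ivl)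
qed

lemma neg_ln_le_root4:
  fixes s :: real
  assumes "0 < s"
  shows "- ln s \<le> 4 / root 4 s"
proof -
  have "ln (1 / root 4 s) \<le> 1 / root 4 s - 1"
    using assms by (intro ln_le_minus_one) simp
  moreover have "ln (1 / root 4 s) = - ln s / 4"
    using assms by (simp add: ln_div ln_root)
  ultimately show ?thesis by simp
qed

text \<open>With m the distance to the nearer endpoint, sin y = sin m \<ge> 2 m / pi; the logarithm
  is then traded for a power -1/4 by ln u \<le> u - 1.\<close>

lemma neg_ln_sin_le:
  assumes y: "0 < y" "y < pi"
  shows "- ln (sin y) \<le> sine_bound y - 2"
proof -
  define s where "s = sin y"
  have s: "0 < s" "s \<le> 1" using y sin_gt_zero by (auto simp: s_def)
  define m where "m = min y (pi - y)"
  have m: "0 < m" "2 * m \<le> pi" using y by (auto simp: m_def min_def)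
  have "sin y = sin m"
    by (auto simp: m_def min_def)
  moreover have "cmod (cis (2 * m) - 1) \<ge> 2 / pi * \<bar>2 * m\<bar>"
    by (rule cis_minus_one_lower_bound) (use m in auto)
  moreover have "cmod (cis (2 * m) - 1) = 2 * \<bar>sin m\<bar>"
    using dist_exp_i_1 [of "2 * m"] by (simp add: dist_norm cis_conv_exp)
  ultimately have "s \<ge> 2 / pi * m"
    using s m by (simp add: s_def)
  then have "m \<le> pi / 2 * s" by (simp add: field_simps)
  also have "\<dots> \<le> 16 * s" using pi_less_4 s by (intro mult_right_mono) auto
  finally have "root 4 m \<le> root 4 (16 * s)" by (simp add: real_root_le_mono)
  also have "root 4 (16 * s) = 2 * root 4 s"
    using real_root_pow_pos2 [of 4 2] by (simp add: real_root_mult real_root_power_cancel [of 4 2, simplified])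
  finally have rm: "root 4 m \<le> 2 * root 4 s" .
  have rs: "0 < root 4 s" "root 4 s \<le> 1" using s by auto
  have rp: "0 < root 4 m" using m by simp
  have m2: "root 4 m \<le> 2"
    using rm rs by linarith
  have "- ln s \<le> 4 / root 4 s" by (rule neg_ln_le_root4 [OF s(1)])
  also have "\<dots> \<le> 4 * (2 / root 4 m)"
  proof -
    have "1 / root 4 s \<le> 2 / root 4 m" using rm rs rp by (simp add: field_simps)
    then show ?thesis by simp
  qed
  \<comment> \<open>The power -1/4 is weakened to -3/4, using root 4 m \<le> 2, to match
    \<open>sine_bound\<close>.\<close>
  also have "\<dots> \<le> 16 * (1 / root 4 m ^ 3) * 2"
  proof -
    have "root 4 m * root 4 m \<le> 2 * 2" using m2 rp by (intro mult_mono) auto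
    then show ?thesis using rp by (simp add: field_simps power3_eq_cube)
  qed
  finally have a: "- ln s \<le> 32 * (1 / root 4 m ^ 3)" by simp
  define T where "T = 1 / (root 4 \<bar>y - 0\<bar>) ^ 3 + 1 / (root 4 \<bar>y - pi\<bar>) ^ 3"
  have "1 / root 4 m ^ 3 \<le> T"
  proof -
    define q where "q x = 1 / root 4 x ^ 3" for x
    have "q \<bar>x\<bar> \<ge> 0" for x by (simp add: q_def)
    moreover have "m = \<bar>y - 0\<bar> \<or> m = \<bar>y - pi\<bar>" using y by (auto simp: m_def min_def)
    ultimately show ?thesis
      unfolding T_def q_def [symmetric] by (metis add_increasing add_increasing2 order_refl)
  qed
  then show ?thesis
    using a unfolding s_def sine_bound_def T_def [symmetric] by linarith
qed

lemma cmod_one_minus_cis: "cmod (1 - cis (2 * y)) = 2 * \<bar>sin y\<bar>"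
  using dist_exp_i_1 [of "2 * y"] by (simp add: dist_norm cis_conv_exp norm_minus_commute)

text \<open>The mean value property: ln |1 - z| is harmonic in the open disc and 0 at the origin,
  and |1 - cis (2 y)| = 2 sin y. Since the logarithm is singular on the unit circle itself, radii
  \<rho> n < 1 are used and sent to 1, with \<open>sine_bound\<close> as a majorant uniform in
  n.\<close>

lemma ln_sin_has_integral: "((\<lambda>y. ln (2 * sin y)) has_integral 0) {0<..<pi}"
proof -
  define \<rho> where "\<rho> n = 1 - 1 / (real n + 2)" for n :: nat
  have \<rho>: "0 < \<rho> n" "\<rho> n < 1" for n by (auto simp: \<rho>_def field_simps)
  have \<rho>lim: "\<rho> \<longlonglongrightarrow> 1"
  proof -
    have "(\<lambda>n. 1 / (real n + 2)) \<longlonglongrightarrow> 0"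
      using LIMSEQ_ignore_initial_segment [OF lim_const_over_n [of "1 :: real"], of 2] by (simp add: add.commute)
    then have "(\<lambda>n. 1 - 1 / (real n + 2)) \<longlonglongrightarrow> 1 - 0" by (intro tendsto_intros)
    then show ?thesis by (simp add: \<rho>_def [abs_def])
  qed
  have int0: "((\<lambda>y. ln (cmod (1 - \<rho> n * cis (2 * y)))) has_integral 0) {0<..<pi}" for n
  proof -
    have re: "Re (1 - z) > 0" if "cmod z < 1" for z :: complex
      using that complex_Re_le_cmod [of z] by simp
    have "(\<lambda>z. Ln (1 - z)) holomorphic_on cball 0 (\<rho> n)"
    proof (intro holomorphic_intros)
      fix z :: complex assume "z \<in> cball 0 (\<rho> n)"
      then have "Re (1 - z) > 0" using \<rho> [of n] by (intro re) auto
      then show "1 - z \<notin> \<real>\<^sub>\<le>\<^sub>0" by (auto simp: complex_nonpos_Reals_iff)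
    qed
    then have "((\<lambda>u. Ln (1 - u) / (u - 0)) has_contour_integral (2 * of_real pi * \<i> * Ln (1 - 0))) (circlepath 0 (\<rho> n))"
      by (rule Cauchy_integral_circlepath_simple) (use \<rho> in auto)
    then have "((\<lambda>t. Ln (1 - \<rho> n * cis t) / (\<rho> n * cis t) * \<rho> n * \<i> * cis t) has_integral 0) {0..2*pi}"
      by (simp add: circlepath_integral_iff)
    then have "((\<lambda>t. (1 / \<i>) * (Ln (1 - \<rho> n * cis t) / (\<rho> n * cis t) * \<rho> n * \<i> * cis t)) has_integral (1 / \<i>) * 0) {0..2*pi}"
      by (rule has_integral_mult_right)
    moreover have "(1 / \<i>) * (Ln (1 - \<rho> n * cis t) / (\<rho> n * cis t) * \<rho> n * \<i> * cis t) = Ln (1 - \<rho> n * cis t)" for t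
      using \<rho> [of n] by (simp add: field_simps)
    ultimately have "((\<lambda>t. Ln (1 - \<rho> n * cis t)) has_integral 0) {0..2*pi}"
      by simp
    then have "((\<lambda>t. Re (Ln (1 - \<rho> n * cis t))) has_integral Re 0) {0..2*pi}"
      by (rule has_integral_Re)
    moreover have "Re (Ln (1 - \<rho> n * cis t)) = ln (cmod (1 - \<rho> n * cis t))" for t
    proof (rule Re_Ln)
      have "cmod (\<rho> n * cis t) < 1" using \<rho> [of n] by (simp add: norm_mult)
      then have "Re (1 - \<rho> n * cis t) > 0" by (rule re)
      then show "1 - \<rho> n * cis t \<noteq> 0" by force
    qed
    ultimately have "((\<lambda>t. ln (cmod (1 - \<rho> n * cis t))) has_integral 0) {0..2*pi}"
      by simp
    from has_integral_stretch_real [OF this, of 2]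
    have "((\<lambda>y. ln (cmod (1 - \<rho> n * cis (2 * y)))) has_integral 0) ((\<lambda>x. x / 2) ` {0..2*pi})"
      by simp
    moreover have "(\<lambda>x. x / 2) ` {0..2*pi} = {0..pi}"
      by (auto simp: image_iff intro!: bexI [where x = "2 * _"])
    ultimately show ?thesis
      by (simp add: has_integral_Icc_iff_Ioo)
  qed
  have bd: "norm (ln (cmod (1 - \<rho> n * cis (2 * y)))) \<le> sine_bound y" if y: "y \<in> {0<..<pi}" for n y
  proof -
    have s: "sin y > 0" using y sin_gt_zero by auto
    \<comment> \<open>Shrinking the radius loses at most a factor 2, so |1 - \<rho> n cis (2 y)|
      \<ge> sin y for every n.\<close>
    have "cmod (1 - cis (2 * y)) \<le> 2 * cmod (1 - \<rho> n * cis (2 * y))"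
    proof -
      have "cmod (1 - cis (2 * y)) \<le> cmod (1 - \<rho> n * cis (2 * y)) + cmod (\<rho> n * cis (2 * y) - cis (2 * y))"
        by (metis diff_add_cancel norm_triangle_ineq add_diff_eq)
      also have "cmod (\<rho> n * cis (2 * y) - cis (2 * y)) = 1 - \<rho> n"
      proof -
        have "\<rho> n * cis (2 * y) - cis (2 * y) = of_real (\<rho> n - 1) * cis (2 * y)" by (simp add: algebra_simps)
        then show ?thesis using \<rho> [of n] by (simp add: norm_mult del: of_real_diff)
      qed
      also have "1 - \<rho> n \<le> cmod (1 - \<rho> n * cis (2 * y))"
        using norm_triangle_ineq2 [of 1 "\<rho> n * cis (2 * y)"] \<rho> [of n] by (simp add: norm_mult)
      finally show ?thesis by simp
    qed
    then have lo: "sin y \<le> cmod (1 - \<rho> n * cis (2 * y))"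
      using s by (simp add: cmod_one_minus_cis)
    have hi: "cmod (1 - \<rho> n * cis (2 * y)) \<le> 2"
      using norm_triangle_ineq4 [of 1 "\<rho> n * cis (2 * y)"] \<rho> [of n] by (simp add: norm_mult)
    have "ln (cmod (1 - \<rho> n * cis (2 * y))) \<le> ln 2" by (subst ln_le_cancel_iff) (use hi lo s in linarith)+
    also have "ln (2::real) \<le> 2" using ln_le_minus_one [of 2] by simp
    finally have u: "ln (cmod (1 - \<rho> n * cis (2 * y))) \<le> 2" .
    have "ln (sin y) \<le> ln (cmod (1 - \<rho> n * cis (2 * y)))" by (subst ln_le_cancel_iff) (use lo s in linarith)+
    then have "- ln (cmod (1 - \<rho> n * cis (2 * y))) \<le> sine_bound y - 2"
      using neg_ln_sin_le [of y] y by auto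
    moreover have "sine_bound y \<ge> 2" by (simp add: sine_bound_def)
    ultimately show ?thesis using u by (simp add: abs_le_iff)
  qed
  have lim: "(\<lambda>n. ln (cmod (1 - \<rho> n * cis (2 * y)))) \<longlonglongrightarrow> ln (2 * sin y)" if y: "y \<in> {0<..<pi}" for y
  proof -
    have s: "sin y > 0" using y sin_gt_zero by auto
    have "cmod (1 - of_real 1 * cis (2 * y)) \<noteq> 0"
      using s by (simp add: cmod_one_minus_cis del: norm_eq_zero)
    then have "(\<lambda>n. ln (cmod (1 - \<rho> n * cis (2 * y)))) \<longlonglongrightarrow> ln (cmod (1 - of_real 1 * cis (2 * y)))"
      by (intro tendsto_ln tendsto_norm tendsto_diff tendsto_mult tendsto_of_real tendsto_const \<rho>lim)
    then show ?thesis using s by (simp add: cmod_one_minus_cis)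
  qed
  have "(\<lambda>y. ln (2 * sin y)) integrable_on {0<..<pi}"
    "(\<lambda>n. integral {0<..<pi} (\<lambda>y. ln (cmod (1 - \<rho> n * cis (2 * y))))) \<longlonglongrightarrow> integral {0<..<pi} (\<lambda>y. ln (2 * sin y))"
    using dominated_convergence [OF has_integral_integrable [OF int0] sine_bound_integrable bd lim] by auto
  moreover have "integral {0<..<pi} (\<lambda>y. ln (cmod (1 - \<rho> n * cis (2 * y)))) = 0" for n
    using int0 by (rule integral_unique)
  ultimately have "(\<lambda>n. 0) \<longlonglongrightarrow> integral {0<..<pi} (\<lambda>y. ln (2 * sin y))" by simp
  then have "integral {0<..<pi} (\<lambda>y. ln (2 * sin y)) = 0"
    by (simp add: LIMSEQ_const_iff)
  then show ?thesis
    using \<open>(\<lambda>y. ln (2 * sin y)) integrable_on {0<..<pi}\<close> by (simp add: has_integral_iff)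
qed

text \<open>Truncation at ln r removes an integrable tail, so the truncated integral tends to the
  full one, which is 0. This is the o(1) in the energy of a boundary pole.\<close>

lemma truncated_ln_sin_integral:
  assumes "0 < r"
  shows "(\<lambda>y. max (ln r) (ln (2 * sin y))) integrable_on {0<..<pi}"
    and "((\<lambda>r. integral {0<..<pi} (\<lambda>y. max (ln r) (ln (2 * sin y)))) \<longlongrightarrow> 0) (at_right 0)"
proof -
  have cont: "continuous_on {0<..<pi} (\<lambda>y. ln (2 * sin y))"
    by (intro continuous_intros) (use sin_gt_zero in force)
  have lnb: "\<bar>ln (2 * sin y)\<bar> \<le> sine_bound y" if y: "y \<in> {0<..<pi}" for y
  proof -
    have s: "sin y > 0" using y sin_gt_zero by auto
    have "ln (sin y) \<le> 0" using s by simp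
    moreover have "ln (2::real) \<le> 2" "0 \<le> ln (2::real)" using ln_le_minus_one [of 2] by auto
    moreover have "- ln (sin y) \<le> sine_bound y - 2" using neg_ln_sin_le [of y] y by auto
    moreover have "ln (2 * sin y) = ln 2 + ln (sin y)" using s by (simp add: ln_mult)
    moreover have "sine_bound y \<ge> 2" by (simp add: sine_bound_def)
    ultimately show ?thesis by linarith
  qed
  have meas: "(\<lambda>y. max (ln r) (ln (2 * sin y))) integrable_on {0<..<pi}" if "0 < r" for r
  proof (rule measurable_bounded_by_integrable_imp_integrable)
    show "(\<lambda>y. max (ln r) (ln (2 * sin y))) \<in> borel_measurable (lebesgue_on {0<..<pi})"
      by (intro continuous_imp_measurable_on_sets_lebesgue continuous_intros cont) auto
    show "(\<lambda>y. \<bar>ln r\<bar> + sine_bound y) integrable_on {0<..<pi}"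
      by (intro integrable_add sine_bound_integrable) (simp add: integrable_on_open_interval_real integrable_const_ivl)
    show "norm (max (ln r) (ln (2 * sin y))) \<le> \<bar>ln r\<bar> + sine_bound y" if "y \<in> {0<..<pi}" for y
      using lnb [OF that] by (auto simp: max_def)
  qed auto
  show "(\<lambda>y. max (ln r) (ln (2 * sin y))) integrable_on {0<..<pi}"
    using meas assms by blast
  have i0: "integral {0<..<pi} (\<lambda>y. ln (2 * sin y)) = 0"
    using ln_sin_has_integral by (rule integral_unique)
  show "((\<lambda>r. integral {0<..<pi} (\<lambda>y. max (ln r) (ln (2 * sin y)))) \<longlongrightarrow> 0) (at_right 0)"
    unfolding tendsto_at_iff_sequentially comp_def
  proof (intro allI impI)
    fix X :: "nat \<Rightarrow> real" assume X: "\<forall>i. X i \<in> {0<..} - {0}" "X \<longlonglongrightarrow> 0"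
    have "\<forall>\<^sub>F n in sequentially. X n < 1" using X(2) by (rule order_tendstoD) simp
    then obtain n0 where n0: "\<And>n. n \<ge> n0 \<Longrightarrow> X n < 1" by (auto simp: eventually_sequentially)
    let ?Y = "\<lambda>n. X (n + n0)"
    have Y: "0 < ?Y n" "?Y n < 1" for n using X(1) n0 by auto
    have lnY: "filterlim (\<lambda>n. ln (?Y n)) at_bot sequentially"
    proof (rule filterlim_compose [OF ln_at_0])
      show "filterlim ?Y (at_right 0) sequentially"
        unfolding filterlim_at
        using Y(1) LIMSEQ_ignore_initial_segment [OF X(2), of n0] by (simp add: less_imp_neq [symmetric])
    qed
    have "(\<lambda>n. integral {0<..<pi} (\<lambda>y. max (ln (?Y n)) (ln (2 * sin y)))) \<longlonglongrightarrow> integral {0<..<pi} (\<lambda>y. ln (2 * sin y))"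
    proof (rule dominated_convergence [OF meas [OF Y(1)] sine_bound_integrable])
      fix n y assume y: "y \<in> {0<..<pi}"
      have "ln (?Y n) < 0" using Y [of n] by simp
      then show "norm (max (ln (?Y n)) (ln (2 * sin y))) \<le> sine_bound y"
        using lnb [OF y] by (auto simp: max_def abs_if split: if_splits)
    next
      fix y assume y: "y \<in> {0<..<pi}"
      have "\<forall>\<^sub>F n in sequentially. ln (?Y n) \<le> ln (2 * sin y)"
        using lnY unfolding filterlim_at_bot by blast
      then have "\<forall>\<^sub>F n in sequentially. max (ln (?Y n)) (ln (2 * sin y)) = ln (2 * sin y)"
        by eventually_elim (simp add: max_def)
      then show "(\<lambda>n. max (ln (?Y n)) (ln (2 * sin y))) \<longlonglongrightarrow> ln (2 * sin y)"
        by (rule tendsto_eventually)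
    qed
    then show "(\<lambda>n. integral {0<..<pi} (\<lambda>y. max (ln (X n)) (ln (2 * sin y)))) \<longlonglongrightarrow> 0"
      unfolding i0 by (rule LIMSEQ_offset)
  qed
qed

text \<open>The region is what the disc minus a small ball becomes in logarithmic coordinates about
  the removed boundary point. Its section at height y is the interval from ln r to ln (2 sin y),
  empty if these are in the wrong order; hence the maximum. The constant part of the length
  integrates to pi ln (1 / r).\<close>

lemma half_disc_strip_measure:
  fixes r :: real
  defines "A \<equiv> {z. 0 < Im z \<and> Im z < pi \<and> ln r \<le> Re z \<and> exp (Re z) < 2 * sin (Im z)}"
  assumes r: "0 < r"
  shows "A \<in> lmeasurable"
    and "measure lebesgue A = pi * ln (1 / r) + integral {0<..<pi} (\<lambda>y. max (ln r) (ln (2 * sin y)))"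
proof -
  let ?f = "\<lambda>y. max (ln r) (ln (2 * sin y)) - ln r"
  define J where "J = integral {0<..<pi} (\<lambda>y. max (ln r) (ln (2 * sin y)))"
  have Ab: "A \<in> sets borel"
    unfolding A_def by measurable
  have [measurable]: "(\<lambda>(x, y). Complex x y) \<in> borel_measurable (lborel \<Otimes>\<^sub>M lborel)"
    unfolding lborel_prod measurable_lborel2 case_prod_beta Complex_eq
    by (intro borel_measurable_continuous_onI continuous_intros)
  let ?P = "(\<lambda>(x, y). Complex x y) -` A \<inter> space (lborel \<Otimes>\<^sub>M lborel)"
  have "emeasure lborel A = emeasure (lborel \<Otimes>\<^sub>M lborel) ?P"
    by (subst lborel_complex_eq_prod, rule emeasure_distr) (use Ab in auto)
  also have "\<dots> = (\<integral>\<^sup>+y. emeasure lborel ((\<lambda>x. (x, y)) -` ?P) \<partial>lborel)"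
    by (rule lborel_pair.emeasure_pair_measure_alt2) (use Ab in measurable)
  also have "\<dots> = (\<integral>\<^sup>+y. ennreal (indicator {0<..<pi} y * ?f y) \<partial>lborel)"
  proof (rule nn_integral_cong)
    fix y :: real
    show "emeasure lborel ((\<lambda>x. (x, y)) -` ?P) = ennreal (indicator {0<..<pi} y * ?f y)"
    proof (cases "y \<in> {0<..<pi}")
      case True
      then have s: "sin y > 0" using sin_gt_zero by auto
      then have ex: "exp x < 2 * sin y \<longleftrightarrow> x < ln (2 * sin y)" for x
        by (metis exp_less_cancel_iff exp_ln mult_pos_pos zero_less_numeral)
      have "(\<lambda>x. (x, y)) -` ?P = {x. ln r \<le> x \<and> exp x < 2 * sin y}"
        using True by (auto simp: A_def space_pair_measure)
      then have "(\<lambda>x. (x, y)) -` ?P = {ln r..<ln (2 * sin y)}"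
        unfolding ex by auto
      then show ?thesis
        using True by (cases "ln r \<le> ln (2 * sin y)") (auto simp: max_def)
    next
      case False
      then have "(\<lambda>x. (x, y)) -` ?P = {}" by (auto simp: A_def)
      then show ?thesis using False by (simp del: greaterThanLessThan_iff)
    qed
  qed
  also have "\<dots> = ennreal (J + pi * ln (1 / r))"
  proof (rule nn_integral_has_integral_lborel)
    have "continuous_on {0<..<pi} ?f"
      by (intro continuous_intros) (use sin_gt_zero in force)
    then show "(\<lambda>y. indicator {0<..<pi} y * ?f y) \<in> borel_measurable borel"
      using borel_measurable_continuous_on_indicator [of "{0<..<pi}" ?f] by simp
    have "((\<lambda>y. ln r) has_integral (pi * ln r)) {0<..<pi}"
      using has_integral_const_real [of "ln r" 0 pi] by (simp add: has_integral_Icc_iff_Ioo)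
    moreover have "((\<lambda>y. max (ln r) (ln (2 * sin y))) has_integral J) {0<..<pi}"
      unfolding J_def by (rule integrable_integral [OF truncated_ln_sin_integral(1) [OF r]])
    ultimately have "(?f has_integral (J - pi * ln r)) {0<..<pi}"
      by (rule has_integral_diff [rotated])
    then have "((\<lambda>y. if y \<in> {0<..<pi} then ?f y else 0) has_integral (J - pi * ln r)) UNIV"
      by (simp only: has_integral_restrict_UNIV)
    moreover have "J - pi * ln r = J + pi * ln (1 / r)" using r by (simp add: ln_div)
    ultimately show "((\<lambda>y. indicator {0<..<pi} y * ?f y) has_integral (J + pi * ln (1 / r))) UNIV"
      by (simp add: indicator_def of_bool_def if_distrib if_distribR cong: if_cong)
  qed (simp add: indicator_def)
  finally have e: "emeasure lborel A = ennreal (J + pi * ln (1 / r))" .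
  then have e': "emeasure lebesgue A = ennreal (J + pi * ln (1 / r))"
    using Ab by simp
  show lm: "A \<in> lmeasurable"
    using Ab e' by (intro fmeasurableI) auto
  have "0 \<le> J + pi * ln (1 / r)"
  proof -
    have c: "(\<lambda>y. ln r) integrable_on {0<..<pi}"
      by (simp add: integrable_on_open_interval_real integrable_const_ivl)
    have "0 \<le> integral {0<..<pi} ?f"
      by (rule Henstock_Kurzweil_Integration.integral_nonneg
          [OF integrable_diff [OF truncated_ln_sin_integral(1) [OF r] c]]) auto
    also have "integral {0<..<pi} ?f = J - integral {0<..<pi} (\<lambda>y. ln r)"
      unfolding J_def by (rule integral_diff [OF truncated_ln_sin_integral(1) [OF r] c])
    also have "integral {0<..<pi} (\<lambda>y. ln r) = pi * ln r"
      using has_integral_const_real [of "ln r" 0 pi] by (simp add: has_integral_Icc_iff_Ioo integral_unique)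
    finally show ?thesis using r by (simp add: ln_div)
  qed
  then show "measure lebesgue A = pi * ln (1 / r) + integral {0<..<pi} (\<lambda>y. max (ln r) (ln (2 * sin y)))"
    using e' unfolding measure_def J_def by (simp add: algebra_simps)
qed

text \<open>In the coordinate \<zeta> with z = b + \<i> b exp \<zeta> the Jacobian |z - b|^2 cancels
  the integrand, so the integral is the area of a strip region. The rotation by \<i> b sends the two
  halves of the tangent line at b to Im \<zeta> = 0 and Im \<zeta> = pi, and expanding |z|^2 shows
  that |z| < 1 means exp (Re \<zeta>) < 2 sin (Im \<zeta>).\<close>

lemma punctured_disc_inverse_square:
  assumes b: "cmod b = 1" and r: "0 < r"
  shows "(\<lambda>z. 1 / (cmod (z - b))\<^sup>2) absolutely_integrable_on (ball 0 1 - ball b r)"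
    and "integral (ball 0 1 - ball b r) (\<lambda>z. 1 / (cmod (z - b))\<^sup>2)
       = pi * ln (1 / r) + integral {0<..<pi} (\<lambda>y. max (ln r) (ln (2 * sin y)))"
proof -
  define A where "A = {z. 0 < Im z \<and> Im z < pi \<and> ln r \<le> Re z \<and> exp (Re z) < 2 * sin (Im z)}"
  note mA = half_disc_strip_measure [OF r, folded A_def]
  define g where "g \<zeta> = b + \<i> * b * exp \<zeta>" for \<zeta>
  have bn: "b \<noteq> 0" using b by auto
  have inj: "inj_on g A"
  proof (rule inj_onI)
    fix x y assume xy: "x \<in> A" "y \<in> A" "g x = g y"
    then have "exp x = exp y" using bn by (simp add: g_def)
    then show "x = y" by (rule exp_complex_eqI [rotated]) (use xy in \<open>auto simp: A_def\<close>)
  qed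
  have gn: "(cmod (g \<zeta>))\<^sup>2 = 1 + exp (Re \<zeta>) * (exp (Re \<zeta>) - 2 * sin (Im \<zeta>))" for \<zeta>
  proof -
    have "g \<zeta> = b * (1 + \<i> * exp \<zeta>)" by (simp add: g_def algebra_simps)
    then have "(cmod (g \<zeta>))\<^sup>2 = (cmod (1 + \<i> * exp \<zeta>))\<^sup>2" by (simp add: norm_mult b)
    also have "\<dots> = (1 - exp (Re \<zeta>) * sin (Im \<zeta>))\<^sup>2 + (exp (Re \<zeta>) * cos (Im \<zeta>))\<^sup>2"
      by (simp add: cmod_power2 Re_exp Im_exp)
    also have "\<dots> = 1 - 2 * (exp (Re \<zeta>) * sin (Im \<zeta>)) + (exp (Re \<zeta>))\<^sup>2 * ((sin (Im \<zeta>))\<^sup>2 + (cos (Im \<zeta>))\<^sup>2)"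
      by algebra
    also have "\<dots> = 1 - 2 * (exp (Re \<zeta>) * sin (Im \<zeta>)) + (exp (Re \<zeta>))\<^sup>2"
      by (simp only: sin_cos_squared_add mult_1_right)
    finally show ?thesis by (simp add: power2_eq_square algebra_simps)
  qed
  have gl: "cmod (g \<zeta>) < 1 \<longleftrightarrow> exp (Re \<zeta>) < 2 * sin (Im \<zeta>)" for \<zeta>
  proof -
    have "cmod (g \<zeta>) < 1 \<longleftrightarrow> (cmod (g \<zeta>))\<^sup>2 < 1"
      by (metis abs_norm_cancel abs_square_less_1)
    then show ?thesis
      unfolding gn by (simp add: mult_less_0_iff)
  qed
  have gb: "cmod (g \<zeta> - b) = exp (Re \<zeta>)" for \<zeta>
    by (simp add: g_def norm_mult b)
  have im: "g ` A = ball 0 1 - ball b r"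
  proof (intro equalityI subsetI)
    fix z assume "z \<in> g ` A"
    then obtain \<zeta> where \<zeta>: "\<zeta> \<in> A" "z = g \<zeta>" by auto
    have "exp (ln r) \<le> exp (Re \<zeta>)" using \<zeta> by (simp add: A_def)
    then show "z \<in> ball 0 1 - ball b r"
      using \<zeta> gl [of \<zeta>] gb [of \<zeta>] r by (auto simp: A_def dist_norm norm_minus_commute)
  next
    fix z assume z: "z \<in> ball 0 1 - ball b r"
    \<comment> \<open>The solution of z = b + \<i> b u. The disc lies on the inner side of the
      tangent at b, hence Im u > 0 and Ln u falls into the strip.\<close>
    define u where "u = \<i> * ((b - z) / b)"
    have "Im u > 0"
    proof -
      have "cmod (z / b) < 1" using z b by (simp add: norm_divide)
      then have "Re (z / b) < 1" using complex_Re_le_cmod [of "z / b"] by linarith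
      moreover have "(b - z) / b = 1 - z / b" using bn by (simp add: diff_divide_distrib)
      ultimately show ?thesis by (simp add: u_def)
    qed
    then have un: "u \<noteq> 0" by auto
    have gu: "g (Ln u) = z" using un bn by (simp add: g_def u_def field_simps)
    have "cmod u = cmod (z - b)" by (simp add: u_def norm_mult norm_divide b norm_minus_commute)
    then have "r \<le> cmod u" using z by (auto simp: dist_norm norm_minus_commute)
    then have "ln r \<le> Re (Ln u)" using r un by (simp add: ln_le_cancel_iff)
    then have "Ln u \<in> A"
      using Im_Ln_pos_lt_imp [OF \<open>Im u > 0\<close>] gl [of "Ln u"] gu z by (auto simp: A_def)
    then show "z \<in> g ` A" using gu by (metis imageI)
  qed
  have der: "(g has_field_derivative \<i> * b * exp z) (at z within A)" for z
    unfolding g_def [abs_def] by (auto intro!: derivative_eq_intros)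
  define f where "f z = complex_of_real (1 / (cmod (z - b))\<^sup>2)" for z
  have one: "(cmod (\<i> * b * exp \<zeta>))\<^sup>2 *\<^sub>R f (g \<zeta>) = 1" for \<zeta>
    unfolding f_def gb by (simp add: norm_mult b scaleR_conv_of_real)
  have "(\<lambda>z. (cmod (\<i> * b * exp z))\<^sup>2 *\<^sub>R f (g z)) absolutely_integrable_on A \<and>
           integral A (\<lambda>z. (cmod (\<i> * b * exp z))\<^sup>2 *\<^sub>R f (g z)) = of_real (measure lebesgue A)
     \<longleftrightarrow> f absolutely_integrable_on (g ` A) \<and> integral (g ` A) f = of_real (measure lebesgue A)"
    by (rule has_absolute_integral_change_of_variables_complex [OF fmeasurableD [OF mA(1)] der inj])
  moreover have "(\<lambda>z. 1 :: complex) absolutely_integrable_on A" "integral A (\<lambda>z. 1 :: complex) = of_real (measure lebesgue A)"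
  proof -
    have 1: "((\<lambda>z. 1 :: real) has_integral measure lebesgue A) A"
      using mA(1) by (simp add: has_integral_iff lmeasure_integral lmeasurable_iff_integrable_on [symmetric])
    then have 2: "((\<lambda>z. complex_of_real 1) has_integral complex_of_real (measure lebesgue A)) A"
      by (rule has_integral_of_real)
    show "integral A (\<lambda>z. 1 :: complex) = of_real (measure lebesgue A)"
      using 2 by (simp add: integral_unique)
    show "(\<lambda>z. 1 :: complex) absolutely_integrable_on A"
      unfolding absolutely_integrable_on_def using 1 2 by auto
  qed
  ultimately have f: "f absolutely_integrable_on (ball 0 1 - ball b r)" "integral (ball 0 1 - ball b r) f = of_real (measure lebesgue A)"
    by (simp_all add: one im)
  have Ref: "Re (f z) = 1 / (cmod (z - b))\<^sup>2" for z by (simp add: f_def)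
  show "(\<lambda>z. 1 / (cmod (z - b))\<^sup>2) absolutely_integrable_on (ball 0 1 - ball b r)"
    using absolutely_integrable_linear [OF f(1) bounded_linear_Re] by (simp add: o_def Ref)
  have "integral (ball 0 1 - ball b r) (\<lambda>z. Re (f z)) = Re (integral (ball 0 1 - ball b r) f)"
    using integral_linear [OF _ bounded_linear_Re, of f] f(1) by (simp add: o_def absolutely_integrable_on_def)
  then show "integral (ball 0 1 - ball b r) (\<lambda>z. 1 / (cmod (z - b))\<^sup>2)
       = pi * ln (1 / r) + integral {0<..<pi} (\<lambda>y. max (ln r) (ln (2 * sin y)))"
    using f(2) mA(2) by (simp add: Ref)
qed

section \<open>Harmonic functions\<close>

lemma has_derivative_partials:
  fixes u :: "complex \<Rightarrow> real"
  assumes "(u has_derivative u') (at z)"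
  shows "((\<lambda>t. u (z + e * of_real t)) has_real_derivative u' e) (at 0)"
proof -
  have 1: "((\<lambda>t. z + e * of_real t) has_derivative (\<lambda>t. e * of_real t)) (at 0)"
    by (auto intro!: derivative_eq_intros)
  have "((\<lambda>t. u (z + e * of_real t)) has_derivative (\<lambda>t. u' (e * of_real t))) (at 0)"
    by (rule has_derivative_compose [OF 1]) (use assms in simp)
  moreover have "u' (e * of_real t) = u' e * t" for t
  proof -
    have "linear u'" using assms has_derivative_linear by blast
    then have "u' (t *\<^sub>R e) = t *\<^sub>R u' e" by (rule linear_scale)
    then show ?thesis by (simp add: scaleR_conv_of_real mult.commute)
  qed
  ultimately show ?thesis
    unfolding has_field_derivative_def by simp
qed

lemma partial_has_derivative:
  assumes "(u has_derivative u') (at z)"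
  shows "partial_x u z = u' 1" "partial_y u z = u' \<i>"
  using has_derivative_partials [OF assms, of 1] has_derivative_partials [OF assms, of \<i>]
  by (auto simp: partial_x_def partial_y_def intro!: DERIV_imp_deriv)

lemma partial_Im_holomorphic:
  assumes "(F has_field_derivative F') (at z)"
  shows "((\<lambda>z. Im (F z)) has_derivative (\<lambda>h. Im (F' * h))) (at z)"
    "partial_x (\<lambda>z. Im (F z)) z = Im F'" "partial_y (\<lambda>z. Im (F z)) z = Re F'"
proof -
  show d: "((\<lambda>z. Im (F z)) has_derivative (\<lambda>h. Im (F' * h))) (at z)"
    using assms unfolding has_field_derivative_def by (rule has_derivative_Im)
  show "partial_x (\<lambda>z. Im (F z)) z = Im F'" "partial_y (\<lambda>z. Im (F z)) z = Re F'"
    by (simp_all add: partial_has_derivative [OF d])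
qed

lemma partial_Re_holomorphic:
  assumes "(F has_field_derivative F') (at z)"
  shows "((\<lambda>z. Re (F z)) has_derivative (\<lambda>h. Re (F' * h))) (at z)"
    "partial_x (\<lambda>z. Re (F z)) z = Re F'" "partial_y (\<lambda>z. Re (F z)) z = - Im F'"
proof -
  show d: "((\<lambda>z. Re (F z)) has_derivative (\<lambda>h. Re (F' * h))) (at z)"
    using assms unfolding has_field_derivative_def by (rule has_derivative_Re)
  show "partial_x (\<lambda>z. Re (F z)) z = Re F'" "partial_y (\<lambda>z. Re (F z)) z = - Im F'"
    by (simp_all add: partial_has_derivative [OF d])
qed

lemma partial_cong:
  assumes "open S" "z \<in> S" "\<And>w. w \<in> S \<Longrightarrow> f w = g w"
  shows "partial_x f z = partial_x g z" "partial_y f z = partial_y g z"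
proof -
  have ev: "\<forall>\<^sub>F t in nhds 0. f (z + e * of_real t) = g (z + e * of_real t)" for e
  proof -
    have "((\<lambda>t. z + e * of_real t) \<longlongrightarrow> z + e * of_real 0) (nhds 0)"
      by (intro tendsto_intros filterlim_ident)
    then have "\<forall>\<^sub>F t in nhds 0. z + e * of_real t \<in> S"
      using assms by (auto dest!: topological_tendstoD)
    then show ?thesis by eventually_elim (use assms in auto)
  qed
  show "partial_x f z = partial_x g z" "partial_y f z = partial_y g z"
    unfolding partial_x_def partial_y_def using ev [of 1] ev [of \<i>]
    by (auto intro!: deriv_cong_ev)
qed

lemma differentiable_cong_open:
  assumes "open S" "z \<in> S" "\<And>w. w \<in> S \<Longrightarrow> f w = g w" "g differentiable (at z)"
  shows "f differentiable (at z)"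
  using assms unfolding differentiable_def
  by (metis has_derivative_transform_within_open)

text \<open>By Cauchy-Riemann the first partials are Im F' and Re F'; all second partials are then
  parts of F'' up to sign, and the two in the Laplacian are opposite.\<close>

lemma harmonic_on_Im:
  assumes F: "F holomorphic_on S" and S: "open S"
  shows "harmonic_on (\<lambda>z. Im (F z)) S"
proof -
  define F1 where "F1 = deriv F"
  define F2 where "F2 = deriv F1"
  have F1: "F1 holomorphic_on S"
    unfolding F1_def by (rule holomorphic_deriv [OF F S])
  have F2: "F2 holomorphic_on S"
    unfolding F2_def by (rule holomorphic_deriv [OF F1 S])
  have d0: "(F has_field_derivative F1 z) (at z)" if "z \<in> S" for z
    unfolding F1_def using holomorphic_derivI [OF F S that] by simp
  have d1: "(F1 has_field_derivative F2 z) (at z)" if "z \<in> S" for z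
    unfolding F2_def using holomorphic_derivI [OF F1 S that] by simp
  have px: "partial_x (\<lambda>z. Im (F z)) z = Im (F1 z)" and py: "partial_y (\<lambda>z. Im (F z)) z = Re (F1 z)" if "z \<in> S" for z
    using partial_Im_holomorphic [OF d0 [OF that]] by auto
  have pxx: "partial_x (partial_x (\<lambda>z. Im (F z))) z = Im (F2 z)"
    and pyx: "partial_y (partial_x (\<lambda>z. Im (F z))) z = Re (F2 z)"
    and pxy: "partial_x (partial_y (\<lambda>z. Im (F z))) z = Re (F2 z)"
    and pyy: "partial_y (partial_y (\<lambda>z. Im (F z))) z = - Im (F2 z)" if "z \<in> S" for z
    using partial_cong [OF S that, of "partial_x (\<lambda>z. Im (F z))" "\<lambda>z. Im (F1 z)", OF px]
      partial_cong [OF S that, of "partial_y (\<lambda>z. Im (F z))" "\<lambda>z. Re (F1 z)", OF py]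
      partial_Im_holomorphic [OF d1 [OF that]] partial_Re_holomorphic [OF d1 [OF that]] by auto
  have c2: "continuous_on S F2"
    using F2 by (rule holomorphic_on_imp_continuous_on)
  show ?thesis
    unfolding harmonic_on_def
  proof (intro conjI ballI)
    fix z assume z: "z \<in> S"
    show "(\<lambda>z. Im (F z)) differentiable (at z)"
      using partial_Im_holomorphic(1) [OF d0 [OF z]] by (auto simp: differentiable_def)
    show "partial_x (\<lambda>z. Im (F z)) differentiable (at z)"
      by (rule differentiable_cong_open [OF S z px]) (use partial_Im_holomorphic(1) [OF d1 [OF z]] in \<open>auto simp: differentiable_def\<close>)
    show "partial_y (\<lambda>z. Im (F z)) differentiable (at z)"
      by (rule differentiable_cong_open [OF S z py]) (use partial_Re_holomorphic(1) [OF d1 [OF z]] in \<open>auto simp: differentiable_def\<close>)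
    show "partial_x (partial_x (\<lambda>z. Im (F z))) z + partial_y (partial_y (\<lambda>z. Im (F z))) z = 0"
      by (simp add: pxx pyy z)
  next
    show "continuous_on S (partial_x (partial_x (\<lambda>z. Im (F z))))"
      using continuous_on_Im [OF c2] by (rule continuous_on_eq) (simp add: pxx)
    show "continuous_on S (partial_y (partial_y (\<lambda>z. Im (F z))))"
      using continuous_on_minus [OF continuous_on_Im [OF c2]] by (rule continuous_on_eq) (simp add: pyy)
    show "continuous_on S (partial_x (partial_y (\<lambda>z. Im (F z))))"
      using continuous_on_Re [OF c2] by (rule continuous_on_eq) (simp add: pxy)
    show "continuous_on S (partial_y (partial_x (\<lambda>z. Im (F z))))"
      using continuous_on_Re [OF c2] by (rule continuous_on_eq) (simp add: pyx)
  qed (fact S)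
qed

lemma partial_diff:
  assumes "f differentiable (at z)" "g differentiable (at z)"
  shows "partial_x (\<lambda>z. f z - g z) z = partial_x f z - partial_x g z"
    "partial_y (\<lambda>z. f z - g z) z = partial_y f z - partial_y g z"
proof -
  obtain f' g' where d: "(f has_derivative f') (at z)" "(g has_derivative g') (at z)"
    using assms by (auto simp: differentiable_def)
  from has_derivative_diff [OF this] have "((\<lambda>z. f z - g z) has_derivative (\<lambda>h. f' h - g' h)) (at z)" .
  from partial_has_derivative [OF this] partial_has_derivative [OF d(1)] partial_has_derivative [OF d(2)]
  show "partial_x (\<lambda>z. f z - g z) z = partial_x f z - partial_x g z"
    "partial_y (\<lambda>z. f z - g z) z = partial_y f z - partial_y g z" by auto
qed

lemma harmonic_on_diff:
  assumes f: "harmonic_on f S" and g: "harmonic_on g S"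
  shows "harmonic_on (\<lambda>z. f z - g z) S"
proof -
  have S: "open S" using f by (simp add: harmonic_on_def)
  note df = f [unfolded harmonic_on_def] note dg = g [unfolded harmonic_on_def]
  have px: "partial_x (\<lambda>z. f z - g z) z = partial_x f z - partial_x g z"
    and py: "partial_y (\<lambda>z. f z - g z) z = partial_y f z - partial_y g z" if "z \<in> S" for z
    using partial_diff [of f z g] df dg that by auto
  have pxx: "partial_x (partial_x (\<lambda>z. f z - g z)) z = partial_x (partial_x f) z - partial_x (partial_x g) z"
    and pyx: "partial_y (partial_x (\<lambda>z. f z - g z)) z = partial_y (partial_x f) z - partial_y (partial_x g) z"
    and pxy: "partial_x (partial_y (\<lambda>z. f z - g z)) z = partial_x (partial_y f) z - partial_x (partial_y g) z"
    and pyy: "partial_y (partial_y (\<lambda>z. f z - g z)) z = partial_y (partial_y f) z - partial_y (partial_y g) z" if "z \<in> S" for z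
    using partial_cong [OF S that, of "partial_x (\<lambda>z. f z - g z)" "\<lambda>z. partial_x f z - partial_x g z", OF px]
      partial_cong [OF S that, of "partial_y (\<lambda>z. f z - g z)" "\<lambda>z. partial_y f z - partial_y g z", OF py]
      partial_diff [of "partial_x f" z "partial_x g"] partial_diff [of "partial_y f" z "partial_y g"] df dg that by auto
  show ?thesis
    unfolding harmonic_on_def
  proof (intro conjI ballI)
    fix z assume z: "z \<in> S"
    show "(\<lambda>z. f z - g z) differentiable (at z)" using df dg z by (auto intro: differentiable_diff)
    show "partial_x (\<lambda>z. f z - g z) differentiable (at z)"
      by (rule differentiable_cong_open [OF S z px]) (use df dg z in \<open>auto intro: differentiable_diff\<close>)
    show "partial_y (\<lambda>z. f z - g z) differentiable (at z)"
      by (rule differentiable_cong_open [OF S z py]) (use df dg z in \<open>auto intro: differentiable_diff\<close>)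
    have "partial_x (partial_x f) z + partial_y (partial_y f) z = 0" "partial_x (partial_x g) z + partial_y (partial_y g) z = 0"
      using df dg z by auto
    then show "partial_x (partial_x (\<lambda>z. f z - g z)) z + partial_y (partial_y (\<lambda>z. f z - g z)) z = 0"
      unfolding pxx [OF z] pyy [OF z] by linarith
  next
    show "continuous_on S (partial_x (partial_x (\<lambda>z. f z - g z)))"
      by (rule continuous_on_eq [where f = "\<lambda>z. partial_x (partial_x f) z - partial_x (partial_x g) z"])
        (use df dg in \<open>auto intro: continuous_on_diff simp: pxx\<close>)
    show "continuous_on S (partial_y (partial_y (\<lambda>z. f z - g z)))"
      by (rule continuous_on_eq [where f = "\<lambda>z. partial_y (partial_y f) z - partial_y (partial_y g) z"])
        (use df dg in \<open>auto intro: continuous_on_diff simp: pyy\<close>)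
    show "continuous_on S (partial_x (partial_y (\<lambda>z. f z - g z)))"
      by (rule continuous_on_eq [where f = "\<lambda>z. partial_x (partial_y f) z - partial_x (partial_y g) z"])
        (use df dg in \<open>auto intro: continuous_on_diff simp: pxy\<close>)
    show "continuous_on S (partial_y (partial_x (\<lambda>z. f z - g z)))"
      by (rule continuous_on_eq [where f = "\<lambda>z. partial_y (partial_x f) z - partial_y (partial_x g) z"])
        (use df dg in \<open>auto intro: continuous_on_diff simp: pyx\<close>)
  qed (fact S)
qed

section \<open>The maximum principle and uniqueness with exceptional boundary points\<close>

lemma second_derivative_at_max:
  fixes f f' :: "real \<Rightarrow> real"
  assumes d: "d > 0" and der: "\<And>t. \<bar>t\<bar> < d \<Longrightarrow> (f has_real_derivative f' t) (at t)"
    and max: "\<And>t. \<bar>t\<bar> < d \<Longrightarrow> f t \<le> f 0" and der2: "(f' has_real_derivative l) (at 0)"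
  shows "l \<le> 0"
proof (rule ccontr)
  assume "\<not> l \<le> 0"
  then have l: "l > 0" by simp
  have f0: "f' 0 = 0"
    by (rule DERIV_local_max [OF der d]) (use d max in auto)
  obtain e where e: "e > 0" "\<And>h. \<lbrakk>h > 0; h < e\<rbrakk> \<Longrightarrow> f' 0 < f' (0 + h)"
    using DERIV_pos_inc_right [OF der2 l] by blast
  define h where "h = min d e / 2"
  have h: "0 < h" "h < d" "h < e" using d e by (auto simp: h_def min_def)
  have "\<exists>\<xi>. 0 < \<xi> \<and> \<xi> < h \<and> f h - f 0 = (h - 0) * f' \<xi>"
    by (rule MVT2) (use h der in auto)
  then obtain \<xi> where \<xi>: "0 < \<xi>" "\<xi> < h" "f h - f 0 = h * f' \<xi>" by auto
  have "f' \<xi> > 0" using e(2) [of \<xi>] \<xi> h f0 by simp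
  then have "f h > f 0" using \<xi>(3) h by (metis diff_gt_0_iff_gt mult_pos_pos)
  then show False using max [of h] h by simp
qed

lemma directional_second_derivative_at_max:
  fixes v p :: "complex \<Rightarrow> real"
  assumes S: "open S" "z \<in> S" and max: "\<And>w. w \<in> S \<Longrightarrow> v w \<le> v z"
    and d1: "\<And>w. w \<in> S \<Longrightarrow> ((\<lambda>t. v (w + e * of_real t)) has_real_derivative p w) (at 0)"
    and d2: "((\<lambda>t. p (z + e * of_real t)) has_real_derivative l) (at 0)"
  shows "l \<le> 0"
proof -
  have "((\<lambda>t. z + e * of_real t) \<longlongrightarrow> z + e * of_real 0) (nhds 0)"
    by (intro tendsto_intros filterlim_ident)
  then have "\<forall>\<^sub>F t in nhds 0. z + e * of_real t \<in> S"
    using S by (auto dest!: topological_tendstoD)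
  then obtain d where d: "d > 0" "\<And>t. \<bar>t\<bar> < d \<Longrightarrow> z + e * of_real t \<in> S"
    unfolding eventually_nhds_metric by (auto simp: dist_real_def)
  show ?thesis
  proof (rule second_derivative_at_max [OF d(1) _ _ d2])
    fix t :: real assume t: "\<bar>t\<bar> < d"
    show "v (z + e * of_real t) \<le> v (z + e * of_real 0)"
      using max [OF d(2) [OF t]] by simp
    have "((\<lambda>s. v (z + e * of_real t + e * of_real s)) has_real_derivative p (z + e * of_real t)) (at 0)"
      by (rule d1 [OF d(2) [OF t]])
    then have "((\<lambda>s. v (z + e * of_real (s + t))) has_real_derivative p (z + e * of_real t)) (at 0)"
      by (simp add: algebra_simps)
    then show "((\<lambda>t. v (z + e * of_real t)) has_real_derivative p (z + e * of_real t)) (at t)"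
      using DERIV_shift [of "\<lambda>t. v (z + e * of_real t)" _ 0 t] by simp
  qed
qed

text \<open>Adding \<delta> |z|^2 makes the Laplacian strictly positive, which an interior maximum
  forbids. The boundary condition is a one-sided bound on the limit superior, the form that a
  barrier argument delivers.\<close>

lemma harmonic_maximum_principle:
  assumes u: "harmonic_on u S" and bS: "bounded S"
    and bd: "\<And>b e. b \<in> frontier S \<Longrightarrow> e > 0 \<Longrightarrow> \<forall>\<^sub>F z in at b within S. u z < m + e"
    and z0: "z0 \<in> S"
  shows "u z0 \<le> m"
proof (rule ccontr)
  assume "\<not> u z0 \<le> m"
  then have gt: "u z0 > m" by simp
  have S: "open S" using u by (simp add: harmonic_on_def)
  have du: "u differentiable (at z)" "partial_x u differentiable (at z)" "partial_y u differentiable (at z)"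
    "partial_x (partial_x u) z + partial_y (partial_y u) z = 0" if "z \<in> S" for z
    using u that by (auto simp: harmonic_on_def)
  have contu: "continuous_on S u"
    using du(1) by (simp add: continuous_at_imp_continuous_on differentiable_imp_continuous_within)
  obtain R where R: "R > 0" "\<And>z. z \<in> S \<Longrightarrow> cmod z \<le> R"
    using bS bounded_pos by blast
  \<comment> \<open>The perturbation stays below a quarter of the gap u z0 - m, and the tolerance at
    the frontier is another quarter. So the set \<open>K\<close> where v is at least v z0 cannot
    accumulate at the frontier and is compact.\<close>
  define \<delta> where "\<delta> = (u z0 - m) / (4 * R\<^sup>2)"
  have \<delta>: "\<delta> > 0" using gt R by (simp add: \<delta>_def)
  have \<delta>R: "\<delta> * R\<^sup>2 = (u z0 - m) / 4" using R by (simp add: \<delta>_def)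
  define v where "v z = u z + \<delta> * (cmod z)\<^sup>2" for z
  have contv: "continuous_on S v"
    unfolding v_def by (intro continuous_intros contu)
  have vle: "v z \<le> u z + (u z0 - m) / 4" if "z \<in> S" for z
  proof -
    have "\<delta> * (cmod z)\<^sup>2 \<le> \<delta> * R\<^sup>2"
      using R(2) [OF that] \<delta> by (intro mult_left_mono power_mono) auto
    then show ?thesis by (simp add: v_def \<delta>R)
  qed
  have v0: "v z0 \<ge> u z0" using \<delta> by (simp add: v_def)
  define K where "K = {z \<in> S. v z \<ge> v z0}"
  have "closed K"
    unfolding closed_sequential_limits
  proof (intro allI impI)
    fix x l assume xl: "(\<forall>n. x n \<in> K) \<and> x \<longlonglongrightarrow> l"
    then have xS: "x n \<in> S" and xv: "v (x n) \<ge> v z0" for n by (auto simp: K_def)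
    have lim: "x \<longlonglongrightarrow> l" using xl by simp
    have lc: "l \<in> closure S" using xS lim closure_sequential by blast
    show "l \<in> K"
    proof (cases "l \<in> S")
      case True
      have "isCont v l" using contv True S by (simp add: continuous_on_eq_continuous_at)
      then have "(\<lambda>n. v (x n)) \<longlonglongrightarrow> v l" using lim by (rule isCont_tendsto_compose)
      then have "v l \<ge> v z0" using xv by (intro LIMSEQ_le_const) auto
      then show ?thesis using True by (simp add: K_def)
    next
      case False
      then have "l \<in> frontier S" using lc S by (simp add: frontier_def interior_open)
      then have "\<forall>\<^sub>F z in at l within S. u z < m + (u z0 - m) / 4"
        using bd [of l "(u z0 - m) / 4"] gt by simp
      moreover have "filterlim x (at l within S) sequentially"
        unfolding filterlim_at using lim xS False by (auto intro!: always_eventually)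
      ultimately have "\<forall>\<^sub>F n in sequentially. u (x n) < m + (u z0 - m) / 4"
        by (rule eventually_compose_filterlim)
      then obtain n where "u (x n) < m + (u z0 - m) / 4"
        by (auto simp: eventually_sequentially)
      then have "v (x n) < u z0" using vle [OF xS [of n]] gt by (simp add: field_simps)
      then show ?thesis using xv [of n] v0 by linarith
    qed
  qed
  moreover have "bounded K" by (rule bounded_subset [OF bS]) (auto simp: K_def)
  ultimately have "compact K" by (simp add: compact_eq_bounded_closed)
  moreover have "z0 \<in> K" using z0 by (simp add: K_def)
  moreover have "continuous_on K v" by (rule continuous_on_subset [OF contv]) (auto simp: K_def)
  ultimately obtain z1 where z1: "z1 \<in> K" "\<And>z. z \<in> K \<Longrightarrow> v z \<le> v z1"
    using continuous_attains_sup [of K v] by blast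
  have z1S: "z1 \<in> S" using z1 by (simp add: K_def)
  have vmax: "v z \<le> v z1" if "z \<in> S" for z
    using z1 that by (cases "z \<in> K") (auto simp: K_def)
  have dsq: "((\<lambda>t. \<delta> * (cmod (w + e * of_real t))\<^sup>2) has_real_derivative 2 * \<delta> * Re (w * cnj e)) (at 0)" for w e
  proof -
    have "(cmod (w + e * of_real t))\<^sup>2 = (cmod w)\<^sup>2 + 2 * Re (w * cnj e) * t + (cmod e)\<^sup>2 * t\<^sup>2" for t
      by (simp only: cmod_power2) (simp add: power2_eq_square algebra_simps)
    then show ?thesis
      by (auto intro!: derivative_eq_intros)
  qed
  have dlin: "((\<lambda>t. 2 * \<delta> * Re ((w + e * of_real t) * cnj e)) has_real_derivative 2 * \<delta> * (cmod e)\<^sup>2) (at 0)" for w e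
  proof -
    have "Re ((w + e * of_real t) * cnj e) = Re (w * cnj e) + t * (cmod e)\<^sup>2" for t
      by (simp only: cmod_power2) (simp add: power2_eq_square algebra_simps)
    then show ?thesis
      by (auto intro!: derivative_eq_intros)
  qed
  have pu: "((\<lambda>t. f (w + 1 * of_real t)) has_real_derivative partial_x f w) (at 0)"
    "((\<lambda>t. f (w + \<i> * of_real t)) has_real_derivative partial_y f w) (at 0)" if df: "f differentiable (at w)" for f :: "complex \<Rightarrow> real" and w
  proof -
    obtain f' where f': "(f has_derivative f') (at w)" using df unfolding differentiable_def by blast
    show "((\<lambda>t. f (w + 1 * of_real t)) has_real_derivative partial_x f w) (at 0)"
      "((\<lambda>t. f (w + \<i> * of_real t)) has_real_derivative partial_y f w) (at 0)"
      using has_derivative_partials [OF f'] partial_has_derivative [OF f'] by metis+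
  qed
  have "partial_x (partial_x u) z1 + 2 * \<delta> * (cmod 1)\<^sup>2 \<le> 0"
  proof (rule directional_second_derivative_at_max [where v = v and e = 1, OF S z1S vmax])
    show "((\<lambda>t. v (w + 1 * of_real t)) has_real_derivative partial_x u w + 2 * \<delta> * Re (w * cnj 1)) (at 0)" if "w \<in> S" for w
      unfolding v_def by (rule DERIV_add [OF pu(1) [OF du(1) [OF that]] dsq])
    show "((\<lambda>t. partial_x u (z1 + 1 * of_real t) + 2 * \<delta> * Re ((z1 + 1 * of_real t) * cnj 1)) has_real_derivative
        partial_x (partial_x u) z1 + 2 * \<delta> * (cmod 1)\<^sup>2) (at 0)"
      by (rule DERIV_add [OF pu(1) [OF du(2) [OF z1S]] dlin])
  qed
  moreover have "partial_y (partial_y u) z1 + 2 * \<delta> * (cmod \<i>)\<^sup>2 \<le> 0"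
  proof (rule directional_second_derivative_at_max [where v = v and e = \<i>, OF S z1S vmax])
    show "((\<lambda>t. v (w + \<i> * of_real t)) has_real_derivative partial_y u w + 2 * \<delta> * Re (w * cnj \<i>)) (at 0)" if "w \<in> S" for w
      unfolding v_def by (rule DERIV_add [OF pu(2) [OF du(1) [OF that]] dsq])
    show "((\<lambda>t. partial_y u (z1 + \<i> * of_real t) + 2 * \<delta> * Re ((z1 + \<i> * of_real t) * cnj \<i>)) has_real_derivative
        partial_y (partial_y u) z1 + 2 * \<delta> * (cmod \<i>)\<^sup>2) (at 0)"
      by (rule DERIV_add [OF pu(2) [OF du(3) [OF z1S]] dlin])
  qed
  ultimately show False
    using du(4) [OF z1S] \<delta> by simp
qed

text \<open>A Phragmen-Lindelof argument: u - e Im B has limit superior at most e c along the whole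
  frontier, because Im B is infinite on P, where u is merely bounded, and at least - c elsewhere,
  where u tends to 0. Then e tends to 0.\<close>

lemma harmonic_nonpos_barrier:
  assumes u: "harmonic_on u S" and bS: "bounded S" and bu: "bounded (u ` S)"
    and B: "B holomorphic_on S" and Blo: "\<And>z. z \<in> S \<Longrightarrow> Im (B z) \<ge> - c" and c: "c \<ge> 0"
    and BP: "\<And>b. b \<in> P \<Longrightarrow> filterlim (\<lambda>z. Im (B z)) at_top (at b within S)"
    and u0: "\<And>b. b \<in> frontier S - P \<Longrightarrow> (u \<longlongrightarrow> 0) (at b within S)"
    and z: "z \<in> S"
  shows "u z \<le> 0"
proof -
  have S: "open S" using u by (simp add: harmonic_on_def)
  obtain M where M: "\<And>z. z \<in> S \<Longrightarrow> \<bar>u z\<bar> \<le> M"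
    using bu unfolding bounded_iff by auto
  have "u z \<le> e * (c + Im (B z))" if e: "e > 0" for e
  proof -
    let ?w = "\<lambda>z. u z - Im (of_real e * B z)"
    have "?w z \<le> e * c"
    proof (rule harmonic_maximum_principle [OF _ bS _ z])
      show "harmonic_on ?w S"
        by (intro harmonic_on_diff u harmonic_on_Im holomorphic_intros B S)
      fix b e' assume b: "b \<in> frontier S" and e': "(e'::real) > 0"
      have inS: "\<forall>\<^sub>F z in at b within S. z \<in> S" by (simp add: eventually_at_filter)
      show "\<forall>\<^sub>F z in at b within S. ?w z < e * c + e'"
      proof (cases "b \<in> P")
        case True
        have "\<forall>\<^sub>F z in at b within S. Im (B z) \<ge> M / e"
          using BP [OF True] by (simp add: filterlim_at_top)
        then show ?thesis
          using inS
        proof eventually_elim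
          case (elim z)
          then have "e * Im (B z) \<ge> M" using e by (simp add: field_simps)
          moreover have "u z \<le> M" using M [OF elim(2)] by simp
          moreover have "0 \<le> e * c" using e c by simp
          ultimately show ?case using e' by simp
        qed
      next
        case False
        then have "(u \<longlongrightarrow> 0) (at b within S)" using u0 b by simp
        then have "\<forall>\<^sub>F z in at b within S. u z < e'" using e' by (rule order_tendstoD)
        then show ?thesis
          using inS
        proof eventually_elim
          case (elim z)
          have "e * Im (B z) \<ge> e * (- c)" using Blo [OF elim(2)] e by (intro mult_left_mono) auto
          then show ?case using elim by simp
        qed
      qed
    qed
    then show ?thesis by (simp add: algebra_simps)
  qed
  then have *: "u z \<le> e * (c + Im (B z))" if "e > 0" for e using that by blast
  have "((\<lambda>e. e * (c + Im (B z))) \<longlongrightarrow> 0 * (c + Im (B z))) (at_right 0)"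
    by (intro tendsto_intros)
  then have "((\<lambda>e. e * (c + Im (B z))) \<longlongrightarrow> 0) (at_right 0)" by simp
  then show ?thesis
    by (rule tendsto_lowerbound) (auto simp: eventually_at_right_less intro!: eventually_at_rightI [of 0 1] *)
qed

lemma harmonic_eq_0_barrier:
  assumes u: "harmonic_on u S" and bS: "bounded S" and bu: "bounded (u ` S)"
    and B: "B holomorphic_on S" and Blo: "\<And>z. z \<in> S \<Longrightarrow> Im (B z) \<ge> - c" and c: "c \<ge> 0"
    and BP: "\<And>b. b \<in> P \<Longrightarrow> filterlim (\<lambda>z. Im (B z)) at_top (at b within S)"
    and u0: "\<And>b. b \<in> frontier S - P \<Longrightarrow> (u \<longlongrightarrow> 0) (at b within S)"
    and z: "z \<in> S"
  shows "u z = 0"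
proof -
  have S: "open S" using u by (simp add: harmonic_on_def)
  have "harmonic_on (\<lambda>z. Im 0) S"
    by (rule harmonic_on_Im) (auto intro: S)
  then have "harmonic_on (\<lambda>z. 0 - u z) S"
    using harmonic_on_diff [OF _ u, of "\<lambda>z. 0"] by simp
  then have "0 - u z \<le> 0"
  proof (rule harmonic_nonpos_barrier [OF _ bS _ B Blo c BP _ z])
    show "bounded ((\<lambda>z. 0 - u z) ` S)"
      using bu by (simp add: bounded_iff)
    show "((\<lambda>z. 0 - u z) \<longlongrightarrow> 0) (at b within S)" if "b \<in> frontier S - P" for b
      using tendsto_minus [OF u0 [OF that]] by simp
  qed
  moreover have "u z \<le> 0"
    by (rule harmonic_nonpos_barrier [OF u bS bu B Blo c BP u0 z])
  ultimately show ?thesis by simp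
qed

section \<open>Boundary geometry of the conformal map\<close>

text \<open>A continuous logarithm is locally the principal one: near x, g stays within pi of g x,
  so g = g x + Ln (f / f x). The general domain covers both the logarithm of \<Phi>' on the disc and
  the angle along the curve.\<close>

lemma continuous_log_has_derivative:
  fixes f g :: "'a::real_normed_vector \<Rightarrow> complex"
  assumes f: "(f has_derivative f') (at x within S)" and x: "x \<in> S"
    and g: "continuous (at x within S) g" and fg: "\<And>y. y \<in> S \<Longrightarrow> f y = exp (g y)"
  shows "(g has_derivative (\<lambda>h. f' h / f x)) (at x within S)"
proof -
  have fx: "f x \<noteq> 0" using fg x by simp
  have "((\<lambda>y. f y / f x) has_derivative (\<lambda>h. f' h / f x)) (at x within S)"
    using has_derivative_mult_left [OF f, of "inverse (f x)"] by (simp add: field_simps)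
  moreover have "(Ln has_derivative (*) (inverse (f x / f x))) (at (f x / f x))"
    using has_field_derivative_Ln [of "f x / f x"] fx by (auto simp: has_field_derivative_def)
  ultimately have "((\<lambda>y. Ln (f y / f x)) has_derivative (\<lambda>h. inverse (f x / f x) * (f' h / f x))) (at x within S)"
    by (rule has_derivative_compose)
  then have d: "((\<lambda>y. g x + Ln (f y / f x)) has_derivative (\<lambda>h. f' h / f x)) (at x within S)"
    using fx by (auto intro!: derivative_eq_intros)
  have "(g \<longlongrightarrow> g x) (at x within S)" using g by (simp add: continuous_within)
  then have "\<forall>\<^sub>F y in at x within S. dist (g y) (g x) < pi"
    by (rule tendstoD) simp
  moreover have "\<forall>\<^sub>F y in at x within S. y \<in> S" by (simp add: eventually_at_filter)
  ultimately have ev: "\<forall>\<^sub>F y in at x within S. g y = g x + Ln (f y / f x)"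
  proof eventually_elim
    case (elim y)
    have "\<bar>Im (g y - g x)\<bar> < pi"
      using elim(1) abs_Im_le_cmod [of "g y - g x"] by (simp add: dist_norm)
    then have "Ln (exp (g y - g x)) = g y - g x" by (intro Ln_exp) auto
    then show ?case using elim fg x by (simp add: exp_diff)
  qed
  show ?thesis
  proof (rule has_derivative_transform_eventually [OF d])
    show "\<forall>\<^sub>F y in at x within S. g x + Ln (f y / f x) = g y"
      using ev by eventually_elim simp
  qed (use fx x in auto)
qed

text \<open>The values lie in the discrete set 2 pi \<i> Z, whose gaps exceed 1.\<close>

lemma two_pi_integer_valued_constant:
  fixes f :: "'a::topological_space \<Rightarrow> complex"
  assumes S: "connected S" and f: "continuous_on S f" and e: "\<And>x. x \<in> S \<Longrightarrow> exp (f x) = 1"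
    and xy: "x \<in> S" "y \<in> S"
  shows "f x = f y"
proof -
  have "f constant_on S"
  proof (rule continuous_discrete_range_constant [OF S f])
    fix x assume x: "x \<in> S"
    show "\<exists>\<epsilon>>0. \<forall>y. y \<in> S \<and> f y \<noteq> f x \<longrightarrow> \<epsilon> \<le> cmod (f y - f x)"
    proof (intro exI [of _ 1] conjI allI impI)
      fix y assume y: "y \<in> S \<and> f y \<noteq> f x"
      then have "exp (f y) = exp (f x)" using e x by simp
      then obtain n where n: "f y = f x + (of_int (2 * n) * pi) * \<i>"
        unfolding exp_eq by blast
      then have "n \<noteq> 0" using y by auto
      have "cmod (f y - f x) = \<bar>of_int (2 * n) * pi\<bar>"
        unfolding n by (simp add: norm_mult abs_mult)
      also have "\<dots> = \<bar>real_of_int (2 * n)\<bar> * pi" by (simp add: abs_mult)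
      also have "\<dots> \<ge> 1 * 1"
        using \<open>n \<noteq> 0\<close> pi_ge_two by (intro mult_mono) linarith+
      finally show "1 \<le> cmod (f y - f x)" by simp
    qed simp
  qed
  then show ?thesis using xy by (auto simp: constant_on_def)
qed

lemma periodic_int_multiple:
  fixes f :: "real \<Rightarrow> 'a"
  assumes "\<And>s. f (s + L) = f s"
  shows "f (s + of_int n * L) = f s"
proof -
  have nat: "f (s + of_nat k * L) = f s" for s and k :: nat
  proof (induction k)
    case (Suc k)
    have "f (s + of_nat (Suc k) * L) = f ((s + of_nat k * L) + L)" by (simp add: algebra_simps)
    then show ?case using assms Suc by simp
  qed simp
  show ?thesis
  proof (cases "n \<ge> 0")
    case True
    then show ?thesis using nat [of s "nat n"] by simp
  next
    case False
    have "f (s + of_int n * L) = f ((s + of_int n * L) + of_nat (nat (- n)) * L)"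
      by (rule nat [symmetric])
    also have "\<dots> = f s" using False by (simp add: algebra_simps)
    finally show ?thesis .
  qed
qed

lemma periodic_reduce:
  fixes L :: real
  assumes "L > 0"
  obtains s' and n :: int where "s' \<in> {0..<L}" "s = s' + of_int n * L"
proof
  show "s - of_int \<lfloor>s / L\<rfloor> * L \<in> {0..<L}"
    using floor_divide_lower [OF assms, of s] floor_divide_upper [OF assms, of s]
    by (simp add: algebra_simps)
  show "s = s - of_int \<lfloor>s / L\<rfloor> * L + of_int \<lfloor>s / L\<rfloor> * L" by simp
qed

text \<open>The common setting of both halves of the theorem; the disc is the instance in which both
  maps are the identity. Derivatives are taken within the closed sets, which expresses C^1
  regularity up to the boundary.\<close>

locale conformal_parametrisation =
  fixes \<Omega> :: "complex set" and \<Phi> \<Phi>' \<Psi> \<Psi>' :: "complex \<Rightarrow> complex" and \<gamma> :: "real \<Rightarrow> complex" and L :: real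
  assumes open_Omega: "open \<Omega>" and bounded_Omega: "bounded \<Omega>" and connected_Omega: "connected \<Omega>"
    and holo_Phi: "\<Phi> holomorphic_on ball 0 1"
    and bij_Phi: "bij_betw \<Phi> (cball 0 1) (closure \<Omega>)"
    and deriv_Phi: "\<And>z. z \<in> cball 0 1 \<Longrightarrow> (\<Phi> has_field_derivative \<Phi>' z) (at z within cball 0 1)"
    and Phi'_nz: "\<And>z. z \<in> cball 0 1 \<Longrightarrow> \<Phi>' z \<noteq> 0"
    and cont_Phi': "continuous_on (cball 0 1) \<Phi>'"
    and Psi_Phi: "\<And>z. z \<in> cball 0 1 \<Longrightarrow> \<Psi> (\<Phi> z) = z"
    and Phi_Psi: "\<And>w. w \<in> closure \<Omega> \<Longrightarrow> \<Phi> (\<Psi> w) = w"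
    and deriv_Psi: "\<And>w. w \<in> closure \<Omega> \<Longrightarrow> (\<Psi> has_field_derivative \<Psi>' w) (at w within closure \<Omega>)"
    and cont_Psi': "continuous_on (closure \<Omega>) \<Psi>'"
    and param: "C11_boundary_param \<Omega> \<gamma> L"
begin

lemma L_pos: "L > 0"
  and gamma_periodic: "\<gamma> (s + L) = \<gamma> s"
  and gamma_inj: "inj_on \<gamma> {0..<L}"
  and gamma_image: "\<gamma> ` {0..L} = frontier \<Omega>"
  and gamma_differentiable: "\<gamma> differentiable (at s)"
  and norm_tangent: "norm (tangent_at \<gamma> s) = 1"
  and winding_gamma: "z \<in> \<Omega> \<Longrightarrow> winding_number (\<lambda>t. \<gamma> (L * t)) z = 1"
  using param by (auto simp: C11_boundary_param_def)

lemma gamma_deriv: "(\<gamma> has_vector_derivative tangent_at \<gamma> s) (at s)"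
  unfolding tangent_at_def using gamma_differentiable vector_derivative_works by blast

lemma continuous_gamma: "continuous_on S \<gamma>"
  using gamma_deriv by (meson continuous_at_imp_continuous_on has_vector_derivative_continuous)

lemma tangent_periodic: "tangent_at \<gamma> (s + L) = tangent_at \<gamma> s"
proof -
  have "((\<lambda>x. x + L) has_vector_derivative 1) (at s)"
    by (auto intro!: derivative_eq_intros)
  then have "((\<gamma> \<circ> (\<lambda>x. x + L)) has_vector_derivative (1 *\<^sub>R tangent_at \<gamma> (s + L))) (at s)"
    by (rule vector_diff_chain_at) (rule gamma_deriv)
  then have "(\<gamma> has_vector_derivative tangent_at \<gamma> (s + L)) (at s)"
    by (simp add: o_def gamma_periodic)
  then show ?thesis
    using gamma_deriv vector_derivative_unique_at by blast
qed

lemma gamma_frontier: "\<gamma> s \<in> frontier \<Omega>"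
proof -
  obtain s' n where s': "s' \<in> {0..<L}" "s = s' + of_int n * L"
    using periodic_reduce [OF L_pos] by blast
  then have "\<gamma> s = \<gamma> s'" using periodic_int_multiple [of \<gamma> L s' n] gamma_periodic by simp
  moreover have "\<gamma> s' \<in> \<gamma> ` {0..L}" using s' by auto
  ultimately show ?thesis using gamma_image by simp
qed

lemma frontier_param:
  assumes "b \<in> frontier \<Omega>"
  obtains s where "s \<in> {0..<L}" "b = \<gamma> s"
proof -
  obtain s where s: "s \<in> {0..L}" "b = \<gamma> s" using assms [folded gamma_image] by blast
  show thesis
  proof (cases "s = L")
    case True
    then have "b = \<gamma> 0" using s gamma_periodic [of 0] by simp
    then show ?thesis using that [of 0] L_pos by simp
  next
    case False
    then show ?thesis using that [of s] s by simp
  qed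
qed

lemma closure_Omega: "closure \<Omega> = \<Omega> \<union> frontier \<Omega>" "\<Omega> \<inter> frontier \<Omega> = {}"
  using open_Omega closure_subset [of \<Omega>] by (auto simp: frontier_def interior_open)

text \<open>A slit domain would have frontier points interior to its closure; here the frontier is a
  Jordan curve. It is also the frontier of its outside, which \<open>\<Omega>\<close> does not meet,
  so every frontier point is a limit of points off the closure. This makes the bijection of the
  closures respect interiors.\<close>

lemma interior_closure_Omega: "interior (closure \<Omega>) \<subseteq> \<Omega>"
proof -
  let ?p = "\<lambda>t. \<gamma> (L * t)"
  have im: "path_image ?p = frontier \<Omega>"
  proof -
    have "(\<lambda>t. L * t) ` {0..1} = {0..L}"
      using L_pos by (simp add: image_mult_atLeastAtMost)
    then have "?p ` {0..1} = \<gamma> ` {0..L}" by (metis image_image)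
    then show ?thesis using gamma_image by (simp add: path_image_def)
  qed
  have "path ?p"
    unfolding path_def by (intro continuous_on_compose2 [OF continuous_gamma [of UNIV]] continuous_intros) auto
  moreover have "loop_free ?p"
    unfolding loop_free_def
  proof (intro ballI impI)
    fix x y :: real assume xy: "x \<in> {0..1}" "y \<in> {0..1}" "?p x = ?p y"
    have g0: "\<gamma> L = \<gamma> 0" using gamma_periodic [of 0] by simp
    have in1: "L * t \<in> {0..<L}" if "t \<in> {0..1}" "t \<noteq> 1" for t
      using that L_pos by (auto simp: mult_less_cancel_left2)
    have inj: "a = b" if "a \<in> {0..<L}" "b \<in> {0..<L}" "\<gamma> a = \<gamma> b" for a b
      using gamma_inj that by (auto dest: inj_onD)
    have zero: "(0::real) \<in> {0..<L}" using L_pos by simp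
    show "x = y \<or> x = 0 \<and> y = 1 \<or> x = 1 \<and> y = 0"
    proof (cases "x = 1"; cases "y = 1")
      assume "x = 1" "y \<noteq> 1"
      then have "0 = L * y" using xy g0 by (intro inj zero in1) auto
      then show ?thesis using L_pos \<open>x = 1\<close> by simp
    next
      assume "x \<noteq> 1" "y = 1"
      then have "L * x = 0" using xy g0 by (intro inj zero in1) auto
      then show ?thesis using L_pos \<open>y = 1\<close> by simp
    next
      assume "x \<noteq> 1" "y \<noteq> 1"
      then have "L * x = L * y" using xy by (intro inj in1) auto
      then show ?thesis using L_pos by simp
    qed simp
  qed
  ultimately have sp: "simple_path ?p" by (simp add: simple_path_def)
  have loop: "pathfinish ?p = pathstart ?p"
    using gamma_periodic [of 0] by (simp add: pathfinish_def pathstart_def)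
  note J = Jordan_inside_outside [OF sp loop, unfolded im]
  let ?O = "outside (frontier \<Omega>)"
  have disj: "\<Omega> \<inter> ?O = {}"
  proof (rule ccontr)
    assume ne: "\<Omega> \<inter> ?O \<noteq> {}"
    \<comment> \<open>The outside is connected and misses the frontier, so meeting
      \<open>\<Omega>\<close> would put all of it inside; but it is unbounded.\<close>
    have "?O \<subseteq> \<Omega>"
    proof (rule ccontr)
      assume "\<not> ?O \<subseteq> \<Omega>"
      then have "?O \<inter> frontier \<Omega> \<noteq> {}"
        using ne J by (intro connected_Int_frontier) auto
      then show False using outside_no_overlap by blast
    qed
    then show False using J bounded_Omega bounded_subset by blast
  qed
  show ?thesis
  proof
    fix z assume z: "z \<in> interior (closure \<Omega>)"
    show "z \<in> \<Omega>"
    proof (rule ccontr)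
      assume "z \<notin> \<Omega>"
      then have "z \<in> frontier \<Omega>" using z interior_subset closure_Omega by blast
      then have "z \<in> closure ?O" using J by (metis Diff_iff frontier_def)
      then obtain y where y: "y \<in> interior (closure \<Omega>)" "y \<in> ?O"
        using z open_Int_closure_eq_empty [of "interior (closure \<Omega>)" ?O] by auto
      then have "y \<in> \<Omega> \<or> y \<in> frontier \<Omega>" using interior_subset closure_Omega by blast
      then show False using y disj outside_no_overlap by blast
    qed
  qed
qed

lemma continuous_Psi: "continuous_on (closure \<Omega>) \<Psi>"
  using deriv_Psi by (meson DERIV_continuous continuous_on_eq_continuous_within)

lemma continuous_Phi: "continuous_on (cball 0 1) \<Phi>"
  using deriv_Phi by (meson DERIV_continuous continuous_on_eq_continuous_within)

lemma Psi_cball: "w \<in> closure \<Omega> \<Longrightarrow> \<Psi> w \<in> cball 0 1"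
  using bij_Phi Psi_Phi unfolding bij_betw_def by (metis image_iff)

lemma Phi_closure: "z \<in> cball 0 1 \<Longrightarrow> \<Phi> z \<in> closure \<Omega>"
  using bij_Phi unfolding bij_betw_def by blast

text \<open>Invariance of domain makes the image open, so it lies in the interior of the
  closure.\<close>

lemma Phi_ball: "z \<in> ball 0 1 \<Longrightarrow> \<Phi> z \<in> \<Omega>"
proof -
  have "open (\<Phi> ` ball 0 1)"
  proof (rule invariance_of_domain)
    show "continuous_on (ball 0 1) \<Phi>" by (rule continuous_on_subset [OF continuous_Phi]) auto
    show "inj_on \<Phi> (ball 0 1)" by (rule inj_on_inverseI [where g = \<Psi>]) (simp add: Psi_Phi)
  qed simp
  moreover have "\<Phi> ` ball 0 1 \<subseteq> closure \<Omega>" using Phi_closure by auto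
  ultimately have "\<Phi> ` ball 0 1 \<subseteq> interior (closure \<Omega>)" by (rule interior_maximal [rotated])
  then show "z \<in> ball 0 1 \<Longrightarrow> \<Phi> z \<in> \<Omega>" using interior_closure_Omega by blast
qed

lemma Psi_ball: "w \<in> \<Omega> \<Longrightarrow> \<Psi> w \<in> ball 0 1"
proof -
  have sub: "\<Omega> \<subseteq> closure \<Omega>" by (rule closure_subset)
  have "open (\<Psi> ` \<Omega>)"
  proof (rule invariance_of_domain)
    show "continuous_on \<Omega> \<Psi>" by (rule continuous_on_subset [OF continuous_Psi sub])
    show "inj_on \<Psi> \<Omega>" by (rule inj_on_inverseI [where g = \<Phi>]) (use Phi_Psi sub in blast)
  qed (rule open_Omega)
  moreover have "\<Psi> ` \<Omega> \<subseteq> cball 0 1" using Psi_cball sub by blast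
  ultimately have "\<Psi> ` \<Omega> \<subseteq> interior (cball 0 1)" by (rule interior_maximal [rotated])
  then show "w \<in> \<Omega> \<Longrightarrow> \<Psi> w \<in> ball 0 1" by (auto simp: interior_cball)
qed

lemma Psi_frontier: "b \<in> frontier \<Omega> \<Longrightarrow> cmod (\<Psi> b) = 1"
proof -
  assume b: "b \<in> frontier \<Omega>"
  then have bc: "b \<in> closure \<Omega>" by (simp add: frontier_def)
  have "\<Psi> b \<notin> ball 0 1"
  proof
    assume "\<Psi> b \<in> ball 0 1"
    then have "\<Phi> (\<Psi> b) \<in> \<Omega>" by (rule Phi_ball)
    then show False using Phi_Psi [OF bc] b closure_Omega(2) by auto
  qed
  then show ?thesis using Psi_cball [OF bc] by simp
qed

lemma Psi_deriv_at: "w \<in> \<Omega> \<Longrightarrow> (\<Psi> has_field_derivative \<Psi>' w) (at w)"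
proof -
  assume w: "w \<in> \<Omega>"
  have "(\<Psi> has_field_derivative \<Psi>' w) (at w within \<Omega>)"
    using deriv_Psi w closure_subset by (meson DERIV_subset subsetD)
  then show ?thesis by (simp only: at_within_open [OF w open_Omega])
qed

lemma Phi_deriv_at: "z \<in> ball 0 1 \<Longrightarrow> (\<Phi> has_field_derivative \<Phi>' z) (at z)"
proof -
  assume z: "z \<in> ball 0 1"
  have "(\<Phi> has_field_derivative \<Phi>' z) (at z within ball 0 1)"
    by (rule DERIV_subset [OF deriv_Phi]) (use z in auto)
  then show ?thesis by (simp only: at_within_open [OF z open_ball])
qed

lemma Psi'_Phi': "z \<in> cball 0 1 \<Longrightarrow> \<Psi>' (\<Phi> z) * \<Phi>' z = 1"
proof -
  assume z: "z \<in> cball 0 1"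
  have "(\<Psi> has_field_derivative \<Psi>' (\<Phi> z)) (at (\<Phi> z) within \<Phi> ` cball 0 1)"
    using deriv_Psi [OF Phi_closure [OF z]] bij_Phi by (simp add: bij_betw_def)
  then have "((\<Psi> \<circ> \<Phi>) has_field_derivative \<Psi>' (\<Phi> z) * \<Phi>' z) (at z within cball 0 1)"
    by (rule DERIV_image_chain) (rule deriv_Phi [OF z])
  then have "((\<lambda>x. x) has_field_derivative \<Psi>' (\<Phi> z) * \<Phi>' z) (at z within cball 0 1)"
    by (rule has_field_derivative_transform_within [OF _ zero_less_one z]) (simp add: Psi_Phi)
  \<comment> \<open>The quotient is constantly 1 off z. Its limit is unique because no point of the
    closed disc is isolated, so the chain rule yields the product 1 also at boundary points.\<close>
  then have 1: "((\<lambda>y. (y - z) / (y - z)) \<longlongrightarrow> \<Psi>' (\<Phi> z) * \<Phi>' z) (at z within cball 0 1)"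
    by (simp add: has_field_derivative_iff)
  have 2: "((\<lambda>y. (y - z) / (y - z)) \<longlongrightarrow> 1) (at z within cball 0 1)"
    by (rule tendsto_eventually) (auto simp: eventually_at_filter)
  have "z islimpt ball 0 1"
    using z by (simp add: islimpt_ball)
  then have "z islimpt cball 0 1"
    by (rule islimpt_subset) auto
  then have "at z within cball 0 1 \<noteq> bot" by (simp add: trivial_limit_within)
  then show ?thesis using tendsto_unique [OF _ 1 2] by simp
qed

text \<open>The logarithm is chosen continuous on the closed disc, since its values on the circle
  are what enters the formulas: Re H carries |\<Phi>'| and Im H its argument.\<close>

definition H :: "complex \<Rightarrow> complex" where
  "H = (SOME h. continuous_on (cball 0 1) h \<and> (\<forall>z\<in>cball 0 1. \<Phi>' z = exp (h z)))"

lemma H: "continuous_on (cball 0 1) H" "z \<in> cball 0 1 \<Longrightarrow> \<Phi>' z = exp (H z)"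
proof -
  have "\<exists>h. continuous_on (cball 0 1) h \<and> (\<forall>z\<in>cball 0 1. \<Phi>' z = exp (h z))"
    using continuous_logarithm_on_cball [OF cont_Phi' Phi'_nz] by metis
  then have "continuous_on (cball 0 1) H \<and> (\<forall>z\<in>cball 0 1. \<Phi>' z = exp (H z))"
    unfolding H_def by (rule someI_ex)
  then show "continuous_on (cball 0 1) H" "z \<in> cball 0 1 \<Longrightarrow> \<Phi>' z = exp (H z)" by auto
qed

lemma H_holomorphic: "H holomorphic_on ball 0 1"
proof -
  have "deriv \<Phi> holomorphic_on ball 0 1"
    by (rule holomorphic_deriv [OF holo_Phi]) simp
  then have hol: "\<Phi>' holomorphic_on ball 0 1"
    by (rule holomorphic_transform) (use Phi_deriv_at in \<open>auto dest: DERIV_imp_deriv\<close>)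
  show ?thesis
    unfolding holomorphic_on_def
  proof
    fix z assume z: "z \<in> ball (0::complex) 1"
    obtain D where "(\<Phi>' has_field_derivative D) (at z within ball 0 1)"
      using hol z unfolding holomorphic_on_def field_differentiable_def by blast
    then have "(\<Phi>' has_derivative (*) D) (at z within ball 0 1)"
      by (simp add: has_field_derivative_def)
    then have "(H has_derivative (\<lambda>h. D * h / \<Phi>' z)) (at z within ball 0 1)"
    proof (rule continuous_log_has_derivative [OF _ z])
      show "continuous (at z within ball 0 1) H"
        using H(1) z by (meson ball_subset_cball continuous_on_eq_continuous_within continuous_on_subset)
    qed (use H(2) in auto)
    moreover have "(\<lambda>h. D * h / \<Phi>' z) = (*) (D / \<Phi>' z)"
      by (simp add: fun_eq_iff)
    ultimately have "(H has_derivative (*) (D / \<Phi>' z)) (at z within ball 0 1)"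
      by (simp only:)
    then show "H field_differentiable at z within ball 0 1"
      by (auto simp: field_differentiable_def has_field_derivative_def)
  qed
qed

lemma Re_H: "z \<in> cball 0 1 \<Longrightarrow> Re (H z) = - ln (cmod (\<Psi>' (\<Phi> z)))"
proof -
  assume z: "z \<in> cball 0 1"
  have "cmod (\<Psi>' (\<Phi> z)) * exp (Re (H z)) = 1"
    using Psi'_Phi' [OF z] H(2) [OF z] by (metis norm_exp_eq_Re norm_mult norm_one)
  then have "cmod (\<Psi>' (\<Phi> z)) = exp (- Re (H z))"
    by (simp add: exp_minus field_simps)
  then show ?thesis by simp
qed

end

section \<open>Angle, tangent angle and curvature along the boundary\<close>

context conformal_parametrisation
begin

definition w :: "real \<Rightarrow> complex" where "w s = \<Psi> (\<gamma> s)"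

lemma gamma_closure: "\<gamma> s \<in> closure \<Omega>"
  using gamma_frontier [of s] by (simp add: frontier_def)

lemma norm_w [simp]: "cmod (w s) = 1"
  unfolding w_def by (rule Psi_frontier [OF gamma_frontier])

lemma Phi_w: "\<Phi> (w s) = \<gamma> s"
  unfolding w_def by (rule Phi_Psi [OF gamma_closure])

lemma w_periodic: "w (s + L) = w s"
  by (simp add: w_def gamma_periodic)

lemma w_deriv: "(w has_vector_derivative tangent_at \<gamma> s * \<Psi>' (\<gamma> s)) (at s)"
proof -
  have "(\<Psi> has_field_derivative \<Psi>' (\<gamma> s)) (at (\<gamma> s) within \<gamma> ` UNIV)"
    by (rule DERIV_subset [OF deriv_Psi [OF gamma_closure]]) (use gamma_closure in auto)
  then have "((\<Psi> \<circ> \<gamma>) has_vector_derivative tangent_at \<gamma> s * \<Psi>' (\<gamma> s)) (at s within UNIV)"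
    using field_vector_diff_chain_within [of \<gamma> "tangent_at \<gamma> s" s UNIV] gamma_deriv by simp
  moreover have "\<Psi> \<circ> \<gamma> = w" by (simp add: w_def fun_eq_iff)
  ultimately show ?thesis by simp
qed

lemma continuous_w: "continuous_on S w"
  using w_deriv by (meson continuous_at_imp_continuous_on has_vector_derivative_continuous)

lemma continuous_tangent: "continuous_on S (tangent_at \<gamma>)"
proof -
  obtain K where K: "\<And>s t. norm (tangent_at \<gamma> s - tangent_at \<gamma> t) \<le> K * \<bar>s - t\<bar>"
    using param unfolding C11_boundary_param_def by blast
  have "K-lipschitz_on UNIV (tangent_at \<gamma>)"
  proof (rule lipschitz_onI)
    show "0 \<le> K" using order_trans [OF norm_ge_zero K [of 0 1]] by simp
  qed (use K in \<open>simp add: dist_norm\<close>)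
  then show ?thesis using lipschitz_on_continuous_on continuous_on_subset by blast
qed

lemma Psi'_nz: "z \<in> closure \<Omega> \<Longrightarrow> \<Psi>' z \<noteq> 0"
  using Psi'_Phi' [OF Psi_cball, of z] Phi_Psi [of z] by auto

definition \<alpha> :: "real \<Rightarrow> real" where
  "\<alpha> = (SOME a. continuous_on UNIV a \<and> (\<forall>s. w s = cis (a s)))"

lemma alpha: "continuous_on UNIV \<alpha>" "w s = cis (\<alpha> s)"
proof -
  have "w s \<noteq> 0" for s using norm_w [of s] by (metis norm_zero zero_neq_one)
  then obtain g where g: "continuous_on UNIV g" "\<And>s. w s = exp (g s)"
    using continuous_logarithm_on_contractible [OF continuous_w [of UNIV]] convex_imp_contractible [OF convex_UNIV]
    by (metis UNIV_I)
  have "Re (g s) = 0" for s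
    using norm_w [of s] g(2) [of s] by (simp add: norm_exp_eq_Re)
  then have "g s = \<i> * of_real (Im (g s))" for s by (simp add: complex_eq_iff)
  then have "w s = cis (Im (g s))" for s using g(2) by (metis cis_conv_exp)
  then have "\<exists>a. continuous_on UNIV a \<and> (\<forall>s. w s = cis (a s))"
    using continuous_on_Im [OF g(1)] by blast
  then have "continuous_on UNIV \<alpha> \<and> (\<forall>s. w s = cis (\<alpha> s))"
    unfolding \<alpha>_def by (rule someI_ex)
  then show "continuous_on UNIV \<alpha>" "w s = cis (\<alpha> s)" by auto
qed

lemma continuous_alpha: "continuous_on S \<alpha>"
  using alpha(1) continuous_on_subset by blast

text \<open>The winding number is prescribed for \<open>\<gamma>\<close>, not for w. Write \<gamma>
  - \<Phi> 0 = w Q(w) with Q the difference quotient of \<Phi> at 0. By injectivity and \<Phi>' 0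
  \<noteq> 0, Q has no zero on the closed disc and so has a logarithm there; along the closed curve
  w it adds no winding. Hence w winds once around 0.\<close>

lemma alpha_winding: "\<alpha> L - \<alpha> 0 = 2 * pi"
proof -
  let ?p = "\<lambda>t. \<gamma> (L * t)"
  let ?z = "\<Phi> 0"
  have z: "?z \<in> \<Omega>" by (rule Phi_ball) simp
  have path: "path ?p"
    unfolding path_def by (intro continuous_on_compose2 [OF continuous_gamma [of UNIV]] continuous_intros) auto
  have "?z \<noteq> \<gamma> s" for s
    using gamma_frontier [of s] z closure_Omega(2) by auto
  then have nz: "?z \<notin> path_image ?p"
    by (auto simp: path_image_def)
  obtain q where q: "path q" "pathfinish q - pathstart q = 2 * of_real pi * \<i> * winding_number ?p ?z"
    "\<And>t. t \<in> {0..1} \<Longrightarrow> ?p t = ?z + exp (q t)"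
    by (rule winding_number_as_continuous_log [OF path nz]) blast
  define Q where "Q z = (if z = 0 then \<Phi>' 0 else (\<Phi> z - \<Phi> 0) / z)" for z
  have "continuous_on (cball 0 1) Q"
    unfolding continuous_on_eq_continuous_within
  proof
    fix z assume z: "z \<in> cball (0::complex) 1"
    show "continuous (at z within cball 0 1) Q"
    proof (cases "z = 0")
      case True
      have "((\<lambda>y. (\<Phi> y - \<Phi> 0) / (y - 0)) \<longlongrightarrow> \<Phi>' 0) (at 0 within cball 0 1)"
        using deriv_Phi [of 0] by (simp add: has_field_derivative_iff)
      then have "(Q \<longlongrightarrow> \<Phi>' 0) (at 0 within cball 0 1)"
        by (rule Lim_transform_eventually) (auto simp: Q_def eventually_at_filter)
      then show ?thesis using True by (simp add: continuous_within Q_def)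
    next
      case False
      have "continuous (at z within cball 0 1) (\<lambda>z. (\<Phi> z - \<Phi> 0) / z)"
        using continuous_Phi z False by (intro continuous_intros) (auto simp: continuous_on_eq_continuous_within)
      then have "((\<lambda>z. (\<Phi> z - \<Phi> 0) / z) \<longlongrightarrow> Q z) (at z within cball 0 1)"
        using False by (simp add: continuous_within Q_def)
      moreover have "\<forall>\<^sub>F y in at z within cball 0 1. y \<noteq> 0"
        by (rule tendsto_imp_eventually_ne [OF tendsto_ident_at False])
      then have "\<forall>\<^sub>F y in at z within cball 0 1. (\<Phi> y - \<Phi> 0) / y = Q y"
        by eventually_elim (simp add: Q_def)
      ultimately show ?thesis
        unfolding continuous_within by (rule Lim_transform_eventually)
    qed
  qed
  moreover have "Q z \<noteq> 0" if "z \<in> cball 0 1" for z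
    unfolding Q_def using Phi'_nz [of 0] Psi_Phi that by (auto) (metis Psi_Phi centre_in_cball mem_cball_0 that zero_le_one)
  ultimately obtain E where E: "continuous_on (cball 0 1) E" "\<And>z. z \<in> cball 0 1 \<Longrightarrow> Q z = exp (E z)"
    using continuous_logarithm_on_cball by blast
  have eq: "?p t - ?z = exp (\<i> * of_real (\<alpha> (L * t)) + E (w (L * t)))" for t
  proof -
    have "w (L * t) \<noteq> 0" using norm_w [of "L * t"] by (metis norm_zero zero_neq_one)
    then have "?p t - ?z = w (L * t) * Q (w (L * t))"
      by (simp add: Q_def Phi_w)
    also have "\<dots> = exp (\<i> * of_real (\<alpha> (L * t))) * exp (E (w (L * t)))"
      using E(2) [of "w (L * t)"] alpha(2) [of "L * t"] by (simp add: cis_conv_exp)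
    finally show ?thesis by (simp add: exp_add)
  qed
  let ?f = "\<lambda>t. q t - (\<i> * of_real (\<alpha> (L * t)) + E (w (L * t)))"
  have "?f 0 = ?f 1"
  proof (rule two_pi_integer_valued_constant [of "{0..1}" ?f])
    have c1: "continuous_on {0..1} (\<lambda>t. \<alpha> (L * t))"
      by (intro continuous_on_compose2 [OF continuous_alpha [of UNIV]] continuous_intros) auto
    have "continuous_on {0..1} (\<lambda>t. w (L * t))"
      by (intro continuous_on_compose2 [OF continuous_w [of UNIV]] continuous_intros) auto
    then have "continuous_on {0..1} (\<lambda>t. E (w (L * t)))"
      by (rule continuous_on_compose2 [OF E(1)]) auto
    then show "continuous_on {0..1} ?f"
      using q(1) c1 unfolding path_def by (intro continuous_intros)
    show "exp (?f t) = 1" if "t \<in> {0..1}" for t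
    proof -
      have "exp (q t) = ?p t - ?z" using q(3) [OF that] by simp
      then show ?thesis using eq [of t] by (simp add: exp_diff)
    qed
  qed auto
  moreover have "w L = w 0" using w_periodic [of 0] by simp
  ultimately have "q 1 - q 0 = \<i> * of_real (\<alpha> L) - \<i> * of_real (\<alpha> 0)"
    by (simp add: algebra_simps)
  moreover have "q 1 - q 0 = 2 * of_real pi * \<i>"
    using q(2) winding_gamma [OF z] by (simp add: pathfinish_def pathstart_def)
  ultimately have "\<i> * of_real (\<alpha> L - \<alpha> 0) = \<i> * of_real (2 * pi)"
    by (simp add: algebra_simps)
  then show ?thesis by (metis complex_i_not_zero mult_cancel_left of_real_eq_iff)
qed

lemma alpha_periodic: "\<alpha> (s + L) = \<alpha> s + 2 * pi"
proof -
  let ?f = "\<lambda>s. \<i> * of_real (\<alpha> (s + L) - \<alpha> s)"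
  have "?f s = ?f 0"
  proof (rule two_pi_integer_valued_constant [of UNIV ?f])
    show "continuous_on UNIV ?f"
      by (intro continuous_intros continuous_on_compose2 [OF continuous_alpha [of UNIV]]) (auto intro: continuous_alpha)
    show "exp (?f x) = 1" for x
    proof -
      have "exp (?f x) = cis (\<alpha> (x + L)) / cis (\<alpha> x)"
        by (simp add: cis_conv_exp exp_diff algebra_simps)
      also have "\<dots> = 1"
        using w_periodic [of x] alpha(2) [of x] alpha(2) [of "x + L"] by simp
      finally show ?thesis .
    qed
  qed auto
  then have "\<alpha> (s + L) - \<alpha> s = \<alpha> (0 + L) - \<alpha> 0"
    by (metis complex_i_not_zero mult_cancel_left of_real_eq_iff)
  then show ?thesis using alpha_winding by simp
qed

lemma alpha_has_derivative_aux:
  "(\<alpha> has_real_derivative Im (tangent_at \<gamma> s * \<Psi>' (\<gamma> s) / w s)) (at s)"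
  "Re (tangent_at \<gamma> s * \<Psi>' (\<gamma> s) / w s) = 0"
proof -
  let ?d = "tangent_at \<gamma> s * \<Psi>' (\<gamma> s)"
  have "((\<lambda>s. \<i> * of_real (\<alpha> s)) has_derivative (\<lambda>h. h *\<^sub>R ?d / w s)) (at s within UNIV)"
  proof (rule continuous_log_has_derivative)
    show "(w has_derivative (\<lambda>h. h *\<^sub>R ?d)) (at s within UNIV)"
      using w_deriv [of s] by (simp add: has_vector_derivative_def)
    have "continuous_on UNIV (\<lambda>s. \<i> * complex_of_real (\<alpha> s))"
      by (intro continuous_intros continuous_alpha)
    then show "continuous (at s within UNIV) (\<lambda>s. \<i> * complex_of_real (\<alpha> s))"
      by (simp add: continuous_on_eq_continuous_within)
    show "w y = exp (\<i> * of_real (\<alpha> y))" for y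
      using alpha(2) by (simp add: cis_conv_exp)
  qed simp
  then have 1: "((\<lambda>s. \<i> * of_real (\<alpha> s)) has_vector_derivative ?d / w s) (at s)"
    by (simp add: has_vector_derivative_def scaleR_conv_of_real)
  then have "((\<lambda>s. Im (\<i> * of_real (\<alpha> s))) has_vector_derivative Im (?d / w s)) (at s)"
    by (rule bounded_linear.has_vector_derivative [OF bounded_linear_Im])
  then show "(\<alpha> has_real_derivative Im (?d / w s)) (at s)"
    by (simp add: has_real_derivative_iff_has_vector_derivative)
  have "((\<lambda>s. Re (\<i> * of_real (\<alpha> s))) has_vector_derivative Re (?d / w s)) (at s)"
    using 1 by (rule bounded_linear.has_vector_derivative [OF bounded_linear_Re])
  then have "((\<lambda>s. 0::real) has_vector_derivative Re (?d / w s)) (at s)" by simp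
  then show "Re (?d / w s) = 0"
    using vector_derivative_unique_at has_vector_derivative_const by blast
qed

definition \<alpha>' :: "real \<Rightarrow> real" where "\<alpha>' s = cmod (\<Psi>' (\<gamma> s))"

lemma alpha'_pos: "\<alpha>' s > 0"
  unfolding \<alpha>'_def using Psi'_nz [OF gamma_closure] by simp

lemma continuous_alpha': "continuous_on S \<alpha>'"
  unfolding \<alpha>'_def
  by (intro continuous_intros continuous_on_compose2 [OF cont_Psi'] continuous_gamma) (use gamma_closure in auto)

text \<open>As |w| = 1, the velocity of w is \<i> D w with D real, and |D| = |\<Psi>'| because the
  tangent is a unit vector. D never vanishes, so its sign is constant, and a negative sign would
  contradict the increase of \<open>\<alpha>\<close> by 2 pi over a period.\<close>

lemma alpha_deriv: "(\<alpha> has_real_derivative \<alpha>' s) (at s)"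
  and w_velocity: "tangent_at \<gamma> s * \<Psi>' (\<gamma> s) = \<i> * of_real (\<alpha>' s) * w s"
proof -
  define D where "D s = Im (tangent_at \<gamma> s * \<Psi>' (\<gamma> s) / w s)" for s
  have wn: "w s \<noteq> 0" for s using norm_w [of s] by (metis norm_zero zero_neq_one)
  have eq: "tangent_at \<gamma> s * \<Psi>' (\<gamma> s) / w s = \<i> * of_real (D s)" for s
    using alpha_has_derivative_aux(2) [of s] by (simp add: complex_eq_iff D_def)
  have absD: "\<bar>D s\<bar> = \<alpha>' s" for s
  proof -
    have "\<bar>D s\<bar> = cmod (\<i> * of_real (D s))" by (simp add: norm_mult)
    also have "\<dots> = \<alpha>' s"
      unfolding eq [symmetric] by (simp add: norm_mult norm_divide norm_tangent \<alpha>'_def)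
    finally show ?thesis .
  qed
  have derD: "(\<alpha> has_real_derivative D s) (at s)" for s
    unfolding D_def by (rule alpha_has_derivative_aux(1))
  have contD: "continuous_on UNIV D"
    unfolding D_def
    by (intro continuous_intros continuous_tangent continuous_w continuous_on_compose2 [OF cont_Psi'] continuous_gamma)
      (use gamma_closure wn in auto)
  have "D s > 0" for s
  proof (rule ccontr)
    assume "\<not> D s > 0"
    have neg: "D t < 0" for t
    proof (rule ccontr)
      assume "\<not> D t < 0"
      have "connected (range D)" using contD by (intro connected_continuous_image) auto
      then have "0 \<in> range D"
        using \<open>\<not> D s > 0\<close> \<open>\<not> D t < 0\<close> unfolding connected_iff_interval by (meson not_less rangeI)
      then obtain x where "D x = 0" by auto
      then show False using absD [of x] alpha'_pos [of x] by simp
    qed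
    have "\<alpha> L < \<alpha> 0"
      by (rule DERIV_neg_imp_decreasing [OF L_pos]) (use derD neg in blast)
    then show False using alpha_winding pi_gt_zero by linarith
  qed
  then have D: "D s = \<alpha>' s" for s using absD [of s] by (metis abs_of_pos)
  show "(\<alpha> has_real_derivative \<alpha>' s) (at s)" using derD D by simp
  show "tangent_at \<gamma> s * \<Psi>' (\<gamma> s) = \<i> * of_real (\<alpha>' s) * w s"
    using eq [of s] D wn [of s] by (simp add: field_simps)
qed

lemma alpha_strict_mono: "s < t \<Longrightarrow> \<alpha> s < \<alpha> t"
  using alpha_deriv alpha'_pos by (intro DERIV_pos_imp_increasing [of s t \<alpha>]) auto

text \<open>The angle of the tangent: differentiating \<gamma> = \<Phi>(w) gives \<i> \<alpha>' w
  \<Phi>'(w), whose argument is this sum. Its increment over a period is that of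
  \<open>\<alpha>\<close>, which yields the total curvature 2 pi.\<close>

definition \<theta> :: "real \<Rightarrow> real" where "\<theta> s = \<alpha> s + pi / 2 + Im (H (w s))"

lemma continuous_H_w: "continuous_on S (\<lambda>s. H (w s))"
  by (rule continuous_on_compose2 [OF H(1) continuous_w]) auto

lemma continuous_theta: "continuous_on S \<theta>"
  unfolding \<theta>_def by (intro continuous_intros continuous_alpha continuous_H_w)

lemma theta_periodic: "\<theta> (s + L) = \<theta> s + 2 * pi"
  by (simp add: \<theta>_def alpha_periodic w_periodic)

lemma tangent_eq: "tangent_at \<gamma> s = cis (\<theta> s)"
proof -
  have 1: "\<Psi>' (\<gamma> s) * exp (H (w s)) = 1"
    using Psi'_Phi' [of "w s"] H(2) [of "w s"] by (simp add: Phi_w)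
  have "tangent_at \<gamma> s = tangent_at \<gamma> s * (\<Psi>' (\<gamma> s) * exp (H (w s)))"
    using 1 by simp
  also have "\<dots> = \<i> * of_real (\<alpha>' s) * w s * exp (H (w s))"
    using w_velocity [of s] by (simp add: mult.assoc)
  finally have 2: "tangent_at \<gamma> s = \<i> * of_real (\<alpha>' s) * w s * exp (H (w s))" .
  have "exp (H (w s)) = of_real (exp (Re (H (w s)))) * cis (Im (H (w s)))"
    by (simp add: exp_eq_polar)
  moreover have "\<alpha>' s * exp (Re (H (w s))) = 1"
    using 1 unfolding \<alpha>'_def by (metis norm_exp_eq_Re norm_mult norm_one)
  then have "complex_of_real (\<alpha>' s) * of_real (exp (Re (H (w s)))) = 1"
    by (metis of_real_1 of_real_mult)
  ultimately have "tangent_at \<gamma> s = \<i> * w s * cis (Im (H (w s)))"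
    using 2 by (simp add: mult_ac)
  also have "\<dots> = cis (pi / 2) * cis (\<alpha> s) * cis (Im (H (w s)))"
    by (simp add: alpha(2))
  also have "\<dots> = cis (\<theta> s)"
    by (simp only: cis_mult \<theta>_def add_ac)
  finally show ?thesis .
qed

text \<open>Only cis \<theta> is known to be Lipschitz, and chords control angles only while these
  differ by at most pi. On short intervals that holds by uniform continuity; longer ones are
  bisected, and the bounds of the halves add up with the same constant.\<close>

lemma theta_lipschitz:
  obtains K where "K \<ge> 0" "\<And>s t. \<bar>\<theta> s - \<theta> t\<bar> \<le> K * \<bar>s - t\<bar>"
proof -
  obtain K where K: "\<And>s t. norm (tangent_at \<gamma> s - tangent_at \<gamma> t) \<le> K * \<bar>s - t\<bar>"
    using param unfolding C11_boundary_param_def by blast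
  have K0: "0 \<le> K" using order_trans [OF norm_ge_zero K [of 0 1]] by simp
  define C where "C = pi / 2 * K"
  have C0: "C \<ge> 0" using K0 by (simp add: C_def)
  have local: "\<bar>\<theta> s - \<theta> t\<bar> \<le> C * \<bar>s - t\<bar>" if "\<bar>\<theta> s - \<theta> t\<bar> \<le> pi" for s t
  proof -
    have "2 / pi * \<bar>\<theta> s - \<theta> t\<bar> \<le> cmod (cis (\<theta> s - \<theta> t) - 1)"
      by (rule cis_minus_one_lower_bound [OF that])
    also have "\<dots> = cmod (cis (\<theta> t) * (cis (\<theta> s - \<theta> t) - 1))" by (simp add: norm_mult)
    also have "cis (\<theta> t) * (cis (\<theta> s - \<theta> t) - 1) = cis (\<theta> s) - cis (\<theta> t)"
      by (simp add: algebra_simps cis_mult)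
    also have "cmod (cis (\<theta> s) - cis (\<theta> t)) \<le> K * \<bar>s - t\<bar>"
      using K [of s t] by (simp add: tangent_eq)
    finally show ?thesis by (simp add: C_def field_simps)
  qed
  \<comment> \<open>Uniform continuity on one period makes the chord estimate applicable at a fixed scale.\<close>
  have "uniformly_continuous_on {0..2*L} \<theta>"
    by (intro compact_uniformly_continuous continuous_theta) auto
  then obtain d where d: "d > 0" "\<And>s t. s \<in> {0..2*L} \<Longrightarrow> t \<in> {0..2*L} \<Longrightarrow> dist t s < d \<Longrightarrow> dist (\<theta> t) (\<theta> s) < pi"
    unfolding uniformly_continuous_on_def using pi_gt_zero by metis
  \<comment> \<open>The bound e \<le> L keeps the second point inside [0, 2 L] once the first has
    been moved into [0, L).\<close>
  define e where "e = min d L"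
  have e: "e > 0" "e \<le> d" "e \<le> L" using d L_pos by (auto simp: e_def)
  have near: "\<bar>\<theta> s - \<theta> t\<bar> \<le> C * \<bar>s - t\<bar>" if st: "s \<le> t" "t - s < e" for s t
  proof (rule local)
    obtain s' n where s': "s' \<in> {0..<L}" "s = s' + of_int n * L"
      using periodic_reduce [OF L_pos] by blast
    define t' where "t' = t - of_int n * L"
    have per: "\<theta> (x + of_int n * L) - \<theta> x = of_int n * (2 * pi)" for x
    proof -
      \<comment> \<open>Subtracting the linear growth 2 pi s / L leaves a periodic function.\<close>
      have "(\<lambda>s. \<theta> s - 2 * pi * s / L) (x + of_int n * L) = (\<lambda>s. \<theta> s - 2 * pi * s / L) x"
        by (rule periodic_int_multiple) (use L_pos in \<open>simp add: theta_periodic field_simps\<close>)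
      moreover have "2 * pi * (x + of_int n * L) / L = 2 * pi * x / L + of_int n * (2 * pi)"
        using L_pos by (simp add: field_simps)
      ultimately show ?thesis by simp
    qed
    have "dist (\<theta> t') (\<theta> s') < pi"
      using s' st e by (intro d) (auto simp: t'_def dist_real_def)
    moreover have "\<theta> s - \<theta> t = \<theta> s' - \<theta> t'"
      using per [of s'] per [of t'] s' by (simp add: t'_def)
    ultimately show "\<bar>\<theta> s - \<theta> t\<bar> \<le> pi" by (simp add: dist_real_def abs_minus_commute)
  qed
  \<comment> \<open>Each bisection doubles the admissible length, so n of them reach 2^n e.\<close>
  have far: "\<bar>\<theta> s - \<theta> t\<bar> \<le> C * \<bar>s - t\<bar>" if "s \<le> t" "t - s < 2 ^ n * e" for s t and n :: nat
    using that
  proof (induction n arbitrary: s t)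
    case 0
    then show ?case using near by simp
  next
    case (Suc n)
    define m where "m = (s + t) / 2"
    have "\<bar>\<theta> s - \<theta> m\<bar> \<le> C * \<bar>s - m\<bar>" "\<bar>\<theta> m - \<theta> t\<bar> \<le> C * \<bar>m - t\<bar>"
      using Suc.prems by (intro Suc.IH; simp add: m_def field_simps)+
    then have "\<bar>\<theta> s - \<theta> t\<bar> \<le> C * \<bar>s - m\<bar> + C * \<bar>m - t\<bar>" by linarith
    also have "\<dots> = C * \<bar>s - t\<bar>"
      using Suc.prems by (simp add: m_def abs_if field_simps)
    finally show ?case .
  qed
  have all: "\<bar>\<theta> s - \<theta> t\<bar> \<le> C * \<bar>s - t\<bar>" if st: "s \<le> t" for s t
  proof -
    obtain n :: nat where "(t - s) / e < 2 ^ n"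
      using real_arch_pow [of 2 "(t - s) / e"] by auto
    then have "t - s < 2 ^ n * e" using e by (simp add: field_simps)
    then show ?thesis using far st by blast
  qed
  have "\<bar>\<theta> s - \<theta> t\<bar> \<le> C * \<bar>s - t\<bar>" for s t
    using all [of s t] all [of t s] by (cases "s \<le> t") (auto simp: abs_minus_commute)
  then show thesis using that C0 by blast
qed

lemma theta_deriv_curvature:
  assumes "(\<theta> has_real_derivative D) (at s)"
  shows "curvature_at \<gamma> s = D"
proof -
  have "((\<lambda>s. \<i> * complex_of_real (\<theta> s)) has_vector_derivative \<i> * of_real D) (at s)"
    by (intro has_vector_derivative_mult_right has_vector_derivative_of_real)
       (use assms in \<open>simp add: has_real_derivative_iff_has_vector_derivative\<close>)
  then have "((exp \<circ> (\<lambda>s. \<i> * complex_of_real (\<theta> s))) has_vector_derivative (\<i> * of_real D) * exp (\<i> * of_real (\<theta> s))) (at s)"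
    by (rule field_vector_diff_chain_at) (rule DERIV_exp)
  moreover have "exp \<circ> (\<lambda>s. \<i> * complex_of_real (\<theta> s)) = tangent_at \<gamma>"
    by (simp add: fun_eq_iff tangent_eq cis_conv_exp)
  ultimately have "vector_derivative (tangent_at \<gamma>) (at s) = (\<i> * of_real D) * tangent_at \<gamma> s"
    by (simp add: vector_derivative_at tangent_eq cis_conv_exp)
  then have "cnj (tangent_at \<gamma> s) * vector_derivative (tangent_at \<gamma>) (at s) = \<i> * of_real D * (cnj (tangent_at \<gamma> s) * tangent_at \<gamma> s)"
    by (simp add: mult_ac)
  also have "cnj (tangent_at \<gamma> s) * tangent_at \<gamma> s = 1"
    using complex_norm_square [of "tangent_at \<gamma> s"] norm_tangent [of s] by (simp add: mult.commute)
  finally show ?thesis by (simp add: curvature_at_def)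
qed

lemma theta_AE_deriv:
  obtains N where "negligible N" "\<And>s. s \<notin> N \<Longrightarrow> (\<theta> has_real_derivative curvature_at \<gamma> s) (at s)"
proof -
  obtain K where K: "K \<ge> 0" "\<And>s t. \<bar>\<theta> s - \<theta> t\<bar> \<le> K * \<bar>s - t\<bar>" using theta_lipschitz by blast
  obtain N where N: "negligible N" "\<And>s. s \<notin> N \<Longrightarrow> \<theta> differentiable (at s)"
    using lipschitz_differentiable_AE [OF K(2)] by blast
  show thesis
  proof
    show "(\<theta> has_real_derivative curvature_at \<gamma> s) (at s)" if s: "s \<notin> N" for s
    proof -
      obtain D where "(\<theta> has_real_derivative D) (at s)"
        using N(2) [OF s] by (metis DERIV_deriv_iff_real_differentiable)
      then show ?thesis using theta_deriv_curvature by simp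
    qed
  qed (fact N)
qed

lemma curvature_has_integral:
  assumes "s \<le> t"
  shows "(curvature_at \<gamma> has_integral (\<theta> t - \<theta> s)) {s..t}"
proof -
  obtain K where K: "K \<ge> 0" "\<And>s t. \<bar>\<theta> s - \<theta> t\<bar> \<le> K * \<bar>s - t\<bar>" using theta_lipschitz by blast
  obtain N where N: "negligible N" "\<And>s. s \<notin> N \<Longrightarrow> (\<theta> has_real_derivative curvature_at \<gamma> s) (at s)"
    using theta_AE_deriv by blast
  show ?thesis
    by (rule lipschitz_fundamental_theorem [OF K(2) N(1) assms]) (use N(2) in auto)
qed

end

section \<open>The canonical phase and its harmonic extension\<close>

text \<open>1 - cis (2 v) = 2 sin v cis (v - pi / 2) with sin v > 0. As u increases through a
  multiple of 2 pi the value falls from pi / 2 to - pi / 2; this drop produces the jump of the phase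
  at a singular point.\<close>

lemma Im_Ln_one_minus_cis:
  assumes "0 < u" "u < 2 * pi"
  shows "Im (Ln (1 - cis u)) = u / 2 - pi / 2"
proof -
  define v where "v = u / 2"
  have v: "0 < v" "v < pi" using assms by (auto simp: v_def)
  have s: "sin v > 0" using v sin_gt_zero by auto
  have "1 - cis (2 * v) = of_real (2 * sin v) * cis (v - pi / 2)"
    by (auto simp: complex_eq_iff cos_diff sin_diff cos_double_sin sin_double power2_eq_square)
  also have "\<dots> = exp (of_real (ln (2 * sin v)) + \<i> * of_real (v - pi / 2))"
    unfolding exp_add cis_conv_exp exp_of_real using s by simp
  finally have "Ln (1 - cis (2 * v)) = of_real (ln (2 * sin v)) + \<i> * of_real (v - pi / 2)"
    using v by (auto intro!: Ln_exp)
  then show ?thesis by (simp add: v_def)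
qed

lemma Re_one_minus_pos:
  assumes "cmod z \<le> 1" "z \<noteq> 1"
  shows "Re (1 - z) > 0"
proof (rule ccontr)
  assume "\<not> Re (1 - z) > 0"
  then have "Re z \<ge> 1" by simp
  moreover have "Re z \<le> cmod z" by (rule complex_Re_le_cmod)
  ultimately have "Re z = 1" "cmod z = 1" using assms(1) by linarith+
  then have "Im z = 0" using cmod_power2 [of z] by simp
  then show False using \<open>Re z = 1\<close> assms(2) by (simp add: complex_eq_iff)
qed

locale conformal_config = conformal_parametrisation +
  fixes N :: nat and a :: "nat \<Rightarrow> complex" and d :: "nat \<Rightarrow> int"
  assumes config: "admissible_config \<Omega> N a d"
begin

lemma a_inj: "inj_on a {..<N}"
  and a_frontier: "j < N \<Longrightarrow> a j \<in> frontier \<Omega>"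
  and d_cases: "j < N \<Longrightarrow> d j = 1 \<or> d j = - 1"
  and d_sum: "(\<Sum>j<N. d j) = 2"
  using config by (auto simp: admissible_config_def)

lemma d_sum_real: "(\<Sum>j<N. real_of_int (d j)) = 2"
  using arg_cong [OF d_sum, of real_of_int] by simp

definition \<sigma> :: "nat \<Rightarrow> real" where "\<sigma> j = (SOME s. s \<in> {0..<L} \<and> \<gamma> s = a j)"

lemma sigma: "j < N \<Longrightarrow> \<sigma> j \<in> {0..<L}" "j < N \<Longrightarrow> \<gamma> (\<sigma> j) = a j"
proof -
  assume "j < N"
  then obtain s where "s \<in> {0..<L}" "a j = \<gamma> s" using frontier_param [OF a_frontier] by blast
  then have "\<exists>s. s \<in> {0..<L} \<and> \<gamma> s = a j" by auto
  then have "\<sigma> j \<in> {0..<L} \<and> \<gamma> (\<sigma> j) = a j"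
    unfolding \<sigma>_def by (rule someI_ex)
  then show "\<sigma> j \<in> {0..<L}" "\<gamma> (\<sigma> j) = a j" by auto
qed

lemma gamma_eq_a_iff: "j < N \<Longrightarrow> s \<in> {0..<L} \<Longrightarrow> \<gamma> s = a j \<longleftrightarrow> s = \<sigma> j"
  using sigma [of j] inj_onD [OF gamma_inj, of s "\<sigma> j"] by auto

definition b :: "nat \<Rightarrow> complex" where "b j = \<Psi> (a j)"

lemma norm_b: "j < N \<Longrightarrow> cmod (b j) = 1"
  unfolding b_def using Psi_frontier a_frontier by blast

lemma b_nz: "j < N \<Longrightarrow> b j \<noteq> 0"
  using norm_b by force

lemma a_closure: "j < N \<Longrightarrow> a j \<in> closure \<Omega>"
  using a_frontier by (simp add: frontier_def)

lemma b_eq_w: "j < N \<Longrightarrow> b j = w (\<sigma> j)"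
  by (simp add: b_def w_def sigma)

lemma Psi_eq_b_iff: "j < N \<Longrightarrow> z \<in> closure \<Omega> \<Longrightarrow> \<Psi> z = b j \<longleftrightarrow> z = a j"
  unfolding b_def using Phi_Psi a_closure by metis

lemma b_inj: "inj_on b {..<N}"
proof (rule inj_onI)
  fix j k assume jk: "j \<in> {..<N}" "k \<in> {..<N}" "b j = b k"
  then have "a j = a k" unfolding b_def by (metis Phi_Psi a_closure lessThan_iff)
  then show "j = k" using a_inj jk by (auto dest: inj_onD)
qed

text \<open>On the circle the imaginary part of each logarithm is half the boundary angle up to a
  constant, with a drop by pi at b j. Weighted by degrees of sum 2 these give
  \<open>\<alpha>\<close> once, and Im H completes it to the tangent angle, so Im G has the boundary
  values of the phase up to a constant. Every factor has positive real part in the disc, so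
  principal logarithms can be used.\<close>

definition G :: "complex \<Rightarrow> complex" where
  "G z = (\<Sum>j<N. of_int (d j) * Ln (1 - z / b j)) + H z"

definition G' :: "complex \<Rightarrow> complex" where
  "G' z = (\<Sum>j<N. of_int (d j) / (z - b j)) + deriv H z"

lemma one_minus_pos:
  assumes "j < N" "z \<in> cball 0 1" "z \<noteq> b j"
  shows "Re (1 - z / b j) > 0"
  using assms norm_b [of j] b_nz [of j]
  by (intro Re_one_minus_pos) (auto simp: norm_divide divide_eq_1_iff)

lemma not_nonpos:
  assumes "j < N" "z \<in> cball 0 1" "z \<noteq> b j"
  shows "1 - z / b j \<notin> \<real>\<^sub>\<le>\<^sub>0"
  using one_minus_pos [OF assms] by (auto simp: complex_nonpos_Reals_iff)

lemma ball_ne_b: "j < N \<Longrightarrow> z \<in> ball 0 1 \<Longrightarrow> z \<noteq> b j"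
  using norm_b by force

lemma Ln_factor_deriv:
  assumes "j < N" "z \<in> ball 0 1"
  shows "((\<lambda>z. Ln (1 - z / b j)) has_field_derivative 1 / (z - b j)) (at z)"
proof -
  have n: "1 - z / b j \<notin> \<real>\<^sub>\<le>\<^sub>0" using assms by (intro not_nonpos ball_ne_b) auto
  have ne: "z - b j \<noteq> 0" "b j \<noteq> 0" using assms ball_ne_b b_nz by auto
  then have e: "- (1 / b j) / (1 - z / b j) = 1 / (z - b j)"
    by (simp add: divide_simps)
  have "((\<lambda>z. Ln (1 - z / b j)) has_field_derivative (- (1 / b j)) / (1 - z / b j)) (at z)"
    using n ne(2) by (auto intro!: derivative_eq_intros simp: field_simps)
  then show ?thesis unfolding e .
qed

lemma G_deriv: "z \<in> ball 0 1 \<Longrightarrow> (G has_field_derivative G' z) (at z)"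
proof -
  assume z: "z \<in> ball 0 1"
  have "(H has_field_derivative deriv H z) (at z)"
    using holomorphic_derivI [OF H_holomorphic _ z] by simp
  moreover have "((\<lambda>z. \<Sum>j<N. of_int (d j) * Ln (1 - z / b j)) has_field_derivative (\<Sum>j<N. of_int (d j) * (1 / (z - b j)))) (at z)"
    by (intro DERIV_sum DERIV_cmult Ln_factor_deriv) (use z in auto)
  ultimately show ?thesis
    unfolding G_def [abs_def] G'_def by (auto intro: DERIV_add)
qed

lemma GPsi_deriv: "z \<in> \<Omega> \<Longrightarrow> ((\<lambda>z. G (\<Psi> z)) has_field_derivative G' (\<Psi> z) * \<Psi>' z) (at z)"
  by (rule DERIV_chain2 [OF G_deriv [OF Psi_ball] Psi_deriv_at])

lemma GPsi_holomorphic: "(\<lambda>z. G (\<Psi> z)) holomorphic_on \<Omega>"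
  using GPsi_deriv by (meson field_differentiable_at_within field_differentiable_def holomorphic_on_def)

lemma continuous_GPsi: "continuous_on (closure \<Omega> - a ` {..<N}) (\<lambda>z. G (\<Psi> z))"
proof -
  have P: "continuous_on (closure \<Omega> - a ` {..<N}) \<Psi>"
    by (rule continuous_on_subset [OF continuous_Psi]) auto
  have "1 - \<Psi> z / b j \<notin> \<real>\<^sub>\<le>\<^sub>0" if "z \<in> closure \<Omega> - a ` {..<N}" "j < N" for z j
    using that Psi_cball Psi_eq_b_iff by (intro not_nonpos) auto
  then show ?thesis
    unfolding G_def using b_nz
    by (intro continuous_intros P continuous_on_compose2 [OF H(1) P]) (use Psi_cball in auto)
qed

text \<open>The additive constant that matches Im G with the tangent angle: the logarithms
  contribute - pi and minus half the weighted angles of the singular points, while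
  \<open>\<theta>\<close> contains pi / 2; compensating both leaves 3 pi / 2.\<close>

definition c0 :: real where "c0 = (\<Sum>j<N. real_of_int (d j) * \<alpha> (\<sigma> j)) / 2 + 3 * pi / 2"

definition \<phi>0 :: "complex \<Rightarrow> real" where "\<phi>0 z = Im (G (\<Psi> z)) + c0"

text \<open>The principal branch needs an angle difference in (0, 2 pi). Before \<sigma> j the
  difference is negative and is raised by 2 pi, half of which appears in the result.\<close>

lemma Im_factor_w:
  assumes j: "j < N" and s: "s \<in> {0..<L}" "s \<noteq> \<sigma> j"
  shows "Im (Ln (1 - w s / b j)) = (\<alpha> s - \<alpha> (\<sigma> j)) / 2 - pi / 2 + (if s < \<sigma> j then pi else 0)"
proof -
  have q: "w s / b j = cis (\<alpha> s - \<alpha> (\<sigma> j))"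
    using alpha(2) by (simp add: b_eq_w j cis_divide)
  have sj: "\<sigma> j \<in> {0..<L}" using sigma j by blast
  show ?thesis
  proof (cases "s < \<sigma> j")
    case True
    have 1: "\<alpha> s < \<alpha> (\<sigma> j)" using True by (rule alpha_strict_mono)
    have "\<alpha> (\<sigma> j) < \<alpha> (s + L)" by (rule alpha_strict_mono) (use s sj in auto)
    then have 2: "\<alpha> (\<sigma> j) < \<alpha> s + 2 * pi" by (simp add: alpha_periodic)
    have "cis (\<alpha> s - \<alpha> (\<sigma> j)) = cis (\<alpha> s - \<alpha> (\<sigma> j) + 2 * pi)"
      by (simp add: cis.ctr)
    then have "Im (Ln (1 - w s / b j)) = (\<alpha> s - \<alpha> (\<sigma> j) + 2 * pi) / 2 - pi / 2"
      unfolding q using Im_Ln_one_minus_cis [of "\<alpha> s - \<alpha> (\<sigma> j) + 2 * pi"] 1 2 by simp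
    then show ?thesis using True by (simp add: field_simps)
  next
    case False
    then have "\<sigma> j < s" using s by simp
    then have 1: "\<alpha> (\<sigma> j) < \<alpha> s" by (rule alpha_strict_mono)
    have "\<alpha> s < \<alpha> (\<sigma> j + L)" by (rule alpha_strict_mono) (use s sj in auto)
    then have 2: "\<alpha> s < \<alpha> (\<sigma> j) + 2 * pi" by (simp add: alpha_periodic)
    show ?thesis
      unfolding q using Im_Ln_one_minus_cis [of "\<alpha> s - \<alpha> (\<sigma> j)"] 1 2 False by simp
  qed
qed

text \<open>The phase is the tangent angle plus pi times the degrees still ahead on [0, L); passing
  \<sigma> j lowers it by pi d j, as the jump condition demands.\<close>

lemma phi0_gamma:
  assumes s: "s \<in> {0..<L}" "\<gamma> s \<notin> a ` {..<N}"
  shows "\<phi>0 (\<gamma> s) = \<theta> s + pi * (\<Sum>j\<in>{j. j < N \<and> s < \<sigma> j}. real_of_int (d j))"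
proof -
  have ne: "s \<noteq> \<sigma> j" if "j < N" for j using s sigma(2) [OF that] that by auto
  have "Im (G (w s)) = (\<Sum>j<N. real_of_int (d j) * Im (Ln (1 - w s / b j))) + Im (H (w s))"
    by (simp add: G_def)
  also have "(\<Sum>j<N. real_of_int (d j) * Im (Ln (1 - w s / b j)))
      = (\<Sum>j<N. real_of_int (d j) * (\<alpha> s / 2 - pi / 2) - real_of_int (d j) * \<alpha> (\<sigma> j) / 2 + (if s < \<sigma> j then pi * real_of_int (d j) else 0))"
    by (rule sum.cong) (use s(1) ne in \<open>auto simp: Im_factor_w algebra_simps add_divide_distrib diff_divide_distrib\<close>)
  also have "\<dots> = (\<Sum>j<N. real_of_int (d j)) * (\<alpha> s / 2 - pi / 2) - (\<Sum>j<N. real_of_int (d j) * \<alpha> (\<sigma> j)) / 2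
      + (\<Sum>j<N. if s < \<sigma> j then pi * real_of_int (d j) else 0)"
    by (simp add: sum.distrib sum_subtractf sum_distrib_right sum_divide_distrib)
  also have "(\<Sum>j<N. if s < \<sigma> j then pi * real_of_int (d j) else 0) = pi * (\<Sum>j\<in>{j. j < N \<and> s < \<sigma> j}. real_of_int (d j))"
  proof -
    have "{j. j < N \<and> s < \<sigma> j} = {..<N} \<inter> {j. s < \<sigma> j}" by auto
    then show ?thesis by (simp add: sum.inter_restrict sum_distrib_left if_distrib cong: if_cong)
  qed
  finally show ?thesis
    unfolding \<phi>0_def w_def [symmetric] c0_def d_sum_real \<theta>_def by (simp add: field_simps)
qed

lemma phi0_boundary_phase: "boundary_phase \<Omega> \<gamma> L N a d \<phi>0"
  unfolding boundary_phase_def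
proof (intro conjI allI impI)
  fix s assume ns: "\<gamma> s \<notin> a ` {..<N}"
  obtain s' n where s': "s' \<in> {0..<L}" "s = s' + of_int n * L"
    using periodic_reduce [OF L_pos] by blast
  have g: "\<gamma> s = \<gamma> s'" and t: "tangent_at \<gamma> s = tangent_at \<gamma> s'"
    using periodic_int_multiple [of \<gamma> L s' n] periodic_int_multiple [of "tangent_at \<gamma>" L s' n]
      gamma_periodic tangent_periodic s' by auto
  \<comment> \<open>An integer, so rotating by pi m only changes a sign and the direction stays
    tangent to the boundary.\<close>
  define m where "m = (\<Sum>j\<in>{j. j < N \<and> s' < \<sigma> j}. d j)"
  have "\<phi>0 (\<gamma> s) = \<theta> s' + pi * of_int m"
    using phi0_gamma [of s'] s' ns g by (simp add: m_def)
  then have "cis (\<phi>0 (\<gamma> s)) = cis (\<theta> s') * cis (pi * of_int m)"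
    by (simp add: cis_mult)
  moreover have "cis (pi * of_int m) = of_real (cos (pi * of_int m))"
    by (simp add: complex_eq_iff sin_int_times_real mult.commute)
  ultimately have "cis (\<phi>0 (\<gamma> s)) = of_real (cos (pi * of_int m)) * cis (\<theta> s')"
    by simp
  moreover have "normal_at \<gamma> s = - \<i> * cis (\<theta> s')"
    unfolding normal_at_def t by (simp add: tangent_eq)
  ultimately show "inner (cis (\<phi>0 (\<gamma> s))) (normal_at \<gamma> s) = 0"
    by (simp add: inner_complex_def)
next
  fix s t assume st: "0 \<le> s \<and> s \<le> t \<and> t < L \<and> \<gamma> s \<notin> a ` {..<N} \<and> \<gamma> t \<notin> a ` {..<N}"
  then have in_s: "s \<in> {0..<L}" "t \<in> {0..<L}" by auto
  have ne: "t \<noteq> \<sigma> j" "s \<noteq> \<sigma> j" if "j < N" for j using st sigma(2) [OF that] that by auto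
  have i: "integral {s..t} (curvature_at \<gamma>) = \<theta> t - \<theta> s"
    using curvature_has_integral st by (intro integral_unique) auto
  have set: "{j. j < N \<and> (\<exists>u\<in>{s<..<t}. \<gamma> u = a j)} = {j. j < N \<and> s < \<sigma> j} - {j. j < N \<and> t < \<sigma> j}"
  proof (intro equalityI subsetI)
    fix j assume "j \<in> {j. j < N \<and> (\<exists>u\<in>{s<..<t}. \<gamma> u = a j)}"
    then obtain u where u: "j < N" "u \<in> {s<..<t}" "\<gamma> u = a j" by auto
    then have "u = \<sigma> j" using gamma_eq_a_iff [of j u] st by auto
    then show "j \<in> {j. j < N \<and> s < \<sigma> j} - {j. j < N \<and> t < \<sigma> j}" using u by auto
  next
    fix j assume j: "j \<in> {j. j < N \<and> s < \<sigma> j} - {j. j < N \<and> t < \<sigma> j}"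
    then have "\<sigma> j \<in> {s<..<t}" using ne [of j] by (auto simp: not_less)
    then show "j \<in> {j. j < N \<and> (\<exists>u\<in>{s<..<t}. \<gamma> u = a j)}" using j sigma(2) [of j] by auto
  qed
  have sd: "(\<Sum>j\<in>{j. j < N \<and> s < \<sigma> j} - {j. j < N \<and> t < \<sigma> j}. real_of_int (d j))
     = (\<Sum>j\<in>{j. j < N \<and> s < \<sigma> j}. real_of_int (d j)) - (\<Sum>j\<in>{j. j < N \<and> t < \<sigma> j}. real_of_int (d j))"
    by (rule sum_diff) (use st in auto)
  show "\<phi>0 (\<gamma> t) - \<phi>0 (\<gamma> s) = integral {s..t} (curvature_at \<gamma>)
      - pi * (\<Sum>j\<in>{j. j < N \<and> (\<exists>u\<in>{s<..<t}. \<gamma> u = a j)}. real_of_int (d j))"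
    unfolding set i sd using phi0_gamma [OF in_s(1)] phi0_gamma [OF in_s(2)] st by (simp add: algebra_simps)
qed

text \<open>Each factor stays in the right half plane, so its argument is below pi / 2, although its
  logarithm is unbounded.\<close>

lemma GPsi_Im_bounded: "bounded ((\<lambda>z. Im (G (\<Psi> z))) ` \<Omega>)"
proof -
  have "compact (H ` cball 0 1)" by (intro compact_continuous_image H) auto
  then have "bounded (H ` cball 0 1)" by (rule compact_imp_bounded)
  then obtain M where M: "\<And>z. z \<in> cball 0 1 \<Longrightarrow> cmod (H z) \<le> M"
    unfolding bounded_iff by blast
  have "\<bar>Im (G (\<Psi> z))\<bar> \<le> real N * (pi / 2) + M" if z: "z \<in> \<Omega>" for z
  proof -
    have zb: "\<Psi> z \<in> ball 0 1" using Psi_ball z by blast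
    have "\<bar>real_of_int (d j) * Im (Ln (1 - \<Psi> z / b j))\<bar> \<le> pi / 2" if "j < N" for j
    proof -
      have "\<bar>Im (Ln (1 - \<Psi> z / b j))\<bar> < pi / 2"
        using one_minus_pos [OF that _ ball_ne_b [OF that zb]] zb by (intro Re_Ln_pos_lt_imp) auto
      then show ?thesis using d_cases [OF that] by (auto simp: abs_mult)
    qed
    then have "\<bar>\<Sum>j<N. real_of_int (d j) * Im (Ln (1 - \<Psi> z / b j))\<bar> \<le> (\<Sum>j<N. pi / 2)"
      by (intro order_trans [OF sum_abs] sum_mono) auto
    moreover have "\<bar>Im (H (\<Psi> z))\<bar> \<le> M"
      using M [of "\<Psi> z"] zb abs_Im_le_cmod [of "H (\<Psi> z)"] by auto
    ultimately show ?thesis unfolding G_def by simp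
  qed
  then show ?thesis unfolding bounded_iff by auto
qed

lemma GPsi_tendsto:
  assumes "z \<in> frontier \<Omega> - a ` {..<N}"
  shows "((\<lambda>z. G (\<Psi> z)) \<longlongrightarrow> G (\<Psi> z)) (at z within \<Omega>)"
proof -
  have "z \<in> closure \<Omega> - a ` {..<N}" using assms by (auto simp: frontier_def)
  then have "((\<lambda>z. G (\<Psi> z)) \<longlongrightarrow> G (\<Psi> z)) (at z within (closure \<Omega> - a ` {..<N}))"
    using continuous_GPsi by (auto simp: continuous_on_def)
  then show ?thesis
    by (rule tendsto_within_subset) (use closure_subset a_frontier closure_Omega(2) in blast)
qed

lemma phi0_harmonic_extension: "harmonic_extension \<Omega> N a \<phi>0 \<phi>0"
  unfolding harmonic_extension_def
proof (intro conjI ballI)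
  have eq: "\<phi>0 = (\<lambda>z. Im (G (\<Psi> z) + \<i> * of_real c0))"
    by (simp add: \<phi>0_def fun_eq_iff)
  show "harmonic_on \<phi>0 \<Omega>"
    unfolding eq by (intro harmonic_on_Im holomorphic_intros GPsi_holomorphic open_Omega)
  obtain M where "\<And>z. z \<in> \<Omega> \<Longrightarrow> \<bar>Im (G (\<Psi> z))\<bar> \<le> M"
    using GPsi_Im_bounded unfolding bounded_iff by auto
  then have "\<bar>\<phi>0 z\<bar> \<le> M + \<bar>c0\<bar>" if "z \<in> \<Omega>" for z
    using that unfolding \<phi>0_def by (meson abs_triangle_ineq add_mono order_refl order_trans)
  then show "bounded (\<phi>0 ` \<Omega>)" unfolding bounded_iff by auto
  fix z assume "z \<in> frontier \<Omega> - a ` {..<N}"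
  then show "(\<phi>0 \<longlongrightarrow> \<phi>0 z) (at z within \<Omega>)"
    unfolding \<phi>0_def [abs_def] by (intro tendsto_intros GPsi_tendsto)
qed

text \<open>The two phases have the same increments between non-singular points, so their difference
  is fixed at one base point. Such a point exists because only finitely many parameters are
  singular.\<close>

lemma boundary_phase_unique:
  assumes \<phi>: "boundary_phase \<Omega> \<gamma> L N a d \<phi>"
  obtains k where "\<And>z. z \<in> frontier \<Omega> - a ` {..<N} \<Longrightarrow> \<phi> z = \<phi>0 z + k"
proof -
  have "infinite ({0..<L} - \<sigma> ` {..<N})"
    using L_pos by (intro Diff_infinite_finite) auto
  then obtain s0 where s0: "s0 \<in> {0..<L}" "s0 \<notin> \<sigma> ` {..<N}"
    by (metis Diff_iff ex_in_conv finite.emptyI)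
  have n0: "\<gamma> s0 \<notin> a ` {..<N}" using s0 gamma_eq_a_iff by auto
  show thesis
  proof
    fix z assume z: "z \<in> frontier \<Omega> - a ` {..<N}"
    then obtain s where s: "s \<in> {0..<L}" "z = \<gamma> s" using frontier_param by blast
    have inc: "\<phi> (\<gamma> y) - \<phi> (\<gamma> x) = \<phi>0 (\<gamma> y) - \<phi>0 (\<gamma> x)"
      if "0 \<le> x" "x \<le> y" "y < L" "\<gamma> x \<notin> a ` {..<N}" "\<gamma> y \<notin> a ` {..<N}" for x y
      using \<phi> [unfolded boundary_phase_def, THEN conjunct2, rule_format, of x y]
        phi0_boundary_phase [unfolded boundary_phase_def, THEN conjunct2, rule_format, of x y] that by simp
    show "\<phi> z = \<phi>0 z + (\<phi> (\<gamma> s0) - \<phi>0 (\<gamma> s0))"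
      using inc [of s s0] inc [of s0 s] s s0 z n0 by (cases "s \<le> s0") auto
  qed
qed

text \<open>The two candidates differ by a bounded harmonic function tending to 0 at the frontier
  except possibly at the a j. The barrier has Im B equal to minus the sum of the ln |1 - \<Psi> z /
  b j|: it is infinite at every a j, and since each factor has modulus at most 2 it is bounded below
  by - N ln 2.\<close>

lemma harmonic_extension_unique:
  assumes \<phi>: "boundary_phase \<Omega> \<gamma> L N a d \<phi>" and ext: "harmonic_extension \<Omega> N a \<phi> \<phi>s"
  obtains k where "\<And>z. z \<in> \<Omega> \<Longrightarrow> \<phi>s z = Im (G (\<Psi> z)) + k"
proof -
  obtain k where k: "\<And>z. z \<in> frontier \<Omega> - a ` {..<N} \<Longrightarrow> \<phi> z = \<phi>0 z + k"
    using boundary_phase_unique [OF \<phi>] by blast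
  define F where "F z = G (\<Psi> z) + \<i> * of_real (c0 + k)" for z
  define u where "u z = \<phi>s z - Im (F z)" for z
  have ImF: "Im (F z) = \<phi>0 z + k" for z by (simp add: F_def \<phi>0_def)
  define B where "B z = - \<i> * (\<Sum>j<N. Ln (1 - \<Psi> z / b j))" for z
  have factor: "Re (1 - \<Psi> z / b j) > 0" "cmod (1 - \<Psi> z / b j) \<le> 2" if z: "z \<in> \<Omega>" and j: "j < N" for z j
  proof -
    have zb: "\<Psi> z \<in> ball 0 1" using Psi_ball z by blast
    then show "Re (1 - \<Psi> z / b j) > 0" using one_minus_pos [OF j _ ball_ne_b [OF j zb]] by auto
    have "cmod (\<Psi> z / b j) \<le> 1" using zb norm_b [OF j] by (simp add: norm_divide)
    then show "cmod (1 - \<Psi> z / b j) \<le> 2" using norm_triangle_ineq4 [of 1 "\<Psi> z / b j"] by simp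
  qed
  have ReLn: "Re (Ln (1 - \<Psi> z / b j)) = ln (cmod (1 - \<Psi> z / b j))" "Re (Ln (1 - \<Psi> z / b j)) \<le> ln 2" if "z \<in> \<Omega>" "j < N" for z j
  proof -
    have ne: "1 - \<Psi> z / b j \<noteq> 0" using factor(1) [OF that] by force
    then show e: "Re (Ln (1 - \<Psi> z / b j)) = ln (cmod (1 - \<Psi> z / b j))" by simp
    show "Re (Ln (1 - \<Psi> z / b j)) \<le> ln 2"
      unfolding e using factor(2) [OF that] ne by (subst ln_le_cancel_iff) auto
  qed
  have ImB: "Im (B z) = - (\<Sum>j<N. Re (Ln (1 - \<Psi> z / b j)))" for z by (simp add: B_def)
  have "u z = 0" if z: "z \<in> \<Omega>" for z
  proof (rule harmonic_eq_0_barrier [where P = "a ` {..<N}" and B = B and c = "real N * ln 2", OF _ bounded_Omega _ _ _ _ _ _ z])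
    show "harmonic_on u \<Omega>"
      unfolding u_def using ext GPsi_holomorphic open_Omega
      by (intro harmonic_on_diff harmonic_on_Im) (auto simp: harmonic_extension_def F_def [abs_def] intro!: holomorphic_intros)
    show "bounded (u ` \<Omega>)"
    proof -
      obtain M1 where M1: "\<And>z. z \<in> \<Omega> \<Longrightarrow> \<bar>\<phi>s z\<bar> \<le> M1"
        using ext unfolding harmonic_extension_def bounded_iff by auto
      obtain M2 where M2: "\<And>z. z \<in> \<Omega> \<Longrightarrow> \<bar>Im (G (\<Psi> z))\<bar> \<le> M2"
        using GPsi_Im_bounded unfolding bounded_iff by auto
      have "\<bar>u z\<bar> \<le> M1 + M2 + \<bar>c0 + k\<bar>" if "z \<in> \<Omega>" for z
        using M1 [OF that] M2 [OF that] by (simp add: u_def F_def)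
      then show ?thesis unfolding bounded_iff by auto
    qed
    have hol: "\<Psi> holomorphic_on \<Omega>"
      using Psi_deriv_at by (meson field_differentiable_at_within field_differentiable_def holomorphic_on_def)
    show "B holomorphic_on \<Omega>"
      unfolding B_def using factor(1) b_nz
      by (intro holomorphic_intros hol) (auto simp: complex_nonpos_Reals_iff not_le)
    show "Im (B z) \<ge> - (real N * ln 2)" if "z \<in> \<Omega>" for z
    proof -
      have "(\<Sum>j<N. Re (Ln (1 - \<Psi> z / b j))) \<le> (\<Sum>j<N. ln 2)"
        using ReLn(2) [OF that] by (intro sum_mono) auto
      then show ?thesis by (simp add: ImB)
    qed
    show "(u \<longlongrightarrow> 0) (at z within \<Omega>)" if z: "z \<in> frontier \<Omega> - a ` {..<N}" for z
    proof -
      have "(\<phi>s \<longlongrightarrow> \<phi> z) (at z within \<Omega>)" using ext z unfolding harmonic_extension_def by blast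
      moreover have "(\<phi>0 \<longlongrightarrow> \<phi>0 z) (at z within \<Omega>)"
        using phi0_harmonic_extension z unfolding harmonic_extension_def by blast
      ultimately have "((\<lambda>z. \<phi>s z - (\<phi>0 z + k)) \<longlongrightarrow> \<phi> z - (\<phi>0 z + k)) (at z within \<Omega>)"
        by (intro tendsto_intros)
      then show ?thesis using k [OF z] by (simp add: u_def [abs_def] ImF)
    qed
    show "filterlim (\<lambda>z. Im (B z)) at_top (at p within \<Omega>)" if p: "p \<in> a ` {..<N}" for p
    proof -
      obtain j where j: "j < N" "p = a j" using p by auto
      \<comment> \<open>A lower bound for Im B near a j: one logarithm diverges, and the others are
        at most ln 2.\<close>
      have lim: "filterlim (\<lambda>z. - (real N * ln 2) + - ln (cmod (1 - \<Psi> z / b j))) at_top (at p within \<Omega>)"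
      proof -
        have "(\<Psi> \<longlongrightarrow> \<Psi> p) (at p within closure \<Omega>)"
          using continuous_Psi a_closure j by (auto simp: continuous_on_def)
        then have "(\<Psi> \<longlongrightarrow> b j) (at p within \<Omega>)"
          using tendsto_within_subset closure_subset j unfolding b_def by blast
        then have "((\<lambda>z. cmod (1 - \<Psi> z / b j)) \<longlongrightarrow> cmod (1 - b j / b j)) (at p within \<Omega>)"
          using b_nz j by (intro tendsto_intros) auto
        then have "((\<lambda>z. cmod (1 - \<Psi> z / b j)) \<longlongrightarrow> 0) (at p within \<Omega>)"
          using b_nz j by simp
        moreover have "\<forall>\<^sub>F z in at p within \<Omega>. cmod (1 - \<Psi> z / b j) \<in> {0<..} \<and> cmod (1 - \<Psi> z / b j) \<noteq> 0"
        proof -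
          have "cmod (1 - \<Psi> z / b j) \<in> {0<..} \<and> cmod (1 - \<Psi> z / b j) \<noteq> 0" if "z \<in> \<Omega>" for z
            using factor(1) [OF that j(1)] by force
          moreover have "\<forall>\<^sub>F z in at p within \<Omega>. z \<in> \<Omega>" by (simp add: eventually_at_filter)
          ultimately show ?thesis by (rule eventually_mono [rotated])
        qed
        ultimately have "filterlim (\<lambda>z. cmod (1 - \<Psi> z / b j)) (at_right 0) (at p within \<Omega>)"
          unfolding filterlim_at by blast
        then have "filterlim (\<lambda>z. ln (cmod (1 - \<Psi> z / b j))) at_bot (at p within \<Omega>)"
          by (rule filterlim_compose [OF ln_at_0])
        then have "filterlim (\<lambda>z. - ln (cmod (1 - \<Psi> z / b j))) at_top (at p within \<Omega>)"
          by (simp add: filterlim_uminus_at_top)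
        then show ?thesis
          by (rule filterlim_tendsto_add_at_top [OF tendsto_const])
      qed
      show ?thesis
      proof (rule filterlim_at_top_mono [OF lim])
        have "- (real N * ln 2) + - ln (cmod (1 - \<Psi> z / b j)) \<le> Im (B z)" if z: "z \<in> \<Omega>" for z
        proof -
          have "(\<Sum>i<N. Re (Ln (1 - \<Psi> z / b i))) = Re (Ln (1 - \<Psi> z / b j)) + (\<Sum>i\<in>{..<N} - {j}. Re (Ln (1 - \<Psi> z / b i)))"
            using j by (intro sum.remove) auto
          also have "(\<Sum>i\<in>{..<N} - {j}. Re (Ln (1 - \<Psi> z / b i))) \<le> (\<Sum>i\<in>{..<N} - {j}. ln 2)"
            using ReLn(2) [OF z] by (intro sum_mono) auto
          also have "(\<Sum>i\<in>{..<N} - {j}. ln 2) \<le> (\<Sum>i<N. ln (2::real))"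
            by (intro sum_mono2) auto
          finally show ?thesis using ReLn(1) [OF z j(1)] by (simp add: ImB)
        qed
        moreover have "\<forall>\<^sub>F z in at p within \<Omega>. z \<in> \<Omega>" by (simp add: eventually_at_filter)
        ultimately show "\<forall>\<^sub>F z in at p within \<Omega>. - (real N * ln 2) + - ln (cmod (1 - \<Psi> z / b j)) \<le> Im (B z)"
          by (rule eventually_mono [rotated])
      qed
    qed
  qed auto
  then have "\<phi>s z = Im (G (\<Psi> z)) + (c0 + k)" if "z \<in> \<Omega>" for z
    using that by (simp add: u_def F_def)
  then show thesis using that by blast
qed

lemma energy_density:
  assumes k: "\<And>z. z \<in> \<Omega> \<Longrightarrow> \<phi>s z = Im (G (\<Psi> z)) + k" and z: "z \<in> \<Omega>"
  shows "(partial_x \<phi>s z)\<^sup>2 + (partial_y \<phi>s z)\<^sup>2 = (cmod (G' (\<Psi> z) * \<Psi>' z))\<^sup>2"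
proof -
  let ?F = "\<lambda>z. G (\<Psi> z) + \<i> * of_real k"
  have "(?F has_field_derivative G' (\<Psi> z) * \<Psi>' z) (at z)"
    using GPsi_deriv [OF z] by (auto intro!: derivative_eq_intros)
  note P = partial_Im_holomorphic [OF this]
  have "partial_x \<phi>s z = partial_x (\<lambda>z. Im (?F z)) z" "partial_y \<phi>s z = partial_y (\<lambda>z. Im (?F z)) z"
    by (rule partial_cong [OF open_Omega z]; simp add: k)+
  then show ?thesis using P by (simp add: cmod_power2 add.commute)
qed

section \<open>The punctured energy transported to the disc\<close>

definition D\<rho> :: "real \<Rightarrow> complex set" where
  "D\<rho> \<rho> = {z \<in> ball 0 1. \<forall>j<N. \<Phi> z \<notin> ball (a j) \<rho>}"

lemma Drho_borel: "D\<rho> \<rho> \<in> sets borel"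
proof -
  have "D\<rho> \<rho> = ball 0 1 - (\<Union>j<N. {z \<in> ball 0 1. \<Phi> z \<in> ball (a j) \<rho>})"
    by (auto simp: D\<rho>_def)
  moreover have "open {z \<in> ball 0 1. \<Phi> z \<in> ball (a j) \<rho>}" for j
  proof -
    have "open (ball 0 1 \<inter> \<Phi> -` ball (a j) \<rho>)"
      by (rule continuous_open_preimage [OF continuous_on_subset [OF continuous_Phi]]) auto
    moreover have "{z \<in> ball 0 1. \<Phi> z \<in> ball (a j) \<rho>} = ball 0 1 \<inter> \<Phi> -` ball (a j) \<rho>" by auto
    ultimately show ?thesis by simp
  qed
  ultimately show ?thesis by auto
qed

lemma Phi_Drho: "\<Phi> ` D\<rho> \<rho> = \<Omega> - (\<Union>j<N. ball (a j) \<rho>)"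
proof (intro equalityI subsetI)
  fix z assume "z \<in> \<Phi> ` D\<rho> \<rho>"
  then show "z \<in> \<Omega> - (\<Union>j<N. ball (a j) \<rho>)" using Phi_ball by (auto simp: D\<rho>_def)
next
  fix z assume z: "z \<in> \<Omega> - (\<Union>j<N. ball (a j) \<rho>)"
  then have "z = \<Phi> (\<Psi> z)" using Phi_Psi closure_subset by (metis DiffD1 subsetD)
  moreover have "\<Psi> z \<in> D\<rho> \<rho>" using z Psi_ball [of z] calculation by (auto simp: D\<rho>_def)
  ultimately show "z \<in> \<Phi> ` D\<rho> \<rho>" by blast
qed

lemma dirichlet_energy_eq:
  assumes k: "\<And>z. z \<in> \<Omega> \<Longrightarrow> \<phi>s z = Im (G (\<Psi> z)) + k"
    and int: "(\<lambda>z. (cmod (G' z))\<^sup>2) absolutely_integrable_on D\<rho> \<rho>"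
  shows "dirichlet_energy_punctured \<Omega> N a \<phi>s \<rho> = integral (D\<rho> \<rho>) (\<lambda>z. (cmod (G' z))\<^sup>2)"
proof -
  let ?f = "\<lambda>z. complex_of_real ((cmod (G' (\<Psi> z) * \<Psi>' z))\<^sup>2)"
  let ?e = "\<lambda>z. (cmod (G' z))\<^sup>2"
  let ?I = "integral (D\<rho> \<rho>) ?e"
  have sub: "D\<rho> \<rho> \<subseteq> ball 0 1" by (auto simp: D\<rho>_def)
  have inj: "inj_on \<Phi> (D\<rho> \<rho>)" by (rule inj_on_inverseI [where g = \<Psi>]) (use sub Psi_Phi in auto)
  have der: "(\<Phi> has_field_derivative \<Phi>' z) (at z within D\<rho> \<rho>)" if "z \<in> D\<rho> \<rho>" for z
    by (rule DERIV_subset [OF deriv_Phi]) (use that sub in auto)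
  \<comment> \<open>The Jacobian |\<Phi>'|^2 cancels the factor |\<Psi>'|^2 of the chain
    rule.\<close>
  have eq: "(cmod (\<Phi>' z))\<^sup>2 *\<^sub>R ?f (\<Phi> z) = of_real (?e z)" if "z \<in> D\<rho> \<rho>" for z
  proof -
    have z: "z \<in> cball 0 1" using that sub by auto
    have "cmod (\<Psi>' (\<Phi> z)) * cmod (\<Phi>' z) = 1" using Psi'_Phi' [OF z] by (metis norm_mult norm_one)
    then have "(cmod (\<Phi>' z))\<^sup>2 * (cmod (G' z * \<Psi>' (\<Phi> z)))\<^sup>2 = (cmod (G' z))\<^sup>2"
      by (simp add: norm_mult power_mult_distrib [symmetric] mult_ac)
    then show ?thesis
      unfolding Psi_Phi [OF z] scaleR_conv_of_real of_real_mult [symmetric] by (simp only:)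
  qed
  have "(\<lambda>z. complex_of_real (?e z)) absolutely_integrable_on D\<rho> \<rho>"
    using absolutely_integrable_linear [OF int bounded_linear_of_real] by (simp add: o_def)
  then have "(\<lambda>z. (cmod (\<Phi>' z))\<^sup>2 *\<^sub>R ?f (\<Phi> z)) absolutely_integrable_on D\<rho> \<rho>"
    by (rule set_integrable_cong [THEN iffD1, OF refl refl _, rotated]) (simp only: eq)
  moreover have "integral (D\<rho> \<rho>) (\<lambda>z. (cmod (\<Phi>' z))\<^sup>2 *\<^sub>R ?f (\<Phi> z)) = of_real ?I"
  proof -
    have "integral (D\<rho> \<rho>) (\<lambda>z. (cmod (\<Phi>' z))\<^sup>2 *\<^sub>R ?f (\<Phi> z)) = integral (D\<rho> \<rho>) (\<lambda>z. complex_of_real (?e z))"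
      by (rule integral_cong) (rule eq)
    then show ?thesis
      using integral_linear [OF _ bounded_linear_of_real, of ?e "D\<rho> \<rho>"] int
      by (simp add: o_def absolutely_integrable_on_def)
  qed
  ultimately have "?f absolutely_integrable_on (\<Phi> ` D\<rho> \<rho>) \<and> integral (\<Phi> ` D\<rho> \<rho>) ?f = of_real ?I"
    using has_absolute_integral_change_of_variables_complex [OF _ der inj, where f = ?f] Drho_borel by auto
  then have f: "?f absolutely_integrable_on (\<Omega> - (\<Union>j<N. ball (a j) \<rho>))" "integral (\<Omega> - (\<Union>j<N. ball (a j) \<rho>)) ?f = of_real ?I"
    by (auto simp: Phi_Drho)
  have "dirichlet_energy_punctured \<Omega> N a \<phi>s \<rho> = integral (\<Omega> - (\<Union>j<N. ball (a j) \<rho>)) (\<lambda>z. Re (?f z))"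
    unfolding dirichlet_energy_punctured_def
    by (rule integral_cong) (use energy_density [OF k] in auto)
  also have "\<dots> = Re (integral (\<Omega> - (\<Union>j<N. ball (a j) \<rho>)) ?f)"
    using integral_linear [OF _ bounded_linear_Re, of ?f] f(1) by (simp add: o_def absolutely_integrable_on_def)
  finally show ?thesis using f(2) by simp
qed

end

section \<open>The logarithm of the derivative as a curvature integral\<close>

text \<open>Clamping the argument to [a, b] extends f to a Lipschitz function on the line. It may
  spoil the derivative at the two endpoints, which therefore join the null set.\<close>

lemma lipschitz_on_fundamental_theorem:
  fixes f f' :: "real \<Rightarrow> real"
  assumes lip: "\<And>x y. x \<in> {a..b} \<Longrightarrow> y \<in> {a..b} \<Longrightarrow> \<bar>f x - f y\<bar> \<le> K * \<bar>x - y\<bar>"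
    and K: "0 \<le> K" and N: "negligible N" and ab: "a \<le> b"
    and der: "\<And>x. x \<in> {a..b} - N \<Longrightarrow> (f has_real_derivative f' x) (at x)"
  shows "(f' has_integral (f b - f a)) {a..b}"
proof -
  define c where "c x = max a (min b x)" for x
  have c_in: "c x \<in> {a..b}" for x using ab by (auto simp: c_def)
  have c_id: "c x = x" if "x \<in> {a..b}" for x using that by (auto simp: c_def)
  have c_lip: "\<bar>c x - c y\<bar> \<le> \<bar>x - y\<bar>" for x y by (auto simp: c_def max_def min_def)
  have "(f' has_integral (f (c b) - f (c a))) {a..b}"
  proof (rule lipschitz_fundamental_theorem [where N = "N \<union> {a, b}" and K = K])
    show "\<bar>f (c x) - f (c y)\<bar> \<le> K * \<bar>x - y\<bar>" for x y
      using lip [OF c_in c_in, of x y] mult_left_mono [OF c_lip [of x y] K] by linarith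
    show "negligible (N \<union> {a, b})" using N by (intro negligible_Un) auto
    show "((\<lambda>x. f (c x)) has_real_derivative f' x) (at x)" if x: "x \<in> {a..b} - (N \<union> {a, b})" for x
    proof (rule has_field_derivative_transform_within_open [where S = "{a<..<b}"])
      show "(f has_real_derivative f' x) (at x)" using der x by auto
      show "f y = f (c y)" if "y \<in> {a<..<b}" for y using c_id that by auto
    qed (use x in auto)
  qed (rule ab)
  then show ?thesis using ab by (simp add: c_id)
qed

text \<open>On [a, b] both factors are bounded and Lipschitz, so their product is Lipschitz and the
  fundamental theorem applies to it. This is the form needed for the tangent angle, whose derivative
  exists only almost everywhere.\<close>

lemma lipschitz_integration_by_parts_real:
  fixes f f' q q' :: "real \<Rightarrow> real"
  assumes lip: "\<And>x y. \<bar>f x - f y\<bar> \<le> K * \<bar>x - y\<bar>" and N: "negligible N" and ab: "a \<le> b"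
    and der: "\<And>x. x \<in> {a..b} - N \<Longrightarrow> (f has_real_derivative f' x) (at x)"
    and q: "\<And>x. x \<in> {a..b} \<Longrightarrow> (q has_real_derivative q' x) (at x)" and q': "continuous_on {a..b} q'"
  shows "((\<lambda>x. f' x * q x) has_integral (f b * q b - f a * q a - integral {a..b} (\<lambda>x. f x * q' x))) {a..b}"
proof -
  have K0: "0 \<le> K" using order_trans [OF abs_ge_zero lip [of 0 1]] by simp
  have "K-lipschitz_on UNIV f"
    using K0 lip by (auto intro!: lipschitz_onI simp: dist_real_def)
  then have contf: "continuous_on {a..b} f"
    using lipschitz_on_continuous_on continuous_on_subset by blast
  have contq: "continuous_on {a..b} q"
    using q by (meson DERIV_isCont continuous_at_imp_continuous_on)
  have "bounded (f ` {a..b})" "bounded (q ` {a..b})" "bounded (q' ` {a..b})"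
    by (auto intro!: compact_imp_bounded compact_continuous_image contf contq q')
  then obtain A B C where "\<forall>x\<in>f ` {a..b}. norm x \<le> A" "\<forall>x\<in>q ` {a..b}. norm x \<le> B" "\<forall>x\<in>q' ` {a..b}. norm x \<le> C"
    unfolding bounded_iff by blast
  then have A: "\<bar>f x\<bar> \<le> A" and B: "\<bar>q x\<bar> \<le> B" and C: "\<bar>q' x\<bar> \<le> C" if "x \<in> {a..b}" for x
    using that by auto
  have nn: "0 \<le> A" "0 \<le> B" "0 \<le> C" using A [of a] B [of a] C [of a] ab by auto
  have qlip: "\<bar>q x - q y\<bar> \<le> C * \<bar>x - y\<bar>" if "x \<in> {a..b}" "y \<in> {a..b}" for x y
  proof -
    have "norm (q x - q y) \<le> C * norm (x - y)"
      by (rule field_differentiable_bound [of "{a..b}" q q'])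
        (use that C q in \<open>auto intro: has_field_derivative_at_within\<close>)
    then show ?thesis by simp
  qed
  have "((\<lambda>x. f' x * q x + f x * q' x) has_integral (f b * q b - f a * q a)) {a..b}"
  proof (rule lipschitz_on_fundamental_theorem [where K = "A * C + B * K", OF _ _ N ab])
    fix x y assume xy: "x \<in> {a..b}" "y \<in> {a..b}"
    have "f x * q x - f y * q y = f x * (q x - q y) + q y * (f x - f y)" by (simp add: algebra_simps)
    then have "\<bar>f x * q x - f y * q y\<bar> \<le> \<bar>f x\<bar> * \<bar>q x - q y\<bar> + \<bar>q y\<bar> * \<bar>f x - f y\<bar>"
      by (metis abs_mult abs_triangle_ineq)
    also have "\<dots> \<le> A * (C * \<bar>x - y\<bar>) + B * (K * \<bar>x - y\<bar>)"
      using A [OF xy(1)] B [OF xy(2)] qlip [OF xy] lip [of x y] nn K0 by (intro add_mono mult_mono) auto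
    finally show "\<bar>f x * q x - f y * q y\<bar> \<le> (A * C + B * K) * \<bar>x - y\<bar>" by (simp add: algebra_simps)
  next
    show "0 \<le> A * C + B * K" using nn K0 by simp
    show "((\<lambda>x. f x * q x) has_real_derivative f' x * q x + f x * q' x) (at x)" if "x \<in> {a..b} - N" for x
      using DERIV_mult [OF der [OF that] q [of x]] that by (simp add: mult.commute)
  qed
  moreover have "((\<lambda>x. f x * q' x) has_integral integral {a..b} (\<lambda>x. f x * q' x)) {a..b}"
    by (intro integrable_integral integrable_continuous_interval continuous_intros contf q')
  ultimately have "((\<lambda>x. f' x * q x + f x * q' x - f x * q' x) has_integral (f b * q b - f a * q a - integral {a..b} (\<lambda>x. f x * q' x))) {a..b}"
    by (rule has_integral_diff)
  then show ?thesis by simp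
qed

lemma has_integral_complex_Re_Im:
  assumes "((\<lambda>x. Re (f x)) has_integral Re I) S" "((\<lambda>x. Im (f x)) has_integral Im I) S"
  shows "(f has_integral I) S"
proof -
  have "((\<lambda>x. complex_of_real (Re (f x)) + \<i> * complex_of_real (Im (f x))) has_integral (complex_of_real (Re I) + \<i> * complex_of_real (Im I))) S"
    by (intro has_integral_add has_integral_mult_right has_integral_of_real assms)
  then show ?thesis by (simp add: complex_eq [symmetric])
qed

lemma lipschitz_integration_by_parts:
  fixes f f' :: "real \<Rightarrow> real" and q q' :: "real \<Rightarrow> complex"
  assumes lip: "\<And>x y. \<bar>f x - f y\<bar> \<le> K * \<bar>x - y\<bar>" and N: "negligible N" and ab: "a \<le> b"
    and der: "\<And>x. x \<in> {a..b} - N \<Longrightarrow> (f has_real_derivative f' x) (at x)"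
    and q: "\<And>x. x \<in> {a..b} \<Longrightarrow> (q has_vector_derivative q' x) (at x)" and q': "continuous_on {a..b} q'"
  shows "((\<lambda>x. of_real (f' x) * q x) has_integral (f b * q b - f a * q a - integral {a..b} (\<lambda>x. f x * q' x))) {a..b}"
proof -
  have "K-lipschitz_on UNIV f"
    using lip order_trans [OF abs_ge_zero lip [of 0 1]] by (auto intro!: lipschitz_onI simp: dist_real_def)
  then have contf: "continuous_on {a..b} f"
    using lipschitz_on_continuous_on continuous_on_subset by blast
  have int: "(\<lambda>x. complex_of_real (f x) * q' x) integrable_on {a..b}"
    by (intro integrable_continuous_interval continuous_intros contf q')
  have re: "Re (integral {a..b} (\<lambda>x. complex_of_real (f x) * q' x)) = integral {a..b} (\<lambda>x. f x * Re (q' x))"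
    using integral_linear [OF int bounded_linear_Re] by (simp add: o_def)
  have im: "Im (integral {a..b} (\<lambda>x. complex_of_real (f x) * q' x)) = integral {a..b} (\<lambda>x. f x * Im (q' x))"
    using integral_linear [OF int bounded_linear_Im] by (simp add: o_def)
  have qr: "((\<lambda>x. Re (q x)) has_real_derivative Re (q' x)) (at x)" "((\<lambda>x. Im (q x)) has_real_derivative Im (q' x)) (at x)"
    if "x \<in> {a..b}" for x
    using bounded_linear.has_vector_derivative [OF bounded_linear_Re q [OF that]]
      bounded_linear.has_vector_derivative [OF bounded_linear_Im q [OF that]]
    by (simp_all add: has_real_derivative_iff_has_vector_derivative)
  show ?thesis
  proof (rule has_integral_complex_Re_Im)
    show "((\<lambda>x. Re (complex_of_real (f' x) * q x)) has_integral
        Re (f b * q b - f a * q a - integral {a..b} (\<lambda>x. f x * q' x))) {a..b}"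
      using lipschitz_integration_by_parts_real [OF lip N ab der qr(1) continuous_on_Re [OF q']] by (simp add: re)
    show "((\<lambda>x. Im (complex_of_real (f' x) * q x)) has_integral
        Im (f b * q b - f a * q a - integral {a..b} (\<lambda>x. f x * q' x))) {a..b}"
      using lipschitz_integration_by_parts_real [OF lip N ab der qr(2) continuous_on_Im [OF q']] by (simp add: im)
  qed
qed

text \<open>The boundary angle runs over a period starting at some real c, while the target integral
  starts at 0. On an interval containing both periods a primitive P exists, and P (x + 2 pi) - P x
  is constant because the integrand is periodic.\<close>

lemma circle_periodic_antiderivative:
  fixes f :: "complex \<Rightarrow> complex"
  assumes f: "continuous_on (sphere 0 1) f"
  obtains P where "\<And>x. x \<in> {min 0 c..max 0 c + 2 * pi} \<Longrightarrow> (P has_vector_derivative f (cis x)) (at x within {min 0 c..max 0 c + 2 * pi})"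
    "P (c + 2 * pi) - P c = integral {0..2*pi} (\<lambda>t. f (cis t))"
proof -
  let ?S = "{min 0 c..max 0 c + 2 * pi}"
  let ?T = "{min 0 c..max 0 c}"
  have "continuous_on ?S (\<lambda>x. f (cis x))"
    by (intro continuous_on_compose2 [OF f] continuous_intros) auto
  then obtain P where P: "\<And>x. x \<in> ?S \<Longrightarrow> (P has_vector_derivative f (cis x)) (at x within ?S)"
    using antiderivative_continuous by blast
  have der0: "((\<lambda>x. P (x + 2 * pi) - P x) has_vector_derivative 0) (at x within ?T)" if x: "x \<in> ?T" for x
  proof -
    have "x \<in> ?S" "x + 2 * pi \<in> ?S" using x by (auto simp: add_increasing2)
    have 1: "(P has_vector_derivative f (cis x)) (at x within ?T)"
      by (rule has_vector_derivative_within_subset [OF P]) (use x in \<open>auto simp: add_increasing2\<close>)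
    have "((\<lambda>x. x + 2 * pi) has_vector_derivative 1) (at x within ?T)"
      by (auto intro!: derivative_eq_intros)
    moreover have "(P has_vector_derivative f (cis (x + 2 * pi))) (at (x + 2 * pi) within (\<lambda>x. x + 2 * pi) ` ?T)"
      by (rule has_vector_derivative_within_subset [OF P [OF \<open>x + 2 * pi \<in> ?S\<close>]]) (use pi_gt_zero in \<open>auto simp del: pi_gt_zero\<close>)
    ultimately have "((P \<circ> (\<lambda>x. x + 2 * pi)) has_vector_derivative 1 *\<^sub>R f (cis (x + 2 * pi))) (at x within ?T)"
      by (rule vector_diff_chain_within)
    moreover have "cis (x + 2 * pi) = cis x" by (simp add: cis.ctr)
    ultimately have "((\<lambda>x. P (x + 2 * pi) - P x) has_vector_derivative f (cis x) - f (cis x)) (at x within ?T)"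
      using 1 by (intro has_vector_derivative_diff) (auto simp: o_def)
    then show ?thesis by simp
  qed
  have "\<exists>k. \<forall>x\<in>?T. P (x + 2 * pi) - P x = k"
  proof (rule has_vector_derivative_zero_constant [OF _ der0])
    show "convex ?T" by simp
    fix k assume "\<And>x. x \<in> ?T \<Longrightarrow> P (x + 2 * pi) - P x = k"
    then show ?thesis by blast
  qed
  then obtain k where k: "\<And>x. x \<in> ?T \<Longrightarrow> P (x + 2 * pi) - P x = k" by blast
  have "((\<lambda>t. f (cis t)) has_integral (P (2 * pi) - P 0)) {0..2*pi}"
  proof (rule fundamental_theorem_of_calculus)
    show "(P has_vector_derivative f (cis x)) (at x within {0..2*pi})" if "x \<in> {0..2*pi}" for x
      by (rule has_vector_derivative_within_subset [OF P]) (use that in auto)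
  qed simp
  moreover have "P (c + 2 * pi) - P c = P (0 + 2 * pi) - P 0" using k [of c] k [of 0] by auto
  ultimately have "P (c + 2 * pi) - P c = integral {0..2*pi} (\<lambda>t. f (cis t))"
    by (simp add: integral_unique)
  then show thesis using that P by blast
qed

text \<open>Cauchy's theorem with continuity up to the circle. It serves to kill antiholomorphic
  contributions: after conjugation these take the form of this integrand.\<close>

lemma circle_conj_integral_zero:
  assumes F: "continuous_on (cball 0 1) F" "F holomorphic_on ball 0 1"
  shows "((\<lambda>t. F (cis t) * cis t) has_integral 0) {0..2*pi}"
proof -
  have "(F has_contour_integral 0) (circlepath 0 1)"
    by (rule Cauchy_theorem_disc [where K = "{}" and a = 0 and e = 1])
      (use F in \<open>auto simp: holomorphic_on_imp_differentiable_at\<close>)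
  then have "((\<lambda>t. F (cis t) * \<i> * cis t) has_integral 0) {0..2*pi}"
    by (simp add: circlepath_integral_iff)
  then have "((\<lambda>t. (1 / \<i>) * (F (cis t) * \<i> * cis t)) has_integral (1 / \<i>) * 0) {0..2*pi}"
    by (rule has_integral_mult_right)
  then show ?thesis by (simp add: field_simps)
qed

context conformal_parametrisation
begin

lemma circle_substitution:
  fixes f :: "complex \<Rightarrow> complex"
  assumes f: "continuous_on (sphere 0 1) f"
  shows "((\<lambda>s. of_real (\<alpha>' s) * f (w s)) has_integral integral {0..2*pi} (\<lambda>t. f (cis t))) {0..L}"
proof -
  let ?S = "{min 0 (\<alpha> 0)..max 0 (\<alpha> 0) + 2 * pi}"
  obtain P where P: "\<And>x. x \<in> ?S \<Longrightarrow> (P has_vector_derivative f (cis x)) (at x within ?S)"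
    "P (\<alpha> 0 + 2 * pi) - P (\<alpha> 0) = integral {0..2*pi} (\<lambda>t. f (cis t))"
    using circle_periodic_antiderivative [OF f, of "\<alpha> 0"] by blast
  have mono: "\<alpha> s \<le> \<alpha> t" if "s \<le> t" for s t
    using alpha_strict_mono [of s t] that by (cases "s = t") auto
  have aL: "\<alpha> L = \<alpha> 0 + 2 * pi" using alpha_winding by simp
  have "((\<lambda>s. of_real (\<alpha>' s) * f (w s)) has_integral (P (\<alpha> L) - P (\<alpha> 0))) {0..L}"
  proof (rule fundamental_theorem_of_calculus)
    fix s assume s: "s \<in> {0..L}"
    have im: "\<alpha> ` {0..L} \<subseteq> ?S"
    proof
      fix x assume "x \<in> \<alpha> ` {0..L}"
      then obtain t where t: "t \<in> {0..L}" "x = \<alpha> t" by auto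
      have "\<alpha> 0 \<le> \<alpha> t" "\<alpha> t \<le> \<alpha> L" using t mono by auto
      then show "x \<in> ?S" using t aL by auto
    qed
    have "(\<alpha> has_vector_derivative \<alpha>' s) (at s within {0..L})"
      using alpha_deriv [of s] by (auto simp: has_real_derivative_iff_has_vector_derivative intro: has_vector_derivative_at_within)
    moreover have "(P has_vector_derivative f (cis (\<alpha> s))) (at (\<alpha> s) within \<alpha> ` {0..L})"
      by (rule has_vector_derivative_within_subset [OF P(1) im]) (use im s in blast)
    ultimately have "((P \<circ> \<alpha>) has_vector_derivative \<alpha>' s *\<^sub>R f (cis (\<alpha> s))) (at s within {0..L})"
      by (rule vector_diff_chain_within)
    then show "((\<lambda>s. P (\<alpha> s)) has_vector_derivative of_real (\<alpha>' s) * f (w s)) (at s within {0..L})"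
      by (simp add: o_def alpha(2) [of s] scaleR_conv_of_real)
  qed (use L_pos in simp)
  then show ?thesis using P(2) aL by simp
qed

text \<open>Im H = (H - cnj H) / (2 \<i>). The H part is Cauchy's formula for the derivative. The
  cnj H part vanishes: on the circle cis t / (cis t - z)^2 is the conjugate of cis t / (1 - cnj z
  cis t)^2, so conjugation makes the integrand holomorphic. The division by 2 \<i> turns 2 pi \<i>
  into pi.\<close>

lemma H_Cauchy:
  assumes z: "z \<in> ball 0 1"
  shows "((\<lambda>t. of_real (Im (H (cis t))) * (\<i> * cis t / (cis t - z)\<^sup>2)) has_integral (of_real pi * deriv H z)) {0..2*pi}"
proof -
  note C = Cauchy_derivative_integral_circlepath [OF H(1) H_holomorphic z]
  let ?I = "contour_integral (circlepath 0 1) (\<lambda>u. H u / (u - z)\<^sup>2)"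
  have "deriv H z = 1 / (2 * of_real pi * \<i>) * ?I"
    using C(2) by (rule DERIV_imp_deriv)
  then have I: "?I = 2 * of_real pi * \<i> * deriv H z" by simp
  have "((\<lambda>u. H u / (u - z)\<^sup>2) has_contour_integral ?I) (circlepath 0 1)"
    using C(1) by (rule has_contour_integral_integral)
  then have 1: "((\<lambda>t. H (cis t) / (cis t - z)\<^sup>2 * \<i> * cis t) has_integral 2 * of_real pi * \<i> * deriv H z) {0..2*pi}"
    unfolding I by (simp add: circlepath_integral_iff)
  have nz: "1 - cnj z * u \<noteq> 0" if "u \<in> cball 0 1" for u
  proof
    assume "1 - cnj z * u = 0"
    then have "cmod (cnj z * u) = 1" by (metis eq_iff_diff_eq_0 norm_one)
    moreover have "cmod (cnj z * u) \<le> cmod z * 1"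
      using that by (simp add: norm_mult mult_left_le)
    ultimately show False using z by simp
  qed
  have "((\<lambda>t. H (cis t) / (1 - cnj z * cis t)\<^sup>2 * cis t) has_integral 0) {0..2*pi}"
  proof (rule circle_conj_integral_zero)
    show "continuous_on (cball 0 1) (\<lambda>u. H u / (1 - cnj z * u)\<^sup>2)"
      using nz by (intro continuous_intros H(1)) auto
    show "(\<lambda>u. H u / (1 - cnj z * u)\<^sup>2) holomorphic_on ball 0 1"
      using nz by (intro holomorphic_intros H_holomorphic) auto
  qed
  from has_integral_linear [OF this bounded_linear_cnj]
  have "((\<lambda>t. cnj (H (cis t) / (1 - cnj z * cis t)\<^sup>2 * cis t)) has_integral 0) {0..2*pi}"
    by (simp add: o_def)
  moreover have "cnj (H (cis t) / (1 - cnj z * cis t)\<^sup>2 * cis t) = cnj (H (cis t)) * (cis t / (cis t - z)\<^sup>2)" for t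
  proof -
    have "cis t - z = cis t * (1 - z * cis (- t))"
      by (simp add: algebra_simps cis_mult)
    then have sq: "(cis t - z)\<^sup>2 = (cis t)\<^sup>2 * (1 - z * cis (- t))\<^sup>2"
      by (simp add: power_mult_distrib)
    have cancel: "cis t / ((cis t)\<^sup>2 * X) = cis (- t) / X" for X
      unfolding cis_inverse [symmetric] by (simp add: power2_eq_square divide_inverse cis_mult)
    have "cis t / (cis t - z)\<^sup>2 = cis (- t) / (1 - z * cis (- t))\<^sup>2"
      unfolding sq by (rule cancel)
    then show ?thesis by (simp add: cis_cnj)
  qed
  ultimately have "((\<lambda>t. cnj (H (cis t)) * (cis t / (cis t - z)\<^sup>2)) has_integral 0) {0..2*pi}"
    by simp
  then have 2: "((\<lambda>t. \<i> * (cnj (H (cis t)) * (cis t / (cis t - z)\<^sup>2))) has_integral \<i> * 0) {0..2*pi}"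
    by (rule has_integral_mult_right)
  have "((\<lambda>t. (1 / (2 * \<i>)) * (H (cis t) / (cis t - z)\<^sup>2 * \<i> * cis t - \<i> * (cnj (H (cis t)) * (cis t / (cis t - z)\<^sup>2))))
      has_integral (1 / (2 * \<i>)) * (2 * of_real pi * \<i> * deriv H z - \<i> * 0)) {0..2*pi}"
    by (intro has_integral_mult_right has_integral_diff 1 2)
  moreover have "(1 / (2 * \<i>)) * (H (cis t) / (cis t - z)\<^sup>2 * \<i> * cis t - \<i> * (cnj (H (cis t)) * (cis t / (cis t - z)\<^sup>2)))
      = of_real (Im (H (cis t))) * (\<i> * cis t / (cis t - z)\<^sup>2)" for t
  proof -
    have "H (cis t) - cnj (H (cis t)) = 2 * \<i> * of_real (Im (H (cis t)))"
      by (simp add: complex_eq_iff)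
    then have *: "of_real (Im (H (cis t))) = (1 / (2 * \<i>)) * (H (cis t) - cnj (H (cis t)))" by simp
    have "h / Q * \<i> * e - \<i> * (h' * (e / Q)) = (h - h') * (\<i> * e / Q)" for h h' Q e :: complex
      by (simp add: divide_inverse algebra_simps)
    then show ?thesis unfolding * by (simp only: mult.assoc)
  qed
  moreover have "(1 / (2 * \<i>)) * (2 * of_real pi * \<i> * deriv H z - \<i> * 0) = of_real pi * deriv H z"
    by (simp add: field_simps)
  ultimately show ?thesis by (simp only:)
qed

lemma alpha'_bounded: obtains M where "M > 0" "\<And>s. \<alpha>' s \<le> M"
proof -
  have "compact (closure \<Omega>)" using bounded_Omega by (simp add: compact_closure)
  then have "bounded (\<Psi>' ` closure \<Omega>)"
    using cont_Psi' by (intro compact_imp_bounded compact_continuous_image)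
  then obtain M where M: "M > 0" "\<And>z. z \<in> closure \<Omega> \<Longrightarrow> cmod (\<Psi>' z) \<le> M"
    unfolding bounded_pos by blast
  then show thesis using that gamma_closure unfolding \<alpha>'_def by blast
qed

lemma w_minus_nz: "z \<in> ball 0 1 \<Longrightarrow> w s - z \<noteq> 0"
  using norm_w [of s] by (auto simp del: norm_w)

text \<open>The curvature is \<theta>' almost everywhere, so integrate by parts against 1 / (w - z).
  To make the boundary terms cancel, \<theta> is replaced by the periodic \<theta> - \<alpha> = pi /
  2 + Im H(w): the constant pi / 2 meets the derivative of a closed curve and gives 0, Im H gives pi
  H'. The part \<alpha>' set aside integrates to 0.\<close>

lemma deriv_H_formula:
  assumes z: "z \<in> ball 0 1"
  shows "((\<lambda>s. of_real (curvature_at \<gamma> s) / (w s - z)) has_integral (of_real pi * deriv H z)) {0..L}"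
proof -
  obtain K where K: "K \<ge> 0" "\<And>s t. \<bar>\<theta> s - \<theta> t\<bar> \<le> K * \<bar>s - t\<bar>" using theta_lipschitz by blast
  obtain N where N: "negligible N" "\<And>s. s \<notin> N \<Longrightarrow> (\<theta> has_real_derivative curvature_at \<gamma> s) (at s)"
    using theta_AE_deriv by blast
  obtain M where M: "M > 0" "\<And>s. \<alpha>' s \<le> M" using alpha'_bounded by blast
  define g where "g s = \<theta> s - \<alpha> s" for s
  have alip: "\<bar>\<alpha> s - \<alpha> t\<bar> \<le> M * \<bar>s - t\<bar>" for s t
  proof -
    have "norm (\<alpha> s - \<alpha> t) \<le> M * norm (s - t)"
      by (rule field_differentiable_bound [of UNIV \<alpha> \<alpha>'])
        (use alpha_deriv M alpha'_pos in \<open>auto simp: less_imp_le\<close>)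
    then show ?thesis by simp
  qed
  have glip: "\<bar>g s - g t\<bar> \<le> (K + M) * \<bar>s - t\<bar>" for s t
    using K(2) [of s t] alip [of s t] unfolding g_def by (simp add: distrib_right)
  let ?q = "\<lambda>s. 1 / (w s - z)"
  let ?q' = "\<lambda>s. - (\<i> * of_real (\<alpha>' s) * w s) / (w s - z)\<^sup>2"
  have q: "(?q has_vector_derivative ?q' s) (at s)" for s
  proof -
    have "(w has_vector_derivative \<i> * of_real (\<alpha>' s) * w s) (at s)"
      using w_deriv [of s] by (simp add: w_velocity)
    moreover have "((\<lambda>u. 1 / (u - z)) has_field_derivative - 1 / (w s - z)\<^sup>2) (at (w s))"
      using w_minus_nz [OF z, of s] by (auto intro!: derivative_eq_intros simp: power2_eq_square)
    ultimately have "(((\<lambda>u. 1 / (u - z)) \<circ> w) has_vector_derivative (\<i> * of_real (\<alpha>' s) * w s) * (- 1 / (w s - z)\<^sup>2)) (at s)"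
      by (rule field_vector_diff_chain_at)
    then show ?thesis by (simp add: o_def)
  qed
  have q': "continuous_on {0..L} ?q'"
    using w_minus_nz [OF z] by (intro continuous_intros continuous_w continuous_alpha') auto
  have per: "g L = g 0" "w L = w 0"
    using theta_periodic [of 0] alpha_periodic [of 0] w_periodic [of 0] by (auto simp: g_def)
  have "((\<lambda>s. of_real (curvature_at \<gamma> s - \<alpha>' s) * ?q s) has_integral
      (g L * ?q L - g 0 * ?q 0 - integral {0..L} (\<lambda>s. g s * ?q' s))) {0..L}"
    by (rule lipschitz_integration_by_parts [OF glip N(1) _ _ q q'])
      (use L_pos N(2) alpha_deriv in \<open>auto simp: g_def [abs_def] intro!: derivative_intros\<close>)
  then have 1: "((\<lambda>s. of_real (curvature_at \<gamma> s - \<alpha>' s) * ?q s) has_integral (- integral {0..L} (\<lambda>s. g s * ?q' s))) {0..L}"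
    by (simp add: per)
  have gs: "g s = pi / 2 + Im (H (w s))" for s by (simp add: g_def \<theta>_def)
  have nzu: "u - z \<noteq> 0" if "u \<in> sphere 0 1" for u using z that by auto
  have 2: "((\<lambda>s. of_real (\<alpha>' s) * (of_real (Im (H (w s))) * (\<i> * w s / (w s - z)\<^sup>2))) has_integral
     integral {0..2*pi} (\<lambda>t. of_real (Im (H (cis t))) * (\<i> * cis t / (cis t - z)\<^sup>2))) {0..L}"
    using nzu continuous_on_subset [OF H(1)] by (intro circle_substitution continuous_intros) auto
  have 3: "((\<lambda>s. of_real (pi / 2) * ?q' s) has_integral of_real (pi / 2) * (?q L - ?q 0)) {0..L}"
    by (intro has_integral_mult_right fundamental_theorem_of_calculus)
      (use L_pos q in \<open>auto intro: has_vector_derivative_at_within\<close>)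
  have "((\<lambda>s. of_real (pi / 2) * ?q' s - of_real (\<alpha>' s) * (of_real (Im (H (w s))) * (\<i> * w s / (w s - z)\<^sup>2))) has_integral
      (of_real (pi / 2) * (?q L - ?q 0) - of_real pi * deriv H z)) {0..L}"
    using has_integral_diff [OF 3 2] integral_unique [OF H_Cauchy [OF z]] by simp
  moreover have "of_real (pi / 2) * ?q' s - of_real (\<alpha>' s) * (of_real (Im (H (w s))) * (\<i> * w s / (w s - z)\<^sup>2)) = of_real (g s) * ?q' s" for s
  proof -
    have e: "of_real (\<alpha>' s) * (of_real m * (\<i> * w s / (w s - z)\<^sup>2)) = - (of_real m * ?q' s)" for m
      by (simp add: mult_ac)
    show ?thesis unfolding e gs by (simp only: of_real_add distrib_right diff_minus_eq_add)
  qed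
  ultimately have "((\<lambda>s. of_real (g s) * ?q' s) has_integral (- (of_real pi * deriv H z))) {0..L}"
    by (simp add: per)
  then have "integral {0..L} (\<lambda>s. of_real (g s) * ?q' s) = - (of_real pi * deriv H z)"
    by (rule integral_unique)
  with 1 have 4: "((\<lambda>s. of_real (curvature_at \<gamma> s - \<alpha>' s) * ?q s) has_integral (of_real pi * deriv H z)) {0..L}"
    by simp
  \<comment> \<open>With respect to the angle, 1 / (cis t - z) integrates to 0: it is the conjugate
    of cis t / (1 - cnj z cis t).\<close>
  have 5: "((\<lambda>s. of_real (\<alpha>' s) * ?q s) has_integral 0) {0..L}"
  proof -
    have "((\<lambda>t. 1 / (1 - cnj z * cis t) * cis t) has_integral 0) {0..2*pi}"
    proof (rule circle_conj_integral_zero)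
      have nz: "1 - cnj z * u \<noteq> 0" if "u \<in> cball 0 1" for u
      proof
        assume "1 - cnj z * u = 0"
        then have "cmod (cnj z * u) = 1" by (metis eq_iff_diff_eq_0 norm_one)
        moreover have "cmod (cnj z * u) \<le> cmod z * 1"
          using that by (simp add: norm_mult mult_left_le)
        ultimately show False using z by simp
      qed
      show "continuous_on (cball 0 1) (\<lambda>u. 1 / (1 - cnj z * u))"
        using nz by (intro continuous_intros) auto
      show "(\<lambda>u. 1 / (1 - cnj z * u)) holomorphic_on ball 0 1"
        using nz by (intro holomorphic_intros) auto
    qed
    from has_integral_linear [OF this bounded_linear_cnj]
    have "((\<lambda>t. cnj (1 / (1 - cnj z * cis t) * cis t)) has_integral 0) {0..2*pi}"
      by (simp add: o_def)
    moreover have "cnj (1 / (1 - cnj z * cis t) * cis t) = 1 / (cis t - z)" for t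
    proof -
      have "cis t - z = cis t * (1 - z * cis (- t))"
        by (simp add: algebra_simps cis_mult)
      then show ?thesis by (simp add: cis_cnj cis_inverse [symmetric] field_simps)
    qed
    ultimately have "integral {0..2*pi} (\<lambda>t. 1 / (cis t - z)) = 0"
      by (simp add: integral_unique)
    moreover have "((\<lambda>s. of_real (\<alpha>' s) * (1 / (w s - z))) has_integral integral {0..2*pi} (\<lambda>t. 1 / (cis t - z))) {0..L}"
      using nzu by (intro circle_substitution continuous_intros) auto
    ultimately show ?thesis by simp
  qed
  have "((\<lambda>s. of_real (curvature_at \<gamma> s - \<alpha>' s) * ?q s + of_real (\<alpha>' s) * ?q s) has_integral (of_real pi * deriv H z + 0)) {0..L}"
    by (rule has_integral_add [OF 4 5])
  moreover have "of_real (curvature_at \<gamma> s - \<alpha>' s) * ?q s + of_real (\<alpha>' s) * ?q s = of_real (curvature_at \<gamma> s) / (w s - z)" for s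
    by (simp add: diff_divide_distrib)
  ultimately show ?thesis by simp
qed

end

section \<open>Absolute integrability of boundary poles\<close>

lemma one_over_root4_ge_1:
  assumes "z \<in> ball (0::complex) 1"
  shows "1 \<le> 1 / root 4 (1 - cmod z)" "0 < root 4 (1 - cmod z)"
proof -
  show "0 < root 4 (1 - cmod z)" using assms by simp
  moreover have "root 4 (1 - cmod z) \<le> 1" using assms by simp
  ultimately show "1 \<le> 1 / root 4 (1 - cmod z)" by simp
qed

lemma absolutely_integrable_on_ball_bound:
  fixes f :: "complex \<Rightarrow> complex" and g :: "complex \<Rightarrow> real"
  assumes "continuous_on (ball 0 1) f" "g absolutely_integrable_on ball 0 1" "\<And>z. z \<in> ball 0 1 \<Longrightarrow> cmod (f z) \<le> g z"
  shows "f absolutely_integrable_on ball 0 1"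
proof (rule measurable_bounded_by_integrable_imp_absolutely_integrable)
  show "f \<in> borel_measurable (lebesgue_on (ball 0 1))"
    by (intro continuous_imp_measurable_on_sets_lebesgue assms) auto
  show "g integrable_on ball 0 1" using assms(2) by (simp add: absolutely_integrable_on_def)
qed (use assms in auto)

lemma inverse_distance_absolutely_integrable:
  assumes "cmod b = 1"
  shows "(\<lambda>z. 1 / (b - z)) absolutely_integrable_on ball 0 1"
proof (rule disc_bound_absolutely_integrable [OF _ assms])
  have "b - z \<noteq> 0" if "z \<in> ball 0 1" for z using that assms by auto
  then show "continuous_on (ball 0 1) (\<lambda>z. 1 / (b - z))" by (intro continuous_intros) auto
  show "cmod (1 / (b - z)) \<le> 1 * (1 / root 4 (1 - cmod z)) * (1 / cmod (b - z) + 1 / root 4 (1 - cmod z))"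
    if z: "z \<in> ball 0 1" for z
  proof -
    have "1 * (1 / cmod (b - z) + 0) \<le> (1 / root 4 (1 - cmod z)) * (1 / cmod (b - z) + 1 / root 4 (1 - cmod z))"
      using one_over_root4_ge_1 [OF z] by (intro mult_mono add_mono) auto
    then show ?thesis by (simp add: norm_divide)
  qed
qed

text \<open>|b - c| is at most the sum x + y of the two distances, which gives 1 / (x y) \<le> (1 /
  x + 1 / y) / |b - c|: two distinct simple poles are no worse than single ones.\<close>

lemma two_pole_absolutely_integrable:
  assumes b: "cmod b = 1" and c: "cmod c = 1" and bc: "b \<noteq> c"
  shows "(\<lambda>z. 1 / (b - z) / cnj (c - z)) absolutely_integrable_on ball 0 1"
proof (rule absolutely_integrable_on_ball_bound)
  have nb: "b - z \<noteq> 0" and nc: "c - z \<noteq> 0" if "z \<in> ball 0 1" for z using that b c by auto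
  show "continuous_on (ball 0 1) (\<lambda>z. 1 / (b - z) / cnj (c - z))"
    using nb nc by (intro continuous_intros) auto
  have "(\<lambda>z. norm (1 / (b - z)) + norm (1 / (c - z))) absolutely_integrable_on ball 0 1"
    by (rule set_integral_add [OF set_integrable_norm [OF inverse_distance_absolutely_integrable [OF b]]
          set_integrable_norm [OF inverse_distance_absolutely_integrable [OF c]]])
  then show "(\<lambda>z. (1 / cmod (b - c)) * (norm (1 / (b - z)) + norm (1 / (c - z)))) absolutely_integrable_on ball 0 1"
    by (rule set_integrable_mult_right)
  show "cmod (1 / (b - z) / cnj (c - z)) \<le> (1 / cmod (b - c)) * (norm (1 / (b - z)) + norm (1 / (c - z)))"
    if z: "z \<in> ball 0 1" for z
  proof -
    define x where "x = cmod (b - z)"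
    define y where "y = cmod (c - z)"
    have xy: "x > 0" "y > 0" using nb [OF z] nc [OF z] by (auto simp: x_def y_def)
    have D: "cmod (b - c) > 0" using bc by simp
    have "cmod (b - c) \<le> x + y"
      unfolding x_def y_def using norm_triangle_ineq4 [of "b - z" "c - z"] by simp
    then have "1 / (x * y) \<le> (1 / cmod (b - c)) * (1 / x + 1 / y)"
      using xy D by (simp add: field_simps)
    moreover have "cmod (1 / (b - z) / cnj (c - z)) = 1 / (x * y)"
      by (simp add: norm_divide norm_mult x_def y_def del: complex_cnj_diff)
    ultimately show ?thesis by (simp add: norm_divide x_def y_def)
  qed
qed

text \<open>This branch of the primitive of 1 / (b - z) vanishes at 0 and extends continuously to
  every other point of the circle, as \<open>disc_kernel_integral\<close> requires.\<close>

lemma Ln_one_minus_radial: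
  assumes b: "cmod b = 1" and c: "cmod c = 1" and bc: "b \<noteq> c"
  shows "((\<lambda>r. - Ln (1 - of_real r * c / b)) \<longlongrightarrow> - Ln (1 - c / b)) (at_left 1)"
    and "z \<in> ball 0 1 \<Longrightarrow> ((\<lambda>z. - Ln (1 - z / b)) has_field_derivative 1 / (b - z)) (at z)"
proof -
  have bn: "b \<noteq> 0" using b by auto
  have pos: "1 - z / b \<notin> \<real>\<^sub>\<le>\<^sub>0" if "cmod z \<le> 1" "z \<noteq> b" for z
  proof -
    have "Re (1 - z / b) > 0" using that b bn by (intro Re_one_minus_pos) (auto simp: norm_divide)
    then show ?thesis by (auto simp: complex_nonpos_Reals_iff)
  qed
  have "((\<lambda>r. - Ln (1 - of_real r * c / b)) \<longlongrightarrow> - Ln (1 - of_real 1 * c / b)) (at_left 1)"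
    by (intro tendsto_intros tendsto_Ln) (use pos [of c] c bc bn in auto)
  then show "((\<lambda>r. - Ln (1 - of_real r * c / b)) \<longlongrightarrow> - Ln (1 - c / b)) (at_left 1)" by simp
  assume z: "z \<in> ball 0 1"
  have "z \<noteq> b" using z b by force
  then have n: "1 - z / b \<notin> \<real>\<^sub>\<le>\<^sub>0" using pos [of z] z by simp
  have ne: "b - z \<noteq> 0" using z b by auto
  have e: "- (- (1 / b) / (1 - z / b)) = 1 / (b - z)"
    using ne bn by (simp add: divide_simps)
  have "((\<lambda>z. - Ln (1 - z / b)) has_field_derivative - (- (1 / b) / (1 - z / b))) (at z)"
    using n bn by (auto intro!: derivative_eq_intros simp: field_simps)
  then show "((\<lambda>z. - Ln (1 - z / b)) has_field_derivative 1 / (b - z)) (at z)" unfolding e .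
qed

lemma two_pole_integral:
  assumes b: "cmod b = 1" and c: "cmod c = 1" and bc: "b \<noteq> c"
  shows "integral (ball 0 1) (\<lambda>z. 1 / (b - z) / cnj (c - z)) = - of_real pi * Ln (1 - c / b)"
proof -
  have "integral (ball 0 1) (\<lambda>z. 1 / (b - z) / cnj (c - z)) = of_real pi * (- Ln (1 - c / b) - (- Ln (1 - 0 / b)))"
    by (rule disc_kernel_integral [OF Ln_one_minus_radial(2) [OF b c bc] c two_pole_absolutely_integrable [OF b c bc]
        Ln_one_minus_radial(1) [OF b c bc]])
  then show ?thesis by simp
qed

lemma Re_Ln_one_minus:
  assumes "cmod b = 1" "b \<noteq> c"
  shows "Re (Ln (1 - c / b)) = ln (cmod (c - b))"
proof -
  have bn: "b \<noteq> 0" using assms by auto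
  have "1 - c / b = (b - c) / b" using bn by (simp add: field_simps)
  moreover have "cmod ((b - c) / b) = cmod (c - b)" using assms by (simp add: norm_divide norm_minus_commute)
  ultimately show ?thesis using assms bn by (simp add: Re_Ln)
qed

section \<open>A Borel version of the curvature and the size of its kernel\<close>

context conformal_parametrisation
begin

text \<open>Where the tangent is not differentiable, \<open>curvature_at\<close> has an unspecified
  value, so measurability and boundedness are known only up to a null set. The product-measure
  argument works with a bounded Borel function instead, equal to it almost everywhere.\<close>

definition \<kappa>b :: "real \<Rightarrow> real" where
  "\<kappa>b = (SOME k. k \<in> borel_measurable borel \<and> (\<exists>K>0. \<forall>s. \<bar>k s\<bar> \<le> K) \<and> negligible {s. k s \<noteq> curvature_at \<gamma> s})"

lemma kappa_b: "\<kappa>b \<in> borel_measurable borel" "\<exists>K>0. \<forall>s. \<bar>\<kappa>b s\<bar> \<le> K" "negligible {s. \<kappa>b s \<noteq> curvature_at \<gamma> s}"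
proof -
  obtain K where K: "K \<ge> 0" "\<And>s t. \<bar>\<theta> s - \<theta> t\<bar> \<le> K * \<bar>s - t\<bar>" using theta_lipschitz by blast
  obtain N where N: "negligible N" "\<And>s. s \<notin> N \<Longrightarrow> (\<theta> has_real_derivative curvature_at \<gamma> s) (at s)"
    using theta_AE_deriv by blast
  define g where "g n s = (\<theta> (s + 1 / real (Suc n)) - \<theta> s) / (1 / real (Suc n))" for n s
  \<comment> \<open>The limit of continuous difference quotients. Where they diverge,
    \<open>lim\<close> is an unspecified number; clamping at K + 1 bounds it there and leaves the
    derivative, at most K in modulus, unchanged elsewhere.\<close>
  define k where "k s = max (- (K + 1)) (min (K + 1) (lim (\<lambda>n. g n s)))" for s
  have gm: "g n \<in> borel_measurable borel" for n
    unfolding g_def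
    by (intro borel_measurable_continuous_onI continuous_intros continuous_on_compose2 [OF continuous_theta [of UNIV]]
        continuous_theta) auto
  have km: "k \<in> borel_measurable borel"
    unfolding k_def by (intro borel_measurable_max borel_measurable_min borel_measurable_lim_metric gm) auto
  have kb: "\<bar>k s\<bar> \<le> K + 1" for s using K(1) by (auto simp: k_def max_def min_def)
  have keq: "k s = curvature_at \<gamma> s" if s: "s \<notin> N" for s
  proof -
    have "((\<lambda>y. (\<theta> y - \<theta> s) / (y - s)) \<longlongrightarrow> curvature_at \<gamma> s) (at s)"
      using N(2) [OF s] by (simp add: has_field_derivative_iff)
    moreover have "filterlim (\<lambda>n. s + 1 / real (Suc n)) (at s) sequentially"
      unfolding filterlim_at
    proof
      have "(\<lambda>n. s + 1 / real (Suc n)) \<longlonglongrightarrow> s + 0"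
        by (intro tendsto_intros lim_1_over_n [THEN LIMSEQ_Suc])
      then show "(\<lambda>n. s + 1 / real (Suc n)) \<longlonglongrightarrow> s" by simp
    qed auto
    ultimately have "(\<lambda>n. (\<theta> (s + 1 / real (Suc n)) - \<theta> s) / (s + 1 / real (Suc n) - s)) \<longlonglongrightarrow> curvature_at \<gamma> s"
      by (rule filterlim_compose)
    then have lim: "(\<lambda>n. g n s) \<longlonglongrightarrow> curvature_at \<gamma> s" by (simp add: g_def)
    have "\<bar>g n s\<bar> \<le> K" for n
    proof -
      have "\<bar>\<theta> (s + 1 / real (Suc n)) - \<theta> s\<bar> \<le> K * (1 / real (Suc n))"
        using K(2) [of "s + 1 / real (Suc n)" s] by simp
      then show ?thesis unfolding g_def abs_divide by (subst pos_divide_le_eq) auto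
    qed
    then have "\<bar>curvature_at \<gamma> s\<bar> \<le> K"
      using tendsto_rabs [OF lim] by (intro LIMSEQ_le_const2 [of "\<lambda>n. \<bar>g n s\<bar>"]) auto
    then show ?thesis using limI [OF lim] by (auto simp: k_def max_def min_def)
  qed
  have "negligible {s. k s \<noteq> curvature_at \<gamma> s}"
    by (rule negligible_subset [OF N(1)]) (use keq in auto)
  then have "\<exists>k. k \<in> borel_measurable borel \<and> (\<exists>K>0. \<forall>s. \<bar>k s\<bar> \<le> K) \<and> negligible {s. k s \<noteq> curvature_at \<gamma> s}"
    using km kb K(1) by (intro exI [of _ k] conjI exI [of _ "K + 1"]) auto
  then have "\<kappa>b \<in> borel_measurable borel \<and> (\<exists>K>0. \<forall>s. \<bar>\<kappa>b s\<bar> \<le> K) \<and> negligible {s. \<kappa>b s \<noteq> curvature_at \<gamma> s}"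
    unfolding \<kappa>b_def by (rule someI_ex)
  then show "\<kappa>b \<in> borel_measurable borel" "\<exists>K>0. \<forall>s. \<bar>\<kappa>b s\<bar> \<le> K" "negligible {s. \<kappa>b s \<noteq> curvature_at \<gamma> s}"
    by blast+
qed

text \<open>Dividing by the minimum of \<alpha>' over a period passes from arc length to the angle,
  where the circle estimate applies.\<close>

lemma kernel_integral_bound:
  obtains C where "C > 0" "\<And>z. z \<in> ball 0 1 \<Longrightarrow> integral {0..L} (\<lambda>s. 1 / cmod (w s - z)) \<le> C / root 4 (1 - cmod z)"
proof -
  obtain C where C: "C > 0"
    "\<And>z. z \<in> ball 0 1 \<Longrightarrow> integral {0..2*pi} (\<lambda>t. 1 / cmod (cis t - z)) \<le> C / root 4 (1 - cmod z)"
    using circle_distance_integral_bound by blast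
  obtain s0 where s0: "s0 \<in> {0..L}" "\<And>s. s \<in> {0..L} \<Longrightarrow> \<alpha>' s0 \<le> \<alpha>' s"
    using continuous_attains_inf [of "{0..L}" \<alpha>'] continuous_alpha' L_pos by auto
  define c where "c = \<alpha>' s0"
  have c: "c > 0" unfolding c_def by (rule alpha'_pos)
  show thesis
  proof
    show "C / c > 0" using C c by simp
    fix z assume z: "z \<in> ball (0::complex) 1"
    have nz: "u - z \<noteq> 0" if "u \<in> sphere 0 1" for u using z that by auto
    have "((\<lambda>s. complex_of_real (\<alpha>' s) * of_real (1 / cmod (w s - z))) has_integral integral {0..2*pi} (\<lambda>t. of_real (1 / cmod (cis t - z)))) {0..L}"
      using nz by (intro circle_substitution continuous_intros) auto
    then have "((\<lambda>s. Re (complex_of_real (\<alpha>' s) * of_real (1 / cmod (w s - z)))) has_integral Re (integral {0..2*pi} (\<lambda>t. complex_of_real (1 / cmod (cis t - z))))) {0..L}"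
      by (rule has_integral_Re)
    moreover have "Re (integral {0..2*pi} (\<lambda>t. complex_of_real (1 / cmod (cis t - z)))) = integral {0..2*pi} (\<lambda>t. 1 / cmod (cis t - z))"
    proof -
      have "(\<lambda>t. 1 / cmod (cis t - z)) integrable_on {0..2*pi}"
        using nz by (intro integrable_continuous_interval continuous_intros) auto
      then have "integral {0..2*pi} (\<lambda>t. complex_of_real (1 / cmod (cis t - z))) = of_real (integral {0..2*pi} (\<lambda>t. 1 / cmod (cis t - z)))"
        using integral_linear [OF _ bounded_linear_of_real [where 'a = complex]] by (simp only: o_def)
      then show ?thesis by simp
    qed
    ultimately have 1: "((\<lambda>s. \<alpha>' s * (1 / cmod (w s - z))) has_integral integral {0..2*pi} (\<lambda>t. 1 / cmod (cis t - z))) {0..L}"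
      by simp
    have "continuous_on {0..L} (\<lambda>s. 1 / cmod (w s - z))"
      using w_minus_nz [OF z] by (intro continuous_intros continuous_w) auto
    then have "((\<lambda>s. c * (1 / cmod (w s - z))) has_integral c * integral {0..L} (\<lambda>s. 1 / cmod (w s - z))) {0..L}"
      by (intro has_integral_mult_right integrable_integral integrable_continuous_interval)
    then have "c * integral {0..L} (\<lambda>s. 1 / cmod (w s - z)) \<le> integral {0..2*pi} (\<lambda>t. 1 / cmod (cis t - z))"
      by (rule has_integral_le [OF _ 1]) (use s0(2) in \<open>auto simp: c_def intro!: divide_right_mono\<close>)
    also have "\<dots> \<le> C / root 4 (1 - cmod z)" by (rule C(2) [OF z])
    finally have "c * integral {0..L} (\<lambda>s. 1 / cmod (w s - z)) \<le> C / root 4 (1 - cmod z)" .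
    moreover have "x \<le> y / c" if "c * x \<le> y" for x y
      using c that by (simp add: pos_le_divide_eq mult.commute)
    ultimately have "integral {0..L} (\<lambda>s. 1 / cmod (w s - z)) \<le> C / root 4 (1 - cmod z) / c"
      by blast
    then show "integral {0..L} (\<lambda>s. 1 / cmod (w s - z)) \<le> C / c / root 4 (1 - cmod z)"
      by (simp add: mult.commute)
  qed
qed

lemma kappa_b_kernel_integrable:
  assumes z: "z \<in> ball 0 1"
  shows "set_integrable lborel {0..L} (\<lambda>s. of_real (\<kappa>b s) / (w s - z))"
    and "(LINT s:{0..L}|lborel. of_real (\<kappa>b s) / (w s - z)) = of_real pi * deriv H z"
proof -
  obtain K where K: "K > 0" "\<And>s. \<bar>\<kappa>b s\<bar> \<le> K" using kappa_b(2) by blast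
  have c: "continuous_on {0..L} (\<lambda>s. 1 / (w s - z))"
    using w_minus_nz [OF z] by (intro continuous_intros continuous_w) auto
  have i: "set_integrable lborel {0..L} (\<lambda>s. K *\<^sub>R (1 / (w s - z)))"
    by (intro borel_integrable_atLeastAtMost' continuous_intros c)
  show si: "set_integrable lborel {0..L} (\<lambda>s. of_real (\<kappa>b s) / (w s - z))"
    unfolding set_integrable_def
  proof (rule Bochner_Integration.integrable_bound [OF i [unfolded set_integrable_def]])
    have "(\<lambda>s. indicator {0..L} s *\<^sub>R (1 / (w s - z))) \<in> borel_measurable lborel"
      using borel_measurable_continuous_on_indicator [OF _ c] by simp
    then have "(\<lambda>s. complex_of_real (\<kappa>b s) * (indicator {0..L} s *\<^sub>R (1 / (w s - z)))) \<in> borel_measurable lborel"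
      using kappa_b(1) by (intro borel_measurable_times) auto
    then show "(\<lambda>s. indicator {0..L} s *\<^sub>R (of_real (\<kappa>b s) / (w s - z))) \<in> borel_measurable lborel"
      by (simp add: scaleR_conv_of_real mult_ac)
    show "AE s in lborel. norm (indicator {0..L} s *\<^sub>R (of_real (\<kappa>b s) / (w s - z))) \<le> norm (indicator {0..L} s *\<^sub>R K *\<^sub>R (1 / (w s - z)))"
      using K by (intro AE_I2) (auto simp: norm_divide indicator_def intro!: divide_right_mono)
  qed
  have "((\<lambda>s. of_real (\<kappa>b s) / (w s - z)) has_integral (of_real pi * deriv H z)) {0..L}"
    by (rule has_integral_spike [OF kappa_b(3) _ deriv_H_formula [OF z]]) auto
  then show "(LINT s:{0..L}|lborel. of_real (\<kappa>b s) / (w s - z)) = of_real pi * deriv H z"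
    using set_borel_integral_eq_integral(2) [OF si] by (simp add: integral_unique)
qed

text \<open>The integral of the kernel in absolute value is bounded along with |H'|, because
  exchanging integrals later rests on the former.\<close>

lemma kernel_norm_bound:
  obtains C where "C > 0"
    "\<And>z. z \<in> ball 0 1 \<Longrightarrow> (LINT s:{0..L}|lborel. norm (complex_of_real (\<kappa>b s) / (w s - z))) \<le> C / root 4 (1 - cmod z)"
    "\<And>z. z \<in> ball 0 1 \<Longrightarrow> cmod (deriv H z) \<le> C / root 4 (1 - cmod z)"
proof -
  obtain K where K: "K > 0" "\<And>s. \<bar>\<kappa>b s\<bar> \<le> K" using kappa_b(2) by blast
  obtain C where C: "C > 0" "\<And>z. z \<in> ball 0 1 \<Longrightarrow> integral {0..L} (\<lambda>s. 1 / cmod (w s - z)) \<le> C / root 4 (1 - cmod z)"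
    using kernel_integral_bound by blast
  have 1: "(LINT s:{0..L}|lborel. norm (complex_of_real (\<kappa>b s) / (w s - z))) \<le> K * C / root 4 (1 - cmod z)" if z: "z \<in> ball 0 1" for z
  proof -
    have "continuous_on {0..L} (\<lambda>s. 1 / cmod (w s - z))"
      using w_minus_nz [OF z] by (intro continuous_intros continuous_w) auto
    then have si: "set_integrable lborel {0..L} (\<lambda>s. 1 / cmod (w s - z))"
      by (rule borel_integrable_atLeastAtMost')
    have "(LINT s:{0..L}|lborel. norm (complex_of_real (\<kappa>b s) / (w s - z))) \<le> (LINT s:{0..L}|lborel. K * (1 / cmod (w s - z)))"
      unfolding set_lebesgue_integral_def
    proof (rule integral_mono)
      show "integrable lborel (\<lambda>s. indicator {0..L} s *\<^sub>R norm (complex_of_real (\<kappa>b s) / (w s - z)))"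
        using set_integrable_norm [OF kappa_b_kernel_integrable(1) [OF z]] by (simp add: set_integrable_def)
      show "integrable lborel (\<lambda>s. indicator {0..L} s *\<^sub>R (K * (1 / cmod (w s - z))))"
        using set_integrable_mult_right [OF si, of K] by (simp add: set_integrable_def)
      show "indicator {0..L} s *\<^sub>R norm (complex_of_real (\<kappa>b s) / (w s - z)) \<le> indicator {0..L} s *\<^sub>R (K * (1 / cmod (w s - z)))" for s
        using K by (auto simp: norm_divide indicator_def intro!: divide_right_mono)
    qed
    also have "\<dots> = K * integral {0..L} (\<lambda>s. 1 / cmod (w s - z))"
      unfolding set_integral_mult_right using set_borel_integral_eq_integral(2) [OF si] by simp
    also have "\<dots> \<le> K * (C / root 4 (1 - cmod z))"
      using C(2) [OF z] K by (intro mult_left_mono) auto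
    finally show ?thesis by simp
  qed
  have 2: "cmod (deriv H z) \<le> K * C / root 4 (1 - cmod z)" if z: "z \<in> ball 0 1" for z
  proof -
    have "cmod (of_real pi * deriv H z) \<le> (LINT s:{0..L}|lborel. norm (complex_of_real (\<kappa>b s) / (w s - z)))"
      unfolding kappa_b_kernel_integrable(2) [OF z, symmetric]
      by (rule set_integral_norm_bound [OF kappa_b_kernel_integrable(1) [OF z]])
    then have "pi * cmod (deriv H z) \<le> K * C / root 4 (1 - cmod z)"
      using 1 [OF z] by (simp add: norm_mult)
    moreover have "1 * cmod (deriv H z) \<le> pi * cmod (deriv H z)"
      using pi_ge_two by (intro mult_right_mono) auto
    ultimately show ?thesis by simp
  qed
  show thesis
    using that [of "K * C"] 1 2 K C by simp
qed

lemma deriv_H_bound: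
  obtains C where "C > 0" "\<And>z. z \<in> ball 0 1 \<Longrightarrow> cmod (deriv H z) \<le> C / root 4 (1 - cmod z)"
proof (rule kernel_norm_bound)
  fix C assume "C > 0" "\<And>z. z \<in> ball 0 1 \<Longrightarrow> cmod (deriv H z) \<le> C / root 4 (1 - cmod z)"
  then show thesis by (rule that)
qed

end

section \<open>Evaluation of the disc integrals that contain H'\<close>

context conformal_parametrisation
begin

lemma continuous_deriv_H: "continuous_on (ball 0 1) (deriv H)"
  by (intro holomorphic_on_imp_continuous_on holomorphic_deriv H_holomorphic) auto

lemma continuous_root4_ball: "continuous_on (ball 0 1) (\<lambda>z::complex. 1 / root 4 (1 - cmod z))"
  by (intro continuous_intros) auto

text \<open>Multiply the conjugated representation of pi cnj H' by f and exchange the integrals: the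
  inner disc integral \<open>I s\<close> then has the conjugate Cauchy kernel and can be evaluated.
  The weight (1 - |z|)^(-1/4) in the hypothesis is what integrating the kernel in absolute value
  along the boundary leaves behind.\<close>

lemma kernel_Fubini:
  fixes f :: "complex \<Rightarrow> complex"
  defines "I \<equiv> \<lambda>s. \<integral>z. indicator (ball 0 1) z *\<^sub>R (f z / cnj (w s - z)) \<partial>lborel"
  assumes contf: "continuous_on (ball 0 1) f"
    and int: "(\<lambda>z. f z * of_real (1 / root 4 (1 - cmod z))) absolutely_integrable_on ball 0 1"
  shows "(\<lambda>z. f z * cnj (deriv H z)) absolutely_integrable_on ball 0 1"
    and "set_integrable lborel {0..L} (\<lambda>s. of_real (\<kappa>b s) * I s)"
    and "(LINT s:{0..L}|lborel. of_real (\<kappa>b s) * I s) = of_real pi * integral (ball 0 1) (\<lambda>z. f z * cnj (deriv H z))"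
proof -
  obtain C where C: "C > 0"
    "\<And>z. z \<in> ball 0 1 \<Longrightarrow> (LINT s:{0..L}|lborel. norm (complex_of_real (\<kappa>b s) / (w s - z))) \<le> C / root 4 (1 - cmod z)"
    "\<And>z. z \<in> ball 0 1 \<Longrightarrow> cmod (deriv H z) \<le> C / root 4 (1 - cmod z)"
    using kernel_norm_bound by blast
  let ?B = "ball (0::complex) 1"
  let ?k = "\<lambda>(z, s). (indicator ?B z * indicator {0..L} s) *\<^sub>R (f z * (of_real (\<kappa>b s) / cnj (w s - z)))"
  have ib: "integrable lborel (\<lambda>z. indicator ?B z *\<^sub>R (f z * of_real (1 / root 4 (1 - cmod z))))"
    using absolutely_integrable_on_iff_lborel(1) [of ?B "\<lambda>z. f z * of_real (1 / root 4 (1 - cmod z))"] int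
      continuous_on_mult [OF contf continuous_on_of_real [OF continuous_root4_ball]] by simp
  have mk: "?k \<in> borel_measurable (lborel \<Otimes>\<^sub>M lborel)"
  proof -
    have "continuous_on (?B \<times> {0..L}) (\<lambda>p. f (fst p) / cnj (w (snd p) - fst p))"
      by (intro continuous_intros continuous_on_compose2 [OF contf] continuous_on_compose2 [OF continuous_w [of UNIV]])
        (use w_minus_nz in \<open>auto simp del: complex_cnj_diff\<close>)
    moreover have "?B \<times> {0..L} \<in> sets borel"
      by (intro borel_Times) auto
    ultimately have "(\<lambda>p. indicator (?B \<times> {0..L}) p *\<^sub>R (f (fst p) / cnj (w (snd p) - fst p))) \<in> borel_measurable borel"
      by (intro borel_measurable_continuous_on_indicator)
    then have 1: "(\<lambda>p. indicator (?B \<times> {0..L}) p *\<^sub>R (f (fst p) / cnj (w (snd p) - fst p))) \<in> borel_measurable (lborel \<Otimes>\<^sub>M lborel)"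
      by (simp add: lborel_prod)
    have "(\<lambda>s. complex_of_real (\<kappa>b s)) \<in> borel_measurable lborel"
      using kappa_b(1) by auto
    then have "(\<lambda>p. complex_of_real (\<kappa>b (snd p))) \<in> borel_measurable (lborel \<Otimes>\<^sub>M lborel)"
      by (rule measurable_compose [OF measurable_snd])
    then have "(\<lambda>p. complex_of_real (\<kappa>b (snd p)) * (indicator (?B \<times> {0..L}) p *\<^sub>R (f (fst p) / cnj (w (snd p) - fst p)))) \<in> borel_measurable (lborel \<Otimes>\<^sub>M lborel)"
      by (rule borel_measurable_times [OF _ 1])
    moreover have "(\<lambda>p. complex_of_real (\<kappa>b (snd p)) * (indicator (?B \<times> {0..L}) p *\<^sub>R (f (fst p) / cnj (w (snd p) - fst p)))) = ?k"
      by (auto simp: fun_eq_iff indicator_def)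
    ultimately show ?thesis by simp
  qed
  have cnj_si: "set_integrable lborel {0..L} (\<lambda>s. of_real (\<kappa>b s) / cnj (w s - z))"
    "(LINT s:{0..L}|lborel. of_real (\<kappa>b s) / cnj (w s - z)) = of_real pi * cnj (deriv H z)" if z: "z \<in> ?B" for z
  proof -
    have e: "of_real (\<kappa>b s) / cnj (w s - z) = cnj (of_real (\<kappa>b s) / (w s - z))" for s by simp
    show "set_integrable lborel {0..L} (\<lambda>s. of_real (\<kappa>b s) / cnj (w s - z))"
      unfolding e using integrable_cnj [OF kappa_b_kernel_integrable(1) [OF z, unfolded set_integrable_def]]
      by (simp add: set_integrable_def)
    have "(LINT s:{0..L}|lborel. of_real (\<kappa>b s) / cnj (w s - z)) = cnj (LINT s:{0..L}|lborel. of_real (\<kappa>b s) / (w s - z))"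
      using integral_bounded_linear [OF bounded_linear_cnj kappa_b_kernel_integrable(1) [OF z, unfolded set_integrable_def]]
      unfolding set_lebesgue_integral_def by simp
    then show "(LINT s:{0..L}|lborel. of_real (\<kappa>b s) / cnj (w s - z)) = of_real pi * cnj (deriv H z)"
      using kappa_b_kernel_integrable(2) [OF z] by simp
  qed
  have ks: "?k (z, s) = (indicator ?B z *\<^sub>R f z) * (indicator {0..L} s *\<^sub>R (of_real (\<kappa>b s) / cnj (w s - z)))" for z s
    by (simp add: scaleR_conv_of_real mult_ac)
  have inner_i: "integrable lborel (\<lambda>s. ?k (z, s))" for z
  proof (cases "z \<in> ?B")
    case True
    then show ?thesis
      unfolding ks using cnj_si(1) [OF True] by (intro integrable_mult_right) (auto simp: set_integrable_def)
  qed (simp add: ks)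
  have inner: "(\<integral>s. ?k (z, s) \<partial>lborel) = indicator ?B z *\<^sub>R (of_real pi * (f z * cnj (deriv H z)))" for z
  proof (cases "z \<in> ?B")
    case True
    have "(\<integral>s. ?k (z, s) \<partial>lborel) = (indicator ?B z *\<^sub>R f z) * (LINT s:{0..L}|lborel. of_real (\<kappa>b s) / cnj (w s - z))"
      by (simp only: ks set_lebesgue_integral_def integral_mult_right_zero)
    then show ?thesis
      unfolding cnj_si(2) [OF True] using True by (simp only: indicator_simps scaleR_one mult.left_commute)
  qed (simp add: ks)
  have inner_n: "(\<integral>s. norm (?k (z, s)) \<partial>lborel) \<le> C * norm (indicator ?B z *\<^sub>R (f z * of_real (1 / root 4 (1 - cmod z))))" for z
  proof (cases "z \<in> ?B")
    case True
    have "norm (?k (z, s)) = cmod (f z) * (indicator {0..L} s *\<^sub>R norm (complex_of_real (\<kappa>b s) / (w s - z)))" for s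
      using True by (simp add: norm_mult norm_divide del: complex_cnj_diff)
    then have "(\<integral>s. norm (?k (z, s)) \<partial>lborel) = cmod (f z) * (LINT s:{0..L}|lborel. norm (complex_of_real (\<kappa>b s) / (w s - z)))"
      by (simp only: set_lebesgue_integral_def integral_mult_right_zero)
    also have "\<dots> \<le> cmod (f z) * (C / root 4 (1 - cmod z))"
      using C(2) [OF True] by (intro mult_left_mono) auto
    also have "\<dots> = C * norm (indicator ?B z *\<^sub>R (f z * of_real (1 / root 4 (1 - cmod z))))"
      using True by (simp add: norm_mult norm_divide)
    finally show ?thesis .
  qed (simp add: ks)
  have ik: "integrable (lborel \<Otimes>\<^sub>M lborel) ?k"
  proof (rule lborel_pair.Fubini_integrable [OF mk])
    show "AE z in lborel. integrable lborel (\<lambda>s. ?k (z, s))" using inner_i by simp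
    show "integrable lborel (\<lambda>z. \<integral>s. norm (?k (z, s)) \<partial>lborel)"
    proof (rule Bochner_Integration.integrable_bound)
      show "integrable lborel (\<lambda>z. C * norm (indicator ?B z *\<^sub>R (f z * of_real (1 / root 4 (1 - cmod z)))))"
        by (intro integrable_mult_right integrable_norm ib)
      show "(\<lambda>z. \<integral>s. norm (?k (z, s)) \<partial>lborel) \<in> borel_measurable lborel"
        by (rule lborel.borel_measurable_lebesgue_integral)
          (use measurable_compose [OF mk borel_measurable_norm] in \<open>simp add: case_prod_beta'\<close>)
      show "AE z in lborel. norm (\<integral>s. norm (?k (z, s)) \<partial>lborel) \<le> norm (C * norm (indicator ?B z *\<^sub>R (f z * of_real (1 / root 4 (1 - cmod z)))))"
      proof (rule AE_I2)
        fix z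
        have "0 \<le> (\<integral>s. norm (?k (z, s)) \<partial>lborel)" by (rule Bochner_Integration.integral_nonneg) (rule norm_ge_zero)
        moreover have "norm x \<le> norm y" if "0 \<le> x" "x \<le> y" for x y :: real using that by simp
        ultimately show "norm (\<integral>s. norm (?k (z, s)) \<partial>lborel) \<le> norm (C * norm (indicator ?B z *\<^sub>R (f z * of_real (1 / root 4 (1 - cmod z)))))"
          using inner_n [of z] by blast
      qed
    qed
  qed
  have outer_i: "integrable lborel (\<lambda>z. indicator ?B z *\<^sub>R (of_real pi * (f z * cnj (deriv H z))))"
    using lborel_pair.integrable_fst' [OF ik] unfolding inner .
  have cfH: "continuous_on ?B (\<lambda>z. f z * cnj (deriv H z))"
    by (intro continuous_intros contf continuous_deriv_H)
  have "integrable lborel (\<lambda>z. (1 / of_real pi) * (indicator ?B z *\<^sub>R (of_real pi * (f z * cnj (deriv H z)))))"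
    by (intro integrable_mult_right outer_i)
  then have "integrable lborel (\<lambda>z. indicator ?B z *\<^sub>R (f z * cnj (deriv H z)))"
    by (simp add: scaleR_conv_of_real)
  then show ai: "(\<lambda>z. f z * cnj (deriv H z)) absolutely_integrable_on ?B"
    using absolutely_integrable_on_iff_lborel(1) [OF cfH] by simp
  have other: "(\<integral>z. ?k (z, s) \<partial>lborel) = indicator {0..L} s *\<^sub>R (of_real (\<kappa>b s) * I s)" for s
  proof -
    have "?k (z, s) = (indicator {0..L} s *\<^sub>R of_real (\<kappa>b s)) * (indicator ?B z *\<^sub>R (f z / cnj (w s - z)))" for z
      by (simp add: scaleR_conv_of_real mult_ac)
    then show ?thesis by (simp only: integral_mult_right_zero I_def) simp
  qed
  have "integrable lborel (\<lambda>s. \<integral>z. ?k (z, s) \<partial>lborel)"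
    using lborel_pair.integrable_snd [OF ik] by simp
  then show "set_integrable lborel {0..L} (\<lambda>s. of_real (\<kappa>b s) * I s)"
    unfolding other set_integrable_def .
  have "(LINT s:{0..L}|lborel. of_real (\<kappa>b s) * I s) = (\<integral>s. (\<integral>z. ?k (z, s) \<partial>lborel) \<partial>lborel)"
    unfolding other set_lebesgue_integral_def by simp
  also have "\<dots> = (\<integral>z. (\<integral>s. ?k (z, s) \<partial>lborel) \<partial>lborel)"
    using lborel_pair.Fubini_integral [OF ik] by simp
  also have "\<dots> = (\<integral>z. of_real pi * (indicator ?B z *\<^sub>R (f z * cnj (deriv H z))) \<partial>lborel)"
    unfolding inner by (simp add: scaleR_conv_of_real mult_ac)
  also have "\<dots> = of_real pi * integral ?B (\<lambda>z. f z * cnj (deriv H z))"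
  proof -
    have e: "integral ?B (\<lambda>z. f z * cnj (deriv H z)) = (\<integral>z. indicator ?B z *\<^sub>R (f z * cnj (deriv H z)) \<partial>lborel)"
      by (rule absolutely_integrable_on_iff_lborel(2) [OF cfH _ ai]) simp
    show ?thesis unfolding e by (rule integral_mult_right_zero)
  qed
  finally show "(LINT s:{0..L}|lborel. of_real (\<kappa>b s) * I s) = of_real pi * integral ?B (\<lambda>z. f z * cnj (deriv H z))" .
qed

text \<open>Returns from the Borel version to \<open>curvature_at\<close>. The null set Z leaves
  room for parameters at which the inner integral is not given by the closed form.\<close>

lemma curvature_integral_transfer:
  fixes J X :: "real \<Rightarrow> complex"
  assumes si: "set_integrable lborel {0..L} (\<lambda>s. of_real (\<kappa>b s) * J s)"
    and eq: "\<And>s. s \<in> {0..L} - Z \<Longrightarrow> J s = X s" and Z: "negligible Z"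
  shows "((\<lambda>s. of_real (curvature_at \<gamma> s) * X s) has_integral (LINT s:{0..L}|lborel. of_real (\<kappa>b s) * J s)) {0..L}"
proof -
  have "((\<lambda>s. of_real (\<kappa>b s) * J s) has_integral (LINT s:{0..L}|lborel. of_real (\<kappa>b s) * J s)) {0..L}"
    using set_borel_integral_eq_integral [OF si] by (simp add: has_integral_iff)
  moreover have "negligible (Z \<union> {s. \<kappa>b s \<noteq> curvature_at \<gamma> s})"
    using Z kappa_b(3) by (rule negligible_Un)
  ultimately show ?thesis
    by (rule has_integral_spike [rotated 2]) (use eq in auto)
qed

lemma deriv_H_absolutely_integrable:
  assumes b: "cmod b = 1"
  shows "(\<lambda>z. deriv H z / cnj (b - z)) absolutely_integrable_on ball 0 1"
proof -
  obtain C where C: "C > 0" "\<And>z. z \<in> ball 0 1 \<Longrightarrow> cmod (deriv H z) \<le> C / root 4 (1 - cmod z)"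
    using deriv_H_bound by blast
  show ?thesis
  proof (rule disc_bound_absolutely_integrable [OF _ b, where K = C])
    have ne: "b - z \<noteq> 0" if "z \<in> ball 0 1" for z using that b by auto
    show "continuous_on (ball 0 1) (\<lambda>z. deriv H z / cnj (b - z))"
      using ne by (intro continuous_intros continuous_deriv_H) (auto simp del: complex_cnj_diff)
    fix z assume z: "z \<in> ball (0::complex) 1"
    note r = one_over_root4_ge_1 [OF z]
    have "cmod (deriv H z / cnj (b - z)) = cmod (deriv H z) * (1 / cmod (b - z))"
      by (simp add: norm_divide del: complex_cnj_diff)
    also have "\<dots> \<le> (C / root 4 (1 - cmod z)) * (1 / cmod (b - z) + 1 / root 4 (1 - cmod z))"
      using C(2) [OF z] r C(1) by (intro mult_mono) auto
    finally show "cmod (deriv H z / cnj (b - z)) \<le> C * (1 / root 4 (1 - cmod z)) * (1 / cmod (b - z) + 1 / root 4 (1 - cmod z))"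
      by simp
  qed
qed

lemma H_kernel_integral:
  assumes b: "cmod b = 1"
  shows "integral (ball 0 1) (\<lambda>z. deriv H z / cnj (b - z)) = of_real pi * (H b - H 0)"
proof (rule disc_kernel_integral [OF _ b deriv_H_absolutely_integrable [OF b]])
  show "(H has_field_derivative deriv H z) (at z)" if "z \<in> ball 0 1" for z
    using holomorphic_derivI [OF H_holomorphic _ that] by simp
  have bb: "b \<in> cball 0 1" using b by simp
  have "(H \<longlongrightarrow> H b) (at b within cball 0 1)"
    using H(1) bb by (simp add: continuous_on_def)
  moreover have "filterlim (\<lambda>r. complex_of_real r * b) (at b within cball 0 1) (at_left 1)"
    unfolding filterlim_at
  proof
    have "((\<lambda>r. complex_of_real r * b) \<longlongrightarrow> of_real 1 * b) (at_left 1)" by (intro tendsto_intros)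
    then show "((\<lambda>r. complex_of_real r * b) \<longlongrightarrow> b) (at_left 1)" by simp
    show "\<forall>\<^sub>F r in at_left 1. complex_of_real r * b \<in> cball 0 1 \<and> complex_of_real r * b \<noteq> b"
    proof (rule eventually_at_leftI [of 0])
      fix r :: real assume r: "r \<in> {0<..<1}"
      have "b \<noteq> 0" using b by auto
      then show "complex_of_real r * b \<in> cball 0 1 \<and> complex_of_real r * b \<noteq> b"
        using r b by (auto simp: norm_mult)
    qed simp
  qed
  ultimately show "((\<lambda>r. H (complex_of_real r * b)) \<longlongrightarrow> H b) (at_left 1)"
    by (rule filterlim_compose)
qed

text \<open>The case f = H' of \<open>kernel_Fubini\<close>, with inner integral pi (H(w s) - H 0).
  It turns the energy of H into a curvature integral and also shows that this energy is
  finite.\<close>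

lemma H_energy:
  shows "(\<lambda>z. (cmod (deriv H z))\<^sup>2) absolutely_integrable_on ball 0 1"
    and "((\<lambda>s. curvature_at \<gamma> s * Re (H (w s) - H 0)) has_integral integral (ball 0 1) (\<lambda>z. (cmod (deriv H z))\<^sup>2)) {0..L}"
proof -
  obtain C where C: "C > 0" "\<And>z. z \<in> ball 0 1 \<Longrightarrow> cmod (deriv H z) \<le> C / root 4 (1 - cmod z)"
    using deriv_H_bound by blast
  have int: "(\<lambda>z. deriv H z * of_real (1 / root 4 (1 - cmod z))) absolutely_integrable_on ball 0 1"
  \<comment> \<open>There is no pole here: \<open>b = 1\<close> is just some point of the circle,
    and the root term of the bound does the work.\<close>
  proof (rule disc_bound_absolutely_integrable [where b = 1 and K = C])
    show "continuous_on (ball 0 1) (\<lambda>z. deriv H z * of_real (1 / root 4 (1 - cmod z)))"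
      by (intro continuous_on_mult continuous_on_of_real continuous_root4_ball continuous_deriv_H)
    fix z assume z: "z \<in> ball (0::complex) 1"
    note r = one_over_root4_ge_1 [OF z]
    have "cmod (deriv H z * of_real (1 / root 4 (1 - cmod z))) = cmod (deriv H z) * (1 / root 4 (1 - cmod z))"
      using r by (simp add: norm_mult norm_divide)
    also have "\<dots> \<le> (C / root 4 (1 - cmod z)) * (1 / cmod (1 - z) + 1 / root 4 (1 - cmod z))"
      using C(2) [OF z] r C(1) by (intro mult_mono) auto
    finally show "cmod (deriv H z * of_real (1 / root 4 (1 - cmod z))) \<le> C * (1 / root 4 (1 - cmod z)) * (1 / cmod (1 - z) + 1 / root 4 (1 - cmod z))"
      by simp
  qed simp
  note F = kernel_Fubini [OF continuous_deriv_H int]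
  have sq: "deriv H z * cnj (deriv H z) = of_real ((cmod (deriv H z))\<^sup>2)" for z
    using complex_norm_square [of "deriv H z"] by simp
  have ai: "(\<lambda>z. complex_of_real ((cmod (deriv H z))\<^sup>2)) absolutely_integrable_on ball 0 1"
    using F(1) unfolding sq .
  show ar: "(\<lambda>z. (cmod (deriv H z))\<^sup>2) absolutely_integrable_on ball 0 1"
    using absolutely_integrable_linear [OF ai bounded_linear_Re] by (simp add: o_def)
  let ?E = "integral (ball 0 1) (\<lambda>z. (cmod (deriv H z))\<^sup>2)"
  have E: "integral (ball 0 1) (\<lambda>z. deriv H z * cnj (deriv H z)) = of_real ?E"
    unfolding sq using integral_linear [OF _ bounded_linear_of_real, of "\<lambda>z. (cmod (deriv H z))\<^sup>2" "ball 0 1"] ar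
    by (simp add: o_def absolutely_integrable_on_def)
  have I: "(\<integral>z. indicator (ball 0 1) z *\<^sub>R (deriv H z / cnj (w s - z)) \<partial>lborel) = of_real pi * (H (w s) - H 0)" for s
  proof -
    have "continuous_on (ball 0 1) (\<lambda>z. deriv H z / cnj (w s - z))"
      using w_minus_nz by (intro continuous_intros continuous_deriv_H) (auto simp del: complex_cnj_diff)
    then show ?thesis
      using absolutely_integrable_on_iff_lborel(2) [OF _ _ deriv_H_absolutely_integrable [OF norm_w [of s]]]
        H_kernel_integral [OF norm_w [of s]] by simp
  qed
  have "((\<lambda>s. of_real (curvature_at \<gamma> s) * (of_real pi * (H (w s) - H 0))) has_integral (of_real pi * of_real ?E)) {0..L}"
    using curvature_integral_transfer [OF F(2), where Z = "{}" and X = "\<lambda>s. of_real pi * (H (w s) - H 0)"] I F(3) E by simp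
  then have "((\<lambda>s. (1 / of_real pi) * (of_real (curvature_at \<gamma> s) * (of_real pi * (H (w s) - H 0)))) has_integral (1 / of_real pi) * (of_real pi * of_real ?E)) {0..L}"
    by (rule has_integral_mult_right)
  then have "((\<lambda>s. of_real (curvature_at \<gamma> s) * (H (w s) - H 0)) has_integral of_real ?E) {0..L}"
    by simp
  from has_integral_Re [OF this]
  show "((\<lambda>s. curvature_at \<gamma> s * Re (H (w s) - H 0)) has_integral ?E) {0..L}"
    by simp
qed

lemma negligible_w_eq: "negligible {s \<in> {0..L}. w s = b}"
proof -
  have "finite {s \<in> {0..<L}. w s = b}"
  proof (rule finite_subset)
    show "{s \<in> {0..<L}. w s = b} \<subseteq> {THE s. s \<in> {0..<L} \<and> \<gamma> s = \<Phi> b}"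
    proof
      fix s assume s: "s \<in> {s \<in> {0..<L}. w s = b}"
      then have g: "\<gamma> s = \<Phi> b" using Phi_w [of s] by auto
      have "(THE s. s \<in> {0..<L} \<and> \<gamma> s = \<Phi> b) = s"
        using s g inj_onD [OF gamma_inj] by (intro the_equality) auto
      then show "s \<in> {THE s. s \<in> {0..<L} \<and> \<gamma> s = \<Phi> b}" by simp
    qed
  qed simp
  then have "finite ({s \<in> {0..<L}. w s = b} \<union> {L})" by simp
  then have "finite {s \<in> {0..L}. w s = b}" by (rule finite_subset [rotated]) auto
  then show ?thesis by (rule negligible_finite)
qed

text \<open>The same integral is evaluated twice: as a conjugate of the integral of H' against the
  kernel at b, and by \<open>kernel_Fubini\<close> with f = 1 / (b - z), where the inner integral is
  - pi Ln (1 - w s / b). Comparing real parts expresses the curvature integral of ln |w - b| through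
  H. Parameters with w s = b, where the inner formula breaks down, are finitely many.\<close>

lemma pole_H_integral:
  assumes b: "cmod b = 1"
  shows "(\<lambda>z. 1 / (b - z) * cnj (deriv H z)) absolutely_integrable_on ball 0 1"
    and "Re (integral (ball 0 1) (\<lambda>z. 1 / (b - z) * cnj (deriv H z))) = pi * Re (H b - H 0)"
    and "((\<lambda>s. curvature_at \<gamma> s * ln (cmod (w s - b))) has_integral (- (pi * Re (H b - H 0)))) {0..L}"
proof -
  have ne: "b - z \<noteq> 0" if "z \<in> ball 0 1" for z using that b by auto
  have c: "continuous_on (ball 0 1) (\<lambda>z. 1 / (b - z))" using ne by (intro continuous_intros) auto
  have int: "(\<lambda>z. 1 / (b - z) * of_real (1 / root 4 (1 - cmod z))) absolutely_integrable_on ball 0 1"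
  proof (rule disc_bound_absolutely_integrable [OF _ b, where K = 1])
    show "continuous_on (ball 0 1) (\<lambda>z. 1 / (b - z) * of_real (1 / root 4 (1 - cmod z)))"
      by (intro continuous_on_mult continuous_on_of_real continuous_root4_ball c)
    fix z assume z: "z \<in> ball (0::complex) 1"
    note r = one_over_root4_ge_1 [OF z]
    have "cmod (1 / (b - z) * of_real (1 / root 4 (1 - cmod z))) = (1 / root 4 (1 - cmod z)) * (1 / cmod (b - z))"
      using r by (simp add: norm_mult norm_divide)
    also have "\<dots> \<le> (1 / root 4 (1 - cmod z)) * (1 / cmod (b - z) + 1 / root 4 (1 - cmod z))"
      using r by (intro mult_left_mono) auto
    finally show "cmod (1 / (b - z) * of_real (1 / root 4 (1 - cmod z))) \<le> 1 * (1 / root 4 (1 - cmod z)) * (1 / cmod (b - z) + 1 / root 4 (1 - cmod z))"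
      by simp
  qed
  note F = kernel_Fubini [OF c int]
  show "(\<lambda>z. 1 / (b - z) * cnj (deriv H z)) absolutely_integrable_on ball 0 1" by (rule F(1))
  let ?E = "integral (ball 0 1) (\<lambda>z. 1 / (b - z) * cnj (deriv H z))"
  have "?E = cnj (integral (ball 0 1) (\<lambda>z. deriv H z / cnj (b - z)))"
  proof -
    have "integral (ball 0 1) (cnj \<circ> (\<lambda>z. deriv H z / cnj (b - z))) = cnj (integral (ball 0 1) (\<lambda>z. deriv H z / cnj (b - z)))"
      by (rule integral_linear [OF _ bounded_linear_cnj])
        (use deriv_H_absolutely_integrable [OF b] in \<open>simp add: absolutely_integrable_on_def\<close>)
    then show ?thesis by (simp add: o_def)
  qed
  then show ReE: "Re ?E = pi * Re (H b - H 0)"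
    using H_kernel_integral [OF b] by simp
  let ?Z = "{s \<in> {0..L}. w s = b}"
  have I: "(\<integral>z. indicator (ball 0 1) z *\<^sub>R (1 / (b - z) / cnj (w s - z)) \<partial>lborel) = - of_real pi * Ln (1 - w s / b)"
    if "s \<in> {0..L} - ?Z" for s
  proof -
    have bw: "b \<noteq> w s" using that by auto
    have "continuous_on (ball 0 1) (\<lambda>z. 1 / (b - z) / cnj (w s - z))"
      using w_minus_nz ne by (intro continuous_intros) (auto simp del: complex_cnj_diff)
    then show ?thesis
      using absolutely_integrable_on_iff_lborel(2) [OF _ _ two_pole_absolutely_integrable [OF b norm_w bw]]
        two_pole_integral [OF b norm_w bw] by simp
  qed
  have "((\<lambda>s. of_real (curvature_at \<gamma> s) * (- of_real pi * Ln (1 - w s / b))) has_integral (of_real pi * ?E)) {0..L}"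
    unfolding F(3) [symmetric] by (rule curvature_integral_transfer [OF F(2) I negligible_w_eq])
  then have "((\<lambda>s. (- 1 / of_real pi) * (of_real (curvature_at \<gamma> s) * (- of_real pi * Ln (1 - w s / b)))) has_integral (- 1 / of_real pi) * (of_real pi * ?E)) {0..L}"
    by (rule has_integral_mult_right)
  then have "((\<lambda>s. of_real (curvature_at \<gamma> s) * Ln (1 - w s / b)) has_integral (- ?E)) {0..L}"
    by simp
  from has_integral_Re [OF this]
  have "((\<lambda>s. curvature_at \<gamma> s * Re (Ln (1 - w s / b))) has_integral (- (pi * Re (H b - H 0)))) {0..L}"
    using ReE by simp
  then show "((\<lambda>s. curvature_at \<gamma> s * ln (cmod (w s - b))) has_integral (- (pi * Re (H b - H 0)))) {0..L}"
    by (rule has_integral_spike [OF negligible_w_eq [of b], rotated]) (use Re_Ln_one_minus [OF b] in auto)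
qed

end

section \<open>The renormalized energy\<close>

lemma sum_off_diagonal_symmetric:
  fixes f :: "nat \<Rightarrow> nat \<Rightarrow> real"
  assumes "\<And>j k. f j k = f k j"
  shows "(\<Sum>j<N. \<Sum>k\<in>{..<N} - {j}. f j k) = 2 * (\<Sum>j<N. \<Sum>k\<in>{j<..<N}. f j k)"
proof (induction N)
  case (Suc N)
  have "(\<Sum>k\<in>{..<Suc N} - {j}. f j k) = (\<Sum>k\<in>{..<N} - {j}. f j k) + f j N" if "j < N" for j
  proof -
    have "{..<Suc N} - {j} = insert N ({..<N} - {j})" using that by auto
    then show ?thesis by simp
  qed
  moreover have "{..<Suc N} - {N} = {..<N}" by auto
  ultimately have L: "(\<Sum>j<Suc N. \<Sum>k\<in>{..<Suc N} - {j}. f j k) = (\<Sum>j<N. \<Sum>k\<in>{..<N} - {j}. f j k) + (\<Sum>j<N. f j N) + (\<Sum>k<N. f N k)"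
    by (simp add: sum.distrib)
  have "(\<Sum>k\<in>{j<..<Suc N}. f j k) = (\<Sum>k\<in>{j<..<N}. f j k) + f j N" if "j < N" for j
  proof -
    have "{j<..<Suc N} = insert N {j<..<N}" using that by auto
    then show ?thesis by simp
  qed
  moreover have "{N<..<Suc N} = {}" by auto
  ultimately have R: "(\<Sum>j<Suc N. \<Sum>k\<in>{j<..<Suc N}. f j k) = (\<Sum>j<N. \<Sum>k\<in>{j<..<N}. f j k) + (\<Sum>j<N. f j N)"
    by (simp add: sum.distrib)
  have "(\<Sum>k<N. f N k) = (\<Sum>j<N. f j N)" by (rule sum.cong) (use assms in auto)
  then show ?case unfolding L R using Suc.IH by simp
qed simp

lemma integral_restrict_superset:
  fixes f :: "'a::euclidean_space \<Rightarrow> real"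
  assumes "S \<subseteq> T" "f integrable_on S"
  shows "(\<lambda>x. if x \<in> S then f x else 0) integrable_on T"
    "integral T (\<lambda>x. if x \<in> S then f x else 0) = integral S f"
proof -
  have "((\<lambda>x. if x \<in> S then f x else 0) has_integral integral S f) T"
    using has_integral_restrict [OF assms(1), of f] assms(2) by (simp add: has_integral_integral)
  then show "(\<lambda>x. if x \<in> S then f x else 0) integrable_on T"
    "integral T (\<lambda>x. if x \<in> S then f x else 0) = integral S f"
    by (auto simp: integral_unique has_integral_integrable)
qed

context conformal_config
begin

text \<open>What remains of |G'|^2 without the diagonal poles; unlike these it is integrable over
  the whole disc. Poles are written 1 / (b j - z), as in the kernel lemmas, which makes G' the
  difference of H' and their weighted sum.\<close>

definition R :: "complex \<Rightarrow> real" where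
  "R z = (\<Sum>j<N. \<Sum>k\<in>{..<N} - {j}. real_of_int (d j * d k) * Re (1 / (b j - z) / cnj (b k - z)))
     - 2 * (\<Sum>j<N. real_of_int (d j) * Re (1 / (b j - z) * cnj (deriv H z))) + (cmod (deriv H z))\<^sup>2"

lemma G'_norm_square:
  assumes z: "z \<in> ball 0 1"
  shows "(cmod (G' z))\<^sup>2 = (\<Sum>j<N. 1 / (cmod (z - b j))\<^sup>2) + R z"
proof -
  define e where "e j = 1 / (b j - z)" for j
  define h where "h = deriv H z"
  define A where "A = (\<Sum>j<N. of_int (d j) * e j)"
  have G: "G' z = h - A"
  proof -
    have "(\<Sum>j<N. of_int (d j) / (z - b j)) = (\<Sum>j<N. - (of_int (d j) * e j))"
    proof (rule sum.cong)
      fix j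
      have "of_int (d j) / (z - b j) = of_int (d j) / (- (b j - z))" by simp
      also have "\<dots> = - (of_int (d j) * e j)" unfolding e_def by (simp only: divide_minus_right) simp
      finally show "of_int (d j) / (z - b j) = - (of_int (d j) * e j)" .
    qed simp
    then show ?thesis by (simp add: G'_def A_def h_def sum_negf)
  qed
  have "(cmod (h - A))\<^sup>2 = (cmod h)\<^sup>2 + (cmod A)\<^sup>2 - 2 * Re (A * cnj h)"
    by (simp only: cmod_power2) (simp add: power2_eq_square algebra_simps)
  moreover have "Re (A * cnj h) = (\<Sum>j<N. real_of_int (d j) * Re (e j * cnj h))"
  proof -
    have "A * cnj h = (\<Sum>j<N. of_int (d j) * (e j * cnj h))"
      by (simp add: A_def sum_distrib_right mult.assoc)
    then show ?thesis by simp
  qed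
  moreover have "(cmod A)\<^sup>2 = (\<Sum>j<N. (cmod (e j))\<^sup>2) + (\<Sum>j<N. \<Sum>k\<in>{..<N} - {j}. real_of_int (d j * d k) * Re (e j * cnj (e k)))"
  proof -
    have "(cmod A)\<^sup>2 = Re (A * cnj A)"
      by (simp only: complex_norm_square [symmetric]) (simp flip: of_real_power)
    also have "A * cnj A = (\<Sum>j<N. \<Sum>k<N. (of_int (d j) * e j) * (of_int (d k) * cnj (e k)))"
      by (simp add: A_def sum_product)
    also have "Re \<dots> = (\<Sum>j<N. \<Sum>k<N. real_of_int (d j * d k) * Re (e j * cnj (e k)))"
      by (simp add: algebra_simps)
    also have "\<dots> = (\<Sum>j<N. (cmod (e j))\<^sup>2 + (\<Sum>k\<in>{..<N} - {j}. real_of_int (d j * d k) * Re (e j * cnj (e k))))"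
    proof (rule sum.cong)
      fix j assume j: "j \<in> {..<N}"
      then have "(\<Sum>k<N. real_of_int (d j * d k) * Re (e j * cnj (e k))) = real_of_int (d j * d j) * Re (e j * cnj (e j)) + (\<Sum>k\<in>{..<N} - {j}. real_of_int (d j * d k) * Re (e j * cnj (e k)))"
        by (intro sum.remove) auto
      \<comment> \<open>Diagonal poles count with coefficient 1 whatever the sign of the
        degree.\<close>
      moreover have "d j * d j = 1" using d_cases [of j] j by auto
      moreover have "Re (e j * cnj (e j)) = (cmod (e j))\<^sup>2"
        by (simp only: complex_norm_square [symmetric]) (simp flip: of_real_power)
      ultimately show "(\<Sum>k<N. real_of_int (d j * d k) * Re (e j * cnj (e k))) = (cmod (e j))\<^sup>2 + (\<Sum>k\<in>{..<N} - {j}. real_of_int (d j * d k) * Re (e j * cnj (e k)))"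
        by simp
    qed simp
    finally show ?thesis by (simp add: sum.distrib)
  qed
  moreover have "(cmod (e j))\<^sup>2 = 1 / (cmod (z - b j))\<^sup>2" for j
    by (simp add: e_def norm_divide power_divide norm_minus_commute)
  moreover have "e j * cnj (e k) = 1 / (b j - z) / cnj (b k - z)" for j k
    by (simp add: e_def)
  ultimately show ?thesis
    unfolding G R_def e_def [symmetric] h_def [symmetric] by simp
qed

lemma Re_absolutely_integrable:
  assumes "f absolutely_integrable_on S"
  shows "(\<lambda>z. c * Re (f z)) absolutely_integrable_on S" "integral S (\<lambda>z. c * Re (f z)) = c * Re (integral S f)"
proof -
  have "(\<lambda>z. Re (f z)) absolutely_integrable_on S"
    using absolutely_integrable_linear [OF assms bounded_linear_Re] by (simp add: o_def)
  then show "(\<lambda>z. c * Re (f z)) absolutely_integrable_on S" by (rule set_integrable_mult_right)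
  have "integral S (\<lambda>z. Re (f z)) = Re (integral S f)"
    using integral_linear [OF _ bounded_linear_Re, of f S] assms by (simp add: o_def absolutely_integrable_on_def)
  then show "integral S (\<lambda>z. c * Re (f z)) = c * Re (integral S f)" by simp
qed

lemma R_integral:
  shows "R absolutely_integrable_on ball 0 1"
    and "integral (ball 0 1) R = (\<Sum>j<N. \<Sum>k\<in>{..<N} - {j}. - pi * real_of_int (d j * d k) * ln (cmod (b k - b j)))
      - 2 * (\<Sum>j<N. real_of_int (d j) * (pi * Re (H (b j) - H 0))) + integral (ball 0 1) (\<lambda>z. (cmod (deriv H z))\<^sup>2)"
proof -
  let ?B = "ball (0::complex) 1"
  let ?f1 = "\<lambda>j k z. real_of_int (d j * d k) * Re (1 / (b j - z) / cnj (b k - z))"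
  let ?f2 = "\<lambda>j z. real_of_int (d j) * Re (1 / (b j - z) * cnj (deriv H z))"
  have f1: "?f1 j k absolutely_integrable_on ?B" "integral ?B (?f1 j k) = - pi * real_of_int (d j * d k) * ln (cmod (b k - b j))"
    if "j < N" "k \<in> {..<N} - {j}" for j k
  proof -
    have ne: "b j \<noteq> b k" using b_inj that by (auto dest: inj_onD)
    have n: "cmod (b j) = 1" "cmod (b k) = 1" using norm_b that by auto
    note T = two_pole_absolutely_integrable [OF n ne]
    show "?f1 j k absolutely_integrable_on ?B" by (rule Re_absolutely_integrable(1) [OF T])
    have "integral ?B (?f1 j k) = real_of_int (d j * d k) * Re (- of_real pi * Ln (1 - b k / b j))"
      unfolding two_pole_integral [OF n ne, symmetric] by (rule Re_absolutely_integrable(2) [OF T])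
    also have "\<dots> = - pi * real_of_int (d j * d k) * ln (cmod (b k - b j))"
      using Re_Ln_one_minus [OF n(1) ne] by simp
    finally show "integral ?B (?f1 j k) = - pi * real_of_int (d j * d k) * ln (cmod (b k - b j))" .
  qed
  have f2: "?f2 j absolutely_integrable_on ?B" "integral ?B (?f2 j) = real_of_int (d j) * (pi * Re (H (b j) - H 0))" if "j < N" for j
    using Re_absolutely_integrable [OF pole_H_integral(1) [OF norm_b [OF that]], of "real_of_int (d j)"]
    unfolding pole_H_integral(2) [OF norm_b [OF that]] by blast+
  have s1: "(\<lambda>z. \<Sum>j<N. \<Sum>k\<in>{..<N} - {j}. ?f1 j k z) absolutely_integrable_on ?B"
    by (intro absolutely_integrable_sum f1) auto
  have s2: "(\<lambda>z. 2 * (\<Sum>j<N. ?f2 j z)) absolutely_integrable_on ?B"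
    by (intro set_integrable_mult_right absolutely_integrable_sum f2) auto
  have s3: "(\<lambda>z. (\<Sum>j<N. \<Sum>k\<in>{..<N} - {j}. ?f1 j k z) - 2 * (\<Sum>j<N. ?f2 j z)) absolutely_integrable_on ?B"
    by (rule set_integral_diff(1) [OF s1 s2])
  have Req: "R = (\<lambda>z. (\<Sum>j<N. \<Sum>k\<in>{..<N} - {j}. ?f1 j k z) - 2 * (\<Sum>j<N. ?f2 j z) + (cmod (deriv H z))\<^sup>2)"
    by (simp add: R_def fun_eq_iff)
  show "R absolutely_integrable_on ?B"
    unfolding Req by (rule set_integral_add(1) [OF s3 H_energy(1)])
  have i: "f integrable_on ?B" if "f absolutely_integrable_on ?B" for f :: "complex \<Rightarrow> real"
    using that by (simp add: absolutely_integrable_on_def)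
  have "integral ?B R = integral ?B (\<lambda>z. \<Sum>j<N. \<Sum>k\<in>{..<N} - {j}. ?f1 j k z) - integral ?B (\<lambda>z. 2 * (\<Sum>j<N. ?f2 j z)) + integral ?B (\<lambda>z. (cmod (deriv H z))\<^sup>2)"
    unfolding Req
    by (simp only: Henstock_Kurzweil_Integration.integral_add [OF i [OF s3] i [OF H_energy(1)]]
        Henstock_Kurzweil_Integration.integral_diff [OF i [OF s1] i [OF s2]])
  also have "integral ?B (\<lambda>z. \<Sum>j<N. \<Sum>k\<in>{..<N} - {j}. ?f1 j k z) = (\<Sum>j<N. integral ?B (\<lambda>z. \<Sum>k\<in>{..<N} - {j}. ?f1 j k z))"
    by (rule Henstock_Kurzweil_Integration.integral_sum [OF finite_lessThan])
      (rule i, intro absolutely_integrable_sum f1, simp_all)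
  also have "\<dots> = (\<Sum>j<N. \<Sum>k\<in>{..<N} - {j}. integral ?B (?f1 j k))"
    by (intro sum.cong refl Henstock_Kurzweil_Integration.integral_sum finite_Diff finite_lessThan i f1) simp_all
  also have "\<dots> = (\<Sum>j<N. \<Sum>k\<in>{..<N} - {j}. - pi * real_of_int (d j * d k) * ln (cmod (b k - b j)))"
    by (intro sum.cong refl f1(2)) auto
  also have "integral ?B (\<lambda>z. 2 * (\<Sum>j<N. ?f2 j z)) = 2 * (\<Sum>j<N. integral ?B (?f2 j))"
  proof -
    have "integral ?B (\<lambda>z. \<Sum>j<N. ?f2 j z) = (\<Sum>j<N. integral ?B (?f2 j))"
      by (rule Henstock_Kurzweil_Integration.integral_sum [OF finite_lessThan]) (rule i, rule f2, simp)
    then show ?thesis by simp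
  qed
  also have "(\<Sum>j<N. integral ?B (?f2 j)) = (\<Sum>j<N. real_of_int (d j) * (pi * Re (H (b j) - H 0)))"
    by (intro sum.cong refl f2(2)) auto
  finally show "integral (ball 0 1) R = (\<Sum>j<N. \<Sum>k\<in>{..<N} - {j}. - pi * real_of_int (d j * d k) * ln (cmod (b k - b j)))
      - 2 * (\<Sum>j<N. real_of_int (d j) * (pi * Re (H (b j) - H 0))) + integral (ball 0 1) (\<lambda>z. (cmod (deriv H z))\<^sup>2)" .
qed

lemma Drho_subset: "D\<rho> \<rho> \<subseteq> ball 0 1"
  by (auto simp: D\<rho>_def)

lemma Drho_exhausts:
  assumes z: "z \<in> ball 0 1"
  shows "\<forall>\<^sub>F \<rho> in at_right 0. z \<in> D\<rho> \<rho>"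
proof -
  have "\<forall>\<^sub>F \<rho> in at_right 0. \<Phi> z \<notin> ball (a j) \<rho>" if "j < N" for j
  proof -
    have "a j \<noteq> \<Phi> z" using a_frontier [OF that] Phi_ball [OF z] closure_Omega(2) by auto
    then have "dist (a j) (\<Phi> z) > 0" by simp
    then show ?thesis by (intro eventually_at_rightI [of 0 "dist (a j) (\<Phi> z)"]) auto
  qed
  then have "\<forall>\<^sub>F \<rho> in at_right 0. \<forall>j\<in>{..<N}. \<Phi> z \<notin> ball (a j) \<rho>"
    by (intro eventually_ball_finite) auto
  then show ?thesis by eventually_elim (use z in \<open>auto simp: D\<rho>_def\<close>)
qed

lemma absolutely_integrable_Drho:
  fixes g :: "complex \<Rightarrow> real"
  assumes "g absolutely_integrable_on ball 0 1"
  shows "g absolutely_integrable_on D\<rho> \<rho>"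
  by (rule set_integrable_subset [OF assms _ Drho_subset]) (use Drho_borel in auto)

text \<open>Dominated convergence along any sequence of radii, since every point of the disc
  eventually belongs to \<open>D\<rho>\<close>. It makes the holes invisible to integrable
  densities.\<close>

lemma Drho_integral_tendsto:
  fixes g :: "complex \<Rightarrow> real"
  assumes g: "g absolutely_integrable_on ball 0 1"
  shows "((\<lambda>\<rho>. integral (D\<rho> \<rho>) g) \<longlongrightarrow> integral (ball 0 1) g) (at_right 0)"
  unfolding tendsto_at_iff_sequentially comp_def
proof (intro allI impI)
  fix X :: "nat \<Rightarrow> real" assume X: "\<forall>i. X i \<in> {0<..} - {0}" "X \<longlonglongrightarrow> 0"
  have Xf: "filterlim X (at_right 0) sequentially"
  proof -
    have "X i \<noteq> 0" for i using X(1) [rule_format, of i] by simp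
    then show ?thesis using X by (auto simp: filterlim_at intro!: always_eventually)
  qed
  let ?g = "\<lambda>n z. if z \<in> D\<rho> (X n) then g z else 0"
  have gi: "g integrable_on D\<rho> (X n)" for n
    using absolutely_integrable_Drho [OF g, of "X n"] by (simp add: absolutely_integrable_on_def)
  note ig = integral_restrict_superset(1) [OF Drho_subset gi]
  have eq: "integral (D\<rho> (X n)) g = integral (ball 0 1) (?g n)" for n
    by (rule integral_restrict_superset(2) [OF Drho_subset gi, symmetric])
  have "(\<lambda>n. integral (ball 0 1) (?g n)) \<longlonglongrightarrow> integral (ball 0 1) g"
  proof (rule dominated_convergence [OF ig])
    show "(\<lambda>z. norm (g z)) integrable_on ball 0 1" using g by (simp add: absolutely_integrable_on_def)
    show "norm (?g n z) \<le> norm (g z)" for n z by simp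
    fix z assume "z \<in> ball (0::complex) 1"
    then have "\<forall>\<^sub>F n in sequentially. z \<in> D\<rho> (X n)"
      using eventually_compose_filterlim [OF Drho_exhausts Xf] by blast
    then have "\<forall>\<^sub>F n in sequentially. ?g n z = g z" by eventually_elim simp
    then show "(\<lambda>n. ?g n z) \<longlonglongrightarrow> g z" by (rule tendsto_eventually)
  qed
  then show "(\<lambda>n. integral (D\<rho> (X n)) g) \<longlonglongrightarrow> integral (ball 0 1) g" by (simp add: eq)
qed

end

section \<open>The energy of a single boundary pole\<close>

context conformal_config
begin

definition \<mu> :: "nat \<Rightarrow> real" where "\<mu> j = cmod (\<Psi>' (a j))"

lemma mu_pos: "j < N \<Longrightarrow> \<mu> j > 0"
  unfolding \<mu>_def using Psi'_nz [OF a_closure] by simp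

text \<open>The vanishing remainder in \<open>punctured_disc_inverse_square\<close>.\<close>

definition tail :: "real \<Rightarrow> real" where
  "tail r = integral {0<..<pi} (\<lambda>y. max (ln r) (ln (2 * sin y)))"

lemma tail_tendsto:
  assumes "c > 0"
  shows "((\<lambda>\<rho>. tail (c * \<rho>)) \<longlongrightarrow> 0) (at_right 0)"
proof -
  have "(tail \<longlongrightarrow> 0) (at_right 0)"
    unfolding tail_def using truncated_ln_sin_integral(2) [OF zero_less_one] .
  moreover have "filterlim (\<lambda>\<rho>. c * \<rho>) (at_right 0) (at_right 0)"
    unfolding filterlim_at
  proof
    have "((\<lambda>\<rho>. c * \<rho>) \<longlongrightarrow> c * 0) (at_right 0)" by (intro tendsto_intros)
    then show "((\<lambda>\<rho>. c * \<rho>) \<longlongrightarrow> 0) (at_right 0)" by simp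
    show "\<forall>\<^sub>F \<rho> in at_right 0. c * \<rho> \<in> {0<..} \<and> c * \<rho> \<noteq> 0"
      by (rule eventually_at_rightI [of 0 1]) (use assms in auto)
  qed
  ultimately show ?thesis by (rule filterlim_compose)
qed

text \<open>The first-order expansion of \<Psi> at a j within the closure. The error is measured
  relative to |\<Psi>'(a j)|, so that radii are distorted by factors 1 \<plusminus>
  \<delta>.\<close>

lemma Psi_distance_near:
  assumes j: "j < N" and \<delta>: "\<delta> > 0"
  obtains \<eta> where "\<eta> > 0" "\<And>y. y \<in> closure \<Omega> \<Longrightarrow> cmod (y - a j) < \<eta> \<Longrightarrow>
      \<bar>cmod (\<Psi> y - b j) - \<mu> j * cmod (y - a j)\<bar> \<le> \<delta> * \<mu> j * cmod (y - a j)"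
proof -
  have "(\<Psi> has_derivative (*) (\<Psi>' (a j))) (at (a j) within closure \<Omega>)"
    using deriv_Psi [OF a_closure [OF j]] by (simp add: has_field_derivative_def)
  then have "\<forall>e>0. \<exists>\<eta>>0. \<forall>y\<in>closure \<Omega>. norm (y - a j) < \<eta> \<longrightarrow> norm (\<Psi> y - \<Psi> (a j) - \<Psi>' (a j) * (y - a j)) \<le> e * norm (y - a j)"
    unfolding has_derivative_within_alt by blast
  moreover have "\<delta> * \<mu> j > 0" using \<delta> mu_pos [OF j] by simp
  ultimately obtain \<eta> where \<eta>: "\<eta> > 0" "\<And>y. y \<in> closure \<Omega> \<Longrightarrow> norm (y - a j) < \<eta> \<Longrightarrow>
      norm (\<Psi> y - \<Psi> (a j) - \<Psi>' (a j) * (y - a j)) \<le> \<delta> * \<mu> j * norm (y - a j)"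
    by blast
  show thesis
  proof (rule that [OF \<eta>(1)])
    fix y assume y: "y \<in> closure \<Omega>" "cmod (y - a j) < \<eta>"
    have "\<bar>cmod (\<Psi> y - b j) - cmod (\<Psi>' (a j) * (y - a j))\<bar> \<le> cmod (\<Psi> y - b j - \<Psi>' (a j) * (y - a j))"
      by (rule norm_triangle_ineq3)
    also have "\<dots> \<le> \<delta> * \<mu> j * cmod (y - a j)" using \<eta>(2) [OF y] by (simp add: b_def)
    finally show "\<bar>cmod (\<Psi> y - b j) - \<mu> j * cmod (y - a j)\<bar> \<le> \<delta> * \<mu> j * cmod (y - a j)"
      by (simp add: norm_mult \<mu>_def)
  qed
qed

lemma Phi_near:
  assumes j: "j < N" and \<eta>: "\<eta> > 0"
  obtains m where "m > 0" "\<And>z. z \<in> ball 0 1 \<Longrightarrow> cmod (z - b j) < m \<Longrightarrow> cmod (\<Phi> z - a j) < \<eta>"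
proof -
  have bc: "b j \<in> cball 0 1" using norm_b [OF j] by simp
  have Pb: "\<Phi> (b j) = a j" unfolding b_def by (rule Phi_Psi [OF a_closure [OF j]])
  obtain m where m: "m > 0" "\<And>z. z \<in> cball 0 1 \<Longrightarrow> dist z (b j) < m \<Longrightarrow> dist (\<Phi> z) (\<Phi> (b j)) < \<eta>"
    using continuous_Phi bc \<eta> unfolding continuous_on_iff by metis
  show thesis
    by (rule that [OF m(1)]) (use m(2) Pb in \<open>auto simp: dist_norm\<close>)
qed

text \<open>If \<Phi> z is near a j the expansion of \<Psi> applies. Otherwise continuity of \<Phi>
  keeps z at a fixed distance m from b j, which exceeds the shrinking radius.\<close>

lemma Drho_subset_outer:
  assumes j: "j < N" and \<delta>: "0 < \<delta>" "\<delta> < 1"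
  shows "\<forall>\<^sub>F \<rho> in at_right 0. D\<rho> \<rho> \<subseteq> ball 0 1 - ball (b j) ((1 - \<delta>) * \<mu> j * \<rho>)"
proof -
  note lp = mu_pos [OF j]
  obtain \<eta> where \<eta>: "\<eta> > 0" "\<And>y. y \<in> closure \<Omega> \<Longrightarrow> cmod (y - a j) < \<eta> \<Longrightarrow>
      \<bar>cmod (\<Psi> y - b j) - \<mu> j * cmod (y - a j)\<bar> \<le> \<delta> * \<mu> j * cmod (y - a j)"
    using Psi_distance_near [OF j \<delta>(1)] by blast
  obtain m where m: "m > 0" "\<And>z. z \<in> ball 0 1 \<Longrightarrow> cmod (z - b j) < m \<Longrightarrow> cmod (\<Phi> z - a j) < \<eta>"
    using Phi_near [OF j \<eta>(1)] by blast
  have c: "(1 - \<delta>) * \<mu> j > 0" using \<delta> lp by simp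
  have "D\<rho> \<rho> \<subseteq> ball 0 1 - ball (b j) ((1 - \<delta>) * \<mu> j * \<rho>)" if \<rho>: "0 < \<rho>" "\<rho> < m / ((1 - \<delta>) * \<mu> j)" for \<rho>
  proof
    fix z assume z: "z \<in> D\<rho> \<rho>"
    then have zb: "z \<in> ball 0 1" and far: "cmod (\<Phi> z - a j) \<ge> \<rho>"
      using j by (auto simp: D\<rho>_def dist_norm norm_minus_commute not_less)
    have "cmod (z - b j) \<ge> (1 - \<delta>) * \<mu> j * \<rho>"
    proof (cases "cmod (\<Phi> z - a j) < \<eta>")
      case True
      have "\<Phi> z \<in> closure \<Omega>" using Phi_closure [of z] zb by auto
      moreover have "\<Psi> (\<Phi> z) = z" using Psi_Phi [of z] zb by auto
      ultimately have "\<bar>cmod (z - b j) - \<mu> j * cmod (\<Phi> z - a j)\<bar> \<le> \<delta> * \<mu> j * cmod (\<Phi> z - a j)"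
        using \<eta>(2) [of "\<Phi> z"] True by simp
      then have "(1 - \<delta>) * \<mu> j * cmod (\<Phi> z - a j) \<le> cmod (z - b j)"
        by (simp add: algebra_simps abs_le_iff)
      moreover have "(1 - \<delta>) * \<mu> j * \<rho> \<le> (1 - \<delta>) * \<mu> j * cmod (\<Phi> z - a j)"
        using far c by (intro mult_left_mono) auto
      ultimately show ?thesis by linarith
    next
      case False
      then have "cmod (z - b j) \<ge> m" using m(2) [OF zb] by linarith
      moreover have "(1 - \<delta>) * \<mu> j * \<rho> < m" using \<rho>(2) c by (simp add: pos_less_divide_eq mult.commute)
      ultimately show ?thesis by linarith
    qed
    then show "z \<in> ball 0 1 - ball (b j) ((1 - \<delta>) * \<mu> j * \<rho>)"
      using zb by (auto simp: dist_norm norm_minus_commute)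
  qed
  then show ?thesis
    using m c by (intro eventually_at_rightI [of 0 "m / ((1 - \<delta>) * \<mu> j)"]) auto
qed

text \<open>\<open>D\<rho>\<close> also omits the preimages of the balls about the other a k, so the
  expected inclusion is available only near b j. The rest of the disc is covered by the fixed set
  outside \<open>ball (b j) r0\<close>, on which the inverse square is integrable.\<close>

lemma Drho_superset_inner:
  assumes j: "j < N" and \<delta>: "0 < \<delta>"
  obtains r0 where "r0 > 0" "\<forall>\<^sub>F \<rho> in at_right 0. ball 0 1 - ball (b j) ((1 + \<delta>) * \<mu> j * \<rho>) \<subseteq> D\<rho> \<rho> \<union> (ball 0 1 - ball (b j) r0)"
proof -
  note lp = mu_pos [OF j]
  obtain \<eta> where \<eta>: "\<eta> > 0" "\<And>y. y \<in> closure \<Omega> \<Longrightarrow> cmod (y - a j) < \<eta> \<Longrightarrow>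
      \<bar>cmod (\<Psi> y - b j) - \<mu> j * cmod (y - a j)\<bar> \<le> \<delta> * \<mu> j * cmod (y - a j)"
    using Psi_distance_near [OF j \<delta>] by blast
  \<comment> \<open>The separation of a j from the other singular points: within e / 2 of a j, balls
    of radius below e / 2 about the others are not met. Inserting 1 makes the set over which the
    minimum is taken nonempty.\<close>
  obtain e where e: "e > 0" "\<And>k. k < N \<Longrightarrow> k \<noteq> j \<Longrightarrow> e \<le> cmod (a k - a j)"
  proof
    let ?A = "insert 1 ((\<lambda>k. cmod (a k - a j)) ` ({..<N} - {j}))"
    have fin: "finite ?A" by simp
    have "x > 0" if "x \<in> ?A" for x
    proof -
      have "a k \<noteq> a j" if "k < N" "k \<noteq> j" for k using a_inj that j by (auto dest: inj_onD)
      then show ?thesis using that by fastforce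
    qed
    then show "Min ?A > 0" using fin by (subst Min_gr_iff) auto
    show "Min ?A \<le> cmod (a k - a j)" if "k < N" "k \<noteq> j" for k
      using fin by (intro Min_le) (use that in auto)
  qed
  obtain r0 where r0: "r0 > 0" "\<And>z. z \<in> ball 0 1 \<Longrightarrow> cmod (z - b j) < r0 \<Longrightarrow> cmod (\<Phi> z - a j) < e / 2"
    using Phi_near [OF j, of "e / 2"] e(1) by auto
  have "ball 0 1 - ball (b j) ((1 + \<delta>) * \<mu> j * \<rho>) \<subseteq> D\<rho> \<rho> \<union> (ball 0 1 - ball (b j) r0)"
    if \<rho>: "0 < \<rho>" "\<rho> < min \<eta> (e / 2)" for \<rho>
  proof
    fix z assume z: "z \<in> ball 0 1 - ball (b j) ((1 + \<delta>) * \<mu> j * \<rho>)"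
    then have zb: "z \<in> ball 0 1" and zfar: "cmod (z - b j) \<ge> (1 + \<delta>) * \<mu> j * \<rho>"
      by (auto simp: dist_norm norm_minus_commute)
    show "z \<in> D\<rho> \<rho> \<union> (ball 0 1 - ball (b j) r0)"
    proof (cases "z \<in> ball (b j) r0")
      case True
      then have near: "cmod (\<Phi> z - a j) < e / 2" using r0(2) [OF zb] by (auto simp: dist_norm norm_minus_commute)
      have "\<Phi> z \<notin> ball (a k) \<rho>" if k: "k < N" for k
      proof
        assume "\<Phi> z \<in> ball (a k) \<rho>"
        then have kn: "cmod (\<Phi> z - a k) < \<rho>" by (auto simp: dist_norm norm_minus_commute)
        show False
        proof (cases "k = j")
          case True
          have "\<Phi> z \<in> closure \<Omega>" using Phi_closure [of z] zb by auto
          moreover have "\<Psi> (\<Phi> z) = z" using Psi_Phi [of z] zb by auto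
          ultimately have "\<bar>cmod (z - b j) - \<mu> j * cmod (\<Phi> z - a j)\<bar> \<le> \<delta> * \<mu> j * cmod (\<Phi> z - a j)"
            using \<eta>(2) [of "\<Phi> z"] kn True \<rho> by simp
          then have "cmod (z - b j) \<le> (1 + \<delta>) * \<mu> j * cmod (\<Phi> z - a j)"
            by (simp add: algebra_simps abs_le_iff)
          also have "\<dots> < (1 + \<delta>) * \<mu> j * \<rho>"
            using kn True \<delta> lp by (intro mult_strict_left_mono) auto
          finally show False using zfar by simp
        next
          case False
          have "cmod (a k - a j) \<le> cmod (\<Phi> z - a j) + cmod (\<Phi> z - a k)"
            using norm_triangle_ineq4 [of "\<Phi> z - a j" "\<Phi> z - a k"] by simp
          then show False using e(2) [OF k False] near kn \<rho> by simp
        qed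
      qed
      then show ?thesis using zb by (auto simp: D\<rho>_def)
    qed (use zb in auto)
  qed
  then have "\<forall>\<^sub>F \<rho> in at_right 0. ball 0 1 - ball (b j) ((1 + \<delta>) * \<mu> j * \<rho>) \<subseteq> D\<rho> \<rho> \<union> (ball 0 1 - ball (b j) r0)"
    using \<eta> e by (intro eventually_at_rightI [of 0 "min \<eta> (e / 2)"]) auto
  then show thesis using that r0(1) by blast
qed

lemma pole_energy_integrable:
  assumes j: "j < N"
  shows "\<forall>\<^sub>F \<rho> in at_right 0. (\<lambda>z. 1 / (cmod (z - b j))\<^sup>2) absolutely_integrable_on D\<rho> \<rho>"
proof -
  have pos: "\<forall>\<^sub>F \<rho> in at_right 0. \<rho> > (0::real)" by (simp add: eventually_at_filter)
  have "\<forall>\<^sub>F \<rho> in at_right 0. D\<rho> \<rho> \<subseteq> ball 0 1 - ball (b j) ((1 - 1/2) * \<mu> j * \<rho>)"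
    by (rule Drho_subset_outer [OF j]) auto
  then show ?thesis
    using pos
  proof eventually_elim
    case (elim \<rho>)
    have "(\<lambda>z. 1 / (cmod (z - b j))\<^sup>2) absolutely_integrable_on (ball 0 1 - ball (b j) ((1 - 1/2) * \<mu> j * \<rho>))"
      using elim mu_pos [OF j] by (intro punctured_disc_inverse_square(1) norm_b j) auto
    then show ?case
      by (rule set_integrable_subset) (use Drho_borel elim in auto)
  qed
qed

text \<open>The integrand is nonnegative, so enlarging the region to the disc minus a round ball
  only increases the integral, and there it is known exactly.\<close>

lemma pole_energy_upper:
  assumes j: "j < N" and \<delta>: "0 < \<delta>" "\<delta> < 1"
  shows "\<forall>\<^sub>F \<rho> in at_right 0. integral (D\<rho> \<rho>) (\<lambda>z. 1 / (cmod (z - b j))\<^sup>2) - pi * ln (1 / \<rho>)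
     \<le> - pi * ln (1 - \<delta>) - pi * ln (\<mu> j) + tail ((1 - \<delta>) * \<mu> j * \<rho>)"
proof -
  have pos: "\<forall>\<^sub>F \<rho> in at_right 0. \<rho> > (0::real)" by (simp add: eventually_at_filter)
  note lp = mu_pos [OF j]
  show ?thesis
    using pos Drho_subset_outer [OF j \<delta>] pole_energy_integrable [OF j]
  proof eventually_elim
    case (elim \<rho>)
    define r where "r = (1 - \<delta>) * \<mu> j * \<rho>"
    have r: "r > 0" using elim \<delta> lp by (simp add: r_def)
    note P = punctured_disc_inverse_square [OF norm_b [OF j] r]
    have "integral (D\<rho> \<rho>) (\<lambda>z. 1 / (cmod (z - b j))\<^sup>2) \<le> integral (ball 0 1 - ball (b j) r) (\<lambda>z. 1 / (cmod (z - b j))\<^sup>2)"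
      using elim P(1) by (intro integral_subset_le) (auto simp: r_def absolutely_integrable_on_def)
    also have "\<dots> = pi * ln (1 / r) + tail r" using P(2) by (simp add: tail_def)
    also have "ln (1 / r) = - ln (1 - \<delta>) - ln (\<mu> j) + ln (1 / \<rho>)"
      using elim \<delta> lp by (simp add: r_def ln_div ln_mult)
    finally show ?case by (simp add: r_def algebra_simps)
  qed
qed

text \<open>The covering set sticks out of \<open>D\<rho>\<close> only away from b j, near the other
  singular points. The excess is at most the integral of a fixed integrable function over the
  complement of \<open>D\<rho>\<close>; this is \<epsilon>, and it vanishes with \<rho>.\<close>

lemma pole_energy_lower:
  assumes j: "j < N" and \<delta>: "0 < \<delta>"
  obtains \<epsilon> :: "real \<Rightarrow> real" where "(\<epsilon> \<longlongrightarrow> 0) (at_right 0)"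
    "\<forall>\<^sub>F \<rho> in at_right 0. - pi * ln (1 + \<delta>) - pi * ln (\<mu> j) + tail ((1 + \<delta>) * \<mu> j * \<rho>) - \<epsilon> \<rho>
      \<le> integral (D\<rho> \<rho>) (\<lambda>z. 1 / (cmod (z - b j))\<^sup>2) - pi * ln (1 / \<rho>)"
proof -
  have pos: "\<forall>\<^sub>F \<rho> in at_right 0. \<rho> > (0::real)" by (simp add: eventually_at_filter)
  note lp = mu_pos [OF j]
  obtain r0 where r0: "r0 > 0" "\<forall>\<^sub>F \<rho> in at_right 0. ball 0 1 - ball (b j) ((1 + \<delta>) * \<mu> j * \<rho>) \<subseteq> D\<rho> \<rho> \<union> (ball 0 1 - ball (b j) r0)"
    using Drho_superset_inner [OF j \<delta>] by blast
  let ?g = "\<lambda>z. 1 / (cmod (z - b j))\<^sup>2"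
  define g0 where "g0 z = (if z \<in> ball 0 1 - ball (b j) r0 then ?g z else 0)" for z
  have g0: "g0 absolutely_integrable_on ball 0 1"
  proof -
    have "set_integrable lebesgue (ball 0 1 - ball (b j) r0) ?g"
      by (rule punctured_disc_inverse_square(1) [OF norm_b [OF j] r0(1)])
    moreover have "indicator (ball 0 1) z *\<^sub>R g0 z = indicator (ball 0 1 - ball (b j) r0) z *\<^sub>R ?g z" for z
      by (auto simp: g0_def indicator_def)
    ultimately show ?thesis by (simp add: set_integrable_def)
  qed
  have g0n: "0 \<le> g0 z" for z by (simp add: g0_def)
  define \<epsilon> where "\<epsilon> \<rho> = integral (ball 0 1) g0 - integral (D\<rho> \<rho>) g0" for \<rho>
  have "(\<epsilon> \<longlongrightarrow> integral (ball 0 1) g0 - integral (ball 0 1) g0) (at_right 0)"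
    unfolding \<epsilon>_def by (intro tendsto_intros Drho_integral_tendsto g0)
  then have e0: "(\<epsilon> \<longlongrightarrow> 0) (at_right 0)" by simp
  have "\<forall>\<^sub>F \<rho> in at_right 0. - pi * ln (1 + \<delta>) - pi * ln (\<mu> j) + tail ((1 + \<delta>) * \<mu> j * \<rho>) - \<epsilon> \<rho>
      \<le> integral (D\<rho> \<rho>) ?g - pi * ln (1 / \<rho>)"
    using pos r0(2) pole_energy_integrable [OF j]
  proof eventually_elim
    case (elim \<rho>)
    define r where "r = (1 + \<delta>) * \<mu> j * \<rho>"
    have r: "r > 0" using elim \<delta> lp by (simp add: r_def)
    note P = punctured_disc_inverse_square [OF norm_b [OF j] r]
    let ?A = "ball 0 1 - ball (b j) r"
    have "?g integrable_on ?A" using P(1) by (simp add: absolutely_integrable_on_def)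
    note iA' = integral_restrict_superset [OF Diff_subset this]
    note iA = iA'(2) [symmetric] iA'(1)
    have iD: "integral (D\<rho> \<rho>) h = integral (ball 0 1) (\<lambda>z. if z \<in> D\<rho> \<rho> then h z else 0)"
      "(\<lambda>z. if z \<in> D\<rho> \<rho> then h z else 0) integrable_on ball 0 1" if "h absolutely_integrable_on D\<rho> \<rho>" for h :: "complex \<Rightarrow> real"
    proof -
      have "h integrable_on D\<rho> \<rho>" using that by (simp add: absolutely_integrable_on_def)
      note r = integral_restrict_superset [OF Drho_subset this]
      show "integral (D\<rho> \<rho>) h = integral (ball 0 1) (\<lambda>z. if z \<in> D\<rho> \<rho> then h z else 0)"
        by (rule r(2) [symmetric])
      show "(\<lambda>z. if z \<in> D\<rho> \<rho> then h z else 0) integrable_on ball 0 1" by (rule r(1))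
    qed
    note iD1 = iD [OF elim(3)] note iD2 = iD [OF absolutely_integrable_Drho [OF g0]]
    have ig0: "g0 integrable_on ball 0 1" using g0 by (simp add: absolutely_integrable_on_def)
    \<comment> \<open>Pointwise: on \<open>D\<rho>\<close> the two \<open>g0\<close> terms cancel,
      and a point of \<open>?A\<close> off \<open>D\<rho>\<close> lies where \<open>g0\<close>
      equals the integrand.\<close>
    have "integral ?A ?g \<le> integral (ball 0 1) (\<lambda>z. (if z \<in> D\<rho> \<rho> then ?g z else 0) + (g0 z - (if z \<in> D\<rho> \<rho> then g0 z else 0)))"
      unfolding iA(1)
    proof (rule integral_le [OF iA(2)])
      show "(\<lambda>z. (if z \<in> D\<rho> \<rho> then ?g z else 0) + (g0 z - (if z \<in> D\<rho> \<rho> then g0 z else 0))) integrable_on ball 0 1"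
        by (intro integrable_add integrable_diff iD1 iD2 ig0)
      fix z assume "z \<in> ball (0::complex) 1"
      show "(if z \<in> ?A then ?g z else 0) \<le> (if z \<in> D\<rho> \<rho> then ?g z else 0) + (g0 z - (if z \<in> D\<rho> \<rho> then g0 z else 0))"
      proof (cases "z \<in> D\<rho> \<rho>")
        case False
        show ?thesis
        proof (cases "z \<in> ?A")
          case True
          then have "z \<in> ball 0 1 - ball (b j) r0" using elim(2) False unfolding r_def by blast
          then show ?thesis using False True by (simp add: g0_def)
        qed (use False g0n in auto)
      qed simp
    qed
    also have "\<dots> = integral (D\<rho> \<rho>) ?g + \<epsilon> \<rho>"
      unfolding \<epsilon>_def iD1(1) iD2(1)
      by (simp only: Henstock_Kurzweil_Integration.integral_add [OF iD1(2) integrable_diff [OF ig0 iD2(2)]]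
          Henstock_Kurzweil_Integration.integral_diff [OF ig0 iD2(2)])
    finally have "integral ?A ?g - \<epsilon> \<rho> \<le> integral (D\<rho> \<rho>) ?g" by simp
    moreover have "integral ?A ?g = pi * ln (1 / r) + tail r" using P(2) by (simp add: tail_def)
    moreover have "ln (1 / r) = - ln (1 + \<delta>) - ln (\<mu> j) + ln (1 / \<rho>)"
      using elim \<delta> lp by (simp add: r_def ln_div ln_mult)
    ultimately have "pi * (- ln (1 + \<delta>) - ln (\<mu> j) + ln (1 / \<rho>)) + tail r - \<epsilon> \<rho> \<le> integral (D\<rho> \<rho>) ?g" by simp
    then show ?case by (simp only: r_def algebra_simps)
  qed
  then show thesis using that e0 by blast
qed

lemma pole_energy_tendsto:
  assumes j: "j < N"
  shows "((\<lambda>\<rho>. integral (D\<rho> \<rho>) (\<lambda>z. 1 / (cmod (z - b j))\<^sup>2) - pi * ln (1 / \<rho>)) \<longlongrightarrow> - pi * ln (\<mu> j)) (at_right 0)"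
proof (rule tendstoI)
  fix e :: real assume e: "e > 0"
  note lp = mu_pos [OF j]
  let ?S = "\<lambda>\<rho>. integral (D\<rho> \<rho>) (\<lambda>z. 1 / (cmod (z - b j))\<^sup>2) - pi * ln (1 / \<rho>)"
  have "((\<lambda>\<delta>. - pi * ln (1 - \<delta>)) \<longlongrightarrow> - pi * ln (1 - 0)) (at_right 0)" "((\<lambda>\<delta>. - pi * ln (1 + \<delta>)) \<longlongrightarrow> - pi * ln (1 + 0)) (at_right 0)"
    by (auto intro!: tendsto_eq_intros)
  note lims = this
  \<comment> \<open>First \<delta> is fixed so that ln (1 \<plusminus> \<delta>) costs less than e /
    2; only afterwards does \<rho> tend to 0.\<close>
  have "\<forall>\<^sub>F \<delta> in at_right 0. - pi * ln (1 - \<delta>) < e / 2"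
    by (rule order_tendstoD(2) [OF lims(1)]) (use e in simp)
  moreover have "\<forall>\<^sub>F \<delta> in at_right 0. - (e / 2) < - pi * ln (1 + \<delta>)"
    by (rule order_tendstoD(1) [OF lims(2)]) (use e in simp)
  moreover have "\<forall>\<^sub>F \<delta> in at_right 0. 0 < \<delta> \<and> \<delta> < (1::real)"
    by (rule eventually_at_rightI [of 0 1]) auto
  ultimately have "\<forall>\<^sub>F \<delta> in at_right 0. - pi * ln (1 - \<delta>) < e / 2 \<and> - (e / 2) < - pi * ln (1 + \<delta>) \<and> 0 < \<delta> \<and> \<delta> < (1::real)"
    by eventually_elim auto
  then obtain \<delta> where \<delta>: "- pi * ln (1 - \<delta>) < e / 2" "- (e / 2) < - pi * ln (1 + \<delta>)" "0 < \<delta>" "\<delta> < 1"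
    using eventually_happens' [OF trivial_limit_at_right_real] by blast
  obtain \<epsilon> where \<epsilon>: "(\<epsilon> \<longlongrightarrow> 0) (at_right 0)"
    "\<forall>\<^sub>F \<rho> in at_right 0. - pi * ln (1 + \<delta>) - pi * ln (\<mu> j) + tail ((1 + \<delta>) * \<mu> j * \<rho>) - \<epsilon> \<rho> \<le> ?S \<rho>"
    using pole_energy_lower [OF j \<delta>(3)] by blast
  have "((\<lambda>\<rho>. tail ((1 + \<delta>) * \<mu> j * \<rho>) - \<epsilon> \<rho>) \<longlongrightarrow> 0 - 0) (at_right 0)"
    by (intro tendsto_diff tail_tendsto \<epsilon>) (use \<delta> lp in simp)
  then have l: "\<forall>\<^sub>F \<rho> in at_right 0. - (e / 2) < tail ((1 + \<delta>) * \<mu> j * \<rho>) - \<epsilon> \<rho>"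
    using e by (intro order_tendstoD) auto
  have "((\<lambda>\<rho>. tail ((1 - \<delta>) * \<mu> j * \<rho>)) \<longlongrightarrow> 0) (at_right 0)"
    by (intro tail_tendsto) (use \<delta> lp in simp)
  then have u: "\<forall>\<^sub>F \<rho> in at_right 0. tail ((1 - \<delta>) * \<mu> j * \<rho>) < e / 2"
    using e by (intro order_tendstoD) auto
  show "\<forall>\<^sub>F \<rho> in at_right 0. dist (?S \<rho>) (- pi * ln (\<mu> j)) < e"
    using l u \<epsilon>(2) pole_energy_upper [OF j \<delta>(3,4)]
  proof eventually_elim
    case (elim \<rho>)
    have "?S \<rho> - (- pi * ln (\<mu> j)) < e" "- e < ?S \<rho> - (- pi * ln (\<mu> j))"
      using elim \<delta> by linarith+
    then show ?case unfolding dist_real_def abs_less_iff by linarith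
  qed
qed

section \<open>Assembling the limit\<close>

definition X :: "nat \<Rightarrow> real" where
  "X j = integral {0..L} (\<lambda>s. curvature_at \<gamma> s * ln (cmod (w s - b j)))"

text \<open>Since Re (H (b j)) = - ln |\<Psi>'(a j)|, the curvature integral of ln |w - b j| is
  explicit up to Re (H 0). This is the source of the terms d k log |\<Psi>'(a k)|.\<close>

lemma X: "j < N \<Longrightarrow> ((\<lambda>s. curvature_at \<gamma> s * ln (cmod (w s - b j))) has_integral X j) {0..L}"
  and X_eq: "j < N \<Longrightarrow> X j = pi * ln (\<mu> j) + pi * Re (H 0)"
proof -
  assume j: "j < N"
  note P = pole_H_integral(3) [OF norm_b [OF j]]
  have Xv: "X j = - (pi * Re (H (b j) - H 0))" unfolding X_def using P by (rule integral_unique)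
  show "((\<lambda>s. curvature_at \<gamma> s * ln (cmod (w s - b j))) has_integral X j) {0..L}" using P Xv by simp
  have "\<Phi> (b j) = a j" unfolding b_def by (rule Phi_Psi [OF a_closure [OF j]])
  then have "Re (H (b j)) = - ln (\<mu> j)" using Re_H [of "b j"] norm_b [OF j] by (simp add: \<mu>_def)
  then show "X j = pi * ln (\<mu> j) + pi * Re (H 0)" unfolding Xv by (simp add: algebra_simps)
qed

text \<open>Here - ln |\<Psi>'| = Re H(w). Splitting off Re (H 0) leaves the curvature form of the
  energy of H, and the constant is weighted by the total curvature 2 pi.\<close>

lemma curvature_log_integral:
  "integral {0..L} (\<lambda>s. curvature_at \<gamma> s * ((\<Sum>j<N. real_of_int (d j) * ln (cmod (\<Psi> (\<gamma> s) - \<Psi> (a j)))) - ln (cmod (\<Psi>' (\<gamma> s)))))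
   = (\<Sum>j<N. real_of_int (d j) * X j) + integral (ball 0 1) (\<lambda>z. (cmod (deriv H z))\<^sup>2) + 2 * pi * Re (H 0)"
proof -
  let ?E = "integral (ball 0 1) (\<lambda>z. (cmod (deriv H z))\<^sup>2)"
  have k: "(curvature_at \<gamma> has_integral 2 * pi) {0..L}"
    using curvature_has_integral [of 0 L] L_pos theta_periodic [of 0] by simp
  have "((\<lambda>s. (\<Sum>j<N. real_of_int (d j) * (curvature_at \<gamma> s * ln (cmod (w s - b j)))) + (curvature_at \<gamma> s * Re (H (w s) - H 0) + curvature_at \<gamma> s * Re (H 0)))
     has_integral ((\<Sum>j<N. real_of_int (d j) * X j) + (?E + 2 * pi * Re (H 0)))) {0..L}"
    by (intro has_integral_add has_integral_sum has_integral_mult_right has_integral_mult_left X H_energy(2) k) auto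
  moreover have "(\<Sum>j<N. real_of_int (d j) * (curvature_at \<gamma> s * ln (cmod (w s - b j)))) + (curvature_at \<gamma> s * Re (H (w s) - H 0) + curvature_at \<gamma> s * Re (H 0))
     = curvature_at \<gamma> s * ((\<Sum>j<N. real_of_int (d j) * ln (cmod (\<Psi> (\<gamma> s) - \<Psi> (a j)))) - ln (cmod (\<Psi>' (\<gamma> s))))" for s
  proof -
    have "Re (H (w s)) = - ln (cmod (\<Psi>' (\<gamma> s)))" using Re_H [of "w s"] by (simp add: Phi_w)
    moreover have "(\<Sum>j<N. real_of_int (d j) * (curvature_at \<gamma> s * ln (cmod (w s - b j)))) = curvature_at \<gamma> s * (\<Sum>j<N. real_of_int (d j) * ln (cmod (\<Psi> (\<gamma> s) - \<Psi> (a j))))"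
      unfolding sum_distrib_left w_def b_def by (intro sum.cong) (auto simp: mult_ac)
    ultimately show ?thesis by (simp add: algebra_simps)
  qed
  ultimately show ?thesis by (simp add: integral_unique)
qed

lemma degree_weighted_X: "(\<Sum>j<N. real_of_int (d j) * X j) = pi * (\<Sum>j<N. real_of_int (d j) * ln (\<mu> j)) + 2 * pi * Re (H 0)"
proof -
  have "(\<Sum>j<N. real_of_int (d j) * X j) = (\<Sum>j<N. pi * (real_of_int (d j) * ln (\<mu> j)) + real_of_int (d j) * (pi * Re (H 0)))"
    by (rule sum.cong) (auto simp: X_eq algebra_simps)
  also have "\<dots> = pi * (\<Sum>j<N. real_of_int (d j) * ln (\<mu> j)) + (\<Sum>j<N. real_of_int (d j)) * (pi * Re (H 0))"
    by (simp add: sum.distrib sum_distrib_left sum_distrib_right)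
  finally show ?thesis unfolding d_sum_real by simp
qed

lemma Dirichlet_tendsto:
  "((\<lambda>\<rho>. integral (D\<rho> \<rho>) (\<lambda>z. (cmod (G' z))\<^sup>2) - real N * pi * ln (1 / \<rho>)) \<longlongrightarrow>
     (\<Sum>j<N. - pi * ln (\<mu> j)) + integral (ball 0 1) R) (at_right 0)"
  "\<forall>\<^sub>F \<rho> in at_right 0. (\<lambda>z. (cmod (G' z))\<^sup>2) absolutely_integrable_on D\<rho> \<rho>"
proof -
  let ?g = "\<lambda>j z. 1 / (cmod (z - b j))\<^sup>2"
  have "\<forall>\<^sub>F \<rho> in at_right 0. \<forall>j\<in>{..<N}. ?g j absolutely_integrable_on D\<rho> \<rho>"
    using pole_energy_integrable by (intro eventually_ball_finite) auto
  then have ev: "\<forall>\<^sub>F \<rho> in at_right 0. (\<lambda>z. (cmod (G' z))\<^sup>2) absolutely_integrable_on D\<rho> \<rho> \<and>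
      integral (D\<rho> \<rho>) (\<lambda>z. (cmod (G' z))\<^sup>2) = (\<Sum>j<N. integral (D\<rho> \<rho>) (?g j)) + integral (D\<rho> \<rho>) R"
  proof eventually_elim
    case (elim \<rho>)
    have s: "(\<lambda>z. \<Sum>j<N. ?g j z) absolutely_integrable_on D\<rho> \<rho>"
      using elim by (intro absolutely_integrable_sum) auto
    have Ri: "R absolutely_integrable_on D\<rho> \<rho>" by (rule absolutely_integrable_Drho [OF R_integral(1)])
    have eq: "(\<Sum>j<N. ?g j z) + R z = (cmod (G' z))\<^sup>2" if "z \<in> D\<rho> \<rho>" for z
      using G'_norm_square [of z] subsetD [OF Drho_subset that] by simp
    have "(\<lambda>z. (\<Sum>j<N. ?g j z) + R z) absolutely_integrable_on D\<rho> \<rho>"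
      by (rule set_integral_add(1) [OF s Ri])
    then have 1: "(\<lambda>z. (cmod (G' z))\<^sup>2) absolutely_integrable_on D\<rho> \<rho>"
      by (rule set_integrable_cong [THEN iffD1, OF refl refl _, rotated]) (rule eq)
    have "integral (D\<rho> \<rho>) (\<lambda>z. (cmod (G' z))\<^sup>2) = integral (D\<rho> \<rho>) (\<lambda>z. (\<Sum>j<N. ?g j z) + R z)"
      by (rule integral_cong) (simp only: eq)
    also have "\<dots> = integral (D\<rho> \<rho>) (\<lambda>z. \<Sum>j<N. ?g j z) + integral (D\<rho> \<rho>) R"
      using s Ri by (intro Henstock_Kurzweil_Integration.integral_add) (auto simp: absolutely_integrable_on_def)
    also have "integral (D\<rho> \<rho>) (\<lambda>z. \<Sum>j<N. ?g j z) = (\<Sum>j<N. integral (D\<rho> \<rho>) (?g j))"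
      using elim by (intro Henstock_Kurzweil_Integration.integral_sum) (auto simp: absolutely_integrable_on_def)
    finally show ?case using 1 by blast
  qed
  then show "\<forall>\<^sub>F \<rho> in at_right 0. (\<lambda>z. (cmod (G' z))\<^sup>2) absolutely_integrable_on D\<rho> \<rho>"
    by eventually_elim blast
  have "((\<lambda>\<rho>. (\<Sum>j<N. integral (D\<rho> \<rho>) (?g j) - pi * ln (1 / \<rho>)) + integral (D\<rho> \<rho>) R) \<longlongrightarrow>
     (\<Sum>j<N. - pi * ln (\<mu> j)) + integral (ball 0 1) R) (at_right 0)"
    by (intro tendsto_add tendsto_sum pole_energy_tendsto Drho_integral_tendsto R_integral(1)) auto
  moreover have "\<forall>\<^sub>F \<rho> in at_right 0. (\<Sum>j<N. integral (D\<rho> \<rho>) (?g j) - pi * ln (1 / \<rho>)) + integral (D\<rho> \<rho>) R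
      = integral (D\<rho> \<rho>) (\<lambda>z. (cmod (G' z))\<^sup>2) - real N * pi * ln (1 / \<rho>)"
    using ev by eventually_elim (simp add: sum_subtractf)
  ultimately show "((\<lambda>\<rho>. integral (D\<rho> \<rho>) (\<lambda>z. (cmod (G' z))\<^sup>2) - real N * pi * ln (1 / \<rho>)) \<longlongrightarrow>
     (\<Sum>j<N. - pi * ln (\<mu> j)) + integral (ball 0 1) R) (at_right 0)"
    by (rule Lim_transform_eventually)
qed

text \<open>The cross terms supply the weighted sum of the X j twice. One copy belongs to the
  curvature integral. The other is evaluated: its pi d j ln \<mu> j joins the - pi ln \<mu> j of the
  diagonal poles to form the coefficient d k - 1, and its 2 pi Re (H 0) is the constant contained in
  the curvature integral.\<close>

lemma limit_value:
  "(\<Sum>j<N. - pi * ln (\<mu> j)) + integral (ball 0 1) R =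
     - 2 * pi * (\<Sum>j<N. \<Sum>k\<in>{j<..<N}. real_of_int (d j * d k) * ln (cmod (\<Psi> (a k) - \<Psi> (a j))))
     + (\<Sum>k<N. pi * real_of_int (d k - 1) * ln (cmod (\<Psi>' (a k))))
     + integral {0..L} (\<lambda>s. curvature_at \<gamma> s * ((\<Sum>j<N. real_of_int (d j) * ln (cmod (\<Psi> (\<gamma> s) - \<Psi> (a j)))) - ln (cmod (\<Psi>' (\<gamma> s)))))"
proof -
  let ?E = "integral (ball 0 1) (\<lambda>z. (cmod (deriv H z))\<^sup>2)"
  let ?P = "\<Sum>j<N. \<Sum>k\<in>{j<..<N}. real_of_int (d j * d k) * ln (cmod (\<Psi> (a k) - \<Psi> (a j)))"
  let ?l = "\<Sum>j<N. ln (\<mu> j)"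
  let ?dl = "\<Sum>j<N. real_of_int (d j) * ln (\<mu> j)"
  have "(\<Sum>j<N. \<Sum>k\<in>{..<N} - {j}. - pi * real_of_int (d j * d k) * ln (cmod (b k - b j)))
      = 2 * (\<Sum>j<N. \<Sum>k\<in>{j<..<N}. - pi * real_of_int (d j * d k) * ln (cmod (b k - b j)))"
    by (rule sum_off_diagonal_symmetric) (simp add: mult.commute norm_minus_commute)
  also have "(\<Sum>j<N. \<Sum>k\<in>{j<..<N}. - pi * real_of_int (d j * d k) * ln (cmod (b k - b j))) = - pi * ?P"
    by (simp add: sum_distrib_left b_def mult.assoc sum_negf)
  finally have 1: "(\<Sum>j<N. \<Sum>k\<in>{..<N} - {j}. - pi * real_of_int (d j * d k) * ln (cmod (b k - b j))) = - 2 * pi * ?P" by simp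
  have "(\<Sum>j<N. real_of_int (d j) * (pi * Re (H (b j) - H 0))) = - (\<Sum>j<N. real_of_int (d j) * X j)"
  proof -
    have "pi * Re (H (b j) - H 0) = - X j" if "j < N" for j
      using has_integral_unique [OF X [OF that] pole_H_integral(3) [OF norm_b [OF that]]] by simp
    then have "(\<Sum>j<N. real_of_int (d j) * (pi * Re (H (b j) - H 0))) = (\<Sum>j<N. real_of_int (d j) * (- X j))"
      by (intro sum.cong) auto
    then show ?thesis by (simp add: sum_negf)
  qed
  then have 2: "integral (ball 0 1) R = - 2 * pi * ?P + 2 * (\<Sum>j<N. real_of_int (d j) * X j) + ?E"
    unfolding R_integral(2) 1 by simp
  have 3: "(\<Sum>j<N. - pi * ln (\<mu> j)) = - pi * ?l"
    by (simp add: sum_distrib_left)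
  have 4: "(\<Sum>k<N. pi * real_of_int (d k - 1) * ln (cmod (\<Psi>' (a k)))) = pi * ?dl - pi * ?l"
  proof -
    have "(\<Sum>k<N. pi * real_of_int (d k - 1) * ln (cmod (\<Psi>' (a k)))) = (\<Sum>k<N. pi * (real_of_int (d k) * ln (\<mu> k)) - pi * ln (\<mu> k))"
      by (rule sum.cong) (auto simp: \<mu>_def algebra_simps)
    then show ?thesis by (simp add: sum_subtractf sum_distrib_left)
  qed
  show ?thesis
    unfolding 2 3 4 curvature_log_integral using degree_weighted_X by simp
qed

theorem renormalized_energy:
  "renormalized_energy_is \<Omega> \<gamma> L N a d
     (- 2 * pi * (\<Sum>j<N. \<Sum>k\<in>{j<..<N}. real_of_int (d j * d k) * ln (cmod (\<Psi> (a k) - \<Psi> (a j))))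
     + (\<Sum>k<N. pi * real_of_int (d k - 1) * ln (cmod (\<Psi>' (a k))))
     + integral {0..L} (\<lambda>s. curvature_at \<gamma> s * ((\<Sum>j<N. real_of_int (d j) * ln (cmod (\<Psi> (\<gamma> s) - \<Psi> (a j)))) - ln (cmod (\<Psi>' (\<gamma> s))))))"
  unfolding renormalized_energy_is_def limit_value [symmetric]
proof (intro conjI allI impI)
  show "\<exists>\<phi> \<phi>s. boundary_phase \<Omega> \<gamma> L N a d \<phi> \<and> harmonic_extension \<Omega> N a \<phi> \<phi>s"
    using phi0_boundary_phase phi0_harmonic_extension by blast
  fix \<phi> \<phi>s assume "boundary_phase \<Omega> \<gamma> L N a d \<phi> \<and> harmonic_extension \<Omega> N a \<phi> \<phi>s"
  then obtain k where k: "\<And>z. z \<in> \<Omega> \<Longrightarrow> \<phi>s z = Im (G (\<Psi> z)) + k"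
    using harmonic_extension_unique by blast
  \<comment> \<open>The energies agree for small \<rho>, once absolute integrability on
    \<open>D\<rho>\<close> is available.\<close>
  have "\<forall>\<^sub>F \<rho> in at_right 0. integral (D\<rho> \<rho>) (\<lambda>z. (cmod (G' z))\<^sup>2) - real N * pi * ln (1 / \<rho>)
      = dirichlet_energy_punctured \<Omega> N a \<phi>s \<rho> - real N * pi * ln (1 / \<rho>)"
    using Dirichlet_tendsto(2) by eventually_elim (simp add: dirichlet_energy_eq [OF k])
  then show "((\<lambda>\<rho>. dirichlet_energy_punctured \<Omega> N a \<phi>s \<rho> - real N * pi * ln (1 / \<rho>)) \<longlongrightarrow>
      (\<Sum>j<N. - pi * ln (\<mu> j)) + integral (ball 0 1) R) (at_right 0)"
    by (rule Lim_transform_eventually [OF Dirichlet_tendsto(1)])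
qed

text \<open>Here |\<Psi>'| = 1 gives Re H = 0. The energy of H then vanishes by its own curvature
  form and the ln \<mu> j are 0, so the curvature term disappears for every admissible
  parametrisation of the circle.\<close>

lemma curvature_log_integral_identity:
  assumes "\<Phi> = (\<lambda>z. z)" "\<And>w. w \<in> closure \<Omega> \<Longrightarrow> \<Psi>' w = 1"
  shows "integral {0..L} (\<lambda>s. curvature_at \<gamma> s * ((\<Sum>j<N. real_of_int (d j) * ln (cmod (\<Psi> (\<gamma> s) - \<Psi> (a j)))) - ln (cmod (\<Psi>' (\<gamma> s))))) = 0"
proof -
  have H0: "Re (H z) = 0" if "z \<in> cball 0 1" for z
    using Re_H [OF that] assms Phi_closure [OF that] by simp
  have "((\<lambda>s. curvature_at \<gamma> s * Re (H (w s) - H 0)) has_integral 0) {0..L}"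
    by (rule has_integral_is_0) (simp add: H0)
  then have "integral (ball 0 1) (\<lambda>z. (cmod (deriv H z))\<^sup>2) = 0"
    using H_energy(2) has_integral_unique by blast
  moreover have "\<mu> j = 1" if "j < N" for j
    unfolding \<mu>_def using assms(2) [OF a_closure [OF that]] by simp
  ultimately show ?thesis
    unfolding curvature_log_integral degree_weighted_X using H0 [of 0] by simp
qed

end

theorem theorem1p6:
  shows
  "(\<forall>N a d \<gamma> L. admissible_config (ball 0 1) N a d \<and> C11_boundary_param (ball 0 1) \<gamma> L \<longrightarrow>
      renormalized_energy_is (ball 0 1) \<gamma> L N a d
        (- 2 * pi * (\<Sum>j<N. \<Sum>k\<in>{j<..<N}. real_of_int (d j * d k) * ln (cmod (a j - a k)))))
   \<and>
   (\<forall>\<Omega> \<Phi> \<Phi>' \<Psi> \<Psi>' N a d \<gamma> L.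
      C11_domain \<Omega> \<and>
      \<Phi> holomorphic_on ball 0 1 \<and>
      bij_betw \<Phi> (cball 0 1) (closure \<Omega>) \<and>
      (\<forall>z\<in>cball 0 1. (\<Phi> has_field_derivative \<Phi>' z) (at z within cball 0 1) \<and> \<Phi>' z \<noteq> 0) \<and>
      continuous_on (cball 0 1) \<Phi>' \<and>
      (\<forall>z\<in>cball 0 1. \<Psi> (\<Phi> z) = z) \<and> (\<forall>w\<in>closure \<Omega>. \<Phi> (\<Psi> w) = w) \<and>
      (\<forall>w\<in>closure \<Omega>. (\<Psi> has_field_derivative \<Psi>' w) (at w within closure \<Omega>)) \<and>
      continuous_on (closure \<Omega>) \<Psi>' \<and>
      admissible_config \<Omega> N a d \<and> C11_boundary_param \<Omega> \<gamma> L \<longrightarrow>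
      renormalized_energy_is \<Omega> \<gamma> L N a d
        (- 2 * pi * (\<Sum>j<N. \<Sum>k\<in>{j<..<N}. real_of_int (d j * d k) * ln (cmod (\<Psi> (a k) - \<Psi> (a j))))
         + (\<Sum>k<N. pi * real_of_int (d k - 1) * ln (cmod (\<Psi>' (a k))))
         + integral {0..L} (\<lambda>s. curvature_at \<gamma> s *
              ((\<Sum>j<N. real_of_int (d j) * ln (cmod (\<Psi> (\<gamma> s) - \<Psi> (a j))))
               - ln (cmod (\<Psi>' (\<gamma> s)))))))"
proof (intro conjI allI impI)
  fix N a d \<gamma> L assume A: "admissible_config (ball 0 1) N a d \<and> C11_boundary_param (ball 0 1) \<gamma> L"
  \<comment> \<open>The disc is its own conformal image: derivative 1 removes the second sum, and
    the curvature integral is 0 by the preceding lemma.\<close>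
  interpret conformal_config "ball 0 1" "\<lambda>z. z" "\<lambda>z. 1" "\<lambda>z. z" "\<lambda>z. 1" \<gamma> L N a d
    by unfold_locales (use A in \<open>auto simp: bij_betw_def\<close>)
  have "(\<Sum>k<N. pi * real_of_int (d k - 1) * ln (cmod 1)) = 0" by simp
  then show "renormalized_energy_is (ball 0 1) \<gamma> L N a d
        (- 2 * pi * (\<Sum>j<N. \<Sum>k\<in>{j<..<N}. real_of_int (d j * d k) * ln (cmod (a j - a k))))"
    using renormalized_energy curvature_log_integral_identity
    by (simp only: norm_minus_commute refl add_0_right)
next
  fix \<Omega> \<Phi> \<Phi>' \<Psi> \<Psi>' N a d \<gamma> L
  assume A: "C11_domain \<Omega> \<and>
      \<Phi> holomorphic_on ball 0 1 \<and>
      bij_betw \<Phi> (cball 0 1) (closure \<Omega>) \<and>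
      (\<forall>z\<in>cball 0 1. (\<Phi> has_field_derivative \<Phi>' z) (at z within cball 0 1) \<and> \<Phi>' z \<noteq> 0) \<and>
      continuous_on (cball 0 1) \<Phi>' \<and>
      (\<forall>z\<in>cball 0 1. \<Psi> (\<Phi> z) = z) \<and> (\<forall>w\<in>closure \<Omega>. \<Phi> (\<Psi> w) = w) \<and>
      (\<forall>w\<in>closure \<Omega>. (\<Psi> has_field_derivative \<Psi>' w) (at w within closure \<Omega>)) \<and>
      continuous_on (closure \<Omega>) \<Psi>' \<and>
      admissible_config \<Omega> N a d \<and> C11_boundary_param \<Omega> \<gamma> L"
  interpret conformal_config \<Omega> \<Phi> \<Phi>' \<Psi> \<Psi>' \<gamma> L N a d
    by unfold_locales (use A in \<open>auto simp: C11_domain_def\<close>)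
  show "renormalized_energy_is \<Omega> \<gamma> L N a d
        (- 2 * pi * (\<Sum>j<N. \<Sum>k\<in>{j<..<N}. real_of_int (d j * d k) * ln (cmod (\<Psi> (a k) - \<Psi> (a j))))
         + (\<Sum>k<N. pi * real_of_int (d k - 1) * ln (cmod (\<Psi>' (a k))))
         + integral {0..L} (\<lambda>s. curvature_at \<gamma> s *
              ((\<Sum>j<N. real_of_int (d j) * ln (cmod (\<Psi> (\<gamma> s) - \<Psi> (a j))))
               - ln (cmod (\<Psi>' (\<gamma> s))))))"
    by (rule renormalized_energy)
qed

end
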